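(* Consider pairs $(a,f)$ such that $a$ is nicely multi-bang, $f\in C^1_c(\mathbb{R}^2)$ is non-negative, and (1) for all $x\in\mathcal{P}_{a,1}$ the line tangent to a boundary at $x$ passes through the set $\{f>0\}$, and (2) for all $x\in\mathcal{P}_{a,2}$ there is a line passing through $x$ that also passes through the set $\{f>0\}$. Then $a$ and $f$ are uniquely determined by $R_af$: if $(a,f)$ and $(a',f')$ are two pairs satisfying all of these hypotheses and $R_af=R_{a'}f'$ on $\mathbb{R}\times\mathbb{S}^1$, then $a=a'$ (as elements of $L^\infty(\mathbb{R}^2)$) and $f=f'$.
   Context: Lines and transforms. For $\theta=(\cos\omega,\sin\omega)\in\mathbb{S}^1$ let $\theta^\perp=(-\sin\omega,\cos\omega)$. A pair $(s,\theta)\in\mathbb{R}\times\mathbb{S}^1$ represents the oriented line $\{s\theta^\perp+t\theta: t\in\mathbb{R}\}$. The beam transform of $a$ is $Da(x,\theta)=\int_0^\infty a(x+t\theta)\,dt$ and the attenuated Radon transform is $$R_af(s,\theta)=\int_{-\infty}^\infty f(s\theta^\perp+t\theta)\,e^{-Da(s\theta^\perp+t\theta,\theta)}\,dt.$$ Multi-bang. $a\in L^\infty(\mathbb{R}^2)$ is multi-bang if there are finitely many distinct non-zero real numbers $a_1,\dots,a_n$ and disjoint bounded open sets $\Omega_1,\dots,\Omega_n\subset\mathbb{R}^2$, with smooth boundaries possibly having corners, such that $a=\sum_{j=1}^n a_j\chi_{\Omega_j}$, the interior of the closure of each $\Omega_j$ equals $\Omega_j$, and any line intersects $\bigcup_j\partial\Omega_j$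 only finitely many times (a segment of the line contained in a boundary being counted as one intersection). "Smooth boundary possibly having corners" means that the boundary consists of finitely many closed curves that are smooth except at finitely many corners, where two smooth arcs (branches) meet at an interior angle in $(0,\pi)\cup(\pi,2\pi)$. $\mathcal{P}_{a,1}$ is the set of points $x\in\partial\Omega_j$, for some $j$, at which $\partial\Omega_j$ has non-zero curvature; $\mathcal{P}_{a,2}$ is the set of points $x\in\partial\Omega_j$, for some $j$, at which $\partial\Omega_j$ has a corner. Nicely multi-bang. $a$ is nicely multi-bang if it is multi-bang and can be written as $a=\sum_{j=1}^N c_j\chi_{C_j}$ with real $c_j\neq0$, where the sets $C_j$ are convex, bounded, open, with smooth boundary possibly having corners, and nested: $C_N\Subset C_{N-1}\Subset\cdots\Subset C_1$. Here $C_j\Subset C_{j-1}$ means that $C_j$ is contained in a compact set that is contained in $C_{j-1}$. *)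

theory Defs
  imports "HOL-Analysis.Analysis"
begin

section \<open>Lines and transforms\<close>

type_synonym plane = "real ^ 2"

definition perp :: "plane \<Rightarrow> plane" where
  "perp \<theta> = vector [- (\<theta> $ 2), \<theta> $ 1]"

definition oriented_line :: "real \<Rightarrow> plane \<Rightarrow> plane set" where
  "oriented_line s \<theta> = range (\<lambda>t. s *\<^sub>R perp \<theta> + t *\<^sub>R \<theta>)"

definition lines :: "plane set set" where
  "lines = {oriented_line s \<theta> |s \<theta>. \<theta> \<in> sphere 0 1}"

definition beam_transform :: "(plane \<Rightarrow> real) \<Rightarrow> plane \<Rightarrow> plane \<Rightarrow> real" where
  "beam_transform a x \<theta> = (LINT t:{0..}|lborel. a (x + t *\<^sub>R \<theta>))"

definition attenuated_radon ::
  "(plane \<Rightarrow> real) \<Rightarrow> (plane \<Rightarrow> real) \<Rightarrow> real \<Rightarrow> plane \<Rightarrow> real" where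
  "attenuated_radon a f s \<theta> =
     (LINT t|lborel. f (s *\<^sub>R perp \<theta> + t *\<^sub>R \<theta>) *
        exp (- beam_transform a (s *\<^sub>R perp \<theta> + t *\<^sub>R \<theta>) \<theta>))"


section \<open>Boundaries that are smooth up to finitely many corners\<close>

definition smooth_on :: "real set \<Rightarrow> (real \<Rightarrow> plane) \<Rightarrow> bool" where
  "smooth_on U \<gamma> \<longleftrightarrow>
     (\<exists>D :: nat \<Rightarrow> real \<Rightarrow> plane. D 0 = \<gamma> \<and>
        (\<forall>k. \<forall>t\<in>U. (D k has_vector_derivative D (Suc k) t) (at t)))"

definition velocity :: "(real \<Rightarrow> plane) \<Rightarrow> real \<Rightarrow> plane" where
  "velocity \<gamma> t = vector_derivative \<gamma> (at t)"

definition acceleration :: "(real \<Rightarrow> plane) \<Rightarrow> real \<Rightarrow> plane" where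
  "acceleration \<gamma> t = vector_derivative (velocity \<gamma>) (at t)"

definition curvature :: "(real \<Rightarrow> plane) \<Rightarrow> real \<Rightarrow> real" where
  "curvature \<gamma> t =
     (velocity \<gamma> t $ 1 * acceleration \<gamma> t $ 2 - velocity \<gamma> t $ 2 * acceleration \<gamma> t $ 1)
       / norm (velocity \<gamma> t) ^ 3"

definition smooth_regular_at :: "(real \<Rightarrow> plane) \<Rightarrow> real \<Rightarrow> bool" where
  "smooth_regular_at \<gamma> t \<longleftrightarrow>
     (\<exists>e>0. smooth_on {t - e<..<t + e} \<gamma>) \<and> velocity \<gamma> t \<noteq> 0"

definition vec_angle :: "plane \<Rightarrow> plane \<Rightarrow> real" where
  "vec_angle u v = arccos ((u \<bullet> v) / (norm u * norm v))"

text \<open>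
  At a corner two regular arcs, smooth up to and including the corner, meet. Smoothness up to the
  endpoint is expressed by extensions \<open>g\<close> and \<open>h\<close> across it. The vectors \<open>- velocity g t\<close> and
  \<open>velocity h t\<close> are the tangents of the two branches pointing away from the corner. If
  \<open>\<alpha> \<in> [0, \<pi>]\<close> is the angle between them, then the interior angle of the domain is \<open>\<alpha>\<close> or
  \<open>2\<pi> - \<alpha>\<close>, depending on the side on which the domain lies, so the interior angle is in
  \<open>(0, \<pi>) \<union> (\<pi>, 2\<pi>)\<close> precisely when \<open>0 < \<alpha> < \<pi>\<close>.
\<close>

definition corner_at :: "(real \<Rightarrow> plane) \<Rightarrow> real \<Rightarrow> bool" where
  "corner_at \<gamma> t \<longleftrightarrow>
     (\<exists>g h. smooth_regular_at g t \<and> smooth_regular_at h t \<and>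
        (\<exists>e>0. (\<forall>s\<in>{t - e..t}. \<gamma> s = g s) \<and> (\<forall>s\<in>{t..t + e}. \<gamma> s = h s)) \<and>
        vec_angle (- velocity g t) (velocity h t) \<in> {0<..<pi})"

text \<open>
  Closed curves are parametrised 1-periodically on the whole line, so that no parameter value
  plays a special role. Continuity follows from the third conjunct.
\<close>

definition closed_curve_with_corners :: "(real \<Rightarrow> plane) \<Rightarrow> bool" where
  "closed_curve_with_corners \<gamma> \<longleftrightarrow>
     (\<forall>t. \<gamma> (t + 1) = \<gamma> t) \<and> inj_on \<gamma> {0..<1} \<and>
     (\<forall>t. smooth_regular_at \<gamma> t \<or> corner_at \<gamma> t) \<and>
     finite {t \<in> {0..<1}. corner_at \<gamma> t}"

definition boundary_curves :: "plane set \<Rightarrow> (real \<Rightarrow> plane) set \<Rightarrow> bool" where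
  "boundary_curves \<Omega> \<Gamma> \<longleftrightarrow>
     finite \<Gamma> \<and> (\<forall>\<gamma>\<in>\<Gamma>. closed_curve_with_corners \<gamma>) \<and> frontier \<Omega> = (\<Union>\<gamma>\<in>\<Gamma>. range \<gamma>)"

definition smooth_boundary_with_corners :: "plane set \<Rightarrow> bool" where
  "smooth_boundary_with_corners \<Omega> \<longleftrightarrow> (\<exists>\<Gamma>. boundary_curves \<Omega> \<Gamma>)"

definition is_boundary_curve :: "plane set \<Rightarrow> (real \<Rightarrow> plane) \<Rightarrow> bool" where
  "is_boundary_curve \<Omega> \<gamma> \<longleftrightarrow> (\<exists>\<Gamma>. boundary_curves \<Omega> \<Gamma> \<and> \<gamma> \<in> \<Gamma>)"

definition boundary_nonzero_curvature_at :: "plane set \<Rightarrow> plane \<Rightarrow> bool" where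
  "boundary_nonzero_curvature_at \<Omega> x \<longleftrightarrow>
     (\<exists>\<gamma> t. is_boundary_curve \<Omega> \<gamma> \<and> \<gamma> t = x \<and> smooth_regular_at \<gamma> t \<and> curvature \<gamma> t \<noteq> 0)"

definition boundary_corner_at :: "plane set \<Rightarrow> plane \<Rightarrow> bool" where
  "boundary_corner_at \<Omega> x \<longleftrightarrow>
     (\<exists>\<gamma> t. is_boundary_curve \<Omega> \<gamma> \<and> \<gamma> t = x \<and> corner_at \<gamma> t)"

definition is_boundary_tangent :: "plane set \<Rightarrow> plane \<Rightarrow> plane set \<Rightarrow> bool" where
  "is_boundary_tangent \<Omega> x L \<longleftrightarrow>
     (\<exists>\<gamma> t. is_boundary_curve \<Omega> \<gamma> \<and> \<gamma> t = x \<and> smooth_regular_at \<gamma> t \<and>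
        L = range (\<lambda>r. x + r *\<^sub>R velocity \<gamma> t))"


section \<open>Multi-bang functions\<close>

text \<open>
  Elements of \<open>L\<^sup>\<infinity>\<close> are represented by Borel functions, and identities between them, including
  the representations below as sums of indicator functions, are understood almost everywhere. This
  matters: on the boundary of an inner set the two representations in \<open>nicely_multi_bang\<close> take
  different values.
\<close>

definition L_infinity :: "(plane \<Rightarrow> real) \<Rightarrow> bool" where
  "L_infinity a \<longleftrightarrow> a \<in> borel_measurable borel \<and> (\<exists>B. AE x in lborel. \<bar>a x\<bar> \<le> B)"

text \<open>
  In the last but one conjunct, counting connected components counts a segment contained in the
  boundary as a single intersection.
\<close>

definition multi_bang_rep ::
  "(plane \<Rightarrow> real) \<Rightarrow> nat \<Rightarrow> (nat \<Rightarrow> real) \<Rightarrow> (nat \<Rightarrow> plane set) \<Rightarrow> bool" where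
  "multi_bang_rep a n v \<Omega> \<longleftrightarrow>
     inj_on v {1..n} \<and> (\<forall>j\<in>{1..n}. v j \<noteq> 0) \<and>
     disjoint_family_on \<Omega> {1..n} \<and>
     (\<forall>j\<in>{1..n}. bounded (\<Omega> j) \<and> open (\<Omega> j) \<and> smooth_boundary_with_corners (\<Omega> j) \<and>
        interior (closure (\<Omega> j)) = \<Omega> j) \<and>
     (\<forall>L\<in>lines. finite (components (L \<inter> (\<Union>j\<in>{1..n}. frontier (\<Omega> j))))) \<and>
     (AE x in lborel. a x = (\<Sum>j\<in>{1..n}. v j * indicator (\<Omega> j) x))"

definition multi_bang :: "(plane \<Rightarrow> real) \<Rightarrow> bool" where
  "multi_bang a \<longleftrightarrow> L_infinity a \<and> (\<exists>n v \<Omega>. multi_bang_rep a n v \<Omega>)"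

text \<open>
  The regions of a representation are regular open sets with null boundary, so up to numbering
  and empty regions they are determined by the class of \<open>a\<close>; the following notions are therefore
  properties of \<open>a\<close> rather than of a chosen representation.
\<close>

definition region :: "(plane \<Rightarrow> real) \<Rightarrow> plane set \<Rightarrow> bool" where
  "region a W \<longleftrightarrow> (\<exists>n v \<Omega>. multi_bang_rep a n v \<Omega> \<and> (\<exists>j\<in>{1..n}. W = \<Omega> j))"

definition curved_points :: "(plane \<Rightarrow> real) \<Rightarrow> plane set" where
  "curved_points a = {x. \<exists>W. region a W \<and> x \<in> frontier W \<and> boundary_nonzero_curvature_at W x}"

definition corner_points :: "(plane \<Rightarrow> real) \<Rightarrow> plane set" where
  "corner_points a = {x. \<exists>W. region a W \<and> x \<in> frontier W \<and> boundary_corner_at W x}"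

definition compactly_inside :: "plane set \<Rightarrow> plane set \<Rightarrow> bool" where
  "compactly_inside A B \<longleftrightarrow> (\<exists>K. compact K \<and> A \<subseteq> K \<and> K \<subseteq> B)"

definition nicely_multi_bang :: "(plane \<Rightarrow> real) \<Rightarrow> bool" where
  "nicely_multi_bang a \<longleftrightarrow> multi_bang a \<and>
     (\<exists>(N::nat) c C.
        (\<forall>j\<in>{1..N}. c j \<noteq> 0 \<and> convex (C j) \<and> bounded (C j) \<and> open (C j) \<and>
           smooth_boundary_with_corners (C j)) \<and>
        (\<forall>j\<in>{2..N}. compactly_inside (C j) (C (j - 1))) \<and>
        (AE x in lborel. a x = (\<Sum>j\<in>{1..N}. c j * indicator (C j) x)))"


section \<open>Admissible pairs\<close>

definition C1_compact_support :: "(plane \<Rightarrow> real) \<Rightarrow> bool" where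
  "C1_compact_support f \<longleftrightarrow>
     (\<exists>f' :: plane \<Rightarrow> plane \<Rightarrow>\<^sub>L real.
        (\<forall>x. (f has_derivative blinfun_apply (f' x)) (at x)) \<and> continuous_on UNIV f') \<and>
     compact (closure {x. f x \<noteq> 0})"

definition tangent_condition :: "(plane \<Rightarrow> real) \<Rightarrow> (plane \<Rightarrow> real) \<Rightarrow> bool" where
  "tangent_condition a f \<longleftrightarrow>
     (\<forall>x\<in>curved_points a. \<forall>W L. region a W \<and> is_boundary_tangent W x L \<longrightarrow>
        L \<inter> {y. f y > 0} \<noteq> {})"

definition corner_condition :: "(plane \<Rightarrow> real) \<Rightarrow> (plane \<Rightarrow> real) \<Rightarrow> bool" where
  "corner_condition a f \<longleftrightarrow>
     (\<forall>x\<in>corner_points a. \<exists>L\<in>lines. x \<in> L \<and> L \<inter> {y. f y > 0} \<noteq> {})"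

definition admissible_pair :: "(plane \<Rightarrow> real) \<Rightarrow> (plane \<Rightarrow> real) \<Rightarrow> bool" where
  "admissible_pair a f \<longleftrightarrow>
     nicely_multi_bang a \<and> C1_compact_support f \<and> (\<forall>x. f x \<ge> 0) \<and>
     tangent_condition a f \<and> corner_condition a f"

end

theory Submission
  imports Defs
begin

text \<open>
  The layers are recovered from the outside inwards. Along a line that crosses or avoids every layer,
  the data are Lipschitz in transversal translations, and their second differences are \<open>o(h)\<close> unless
  the line meets a corner. Suppose that the first \<open>m - 1\<close> layers agree but \<open>C\<^sub>m\<close> sticks out of \<open>C'\<^sub>m\<close>.
  By Sard's theorem, some normal separating the protruding part of \<open>C\<^sub>m\<close> from \<open>C'\<^sub>m\<close> supports \<open>C\<^sub>m\<close> at a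
  point of non-zero curvature or at a corner. In the first case the tangent meets \<open>{f > 0}\<close> and the length
  of the nearby chords, which the data detect, is not \<open>O(h)\<close>; in the second case some line through the
  corner meets \<open>{f > 0}\<close> and gives a second difference of exact order \<open>h\<close>. Neither can happen for the
  data of the other pair, so \<open>C\<^sub>m = C'\<^sub>m\<close>.

  Once the shapes agree, let \<open>c\<^sub>i = c'\<^sub>i\<close> for \<open>i < m\<close> and \<open>f = f'\<close> outside \<open>C\<^bsub>m-1\<^esub>\<close>. On lines missing \<open>C\<^sub>m\<close>
  the attenuation is affine in \<open>t\<close> wherever \<open>f \<noteq> f'\<close>, so the exponential Radon transform of \<open>f - f'\<close>
  vanishes there, and the support theorem gives \<open>f = f'\<close> outside \<open>C\<^sub>m\<close>. If \<open>f\<close> is positive somewhere outside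
  \<open>C\<^sub>m\<close>, then on lines near a tangent to \<open>C\<^sub>m\<close> from there, with chords of length \<open>\<rho>\<close> at distance \<open>h\<close>,
  the term \<open>f - f'\<close> contributes only \<open>O(h \<rho>)\<close>, while \<open>c\<^sub>m \<noteq> c'\<^sub>m\<close> would contribute at least a multiple
  of \<open>\<rho>\<close>. Otherwise \<open>f\<close> and \<open>f'\<close> vanish outside \<open>C\<^sub>m\<close>, which then has a corner, and the second
  differences there determine \<open>c\<^sub>m\<close> times the value of the data on the line.
\<close>

section \<open>Exponential Radon transforms\<close>

text \<open>Until the shapes are known the two sources are unrelated, so nothing can be cancelled
  between the pairs: the data of the second pair enter only through their regularity near lines that
  are not tangent to its layers. First differences do not isolate a corner, because the unknown
  gradient of the source and the smooth ends of chords also vary linearly; the symmetric second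
  difference removes these terms. A line supporting \<open>C m\<close> is not regular for the first
  pair. Near it the data are compared with \<open>layered_radon (m - 1) c C f\<close>, which is
  Lipschitz there and equals the data on the side where \<open>C m\<close> is missed. A layer
  attenuates a source point only if it lies ahead of it; as every line may be traversed both ways,
  the direction is chosen so that the point of \<open>{f > 0}\<close> has a negative parameter
  relative to the boundary point. Since \<open>a\<close> can be altered on any single line, its
  transform on one line carries no information; \<open>layered_radon\<close>, computed from the sets
  themselves, takes its place.\<close>

definition dir :: "real \<Rightarrow> plane" where
  "dir w = vector [cos w, sin w]"

lemma perp_dir: "perp (dir w) = vector [- sin w, cos w]"
  by (simp add: perp_def dir_def)

lemma inner_plane: "x \<bullet> y = x $ 1 * y $ 1 + x $ 2 * y $ (2::2)" for x y :: plane
  by (simp add: inner_vec_def UNIV_2)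

lemma norm_plane_sq: "(norm x)^2 = (x $ 1)^2 + (x $ 2)^2" for x :: plane
  by (simp only: power2_norm_eq_inner inner_plane) (simp add: power2_eq_square)

lemma norm_perp [simp]: "norm (perp \<theta>) = norm \<theta>"
  unfolding norm_eq_sqrt_inner inner_plane by (simp add: perp_def add.commute)

lemma inner_perp_self [simp]: "perp \<theta> \<bullet> \<theta> = 0" "\<theta> \<bullet> perp \<theta> = 0"
  by (simp_all add: inner_plane perp_def)

lemma norm_dir [simp]: "norm (dir w) = 1"
  by (simp add: norm_eq_sqrt_inner inner_plane dir_def flip: power2_eq_square)

lemma unit_vector_dir:
  fixes \<theta> :: plane
  assumes "norm \<theta> = 1"
  obtains w where "\<theta> = dir w"
proof -
  have "(\<theta> $ 1)^2 + (\<theta> $ 2)^2 = 1"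
    using assms norm_plane_sq[of \<theta>] by simp
  then obtain w where "\<theta> $ 1 = cos w" "\<theta> $ 2 = sin w"
    using sincos_total_2pi by metis
  then have "\<theta> = dir w" by (simp add: vec_eq_iff forall_2 dir_def)
  then show thesis by (rule that)
qed

lemma dir_has_derivative: "(dir has_vector_derivative perp (dir w)) (at w)"
proof -
  have eq: "dir = (\<lambda>w. cos w *\<^sub>R axis 1 1 + sin w *\<^sub>R axis 2 1)"
    by (auto simp: fun_eq_iff dir_def vec_eq_iff forall_2 axis_def)
  have eq2: "perp (dir w) = (- sin w) *\<^sub>R axis 1 1 + cos w *\<^sub>R axis 2 1"
    by (auto simp: perp_dir vec_eq_iff forall_2 axis_def)
  show ?thesis unfolding eq2 unfolding eq
    by (auto intro!: derivative_eq_intros simp: has_vector_derivative_def algebra_simps)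
qed

lemma perp_dir_has_derivative: "((\<lambda>w. perp (dir w)) has_vector_derivative - dir w) (at w)"
proof -
  have eq: "(\<lambda>w. perp (dir w)) = (\<lambda>w. (- sin w) *\<^sub>R axis 1 1 + cos w *\<^sub>R axis 2 1)"
    by (auto simp: fun_eq_iff perp_dir vec_eq_iff forall_2 axis_def)
  have eq2: "- dir w = (- cos w) *\<^sub>R axis 1 1 + (- sin w) *\<^sub>R axis 2 1"
    by (auto simp: dir_def vec_eq_iff forall_2 axis_def)
  show ?thesis unfolding eq2 eq
    by (auto intro!: derivative_eq_intros simp: has_vector_derivative_def algebra_simps)
qed

lemma isCont_dir: "isCont dir w" and isCont_perp_dir: "isCont (\<lambda>w. perp (dir w)) w"
  using dir_has_derivative perp_dir_has_derivative
  by (blast intro: has_vector_derivative_continuous)+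

lemma continuous_on_dir [continuous_intros]:
  assumes "continuous_on S f"
  shows "continuous_on S (\<lambda>x. dir (f x))" "continuous_on S (\<lambda>x. perp (dir (f x)))"
  using assms isCont_dir isCont_perp_dir
  by (auto intro!: continuous_on_compose2[where g = dir and t = UNIV]
      continuous_on_compose2[where g = "\<lambda>w. perp (dir w)" and t = UNIV] continuous_at_imp_continuous_on)

lemma has_real_derivative_parametric_integral:
  fixes F F' :: "real \<Rightarrow> real \<Rightarrow> real"
  assumes "\<And>x t. ((\<lambda>x. F x t) has_real_derivative F' x t) (at x)"
    and "continuous_on UNIV (\<lambda>(x,t). F' x t)"
    and "\<And>x. continuous_on UNIV (F x)"
  shows "((\<lambda>x. integral {a..b} (F x)) has_real_derivative integral {a..b} (F' x)) (at x)"
proof -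
  have "((\<lambda>x. integral (cbox a b) (F x)) has_field_derivative integral (cbox a b) (F' x)) (at x within UNIV)"
  proof (rule leibniz_rule_field_derivative)
    show "(F x) integrable_on cbox a b" for x
      by (rule integrable_continuous) (rule continuous_on_subset[OF assms(3)], simp)
    show "continuous_on (UNIV \<times> cbox a b) (\<lambda>(x,t). F' x t)"
      by (rule continuous_on_subset[OF assms(2)]) simp
  qed (use assms(1) in auto)
  then show ?thesis by simp
qed

text \<open>Orthogonality to monomials extends to polynomials. Replacing one factor of
  \<open>G t * G t\<close> by \<open>G t - p t\<close>, with \<open>p\<close> uniformly
  \<open>e\<close>-close to \<open>G\<close> by Weierstrass, shows that the integral of the square
  is at most \<open>e\<close> times that of \<open>\<bar>G t\<bar>\<close>, for every
  \<open>e > 0\<close>.\<close>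

lemma moments_zero_imp_zero:
  fixes G :: "real \<Rightarrow> real"
  assumes cont: "continuous_on {a..b} G"
    and mom: "\<And>k. integral {a..b} (\<lambda>t. t ^ k * G t) = 0"
    and t: "t \<in> {a..b}" and "a < b"
  shows "G t = 0"
proof -
  have int: "(\<lambda>t. p t * G t) integrable_on {a..b}" if "continuous_on {a..b} p" for p
    by (intro integrable_continuous_interval continuous_intros that cont)
  have poly: "integral {a..b} (\<lambda>t. p t * G t) = 0" if p: "real_polynomial_function p" for p
  proof -
    from p obtain c n where c: "p = (\<lambda>x. \<Sum>i\<le>n. c i * x ^ i)"
      unfolding real_polynomial_function_iff_sum by blast
    have "integral {a..b} (\<lambda>t. p t * G t) = integral {a..b} (\<lambda>t. \<Sum>i\<le>n. c i * (t ^ i * G t))"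
      by (simp add: c sum_distrib_right mult.assoc)
    also have "\<dots> = (\<Sum>i\<le>n. integral {a..b} (\<lambda>t. c i * (t ^ i * G t)))"
      by (rule integral_sum) (auto intro!: integrable_continuous_interval continuous_intros cont)
    also have "\<dots> = 0" by (simp add: mom)
    finally show ?thesis .
  qed
  have cabs: "continuous_on {a..b} (\<lambda>t. \<bar>G t\<bar>)" by (intro continuous_intros cont)
  have bound: "integral {a..b} (\<lambda>t. G t * G t) \<le> e * integral {a..b} (\<lambda>t. \<bar>G t\<bar>)" if "e > 0" for e
  proof -
    obtain p where p: "real_polynomial_function p" "\<And>x. x \<in> {a..b} \<Longrightarrow> \<bar>G x - p x\<bar> < e"
      using Stone_Weierstrass_real_polynomial_function[OF compact_Icc cont \<open>e > 0\<close>] by metis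
    have cp: "continuous_on {a..b} p"
      using p(1) by (simp add: continuous_on_polymonial_function real_polynomial_function_eq)
    have "integral {a..b} (\<lambda>t. G t * G t) = integral {a..b} (\<lambda>t. (G t - p t) * G t)"
      using integral_diff[OF int[OF cont] int[OF cp]] poly[OF p(1)] by (simp add: algebra_simps)
    also have "\<dots> \<le> integral {a..b} (\<lambda>t. e * \<bar>G t\<bar>)"
    proof (rule integral_le)
      show "(\<lambda>t. (G t - p t) * G t) integrable_on {a..b}"
        by (intro int continuous_intros cont cp)
      show "(\<lambda>t. e * \<bar>G t\<bar>) integrable_on {a..b}"
        by (intro integrable_continuous_interval continuous_intros cont)
      show "(G t - p t) * G t \<le> e * \<bar>G t\<bar>" if "t \<in> {a..b}" for t
      proof -
        have "(G t - p t) * G t \<le> \<bar>G t - p t\<bar> * \<bar>G t\<bar>"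
          by (metis abs_ge_self abs_mult)
        also have "\<dots> \<le> e * \<bar>G t\<bar>"
          by (rule mult_right_mono) (use p(2)[OF that] in auto)
        finally show ?thesis .
      qed
    qed
    finally show ?thesis by simp
  qed
  have nn: "integral {a..b} (\<lambda>t. \<bar>G t\<bar>) \<ge> 0"
    by (rule integral_nonneg) (auto intro: integrable_continuous_interval cabs)
  have "integral {a..b} (\<lambda>t. G t * G t) \<le> 0"
  proof (rule field_le_epsilon)
    fix e :: real assume "e > 0"
    let ?A = "integral {a..b} (\<lambda>t. \<bar>G t\<bar>)"
    have "integral {a..b} (\<lambda>t. G t * G t) \<le> e / (?A + 1) * ?A"
      using bound[of "e / (?A + 1)"] nn \<open>e > 0\<close> by simp
    also have "\<dots> \<le> e" using nn \<open>e > 0\<close> by (simp add: field_simps)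
    finally show "integral {a..b} (\<lambda>t. G t * G t) \<le> 0 + e" by simp
  qed
  moreover have "integral {a..b} (\<lambda>t. G t * G t) \<ge> 0"
    by (rule integral_nonneg[OF int[OF cont]]) simp
  ultimately have "integral {a..b} (\<lambda>t. G t * G t) = 0" by simp
  then have "G t * G t = 0"
    using integral_eq_0_iff[OF continuous_on_mult[OF cont cont] \<open>a < b\<close>] t by simp
  then show ?thesis by simp
qed

text \<open>The direction is given by an angle so that it can be differentiated as a real variable;
  \<open>s\<close> is the signed distance from the origin along \<open>perp (dir w)\<close>.\<close>

definition line_pt :: "real \<Rightarrow> real \<Rightarrow> real \<Rightarrow> plane" where
  "line_pt s w t = s *\<^sub>R perp (dir w) + t *\<^sub>R dir w"

lemma norm_line_pt_sq: "(norm (line_pt s w t))^2 = s^2 + t^2"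
proof -
  have "perp (dir w) \<bullet> perp (dir w) = 1" "dir w \<bullet> dir w = 1"
    by (simp_all add: dot_square_norm)
  then show ?thesis
    unfolding power2_norm_eq_inner line_pt_def
    by (simp add: inner_add_left inner_add_right inner_commute power2_eq_square)
qed

lemma line_pt_surj: "\<exists>t. line_pt (y \<bullet> perp (dir w)) w t = y"
proof
  have "y $ i * (cos w)\<^sup>2 + y $ i * (sin w)\<^sup>2 = y $ i" for i
    by (metis distrib_left mult.right_neutral sin_cos_squared_add2)
  from this[of 1] this[of 2]
  show "line_pt (y \<bullet> perp (dir w)) w (y \<bullet> dir w) = y"
    by (simp add: vec_eq_iff forall_2 line_pt_def perp_def inner_plane dir_def power2_eq_square algebra_simps)
qed

lemma line_pt_inner_perp: "line_pt s w t \<bullet> perp (dir w) = s"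
proof -
  have "perp (dir w) \<bullet> perp (dir w) = 1"
    by (simp add: dot_square_norm)
  then show ?thesis by (simp add: line_pt_def inner_add_left)
qed

lemma line_misses_iff: "(\<forall>t. line_pt s w t \<notin> K) \<longleftrightarrow> (\<forall>y\<in>K. y \<bullet> perp (dir w) \<noteq> s)"
  by (metis line_pt_inner_perp line_pt_surj)

text \<open>The projection of a convex set to the normal direction is an interval, so a value
  outside it leaves the whole set on one side. A missing line can thus be pushed to infinity through
  missing lines, and far away the integrals of a compactly supported function vanish.\<close>

lemma line_misses_ray:
  assumes "convex K" "\<forall>t. line_pt s w t \<notin> K"
  shows "(\<forall>s'\<ge>s. \<forall>t. line_pt s' w t \<notin> K) \<or> (\<forall>s'\<le>s. \<forall>t. line_pt s' w t \<notin> K)"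
proof -
  define P where "P = (\<lambda>y. y \<bullet> perp (dir w)) ` K"
  have "convex P" unfolding P_def
    by (rule convex_linear_image[OF _ assms(1)]) (simp add: linear_iff inner_add_left)
  then have int: "is_interval P" by (simp add: is_interval_convex_1)
  have s: "s \<notin> P" using assms(2) unfolding line_misses_iff P_def by auto
  have "(\<forall>y\<in>P. y < s) \<or> (\<forall>y\<in>P. s < y)"
  proof (rule ccontr)
    assume "\<not> ?thesis"
    then obtain y z where "y \<in> P" "z \<in> P" "s \<le> y" "z \<le> s" by (auto simp: not_less)
    then show False using s mem_is_interval_1_I[OF int] by blast
  qed
  then show ?thesis unfolding line_misses_iff P_def by force
qed

text \<open>Compactness gives a positive distance \<open>d\<close> between the line and
  \<open>K\<close>, and projections of points of norm at most \<open>B\<close> change by less than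
  \<open>d\<close> when the normal changes by less than \<open>d / B\<close>. Identities on missing
  lines may therefore be differentiated with respect to the angle.\<close>

lemma eventually_line_misses:
  assumes "compact K" "\<forall>t. line_pt s w t \<notin> K"
  shows "eventually (\<lambda>w. \<forall>t. line_pt s w t \<notin> K) (at w)"
proof (cases "K = {}")
  case False
  obtain y0 where y0: "y0 \<in> K" "\<And>y. y \<in> K \<Longrightarrow> \<bar>y0 \<bullet> perp (dir w) - s\<bar> \<le> \<bar>y \<bullet> perp (dir w) - s\<bar>"
  proof -
    have "continuous_on K (\<lambda>y. \<bar>y \<bullet> perp (dir w) - s\<bar>)" by (intro continuous_intros)
    from continuous_attains_inf[OF assms(1) False this] show thesis using that by blast
  qed
  define d where "d = \<bar>y0 \<bullet> perp (dir w) - s\<bar>"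
  have "d > 0" using assms(2) y0(1) unfolding line_misses_iff d_def by auto
  obtain B where B: "B > 0" "\<And>y. y \<in> K \<Longrightarrow> norm y \<le> B"
    using compact_imp_bounded[OF assms(1)] unfolding bounded_pos by blast
  have "((\<lambda>w. perp (dir w)) \<longlongrightarrow> perp (dir w)) (at w)"
    using isCont_perp_dir by (simp add: isCont_def)
  then have "eventually (\<lambda>v. dist (perp (dir v)) (perp (dir w)) < d / B) (at w)"
    by (rule tendstoD) (use \<open>d > 0\<close> B in simp)
  then show ?thesis
  proof (rule eventually_mono)
    fix v assume v: "dist (perp (dir v)) (perp (dir w)) < d / B"
    show "\<forall>t. line_pt s v t \<notin> K"
      unfolding line_misses_iff
    proof (intro ballI notI)
      fix y assume y: "y \<in> K" "y \<bullet> perp (dir v) = s"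
      have "d \<le> \<bar>y \<bullet> perp (dir w) - y \<bullet> perp (dir v)\<bar>" using y0(2)[OF y(1)] y(2) d_def by simp
      also have "\<dots> = \<bar>y \<bullet> (perp (dir w) - perp (dir v))\<bar>" by (simp add: inner_diff_right)
      also have "\<dots> \<le> norm y * norm (perp (dir w) - perp (dir v))" by (rule Cauchy_Schwarz_ineq2)
      also have "\<dots> \<le> B * norm (perp (dir w) - perp (dir v))"
        by (rule mult_right_mono[OF B(2)[OF y(1)]]) simp
      also have "\<dots> < B * (d / B)"
        using v B(1) by (intro mult_strict_left_mono) (simp_all add: dist_norm norm_minus_commute)
      finally show False using B(1) by simp
    qed
  qed
qed simp

text \<open>
  Differentiating \<open>\<integral> t\<^sup>k e\<^sup>\<mu>\<^sup>t g = 0\<close> with respect to the direction of the line brings out another factor \<open>t\<close>,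
  and a function all of whose moments vanish is zero.
\<close>

theorem exponential_radon_support:
  fixes g :: "plane \<Rightarrow> real" and g' :: "plane \<Rightarrow> plane \<Rightarrow>\<^sub>L real"
  assumes der: "\<And>x. (g has_derivative blinfun_apply (g' x)) (at x)"
    and cont: "continuous_on UNIV g'"
    and supp: "\<And>x. norm x \<ge> R \<Longrightarrow> g x = 0" and R: "R > 0"
    and K: "compact K" "convex K"
    and zero: "\<And>s w. \<forall>t. line_pt s w t \<notin> K \<Longrightarrow>
           integral {-R..R} (\<lambda>t. exp (\<mu> * t) * g (line_pt s w t)) = 0"
    and x: "x \<notin> K"
  shows "g x = 0"
proof -
  define e where "e k t = t ^ k * exp (\<mu> * t)" for k t
  define I where "I k s w = integral {-R..R} (\<lambda>t. e k t * g (line_pt s w t))" for k s w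
  define S where "S k s w = integral {-R..R} (\<lambda>t. e k t * g' (line_pt s w t) (perp (dir w)))" for k s w
  define A where "A k s w = integral {-R..R} (\<lambda>t. e k t * g' (line_pt s w t) (dir w))" for k s w
  define Z where "Z s w \<longleftrightarrow> (\<forall>t. line_pt s w t \<notin> K)" for s w
  have contg: "continuous_on S g" for S
    using der by (meson continuous_at_imp_continuous_on has_derivative_continuous)
  have lp_cont: "continuous_on UNIV (\<lambda>(s,t). line_pt s w t)"
    "continuous_on UNIV (\<lambda>(w,t). line_pt s w t)"
    "continuous_on UNIV (\<lambda>t. line_pt s w t)" for s w
    unfolding line_pt_def split_def by (intro continuous_intros)+
  have econt: "continuous_on S (\<lambda>x. e k (h x))" if "continuous_on S h" for S k and h :: "'b::topological_space \<Rightarrow> real"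
    unfolding e_def by (intro continuous_intros that)
  have gl_cont: "continuous_on S (\<lambda>t. g (line_pt s w t))" for s w S
    by (rule continuous_on_compose2[OF contg[of UNIV]]) (use lp_cont(3) in \<open>auto intro: continuous_on_subset\<close>)
  have g'_cont: "continuous_on S (\<lambda>x. blinfun_apply (g' (h x)) (v x))"
    if "continuous_on S h" "continuous_on S v" for S v and h :: "'b::topological_space \<Rightarrow> plane"
    by (intro continuous_intros continuous_on_compose2[OF cont] that) simp
  have gl_int: "(\<lambda>t. e k t * g (line_pt s w t)) integrable_on {-R..R}" for k s w
    by (intro integrable_continuous_interval continuous_intros econt gl_cont)
  have g'l_int: "(\<lambda>t. e k t * g' (line_pt s w t) v) integrable_on {-R..R}" for k s w v
    by (intro integrable_continuous_interval continuous_intros econt g'_cont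
        continuous_on_subset[OF lp_cont(3)]) simp
  have gder: "((\<lambda>x. g (h x)) has_real_derivative g' (h x) v) (at x)"
    if "(h has_vector_derivative v) (at x)" for h v and x :: real
  proof -
    have "((\<lambda>x. g (h x)) has_derivative (\<lambda>d. g' (h x) (d *\<^sub>R v))) (at x)"
      using has_derivative_compose[OF that[unfolded has_vector_derivative_def] der] by simp
    moreover have "(\<lambda>d. g' (h x) (d *\<^sub>R v)) = (*) (g' (h x) v)"
      by (auto simp: fun_eq_iff blinfun.scaleR_right)
    ultimately show ?thesis by (simp add: has_field_derivative_def)
  qed
  have dI_s: "((\<lambda>s. I k s w) has_real_derivative S k s w) (at s)" for k s w
    unfolding I_def S_def
  proof (rule has_real_derivative_parametric_integral)
    fix s t
    have "((\<lambda>s. line_pt s w t) has_vector_derivative perp (dir w)) (at s)"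
      unfolding line_pt_def by (auto intro!: derivative_eq_intros simp: has_vector_derivative_def)
    then show "((\<lambda>s. e k t * g (line_pt s w t)) has_real_derivative
                e k t * g' (line_pt s w t) (perp (dir w))) (at s)"
      by (intro DERIV_cmult gder)
  next
    show "continuous_on UNIV (\<lambda>(s, t). e k t * g' (line_pt s w t) (perp (dir w)))"
      unfolding split_def
      by (intro continuous_intros econt g'_cont lp_cont(1)[unfolded split_def])
  qed (intro continuous_intros econt gl_cont)
  have I_cont: "continuous_on X (\<lambda>s. I k s w)" for X k w
    by (rule DERIV_continuous_on) (rule has_field_derivative_at_within, rule dI_s)
  \<comment> \<open>Turning the line about the origin moves its point at parameter \<open>t\<close>
    with velocity \<open>t *\<^sub>R perp (dir w) - s *\<^sub>R dir w\<close>; the factor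
    \<open>t\<close> in the first term raises the order of the moment.\<close>
  have dI_w: "((\<lambda>w. I k s w) has_real_derivative S (Suc k) s w - s * A k s w) (at w)" for k s w
  proof -
    have "((\<lambda>w. I k s w) has_real_derivative
            integral {-R..R} (\<lambda>t. e k t * g' (line_pt s w t) (t *\<^sub>R perp (dir w) - s *\<^sub>R dir w))) (at w)"
      unfolding I_def
    proof (rule has_real_derivative_parametric_integral)
      fix w t
      have "((\<lambda>w. line_pt s w t) has_vector_derivative (s *\<^sub>R (- dir w) + t *\<^sub>R perp (dir w))) (at w)"
        unfolding line_pt_def
        by (intro has_vector_derivative_add bounded_linear.has_vector_derivative[OF bounded_linear_scaleR_right]
            dir_has_derivative perp_dir_has_derivative)
      then have "((\<lambda>w. line_pt s w t) has_vector_derivative (t *\<^sub>R perp (dir w) - s *\<^sub>R dir w)) (at w)"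
        by simp
      then show "((\<lambda>w. e k t * g (line_pt s w t)) has_real_derivative
                e k t * g' (line_pt s w t) (t *\<^sub>R perp (dir w) - s *\<^sub>R dir w)) (at w)"
        by (intro DERIV_cmult gder)
    next
      show "continuous_on UNIV (\<lambda>(w, t). e k t * g' (line_pt s w t) (t *\<^sub>R perp (dir w) - s *\<^sub>R dir w))"
        unfolding split_def
        by (intro continuous_intros econt g'_cont lp_cont(2)[unfolded split_def])
    qed (intro continuous_intros econt gl_cont)
    moreover have "integral {-R..R} (\<lambda>t. e k t * g' (line_pt s w t) (t *\<^sub>R perp (dir w) - s *\<^sub>R dir w))
        = integral {-R..R} (\<lambda>t. e (Suc k) t * g' (line_pt s w t) (perp (dir w)) - s * (e k t * g' (line_pt s w t) (dir w)))"
      by (rule integral_cong) (simp add: e_def blinfun.diff_right blinfun.scaleR_right algebra_simps)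
    moreover have "\<dots> = S (Suc k) s w - s * A k s w"
      unfolding S_def A_def
      by (intro integral_unique has_integral_diff has_integral_mult_right integrable_integral g'l_int)
    ultimately show ?thesis by simp
  qed
  \<comment> \<open>Integration by parts along the line: the derivative falls on
    \<open>t ^ k * exp (\<mu> * t)\<close>, and the boundary terms vanish because \<open>g\<close>
    does where \<open>\<bar>t\<bar> = R\<close>. Only moments of orders \<open>k - 1\<close> and
    \<open>k\<close> remain; for \<open>k = 0\<close> the truncated \<open>k - 1\<close> has
    coefficient 0.\<close>
  have A: "A k s w = - (real k * I (k - 1) s w + \<mu> * I k s w)" for k s w
  proof -
    let ?F = "\<lambda>t. e k t * g (line_pt s w t)"
    let ?F' = "\<lambda>t. e k t * g' (line_pt s w t) (dir w) +
                (real k * (e (k - 1) t * g (line_pt s w t)) + \<mu> * (e k t * g (line_pt s w t)))"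
    have "((\<lambda>t. ?F' t) has_integral (?F R - ?F (-R))) {-R..R}"
    proof (rule fundamental_theorem_of_calculus)
      fix t
      have "((\<lambda>t. line_pt s w t) has_vector_derivative dir w) (at t)"
        unfolding line_pt_def by (auto intro!: derivative_eq_intros simp: has_vector_derivative_def)
      from gder[OF this] have "(?F has_real_derivative ?F' t) (at t)"
        unfolding e_def by (auto intro!: derivative_eq_intros simp: algebra_simps)
      then show "(?F has_vector_derivative ?F' t) (at t within {-R..R})"
        by (simp add: has_real_derivative_iff_has_vector_derivative has_vector_derivative_at_within)
    qed (use R in simp)
    moreover have "g (line_pt s w t) = 0" if "\<bar>t\<bar> = R" for t
    proof (rule supp, rule power2_le_imp_le)
      have "t^2 = R^2" using that by (metis power2_abs)
      then show "R\<^sup>2 \<le> (norm (line_pt s w t))\<^sup>2" by (simp add: norm_line_pt_sq add_increasing add_increasing2)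
    qed simp
    ultimately have "integral {-R..R} ?F' = 0" using R by (simp add: integral_unique)
    moreover have "(?F' has_integral (A k s w + (real k * I (k - 1) s w + \<mu> * I k s w))) {-R..R}"
    proof (intro has_integral_add has_integral_mult_right)
      show "((\<lambda>t. e k t * g' (line_pt s w t) (dir w)) has_integral A k s w) {-R..R}"
        unfolding A_def by (rule integrable_integral) (rule g'l_int)
      show "((\<lambda>t. e (k - 1) t * g (line_pt s w t)) has_integral I (k - 1) s w) {-R..R}"
        unfolding I_def by (rule integrable_integral) (rule gl_int)
      show "((\<lambda>t. e k t * g (line_pt s w t)) has_integral I k s w) {-R..R}"
        unfolding I_def by (rule integrable_integral) (rule gl_int)
    qed
    then have "integral {-R..R} ?F' = A k s w + (real k * I (k - 1) s w + \<mu> * I k s w)"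
      by (rule integral_unique)
    ultimately show ?thesis by simp
  qed
  have far: "I k s w = 0" if "\<bar>s\<bar> \<ge> R" for k s w
  proof -
    have "g (line_pt s w t) = 0" for t
    proof (rule supp, rule power2_le_imp_le)
      have "R^2 \<le> s^2" using that R by (metis abs_le_square_iff abs_of_pos)
      then show "R\<^sup>2 \<le> (norm (line_pt s w t))\<^sup>2" by (simp add: norm_line_pt_sq add_increasing add_increasing2)
    qed simp
    then show ?thesis by (simp add: I_def)
  qed
  \<comment> \<open>If the moments of orders \<open>k - 1\<close> and \<open>k\<close> vanish on all
    missing lines, so does \<open>A k\<close>, and the angular derivative of \<open>I k\<close>
    leaves \<open>S (Suc k) = 0\<close>. As \<open>S (Suc k)\<close> is the derivative of
    \<open>I (Suc k)\<close> in \<open>s\<close>, the latter is constant along a family of missing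
    lines that reaches beyond distance \<open>R\<close>.\<close>
  have step: "I (Suc k) s w = 0"
    if k: "\<And>s w. Z s w \<Longrightarrow> I k s w = 0" "\<And>s w. k > 0 \<Longrightarrow> Z s w \<Longrightarrow> I (k - 1) s w = 0"
      and Z: "Z s w" for k s w
  proof -
    have d0: "S (Suc k) s w = 0" if Z: "Z s w" for s w
    proof -
      have "A k s w = 0" using A k that by (cases k) auto
      moreover have "eventually (\<lambda>w. I k s w = 0) (nhds w)"
        unfolding eventually_nhds_conv_at
        using eventually_mono[OF eventually_line_misses[OF K(1) that[unfolded Z_def]] k(1)[unfolded Z_def]]
          k(1)[OF that] by auto
      then have "((\<lambda>w. I k s w) has_real_derivative 0) (at w) \<longleftrightarrow> ((\<lambda>w. 0) has_real_derivative 0) (at w)"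
        by (intro DERIV_cong_ev) auto
      then have "((\<lambda>w. I k s w) has_real_derivative 0) (at w)" by simp
      ultimately show ?thesis using DERIV_unique[OF dI_w[of k s w]] by fastforce
    qed
    consider "\<forall>s'\<ge>s. Z s' w" | "\<forall>s'\<le>s. Z s' w"
      using line_misses_ray[OF K(2) Z[unfolded Z_def]] unfolding Z_def by blast
    then show ?thesis
    proof cases
      case 1
      let ?b = "max R s + 1"
      have "I (Suc k) ?b w = I (Suc k) s w"
      proof (rule DERIV_isconst_end[where f = "\<lambda>s. I (Suc k) s w"])
        show "continuous_on {s..?b} (\<lambda>s. I (Suc k) s w)"
          by (rule I_cont)
        show "DERIV (\<lambda>s. I (Suc k) s w) x :> 0" if "s < x" "x < ?b" for x
          using dI_s[of "Suc k" w x] d0[of x w] 1 that by simp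
      qed simp
      then show ?thesis using far[of ?b "Suc k" w] by simp
    next
      case 2
      let ?a = "min (-R) s - 1"
      have "I (Suc k) s w = I (Suc k) ?a w"
      proof (rule DERIV_isconst_end[where f = "\<lambda>s. I (Suc k) s w"])
        show "continuous_on {?a..s} (\<lambda>s. I (Suc k) s w)"
          by (rule I_cont)
        show "DERIV (\<lambda>s. I (Suc k) s w) x :> 0" if "?a < x" "x < s" for x
          using dI_s[of "Suc k" w x] d0[of x w] 2 that by simp
      qed simp
      then show ?thesis using far[of ?a "Suc k" w] by simp
    qed
  qed
  \<comment> \<open>Two consecutive orders are carried through the induction because
    \<open>A k\<close> refers to both \<open>k - 1\<close> and \<open>k\<close>.\<close>
  have I0: "I k s w = 0 \<and> I (Suc k) s w = 0" if "Z s w" for k s w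
    using that
  proof (induction k arbitrary: s w)
    case 0
    have z: "I 0 s w = 0" if "Z s w" for s w
      using zero[OF that[unfolded Z_def]] by (simp add: I_def e_def)
    show ?case using step[of 0] z 0 by simp
  next
    case (Suc k)
    then show ?case using step[of "Suc k" s w] by simp
  qed
  \<comment> \<open>A hyperplane separating \<open>x\<close> from \<open>K\<close> has, up to
    length, the normal \<open>perp (dir w)\<close>; its parallel through \<open>x\<close> misses
    \<open>K\<close>.\<close>
  obtain w where w: "Z (x \<bullet> perp (dir w)) w"
  proof (cases "K = {}")
    case True
    then show thesis using that unfolding Z_def by blast
  next
    case False
    obtain a b where ab: "a \<bullet> x < b" "\<forall>y\<in>K. b < a \<bullet> y"
      using separating_hyperplane_closed_point[OF K(2) compact_imp_closed[OF K(1)] x] by blast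
    have "a \<noteq> 0" using ab False by fastforce
    then have "norm (- perp a /\<^sub>R norm a) = 1" by simp
    then obtain w where w: "- perp a /\<^sub>R norm a = dir w"
      using unit_vector_dir by metis
    have pd: "perp (dir w) = a /\<^sub>R norm a"
      unfolding w[symmetric] by (simp add: perp_def vec_eq_iff forall_2)
    have "y \<bullet> a \<noteq> x \<bullet> a" if "y \<in> K" for y
      using ab that by (metis inner_commute not_less_iff_gr_or_eq order_less_trans)
    then have "Z (x \<bullet> perp (dir w)) w"
      using \<open>a \<noteq> 0\<close> unfolding Z_def line_misses_iff pd by simp
    then show thesis by (rule that)
  qed
  obtain t where t: "line_pt (x \<bullet> perp (dir w)) w t = x" using line_pt_surj by blast
  show ?thesis
  proof (cases "\<bar>t\<bar> \<ge> R")
    case True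
    then have "R^2 \<le> t^2" using R by (metis abs_le_square_iff abs_of_pos)
    then have "R\<^sup>2 \<le> (norm (line_pt (x \<bullet> perp (dir w)) w t))\<^sup>2" unfolding norm_line_pt_sq by (simp add: add_increasing)
    then show ?thesis using t supp power2_le_imp_le[of R "norm x"] by simp
  next
    case False
    have "exp (\<mu> * t) * g (line_pt (x \<bullet> perp (dir w)) w t) = 0"
    proof (rule moments_zero_imp_zero[where G = "\<lambda>t. exp (\<mu> * t) * g (line_pt (x \<bullet> perp (dir w)) w t)"])
      show "continuous_on {-R..R} (\<lambda>t. exp (\<mu> * t) * g (line_pt (x \<bullet> perp (dir w)) w t))"
        by (intro continuous_intros gl_cont)
      show "integral {-R..R} (\<lambda>t. t ^ k * (exp (\<mu> * t) * g (line_pt (x \<bullet> perp (dir w)) w t))) = 0" for k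
        using I0[OF w, of k] by (simp add: I_def e_def mult.assoc)
    qed (use False R in auto)
    then show ?thesis using t by simp
  qed
qed

section \<open>Chords of convex bodies\<close>

text \<open>In a pair \<open>(h, t)\<close>, \<open>h\<close> is the displacement of a line and
  \<open>t\<close> the position along it. On an empty section the supremum is an arbitrary value,
  which is why facts about the ends of a chord carry a witness such as
  \<open>(h, p0) \<in> S\<close>.\<close>

definition chord_top :: "(real \<times> real) set \<Rightarrow> real \<Rightarrow> real" where
  "chord_top S h = Sup {t. (h, t) \<in> S}"

definition chord_bot :: "(real \<times> real) set \<Rightarrow> real \<Rightarrow> real" where
  "chord_bot S h = Inf {t. (h, t) \<in> S}"

text \<open>Reversal of the lines. It exchanges the two ends of each chord, so facts about lower
  ends follow from those about upper ends.\<close>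

definition flip :: "(real \<times> real) set \<Rightarrow> (real \<times> real) set" where
  "flip S = {(h, t). (h, - t) \<in> S}"

text \<open>Affine functions have second difference 0, so differentiability at 0 gives
  \<open>o(h)\<close>, while a kink contributes a multiple of \<open>h\<close>.\<close>

definition second_diff :: "(real \<Rightarrow> real) \<Rightarrow> real \<Rightarrow> real" where
  "second_diff g h = g h + g (- h) - 2 * g 0"

lemma affine_param:
  fixes a b x :: real
  assumes "a \<noteq> b"
  shows "(1 - (x - a) / (b - a)) * a + (x - a) / (b - a) * b = x"
proof -
  have eq: "(1 - u) * a + u * b = a + u * (b - a)" for u by (simp add: algebra_simps)
  show ?thesis unfolding eq using assms by simp
qed

lemma affine_same: "(1 - u) * b + u * b = (b :: real)"
  by (simp add: left_diff_distrib)

locale convex_body =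
  fixes S :: "(real \<times> real) set"
  assumes convex: "convex S" and open_S: "open S" and bounded_S: "bounded S"
begin

lemma mem_combine:
  assumes "(a, s) \<in> S" "(b, t) \<in> S" "0 \<le> u" "u \<le> 1"
  shows "((1 - u) * a + u * b, (1 - u) * s + u * t) \<in> S"
  using convexD[OF convex assms(1,2), of "1 - u" u] assms(3,4) by simp

lemma mem_combine_closure:
  assumes "(a, s) \<in> S" "(b, t) \<in> closure S" "0 \<le> u" "u < 1"
  shows "((1 - u) * a + u * b, (1 - u) * s + u * t) \<in> S"
proof (cases "u = 0 \<or> (a, s) = (b, t)")
  case True
  then have "((1 - u) * a + u * b, (1 - u) * s + u * t) = (a, s)"
    using affine_same by auto
  then show ?thesis using assms(1) by simp
next
  case False
  have "open_segment (a, s) (b, t) \<subseteq> interior S"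
    using in_interior_closure_convex_segment[OF convex _ assms(2)] assms(1) open_S
    by (simp add: interior_open)
  moreover have "(1 - u) *\<^sub>R (a, s) + u *\<^sub>R (b, t) \<in> open_segment (a, s) (b, t)"
    unfolding in_segment(2) using False assms(3,4) by (intro conjI exI[of _ u]) auto
  ultimately show ?thesis using interior_subset by auto
qed

lemma chord_bdd: "bdd_above {t. (h, t) \<in> S}" "bdd_below {t. (h, t) \<in> S}"
proof -
  obtain B where B: "\<And>x. x \<in> S \<Longrightarrow> norm x \<le> B"
    using bounded_S unfolding bounded_iff by blast
  have bd: "t \<le> B \<and> - B \<le> t" if "(h, t) \<in> S" for t
    using B[OF that] norm_snd_le[of t h] by auto
  show "bdd_above {t. (h, t) \<in> S}" by (rule bdd_aboveI[of _ B]) (use bd in blast)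
  show "bdd_below {t. (h, t) \<in> S}" by (rule bdd_belowI[of _ "-B"]) (use bd in blast)
qed

lemma chord_open: "open {t. (h, t) \<in> S}"
proof -
  have "open ((\<lambda>t. (h, t)) -` S)"
    by (rule open_vimage[OF open_S]) (intro continuous_intros)
  then show ?thesis by (simp add: vimage_def)
qed

lemma le_chord_top: "(h, t) \<in> S \<Longrightarrow> t \<le> chord_top S h"
  unfolding chord_top_def by (rule cSup_upper[OF _ chord_bdd(1)]) simp

lemma chord_bot_le: "(h, t) \<in> S \<Longrightarrow> chord_bot S h \<le> t"
  unfolding chord_bot_def by (rule cInf_lower[OF _ chord_bdd(2)]) simp

lemma less_chord_top:
  assumes "(h, t) \<in> S" shows "t < chord_top S h"
proof -
  obtain e where "e > 0" "\<And>y. dist y t < e \<Longrightarrow> (h, y) \<in> S"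
    using chord_open[of h] assms unfolding open_dist by auto
  then have "(h, t + e / 2) \<in> S" by (simp add: dist_real_def)
  then show ?thesis using le_chord_top[of h "t + e / 2"] \<open>e > 0\<close> by simp
qed

lemma chord_bot_less:
  assumes "(h, t) \<in> S" shows "chord_bot S h < t"
proof -
  obtain e where "e > 0" "\<And>y. dist y t < e \<Longrightarrow> (h, y) \<in> S"
    using chord_open[of h] assms unfolding open_dist by auto
  then have "(h, t - e / 2) \<in> S" by (simp add: dist_real_def)
  then show ?thesis using chord_bot_le[of h "t - e / 2"] \<open>e > 0\<close> by simp
qed

lemma chord_eq:
  assumes "(h, p0) \<in> S"
  shows "{t. (h, t) \<in> S} = {chord_bot S h<..<chord_top S h}"
proof (intro equalityI subsetI)
  fix t assume "t \<in> {t. (h, t) \<in> S}"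
  then show "t \<in> {chord_bot S h<..<chord_top S h}"
    using less_chord_top chord_bot_less by auto
next
  fix t assume t: "t \<in> {chord_bot S h<..<chord_top S h}"
  have ne: "{t. (h, t) \<in> S} \<noteq> {}" using assms by auto
  obtain t1 where t1: "(h, t1) \<in> S" "t < t1"
    using t less_cSup_iff[OF ne chord_bdd(1)] unfolding chord_top_def by auto
  obtain t2 where t2: "(h, t2) \<in> S" "t2 < t"
    using t cInf_less_iff[OF ne chord_bdd(2)] unfolding chord_bot_def by auto
  have "((1 - (t - t2) / (t1 - t2)) * h + (t - t2) / (t1 - t2) * h,
         (1 - (t - t2) / (t1 - t2)) * t2 + (t - t2) / (t1 - t2) * t1) \<in> S"
    using t1 t2 by (intro mem_combine) auto
  moreover have "(1 - (t - t2) / (t1 - t2)) * t2 + (t - t2) / (t1 - t2) * t1 = t"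
    using t1 t2 by (intro affine_param) simp
  ultimately show "t \<in> {t. (h, t) \<in> S}" by (simp add: algebra_simps)
qed

lemma flip_body: "convex_body (flip S)"
proof
  have eq: "flip S = (\<lambda>x. (fst x, - snd x)) -` S" by (auto simp: flip_def)
  have eq': "flip S = (\<lambda>x. (fst x, - snd x)) ` S"
    unfolding eq by (auto simp: image_iff) (metis fst_conv minus_minus snd_conv)
  have lin: "linear (\<lambda>x :: real \<times> real. (fst x, - snd x))" by (auto simp: linear_iff)
  show "convex (flip S)" unfolding eq' by (rule convex_linear_image[OF lin convex])
  show "bounded (flip S)" unfolding eq' by (rule bounded_linear_image[OF bounded_S]) (simp add: linear_linear lin linear_conv_bounded_linear[symmetric])
  show "open (flip S)" unfolding eq by (rule open_vimage[OF open_S]) (intro continuous_intros)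
qed

lemma closure_flip: "(h, t) \<in> closure S \<Longrightarrow> (h, - t) \<in> closure (flip S)"
proof -
  have eq: "flip S = (\<lambda>x. (fst x, - snd x)) ` S"
    by (auto simp: flip_def image_iff) (metis fst_conv minus_minus snd_conv)
  have "(\<lambda>x. (fst x, - snd x)) ` closure S \<subseteq> closure (flip S)" unfolding eq
    by (rule image_closure_subset) (auto intro!: continuous_intros closure_subset)
  then show "(h, t) \<in> closure S \<Longrightarrow> (h, - t) \<in> closure (flip S)" by force
qed

lemma chord_bot_flip: "chord_bot S h = - chord_top (flip S) h"
proof -
  have "{t. (h, t) \<in> flip S} = uminus ` {t. (h, t) \<in> S}"
    by (auto simp: flip_def image_iff) (metis minus_minus)
  then show ?thesis by (simp add: chord_bot_def chord_top_def Inf_real_def)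
qed

lemma closure_le_chord_top:
  assumes "(h, t) \<in> closure S" "(h, p0) \<in> S"
  shows "t \<le> chord_top S h"
proof (rule ccontr)
  assume "\<not> ?thesis"
  then have lt: "chord_top S h < t" by simp
  moreover have "p0 < chord_top S h" by (rule less_chord_top[OF assms(2)])
  ultimately have ot: "p0 < t" by simp
  let ?u = "(chord_top S h - p0) / (t - p0)"
  have "((1 - ?u) * h + ?u * h, (1 - ?u) * p0 + ?u * t) \<in> S"
    using lt ot \<open>p0 < chord_top S h\<close> by (intro mem_combine_closure assms) auto
  moreover have "(1 - ?u) * p0 + ?u * t = chord_top S h" using ot by (intro affine_param) simp
  ultimately have "(h, chord_top S h) \<in> S" by (simp add: algebra_simps)
  then show False using less_chord_top by blast
qed

lemma closure_ge_chord_bot: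
  assumes "(h, t) \<in> closure S" "(h, p0) \<in> S"
  shows "chord_bot S h \<le> t"
  using convex_body.closure_le_chord_top[OF flip_body closure_flip[OF assms(1)], of "-p0"] assms(2)
  by (simp add: chord_bot_flip flip_def)

lemma chord_top_in_closure:
  assumes "(h, p0) \<in> S" shows "(h, chord_top S h) \<in> closure S"
proof -
  have ne: "{t. (h, t) \<in> S} \<noteq> {}" using assms by auto
  have "chord_top S h \<in> closure {t. (h, t) \<in> S}"
    unfolding chord_top_def by (rule closure_contains_Sup[OF ne chord_bdd(1)])
  moreover have "(\<lambda>t. (h, t)) ` closure {t. (h, t) \<in> S} \<subseteq> closure S"
    by (rule image_closure_subset) (auto intro!: continuous_intros subsetD[OF closure_subset])
  ultimately show ?thesis by blast
qed

lemma chord_bot_in_closure: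
  assumes "(h, p0) \<in> S" shows "(h, chord_bot S h) \<in> closure S"
proof -
  have ne: "{t. (h, t) \<in> S} \<noteq> {}" using assms by auto
  have "chord_bot S h \<in> closure {t. (h, t) \<in> S}"
    unfolding chord_bot_def by (rule closure_contains_Inf[OF ne chord_bdd(2)])
  moreover have "(\<lambda>t. (h, t)) ` closure {t. (h, t) \<in> S} \<subseteq> closure S"
    by (rule image_closure_subset) (auto intro!: continuous_intros subsetD[OF closure_subset])
  ultimately show ?thesis by blast
qed

lemma chord_top_concave:
  assumes "(a, p) \<in> S" "(b, q) \<in> S" "0 \<le> u" "u \<le> 1"
  shows "(1 - u) * chord_top S a + u * chord_top S b \<le> chord_top S ((1 - u) * a + u * b)"
proof (rule field_le_epsilon)
  fix e :: real assume "e > 0"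
  have ne: "{t. (a, t) \<in> S} \<noteq> {}" "{t. (b, t) \<in> S} \<noteq> {}" using assms by auto
  obtain s where s: "(a, s) \<in> S" "chord_top S a - e < s"
    using less_cSup_iff[OF ne(1) chord_bdd(1), of "chord_top S a - e"] \<open>e > 0\<close>
    unfolding chord_top_def by auto
  obtain t where t: "(b, t) \<in> S" "chord_top S b - e < t"
    using less_cSup_iff[OF ne(2) chord_bdd(1), of "chord_top S b - e"] \<open>e > 0\<close>
    unfolding chord_top_def by auto
  have "(1 - u) * chord_top S a + u * chord_top S b \<le> (1 - u) * (s + e) + u * (t + e)"
    using s t assms by (intro add_mono mult_left_mono) auto
  also have "\<dots> = ((1 - u) * s + u * t) + e" by (simp add: algebra_simps)
  also have "\<dots> \<le> chord_top S ((1 - u) * a + u * b) + e"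
    using le_chord_top[OF mem_combine[OF s(1) t(1) assms(3,4)]] by simp
  finally show "(1 - u) * chord_top S a + u * chord_top S b \<le> chord_top S ((1 - u) * a + u * b) + e" .
qed

end

text \<open>This is the beam transform, at position \<open>t\<close> of the line with displacement
  \<open>h\<close>, of the indicator function of the layer.\<close>

definition ray_meas :: "(real \<times> real) set \<Rightarrow> real \<Rightarrow> real \<Rightarrow> real" where
  "ray_meas S h t = measure lborel {r. t \<le> r \<and> (h, r) \<in> S}"

text \<open>Near \<open>u0\<close> the value \<open>g u\<close> has the sign of
  \<open>v * (u - u0)\<close>, and both halves of a neighbourhood are available. Applied to a
  coordinate of a curve, this yields points of the curve where that coordinate is small and of
  prescribed sign.\<close>

lemma small_values_both_signs:
  fixes g :: "real \<Rightarrow> real"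
  assumes der: "(g has_real_derivative v) (at u0)" and "v \<noteq> 0" "g u0 = 0"
    and ev: "eventually P (at u0)" and "e > 0"
  shows "\<exists>u. P u \<and> 0 < g u \<and> g u < e" "\<exists>u. P u \<and> - e < g u \<and> g u < 0"
proof -
  have "((\<lambda>u. (g u / (u - u0)) * v) \<longlongrightarrow> v * v) (at u0)"
    using der \<open>g u0 = 0\<close> unfolding has_field_derivative_iff by (intro tendsto_intros) simp
  moreover have "v * v > 0" using \<open>v \<noteq> 0\<close> by (metis not_real_square_gt_zero)
  ultimately have e1: "eventually (\<lambda>u. 0 < (g u / (u - u0)) * v) (at u0)"
    by (rule order_tendstoD(1))
  have "(g \<longlongrightarrow> 0) (at u0)"
    using DERIV_isCont[OF der] \<open>g u0 = 0\<close> by (simp add: isCont_def)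
  from tendstoD[OF this \<open>e > 0\<close>] have e2: "eventually (\<lambda>u. \<bar>g u\<bar> < e) (at u0)" by simp
  from eventually_conj[OF ev eventually_conj[OF e1 e2]]
  obtain d where d: "d > 0" "\<And>u. u \<noteq> u0 \<Longrightarrow> dist u u0 < d \<Longrightarrow> P u \<and> 0 < (g u / (u - u0)) * v \<and> \<bar>g u\<bar> < e"
    unfolding eventually_at by auto
  have r: "P (u0 + d / 2)" "0 < (g (u0 + d / 2) / (d / 2)) * v" "\<bar>g (u0 + d / 2)\<bar> < e"
    using d(2)[of "u0 + d / 2"] d(1) by (auto simp: dist_real_def)
  have l: "P (u0 - d / 2)" "0 < (g (u0 - d / 2) / (- (d / 2))) * v" "\<bar>g (u0 - d / 2)\<bar> < e"
    using d(2)[of "u0 - d / 2"] d(1) by (auto simp: dist_real_def)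
  have r': "0 < g (u0 + d / 2) * v" using r(2) d(1) by (simp add: zero_less_mult_iff zero_less_divide_iff divide_less_0_iff)
  have l': "g (u0 - d / 2) * v < 0" using l(2) d(1) by (simp add: zero_less_mult_iff mult_less_0_iff zero_less_divide_iff divide_less_0_iff)
  consider "v > 0" | "v < 0" using \<open>v \<noteq> 0\<close> by linarith
  then have "(\<exists>u. P u \<and> 0 < g u \<and> g u < e) \<and> (\<exists>u. P u \<and> - e < g u \<and> g u < 0)"
  proof cases
    case 1
    then have "0 < g (u0 + d / 2)" "g (u0 - d / 2) < 0"
      using r' l' by (simp_all add: zero_less_mult_iff mult_less_0_iff)
    then show ?thesis using r l by (intro conjI exI[of _ "u0 + d / 2"] exI[of _ "u0 - d / 2"]) auto
  next
    case 2
    then have "g (u0 + d / 2) < 0" "0 < g (u0 - d / 2)"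
      using r' l' by (simp_all add: zero_less_mult_iff mult_less_0_iff)
    then show ?thesis using r l by (intro conjI exI[of _ "u0 - d / 2"] exI[of _ "u0 + d / 2"]) auto
  qed
  then show "\<exists>u. P u \<and> 0 < g u \<and> g u < e" "\<exists>u. P u \<and> - e < g u \<and> g u < 0" by blast+
qed

section \<open>Length of the part of a chord ahead of a given position\<close>

context convex_body begin

lemma ray_meas_chord:
  assumes "(h, p0) \<in> S"
  shows "ray_meas S h t = max 0 (chord_top S h - max t (chord_bot S h))"
proof -
  have "chord_bot S h < chord_top S h" using less_chord_top chord_bot_less assms by fastforce
  have "{r. t \<le> r \<and> (h, r) \<in> S} = {t..} \<inter> {chord_bot S h<..<chord_top S h}"
    unfolding chord_eq[OF assms, symmetric] by auto
  also have "\<dots> = (if t \<le> chord_bot S h then {chord_bot S h<..<chord_top S h} else {t..<chord_top S h})"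
    by auto
  finally show ?thesis unfolding ray_meas_def
    using \<open>chord_bot S h < chord_top S h\<close> by (auto simp: max_def)
qed

lemma ray_meas_empty: "(\<And>p0. (h, p0) \<notin> S) \<Longrightarrow> ray_meas S h t = 0"
  by (simp add: ray_meas_def)

lemma ray_meas_nonneg: "0 \<le> ray_meas S h t" by (simp add: ray_meas_def)

lemma ray_meas_bound: "\<exists>M. \<forall>h t. ray_meas S h t \<le> M"
proof -
  obtain B where B: "\<And>x. x \<in> S \<Longrightarrow> norm x \<le> B"
    using bounded_S unfolding bounded_iff by blast
  have "ray_meas S h t \<le> 2 * \<bar>B\<bar>" for h t
  proof (cases "\<exists>p0. (h, p0) \<in> S")
    case True
    then obtain p0 where p0: "(h, p0) \<in> S" by blast
    have ne: "{t. (h, t) \<in> S} \<noteq> {}" using p0 by auto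
    have bd: "t \<le> B \<and> - B \<le> t" if "(h, t) \<in> S" for t
      using B[OF that] norm_snd_le[of t h] by auto
    have "chord_top S h \<le> B" unfolding chord_top_def by (rule cSup_least[OF ne]) (use bd in blast)
    moreover have "- B \<le> chord_bot S h" unfolding chord_bot_def by (rule cInf_greatest[OF ne]) (use bd in blast)
    ultimately show ?thesis unfolding ray_meas_chord[OF p0] by (auto simp: max_def)
  next
    case False
    then show ?thesis by (subst ray_meas_empty) auto
  qed
  then show ?thesis by blast
qed

lemma ray_meas_antimono:
  assumes "t \<le> t'" shows "ray_meas S h t' \<le> ray_meas S h t"
proof (cases "\<exists>p0. (h, p0) \<in> S")
  case True
  then obtain p0 where p0: "(h, p0) \<in> S" by blast
  show ?thesis unfolding ray_meas_chord[OF p0] using assms by (auto simp: max_def)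
qed (simp add: ray_meas_empty)

lemma ray_meas_measurable: "ray_meas S h \<in> borel_measurable borel"
proof -
  have "mono (\<lambda>t. - ray_meas S h t)" by (intro monoI) (simp add: ray_meas_antimono)
  then have "(\<lambda>t. - (- ray_meas S h t)) \<in> borel_measurable borel"
    by (intro borel_measurable_uminus borel_measurable_mono)
  then show ?thesis by simp
qed

lemma ray_meas_ge:
  assumes "(h, r1) \<in> S" "(h, r2) \<in> S" "t \<le> r1"
  shows "r2 - r1 \<le> ray_meas S h t"
  unfolding ray_meas_chord[OF assms(1)]
  using le_chord_top[OF assms(2)] chord_bot_le[OF assms(1)] assms(3) by (auto simp: max_def)

text \<open>The segment from a point of \<open>S\<close> to the closure point \<open>(0, 0)\<close>
  stays in \<open>S\<close> short of its end, so the slope \<open>r / d\<close> recurs on all chords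
  closer to the apex.\<close>

lemma wedge_mem:
  assumes "(0, 0) \<in> closure S" "(- d, r) \<in> S" "0 < h" "h < d"
  shows "(- h, h * (r / d)) \<in> S"
proof -
  have "((1 - (1 - h / d)) * (- d) + (1 - h / d) * 0, (1 - (1 - h / d)) * r + (1 - h / d) * 0) \<in> S"
    using assms by (intro mem_combine_closure) auto
  then show ?thesis using assms by simp
qed

section \<open>Lipschitz bounds and second differences of the ends of a chord\<close>

lemma crossing_nbhd:
  assumes "(0, p0) \<in> S"
  obtains e where "e > 0" "\<And>h. \<bar>h\<bar> \<le> e \<Longrightarrow> (h, p0) \<in> S"
proof -
  have "open ((\<lambda>h. (h, p0)) -` S)" by (rule open_vimage[OF open_S]) (intro continuous_intros)
  then obtain d where "d > 0" "\<And>h. dist h 0 < d \<Longrightarrow> (h, p0) \<in> S"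
    using assms unfolding open_dist vimage_eq by blast
  then show thesis by (intro that[of "d / 2"]) auto
qed

text \<open>A concave function that stays above \<open>p0\<close> on \<open>[-e, e]\<close> has
  slopes at 0 bounded by its height over \<open>p0\<close> divided by \<open>e\<close>. The lower
  bound comes from the secant to the end of the interval on the same side, the upper bound from 0
  lying between the point and the opposite end.\<close>

lemma chord_top_lipschitz:
  assumes "(0, p0) \<in> S"
  obtains K e where "K \<ge> 0" "e > 0" "\<And>h. \<bar>h\<bar> \<le> e \<Longrightarrow> (h, p0) \<in> S"
    "\<And>h. \<bar>h\<bar> \<le> e \<Longrightarrow> \<bar>chord_top S h - chord_top S 0\<bar> \<le> K * \<bar>h\<bar>"
proof -
  obtain e where e: "e > 0" "\<And>h. \<bar>h\<bar> \<le> e \<Longrightarrow> (h, p0) \<in> S" using crossing_nbhd[OF assms] by blast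
  let ?T = "chord_top S"
  define K where "K = (?T 0 - p0) / e"
  have K: "K \<ge> 0" using le_chord_top[OF assms] e(1) by (simp add: K_def)
  have main: "\<bar>?T (\<sigma> * k) - ?T 0\<bar> \<le> K * k" if "\<sigma> = 1 \<or> \<sigma> = -1" "0 < k" "k \<le> e" for \<sigma> k
  proof -
    have abs: "\<bar>\<sigma> * x\<bar> = \<bar>x\<bar>" for x using that(1) by auto
    have m: "(\<sigma> * e, p0) \<in> S" "(- (\<sigma> * e), p0) \<in> S" "(\<sigma> * k, p0) \<in> S"
      using e that by (auto intro!: e(2) simp: abs)
    have "(1 - k / e) * ?T 0 + k / e * ?T (\<sigma> * e) \<le> ?T ((1 - k / e) * 0 + k / e * (\<sigma> * e))"
      by (rule chord_top_concave[OF assms m(1)]) (use that e(1) in auto)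
    moreover have "k / e * p0 \<le> k / e * ?T (\<sigma> * e)"
      using le_chord_top[OF m(1)] that e(1) by (intro mult_left_mono) auto
    ultimately have "(1 - k / e) * ?T 0 + k / e * p0 \<le> ?T (\<sigma> * k)"
      using e(1) by (simp add: mult.commute)
    moreover have "(1 - k / e) * ?T 0 + k / e * p0 = ?T 0 - K * k"
      using e(1) by (simp add: K_def field_simps)
    ultimately have lower: "?T 0 - K * k \<le> ?T (\<sigma> * k)" by simp
    \<comment> \<open>The weight for which 0 is the convex combination of
      \<open>\<sigma> * k\<close> and \<open>- (\<sigma> * e)\<close>.\<close>
    define v where "v = k / (k + e)"
    have v: "0 \<le> v" "v \<le> 1" "1 - v = e / (k + e)" using that e(1) by (auto simp: v_def field_simps)
    have "(1 - v) * (\<sigma> * k) + v * (- (\<sigma> * e)) = 0" unfolding v(3) by (simp add: v_def)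
    then have "(1 - v) * ?T (\<sigma> * k) + v * ?T (- (\<sigma> * e)) \<le> ?T 0"
      using chord_top_concave[OF m(3) m(2) v(1,2)] by (simp only:)
    moreover have "v * p0 \<le> v * ?T (- (\<sigma> * e))"
      using le_chord_top[OF m(2)] v by (intro mult_left_mono) auto
    ultimately have "(1 - v) * ?T (\<sigma> * k) + v * p0 \<le> ?T 0" by simp
    then have "(k + e) * ((1 - v) * ?T (\<sigma> * k) + v * p0) \<le> (k + e) * ?T 0"
      using that e(1) by (intro mult_left_mono) auto
    moreover have "(k + e) * (1 - v) = e" "(k + e) * v = k"
      unfolding v(3) using that e(1) by (simp_all add: v_def)
    then have "(k + e) * ((1 - v) * ?T (\<sigma> * k) + v * p0) = e * ?T (\<sigma> * k) + k * p0"
      by (simp only: distrib_left mult.assoc[symmetric])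
    ultimately have "e * ?T (\<sigma> * k) + k * p0 \<le> (k + e) * ?T 0" by simp
    then have "?T (\<sigma> * k) \<le> ?T 0 + K * k" using e(1) by (simp add: K_def field_simps)
    with lower show ?thesis by simp
  qed
  have "\<bar>?T h - ?T 0\<bar> \<le> K * \<bar>h\<bar>" if "\<bar>h\<bar> \<le> e" for h
  proof -
    consider "h = 0" | "h > 0" | "h < 0" by linarith
    then show ?thesis
      using main[of 1 h] main[of "-1" "-h"] that by cases auto
  qed
  then show thesis using that[OF K e(1) e(2)] by blast
qed

lemma chord_bot_lipschitz:
  assumes "(0, p0) \<in> S"
  obtains K e where "K \<ge> 0" "e > 0" "\<And>h. \<bar>h\<bar> \<le> e \<Longrightarrow> (h, p0) \<in> S"
    "\<And>h. \<bar>h\<bar> \<le> e \<Longrightarrow> \<bar>chord_bot S h - chord_bot S 0\<bar> \<le> K * \<bar>h\<bar>"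
proof -
  have "(0, - p0) \<in> flip S" using assms by (simp add: flip_def)
  from convex_body.chord_top_lipschitz[OF flip_body this]
  obtain K e where "K \<ge> 0" "e > 0" "\<And>h. \<bar>h\<bar> \<le> e \<Longrightarrow> (h, - p0) \<in> flip S"
    "\<And>h. \<bar>h\<bar> \<le> e \<Longrightarrow> \<bar>chord_top (flip S) h - chord_top (flip S) 0\<bar> \<le> K * \<bar>h\<bar>" by blast
  then show thesis
    by (intro that[of K e]) (auto simp: chord_bot_flip flip_def abs_minus_commute)
qed

lemma second_diff_top_nonpos:
  assumes "(h, p) \<in> S" "(- h, q) \<in> S"
  shows "second_diff (chord_top S) h \<le> 0"
  using chord_top_concave[OF assms, of "1/2"] by (simp add: second_diff_def)

lemma second_diff_bot: "second_diff (chord_bot S) h = - second_diff (chord_top (flip S)) h"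
  by (simp add: second_diff_def chord_bot_flip)

text \<open>Concavity already gives a second difference of at most 0. Points of the curve on either
  side of the line lie at or below the top and have secant slopes near \<open>m = vt / vs\<close>;
  concavity transfers these bounds to all smaller \<open>h\<close>, so that the slopes to the right
  and to the left nearly cancel. The condition \<open>vs \<noteq> 0\<close> says that the curve
  crosses the line transversally.\<close>

lemma second_diff_top_smooth:
  assumes p0: "(0, p0) \<in> S"
    and cs: "(cs has_real_derivative vs) (at u0)" "vs \<noteq> 0" "cs u0 = 0"
    and ct: "(ct has_real_derivative vt) (at u0)" "ct u0 = chord_top S 0"
    and ev: "eventually (\<lambda>u. (cs u, ct u) \<in> closure S) (at u0)"
  shows "((\<lambda>h. second_diff (chord_top S) h / h) \<longlongrightarrow> 0) (at_right 0)"
proof (rule tendstoI)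
  fix e0 :: real assume "e0 > 0"
  define \<epsilon> where "\<epsilon> = e0 / 3"
  have \<epsilon>: "\<epsilon> > 0" using \<open>e0 > 0\<close> by (simp add: \<epsilon>_def)
  let ?T = "chord_top S"
  define m where "m = vt / vs"
  obtain e where e: "e > 0" "\<And>h. \<bar>h\<bar> \<le> e \<Longrightarrow> (h, p0) \<in> S" using crossing_nbhd[OF p0] by blast
  have "((\<lambda>u. ((ct u - ct u0) / (u - u0)) / ((cs u - cs u0) / (u - u0))) \<longlongrightarrow> m) (at u0)"
    unfolding m_def using cs ct unfolding has_field_derivative_iff by (intro tendsto_divide)
  moreover have "eventually (\<lambda>u. ((ct u - ct u0) / (u - u0)) / ((cs u - cs u0) / (u - u0)) = (ct u - ?T 0) / cs u) (at u0)"
    unfolding eventually_at by (intro exI[of _ 1]) (auto simp: cs ct)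
  ultimately have "((\<lambda>u. (ct u - ?T 0) / cs u) \<longlongrightarrow> m) (at u0)"
    by (rule Lim_transform_eventually)
  from tendstoD[OF this \<epsilon>] have "eventually (\<lambda>u. \<bar>(ct u - ?T 0) / cs u - m\<bar> < \<epsilon>) (at u0)"
    by (simp add: dist_real_def)
  from eventually_conj[OF ev this] have P: "eventually (\<lambda>u. (cs u, ct u) \<in> closure S \<and> \<bar>(ct u - ?T 0) / cs u - m\<bar> < \<epsilon>) (at u0)" .
  obtain up where up: "(cs up, ct up) \<in> closure S" "\<bar>(ct up - ?T 0) / cs up - m\<bar> < \<epsilon>" "0 < cs up" "cs up < e"
    using small_values_both_signs(1)[OF cs P e(1)] by blast
  obtain um where um: "(cs um, ct um) \<in> closure S" "\<bar>(ct um - ?T 0) / cs um - m\<bar> < \<epsilon>" "- e < cs um" "cs um < 0"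
    using small_values_both_signs(2)[OF cs P e(1)] by blast
  have chord: "?T 0 + h * ((c - ?T 0) / b) \<le> ?T h"
    if "(b, c) \<in> closure S" "\<bar>b\<bar> \<le> e" "0 \<le> h / b" "h / b \<le> 1" "b \<noteq> 0" for b c h
  proof -
    have e0: "(1 - h / b) * 0 + h / b * b = h" using that(5) by simp
    have "(1 - h / b) * ?T 0 + h / b * ?T b \<le> ?T h"
      using chord_top_concave[OF p0 e(2)[OF that(2)] that(3,4)] by (simp only: e0)
    moreover have "h / b * c \<le> h / b * ?T b"
      using closure_le_chord_top[OF that(1) e(2)] that by (intro mult_left_mono) auto
    moreover have "?T 0 + h * ((c - ?T 0) / b) = (1 - h / b) * ?T 0 + h / b * c"
      by (simp add: diff_divide_distrib algebra_simps)
    ultimately show ?thesis by simp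
  qed
  have "\<bar>second_diff ?T h / h\<bar> < e0" if h: "0 < h" "h < min (cs up) (- cs um)" for h
  proof -
    have he: "\<bar>h\<bar> \<le> e" using h up by simp
    have "second_diff ?T h \<le> 0"
      by (rule second_diff_top_nonpos[of _ p0 p0]) (use he in \<open>auto intro!: e(2)\<close>)
    moreover have "?T 0 + h * (m - \<epsilon>) \<le> ?T h"
    proof -
      have "h * (m - \<epsilon>) \<le> h * ((ct up - ?T 0) / cs up)"
        using up(2) h(1) by (intro mult_left_mono) auto
      then show ?thesis using chord[of "cs up" "ct up" h] up h by auto
    qed
    moreover have "?T 0 - h * (m + \<epsilon>) \<le> ?T (- h)"
    proof -
      have "h * ((ct um - ?T 0) / cs um) \<le> h * (m + \<epsilon>)"
        using um(2) h(1) by (intro mult_left_mono) auto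
      moreover have "?T 0 + (- h) * ((ct um - ?T 0) / cs um) \<le> ?T (- h)"
      proof (rule chord)
        show "0 \<le> - h / cs um" using um h by (intro divide_nonpos_neg) auto
        show "- h / cs um \<le> 1" using um h by (subst neg_divide_le_eq) auto
      qed (use um in auto)
      ultimately show ?thesis by simp
    qed
    ultimately have "- (2 * \<epsilon> * h) \<le> second_diff ?T h" "second_diff ?T h \<le> 0"
      by (simp_all add: second_diff_def algebra_simps)
    then have "\<bar>second_diff ?T h\<bar> \<le> 2 * \<epsilon> * h" by simp
    then have "\<bar>second_diff ?T h / h\<bar> \<le> 2 * \<epsilon>" using h(1) by (simp add: field_simps)
    also have "\<dots> < e0" using \<open>e0 > 0\<close> by (simp add: \<epsilon>_def)
    finally show ?thesis .
  qed
  then show "eventually (\<lambda>h. dist (second_diff ?T h / h) 0 < e0) (at_right 0)"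
    unfolding eventually_at_right_field
    by (intro exI[of _ "min (cs up) (- cs um)"]) (use up um in auto)
qed

lemma second_diff_bot_smooth:
  assumes p0: "(0, p0) \<in> S"
    and cs: "(cs has_real_derivative vs) (at u0)" "vs \<noteq> 0" "cs u0 = 0"
    and ct: "(ct has_real_derivative vt) (at u0)" "ct u0 = chord_bot S 0"
    and ev: "eventually (\<lambda>u. (cs u, ct u) \<in> closure S) (at u0)"
  shows "((\<lambda>h. second_diff (chord_bot S) h / h) \<longlongrightarrow> 0) (at_right 0)"
proof -
  have "((\<lambda>h. second_diff (chord_top (flip S)) h / h) \<longlongrightarrow> 0) (at_right 0)"
  proof (rule convex_body.second_diff_top_smooth[OF flip_body _ cs])
    show "(0, - p0) \<in> flip S" using p0 by (simp add: flip_def)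
    show "((\<lambda>u. - ct u) has_real_derivative - vt) (at u0)" by (rule DERIV_minus[OF ct(1)])
    show "- ct u0 = chord_top (flip S) 0" using ct(2) by (simp add: chord_bot_flip)
    show "eventually (\<lambda>u. (cs u, - ct u) \<in> closure (flip S)) (at u0)"
      using ev by (rule eventually_mono) (rule closure_flip)
  qed
  from tendsto_minus[OF this] show ?thesis by (simp add: second_diff_bot)
qed

text \<open>Both lines through the end of the chord bound the top from above; the smaller slope is
  used to the right and the larger one to the left.\<close>

lemma second_diff_top_kink:
  assumes "(h, p) \<in> S" "(- h, q) \<in> S" "0 < h"
    and 1: "\<And>s t. (s, t) \<in> S \<Longrightarrow> t - chord_top S 0 \<le> m1 * s"
    and 2: "\<And>s t. (s, t) \<in> S \<Longrightarrow> t - chord_top S 0 \<le> m2 * s"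
  shows "second_diff (chord_top S) h \<le> - (\<bar>m1 - m2\<bar> * h)"
proof -
  have le: "chord_top S s \<le> chord_top S 0 + m * s"
    if "(s, p) \<in> S" "\<And>s t. (s, t) \<in> S \<Longrightarrow> t - chord_top S 0 \<le> m * s" for s m p
    unfolding chord_top_def[of S s]
    by (rule cSup_least) (use that in force)+
  show ?thesis
    using le[OF assms(1) 1] le[OF assms(1) 2] le[OF assms(2) 1] le[OF assms(2) 2] \<open>0 < h\<close>
    by (cases "m1 \<le> m2") (auto simp: second_diff_def algebra_simps)
qed

lemma missing_nbhd:
  assumes "\<And>t. (0, t) \<notin> closure S"
  obtains e where "e > 0" "\<And>h t. \<bar>h\<bar> \<le> e \<Longrightarrow> (h, t) \<notin> closure S"
proof -
  have "compact (fst ` closure S)"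
    by (intro compact_continuous_image continuous_intros) (simp add: bounded_S)
  then have "closed (fst ` closure S)" by (rule compact_imp_closed)
  moreover have "0 \<in> - (fst ` closure S)" using assms by auto
  ultimately obtain d where d: "d > 0" "\<And>h. dist h 0 < d \<Longrightarrow> h \<in> - (fst ` closure S)"
    using open_dist[of "- (fst ` closure S)"] by (metis open_Compl)
  show thesis
  proof (rule that[of "d / 2"])
    show "(h, t) \<notin> closure S" if "\<bar>h\<bar> \<le> d / 2" for h t
      using d(2)[of h] d(1) that by (force simp: image_iff)
  qed (use d in simp)
qed

text \<open>The length ahead of \<open>t\<close> is a 1-Lipschitz function of each end of the chord,
  uniformly in \<open>t\<close>. Lines that touch the closure without entering the set are excluded:
  there the length can grow like a square root.\<close>

lemma ray_meas_lipschitz: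
  assumes "(\<exists>p0. (0, p0) \<in> S) \<or> (\<forall>t. (0, t) \<notin> closure S)"
  obtains K e where "K \<ge> 0" "e > 0" "\<And>h t. \<bar>h\<bar> \<le> e \<Longrightarrow> \<bar>ray_meas S h t - ray_meas S 0 t\<bar> \<le> K * \<bar>h\<bar>"
  using assms
proof
  assume "\<exists>p0. (0, p0) \<in> S"
  then obtain p0 where p0: "(0, p0) \<in> S" by blast
  obtain K e where T: "K \<ge> 0" "e > 0" "\<And>h. \<bar>h\<bar> \<le> e \<Longrightarrow> (h, p0) \<in> S"
    "\<And>h. \<bar>h\<bar> \<le> e \<Longrightarrow> \<bar>chord_top S h - chord_top S 0\<bar> \<le> K * \<bar>h\<bar>"
    by (rule chord_top_lipschitz[OF p0]) (rule that)
  obtain K' e' where B: "K' \<ge> 0" "e' > 0" "\<And>h. \<bar>h\<bar> \<le> e' \<Longrightarrow> (h, p0) \<in> S"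
    "\<And>h. \<bar>h\<bar> \<le> e' \<Longrightarrow> \<bar>chord_bot S h - chord_bot S 0\<bar> \<le> K' * \<bar>h\<bar>"
    by (rule chord_bot_lipschitz[OF p0]) (rule that)
  show thesis
  proof (rule that[of "K + K'" "min e e'"])
    fix h t :: real assume h: "\<bar>h\<bar> \<le> min e e'"
    have "\<bar>ray_meas S h t - ray_meas S 0 t\<bar> \<le> \<bar>chord_top S h - chord_top S 0\<bar> + \<bar>chord_bot S h - chord_bot S 0\<bar>"
      using h T(2) T(3)[of h] by (subst ray_meas_chord[of _ p0], simp_all add: p0)+ (auto simp: max_def)
    also have "\<dots> \<le> (K + K') * \<bar>h\<bar>" using T(4)[of h] B(4)[of h] h by (simp add: algebra_simps)
    finally show "\<bar>ray_meas S h t - ray_meas S 0 t\<bar> \<le> (K + K') * \<bar>h\<bar>" .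
  qed (use T B in auto)
next
  assume "\<forall>t. (0, t) \<notin> closure S"
  then obtain e where e: "e > 0" "\<And>h t. \<bar>h\<bar> \<le> e \<Longrightarrow> (h, t) \<notin> closure S"
    using missing_nbhd by blast
  have z: "ray_meas S h t = 0" if "\<bar>h\<bar> \<le> e" for h t
    by (rule ray_meas_empty) (use e(2)[OF that] closure_subset in blast)
  show thesis
    by (rule that[of 0 e]) (use e(1) z z[of 0] in auto)
qed

lemma eventually_chord:
  assumes p0: "(0, p0) \<in> S"
  shows "(chord_top S \<longlongrightarrow> chord_top S 0) (at 0)" "(chord_bot S \<longlongrightarrow> chord_bot S 0) (at 0)"
    "eventually (\<lambda>h. (h, p0) \<in> S) (at 0)"
proof -
  obtain K e where T: "K \<ge> 0" "e > 0" "\<And>h. \<bar>h\<bar> \<le> e \<Longrightarrow> (h, p0) \<in> S"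
    "\<And>h. \<bar>h\<bar> \<le> e \<Longrightarrow> \<bar>chord_top S h - chord_top S 0\<bar> \<le> K * \<bar>h\<bar>"
    by (rule chord_top_lipschitz[OF p0]) (rule that)
  obtain K' e' where B: "K' \<ge> 0" "e' > 0" "\<And>h. \<bar>h\<bar> \<le> e' \<Longrightarrow> (h, p0) \<in> S"
    "\<And>h. \<bar>h\<bar> \<le> e' \<Longrightarrow> \<bar>chord_bot S h - chord_bot S 0\<bar> \<le> K' * \<bar>h\<bar>"
    by (rule chord_bot_lipschitz[OF p0]) (rule that)
  have lim: "((\<lambda>h. k * \<bar>h\<bar>) \<longlongrightarrow> 0) (at 0)" for k :: real
    by (auto intro!: tendsto_eq_intros)
  have ev: "eventually (\<lambda>h. \<bar>h\<bar> \<le> d) (at 0)" if "d > 0" for d :: real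
    unfolding eventually_at using that by (intro exI[of _ d]) auto
  show "(chord_top S \<longlongrightarrow> chord_top S 0) (at 0)"
    by (rule LIM_zero_cancel, rule Lim_null_comparison[OF _ lim[of K]])
       (rule eventually_mono[OF ev[OF T(2)]], use T(4) in auto)
  show "(chord_bot S \<longlongrightarrow> chord_bot S 0) (at 0)"
    by (rule LIM_zero_cancel, rule Lim_null_comparison[OF _ lim[of K']])
       (rule eventually_mono[OF ev[OF B(2)]], use B(4) in auto)
  show "eventually (\<lambda>h. (h, p0) \<in> S) (at 0)"
    by (rule eventually_mono[OF ev[OF T(2)]]) (use T(3) in auto)
qed

text \<open>A position before the chord sees both ends move, one inside it sees only the upper end,
  and one past it sees nothing. The two end positions are left out; they form a null set for the
  later integrals.\<close>

lemma second_diff_ray_meas: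
  assumes p0: "(0, p0) \<in> S"
  shows "t < chord_bot S 0 \<Longrightarrow> eventually (\<lambda>h. second_diff (\<lambda>h. ray_meas S h t) h
            = second_diff (chord_top S) h - second_diff (chord_bot S) h) (at_right 0)"
    and "chord_bot S 0 < t \<Longrightarrow> t < chord_top S 0 \<Longrightarrow>
         eventually (\<lambda>h. second_diff (\<lambda>h. ray_meas S h t) h = second_diff (chord_top S) h) (at_right 0)"
    and "chord_top S 0 < t \<Longrightarrow> eventually (\<lambda>h. second_diff (\<lambda>h. ray_meas S h t) h = 0) (at_right 0)"
proof -
  have both: "eventually (\<lambda>h. P h \<and> P (- h)) (at_right 0)" if "eventually P (at 0)" for P :: "real \<Rightarrow> bool"
  proof -
    obtain d where d: "d > 0" "\<And>h. h \<noteq> 0 \<Longrightarrow> dist h 0 < d \<Longrightarrow> P h"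
      using \<open>eventually P (at 0)\<close> unfolding eventually_at by auto
    then show ?thesis unfolding eventually_at_right_field by (intro exI[of _ d]) auto
  qed
  note ev = eventually_chord[OF p0]
  note rm = ray_meas_chord[where ?p0.0 = p0]
  have lt: "chord_bot S h < chord_top S h" if "(h, p0) \<in> S" for h
    using less_chord_top[OF that] chord_bot_less[OF that] by simp
  show "eventually (\<lambda>h. second_diff (\<lambda>h. ray_meas S h t) h
            = second_diff (chord_top S) h - second_diff (chord_bot S) h) (at_right 0)"
    if t: "t < chord_bot S 0"
  proof (rule eventually_mono[OF both[OF eventually_conj[OF ev(3) order_tendstoD(1)[OF ev(2) t]]]])
    fix h assume h: "((h, p0) \<in> S \<and> t < chord_bot S h) \<and> (- h, p0) \<in> S \<and> t < chord_bot S (- h)"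
    have "ray_meas S k t = chord_top S k - chord_bot S k" if "(k, p0) \<in> S" "t < chord_bot S k" for k
      using rm[OF that(1)] lt[OF that(1)] that(2) by (simp add: max_def)
    then show "second_diff (\<lambda>h. ray_meas S h t) h = second_diff (chord_top S) h - second_diff (chord_bot S) h"
      using h p0 t by (simp add: second_diff_def)
  qed
  show "eventually (\<lambda>h. second_diff (\<lambda>h. ray_meas S h t) h = second_diff (chord_top S) h) (at_right 0)"
    if t: "chord_bot S 0 < t" "t < chord_top S 0"
  proof (rule eventually_mono[OF both[OF eventually_conj[OF ev(3) eventually_conj[OF
            order_tendstoD(2)[OF ev(2) t(1)] order_tendstoD(1)[OF ev(1) t(2)]]]]])
    fix h assume h: "((h, p0) \<in> S \<and> chord_bot S h < t \<and> t < chord_top S h) \<and>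
      (- h, p0) \<in> S \<and> chord_bot S (- h) < t \<and> t < chord_top S (- h)"
    have "ray_meas S k t = chord_top S k - t" if "(k, p0) \<in> S" "chord_bot S k < t" "t < chord_top S k" for k
      using rm[OF that(1)] that(2,3) by (simp add: max_def)
    then show "second_diff (\<lambda>h. ray_meas S h t) h = second_diff (chord_top S) h"
      using h p0 t by (simp add: second_diff_def)
  qed
  show "eventually (\<lambda>h. second_diff (\<lambda>h. ray_meas S h t) h = 0) (at_right 0)"
    if t: "chord_top S 0 < t"
  proof (rule eventually_mono[OF both[OF eventually_conj[OF ev(3) order_tendstoD(2)[OF ev(1) t]]]])
    fix h assume h: "((h, p0) \<in> S \<and> chord_top S h < t) \<and> (- h, p0) \<in> S \<and> chord_top S (- h) < t"
    have "ray_meas S k t = 0" if "(k, p0) \<in> S" "chord_top S k < t" for k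
      using rm[OF that(1)] that(2) by (simp add: max_def)
    then show "second_diff (\<lambda>h. ray_meas S h t) h = 0"
      using h p0 t by (simp add: second_diff_def)
  qed
qed

end

section \<open>Orthonormal frames and planar sets in their coordinates\<close>

lemma frame_expand:
  fixes n \<theta> y :: plane
  assumes "norm n = 1" "norm \<theta> = 1" "n \<bullet> \<theta> = 0"
  shows "(y \<bullet> n) *\<^sub>R n + (y \<bullet> \<theta>) *\<^sub>R \<theta> = y"
proof -
  have 1: "n $ 1 * n $ 1 + n $ 2 * n $ 2 = 1" "\<theta> $ 1 * \<theta> $ 1 + \<theta> $ 2 * \<theta> $ 2 = 1"
    using norm_plane_sq[of n] norm_plane_sq[of \<theta>] assms(1,2) by (simp_all add: power2_eq_square)
  have 2: "n $ 1 * \<theta> $ 1 + n $ 2 * \<theta> $ 2 = 0" using assms(3) by (simp add: inner_plane)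
  have a: "n $ 1 * n $ 1 + \<theta> $ 1 * \<theta> $ 1 = 1" using 1 2 by algebra
  have b: "n $ 2 * n $ 2 + \<theta> $ 2 * \<theta> $ 2 = 1" using 1 2 by algebra
  have c: "n $ 1 * n $ 2 + \<theta> $ 1 * \<theta> $ 2 = 0" using 1 2 by algebra
  have "(y $ 1 * n $ 1 + y $ 2 * n $ 2) * n $ 1 + (y $ 1 * \<theta> $ 1 + y $ 2 * \<theta> $ 2) * \<theta> $ 1 = y $ 1"
    using a c by algebra
  moreover have "(y $ 1 * n $ 1 + y $ 2 * n $ 2) * n $ 2 + (y $ 1 * \<theta> $ 1 + y $ 2 * \<theta> $ 2) * \<theta> $ 2 = y $ 2"
    using b c by algebra
  ultimately show ?thesis by (simp add: vec_eq_iff forall_2 inner_plane)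
qed

text \<open>For orthonormal \<open>n\<close> and \<open>\<theta>\<close> the first coordinate
  displaces the line through \<open>x\<close> with direction \<open>\<theta>\<close> and the second
  runs along it; each layer then becomes a \<open>convex_body\<close>.\<close>

definition slice :: "plane set \<Rightarrow> plane \<Rightarrow> plane \<Rightarrow> plane \<Rightarrow> (real \<times> real) set" where
  "slice C x n \<theta> = {(h, t). x + h *\<^sub>R n + t *\<^sub>R \<theta> \<in> C}"

lemma mem_slice: "(h, t) \<in> slice C x n \<theta> \<longleftrightarrow> x + h *\<^sub>R n + t *\<^sub>R \<theta> \<in> C"
  by (simp add: slice_def)

context
  fixes n \<theta> :: plane
  assumes frame: "norm n = 1" "norm \<theta> = 1" "n \<bullet> \<theta> = 0"
begin

lemma frame_inner: "n \<bullet> n = 1" "\<theta> \<bullet> \<theta> = 1" "\<theta> \<bullet> n = 0"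
  using frame by (simp_all add: dot_square_norm inner_commute)

lemma frame_coords: "x + ((y - x) \<bullet> n) *\<^sub>R n + ((y - x) \<bullet> \<theta>) *\<^sub>R \<theta> = y"
  using frame_expand[OF frame, of "y - x"] by (simp add: add.assoc)

lemma slice_eq_image: "slice C x n \<theta> = (\<lambda>y. ((y - x) \<bullet> n, (y - x) \<bullet> \<theta>)) ` C"
proof (intro equalityI subsetI)
  fix z assume "z \<in> slice C x n \<theta>"
  then show "z \<in> (\<lambda>y. ((y - x) \<bullet> n, (y - x) \<bullet> \<theta>)) ` C"
    by (intro image_eqI[of _ _ "x + fst z *\<^sub>R n + snd z *\<^sub>R \<theta>"])
       (auto simp: slice_def inner_add_left frame_inner frame(3))
next
  fix z assume "z \<in> (\<lambda>y. ((y - x) \<bullet> n, (y - x) \<bullet> \<theta>)) ` C"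
  then show "z \<in> slice C x n \<theta>" by (auto simp: slice_def frame_coords)
qed

lemma slice_body:
  assumes "convex C" "open C" "bounded C"
  shows "convex_body (slice C x n \<theta>)"
proof
  have eq: "slice C x n \<theta> = (\<lambda>z. x + fst z *\<^sub>R n + snd z *\<^sub>R \<theta>) -` C"
    by (auto simp: slice_def)
  show "open (slice C x n \<theta>)" unfolding eq
    by (rule open_vimage[OF assms(2)]) (intro continuous_intros)
  show "convex (slice C x n \<theta>)"
  proof (rule convexI)
    fix z w u v assume z: "z \<in> slice C x n \<theta>" "w \<in> slice C x n \<theta>" and u: "0 \<le> u" "0 \<le> v" "u + v = (1 :: real)"
    have "u *\<^sub>R (x + fst z *\<^sub>R n + snd z *\<^sub>R \<theta>) + v *\<^sub>R (x + fst w *\<^sub>R n + snd w *\<^sub>R \<theta>) \<in> C"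
      using z by (intro convexD[OF assms(1)] u) (auto simp: eq)
    moreover have "u *\<^sub>R (x + fst z *\<^sub>R n + snd z *\<^sub>R \<theta>) + v *\<^sub>R (x + fst w *\<^sub>R n + snd w *\<^sub>R \<theta>)
      = (u + v) *\<^sub>R x + (u * fst z + v * fst w) *\<^sub>R n + (u * snd z + v * snd w) *\<^sub>R \<theta>"
      by (simp add: algebra_simps)
    ultimately show "u *\<^sub>R z + v *\<^sub>R w \<in> slice C x n \<theta>" using u by (simp add: eq)
  qed
  obtain B where B: "\<And>y. y \<in> C \<Longrightarrow> norm y \<le> B" using assms(3) unfolding bounded_iff by blast
  have "norm z \<le> 2 * (B + norm x)" if z: "z \<in> slice C x n \<theta>" for z
  proof -
    obtain y where y: "y \<in> C" "z = ((y - x) \<bullet> n, (y - x) \<bullet> \<theta>)"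
      using z unfolding slice_eq_image by blast
    have "norm (y - x) \<le> B + norm x" using norm_triangle_ineq4[of y x] B[OF y(1)] by simp
    moreover have "\<bar>(y - x) \<bullet> n\<bar> \<le> norm (y - x)" "\<bar>(y - x) \<bullet> \<theta>\<bar> \<le> norm (y - x)"
      using Cauchy_Schwarz_ineq2[of "y - x" n] Cauchy_Schwarz_ineq2[of "y - x" \<theta>] frame by simp_all
    ultimately show ?thesis unfolding y(2)
      using norm_Pair_le[of "(y - x) \<bullet> n" "(y - x) \<bullet> \<theta>"] by simp
  qed
  then show "bounded (slice C x n \<theta>)" unfolding bounded_iff by blast
qed

lemma mem_closure_slice: "(h, t) \<in> closure (slice C x n \<theta>) \<longleftrightarrow> x + h *\<^sub>R n + t *\<^sub>R \<theta> \<in> closure C"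
proof
  let ?f = "\<lambda>z. x + fst z *\<^sub>R n + snd z *\<^sub>R \<theta>"
  assume "(h, t) \<in> closure (slice C x n \<theta>)"
  moreover have "?f ` closure (slice C x n \<theta>) \<subseteq> closure C"
    by (rule image_closure_subset)
       (auto intro!: continuous_intros subsetD[OF closure_subset] simp: slice_def)
  ultimately show "x + h *\<^sub>R n + t *\<^sub>R \<theta> \<in> closure C" by force
next
  let ?g = "\<lambda>y. ((y - x) \<bullet> n, (y - x) \<bullet> \<theta>)"
  assume "x + h *\<^sub>R n + t *\<^sub>R \<theta> \<in> closure C"
  moreover have "?g ` closure C \<subseteq> closure (slice C x n \<theta>)"
    unfolding slice_eq_image
    by (rule image_closure_subset) (auto intro!: continuous_intros subsetD[OF closure_subset])
  ultimately have "?g (x + h *\<^sub>R n + t *\<^sub>R \<theta>) \<in> closure (slice C x n \<theta>)" by blast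
  then show "(h, t) \<in> closure (slice C x n \<theta>)"
    by (simp add: inner_add_left frame_inner frame(3))
qed

end

section \<open>Attenuated integrals along parallel lines\<close>

text \<open>This and \<open>layered_radon\<close> are defined by the layers themselves and not by a
  representative of the class of \<open>a\<close>, so they are meaningful on every single line. They
  give the attenuated Radon transform on almost every line of each parallel family.\<close>

definition optical_depth :: "nat \<Rightarrow> (nat \<Rightarrow> real) \<Rightarrow> (nat \<Rightarrow> plane set) \<Rightarrow> plane \<Rightarrow> plane \<Rightarrow> real \<Rightarrow> real" where
  "optical_depth N c C p \<theta> t = (\<Sum>j\<in>{1..N}. c j * measure lborel {r. t \<le> r \<and> p + r *\<^sub>R \<theta> \<in> C j})"

definition layered_radon ::
  "nat \<Rightarrow> (nat \<Rightarrow> real) \<Rightarrow> (nat \<Rightarrow> plane set) \<Rightarrow> (plane \<Rightarrow> real) \<Rightarrow> plane \<Rightarrow> plane \<Rightarrow> real" where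
  "layered_radon N c C f p \<theta> = (LINT t|lborel. f (p + t *\<^sub>R \<theta>) * exp (- optical_depth N c C p \<theta> t))"

text \<open>Excluded are the lines that touch the closure of a layer without entering the layer;
  near those the data need not be Lipschitz.\<close>

definition regular_line :: "nat \<Rightarrow> (nat \<Rightarrow> plane set) \<Rightarrow> plane \<Rightarrow> plane \<Rightarrow> bool" where
  "regular_line N C p \<theta> \<longleftrightarrow>
     (\<forall>j\<in>{1..N}. (\<exists>t. p + t *\<^sub>R \<theta> \<in> C j) \<or> (\<forall>t. p + t *\<^sub>R \<theta> \<notin> closure (C j)))"

lemma measure_ray_eq_ray_meas:
  "measure lborel {r. t \<le> r \<and> x + h *\<^sub>R n + r *\<^sub>R \<theta> \<in> C} = ray_meas (slice C x n \<theta>) h t"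
  by (simp add: ray_meas_def mem_slice)

text \<open>The derivative vanishes where the function does on an open set, hence far out; being
  continuous it is bounded on the whole plane, and the mean value inequality gives
  \<open>L\<close>.\<close>

lemma C1_compact_support_bounds:
  assumes "C1_compact_support f"
  obtains M L R where "M > 0" "L > 0" "R > 0" "\<And>x. \<bar>f x\<bar> \<le> M" "\<And>x y. \<bar>f x - f y\<bar> \<le> L * norm (x - y)"
    "\<And>x. norm x \<ge> R \<Longrightarrow> f x = 0"
proof -
  obtain f' :: "plane \<Rightarrow> plane \<Rightarrow>\<^sub>L real" where der: "\<And>x. (f has_derivative blinfun_apply (f' x)) (at x)"
    and cont: "continuous_on UNIV f'" and supp: "compact (closure {x. f x \<noteq> 0})"
    using assms unfolding C1_compact_support_def by blast
  obtain R0 where R0: "\<And>x. x \<in> closure {x. f x \<noteq> 0} \<Longrightarrow> norm x \<le> R0"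
    using compact_imp_bounded[OF supp] unfolding bounded_iff by blast
  define R where "R = max R0 0 + 1"
  have R: "R > 0" by (simp add: R_def)
  have z: "f x = 0" if "norm x > R0" for x
    using R0[of x] that closure_subset[of "{x. f x \<noteq> 0}"] by force
  have z': "f' x = 0" if "norm x > R0" for x
  proof -
    have op: "open {x :: plane. norm x > R0}" by (intro open_Collect_less continuous_intros)
    have "(f has_derivative (\<lambda>_. 0)) (at x)"
      by (rule has_derivative_transform_within_open[OF has_derivative_const[of 0] op])
         (use that z in auto)
    from has_derivative_unique[OF der this] show ?thesis by (intro blinfun_eqI) simp
  qed
  have "compact (f' ` cball 0 R)" by (intro compact_continuous_image continuous_on_subset[OF cont]) auto
  from compact_imp_bounded[OF this] obtain L where L: "L > 0" "\<And>x. x \<in> cball 0 R \<Longrightarrow> norm (f' x) \<le> L"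
    unfolding bounded_pos by blast
  have L': "norm (f' x) \<le> L" for x
    using L z'[of x] by (cases "norm x \<le> R") (auto simp: R_def)
  have lip: "\<bar>f x - f y\<bar> \<le> L * norm (x - y)" for x y
  proof -
    have "norm (f x - f y) \<le> L * norm (x - y)"
    proof (rule differentiable_bound[of UNIV f "\<lambda>x. blinfun_apply (f' x)"])
      show "onorm (blinfun_apply (f' x)) \<le> L" for x using L' by (simp add: norm_blinfun.rep_eq)
    qed (use der in \<open>auto intro: has_derivative_at_withinI\<close>)
    then show ?thesis by simp
  qed
  have contf: "continuous_on (cball 0 R) f"
    using der by (meson continuous_at_imp_continuous_on has_derivative_continuous)
  from compact_imp_bounded[OF compact_continuous_image[OF contf compact_cball]]
  obtain M where M: "M > 0" "\<And>x. x \<in> cball 0 R \<Longrightarrow> \<bar>f x\<bar> \<le> M"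
    unfolding bounded_pos by auto
  have "\<bar>f x\<bar> \<le> M" for x
    using M z[of x] by (cases "norm x \<le> R") (auto simp: R_def)
  moreover have "f x = 0" if "norm x \<ge> R" for x using that by (intro z) (auto simp: R_def)
  ultimately show thesis using that[OF M(1) L(1) R _ lip] by blast
qed

lemma C1_compact_support_continuous:
  assumes "C1_compact_support f" shows "continuous_on S f"
  using assms unfolding C1_compact_support_def
  by (meson continuous_at_imp_continuous_on has_derivative_continuous)

lemma C1_second_diff:
  assumes "C1_compact_support f"
  shows "((\<lambda>h. second_diff (\<lambda>h. f (x + h *\<^sub>R n)) h / h) \<longlongrightarrow> 0) (at_right 0)"
proof -
  obtain f' where der: "(f has_derivative f') (at (x + 0 *\<^sub>R n))"
    using assms unfolding C1_compact_support_def by fastforce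
  let ?g = "\<lambda>h. f (x + h *\<^sub>R n)"
  have "((\<lambda>h. x + h *\<^sub>R n) has_derivative (\<lambda>h. h *\<^sub>R n)) (at 0)"
    by (auto intro!: derivative_eq_intros)
  from has_derivative_compose[OF this der] have "(?g has_derivative (\<lambda>h. f' (h *\<^sub>R n))) (at 0)" .
  moreover have "(\<lambda>h. f' (h *\<^sub>R n)) = (*) (f' n)"
    using linear_scale[OF has_derivative_linear[OF der]] by (auto simp: fun_eq_iff)
  ultimately have d: "(?g has_real_derivative f' n) (at 0)" by (simp add: has_field_derivative_def)
  then have l: "((\<lambda>h. (?g h - ?g 0) / h) \<longlongrightarrow> f' n) (at 0)"
    unfolding has_field_derivative_iff by simp
  have "filterlim uminus (at_left 0) (at_right (0 :: real))"
    using filterlim_at_left_to_right[of "\<lambda>x. x" "at_left 0" "0::real"] 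
    by (simp add: filterlim_def filtermap_ident at_right_minus filtermap_filtermap)
  then have mi: "filterlim uminus (at 0) (at_right (0 :: real))"
    by (rule filterlim_mono) (auto simp: at_le)
  have r: "((\<lambda>h. (?g h - ?g 0) / h) \<longlongrightarrow> f' n) (at_right 0)"
    by (rule filterlim_mono[OF l order_refl]) (simp add: at_le)
  have "((\<lambda>h. (?g h - ?g 0) / h - (?g (- h) - ?g 0) / (- h)) \<longlongrightarrow> f' n - f' n) (at_right 0)"
    by (intro tendsto_diff r filterlim_compose[OF l mi])
  moreover have "(\<lambda>h. (?g h - ?g 0) / h - (?g (- h) - ?g 0) / (- h)) = (\<lambda>h. second_diff ?g h / h)"
    by (auto simp: fun_eq_iff second_diff_def diff_divide_distrib add_divide_distrib)
  ultimately show ?thesis by simp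
qed

section \<open>Attenuated integrals under parallel displacement of the line\<close>

lemma exp_diff_le:
  fixes a b Q :: real
  assumes "\<bar>a\<bar> \<le> Q" "\<bar>b\<bar> \<le> Q"
  shows "\<bar>exp (- a) - exp (- b)\<bar> \<le> exp Q * \<bar>a - b\<bar>"
proof -
  have le: "exp x - exp y \<le> exp Q * \<bar>x - y\<bar>" if "x \<le> Q" for x y :: real
  proof -
    have "exp x * (1 + (y - x)) \<le> exp x * exp (y - x)"
      by (intro mult_left_mono exp_ge_add_one_self) simp
    also have "\<dots> = exp y" by (simp flip: exp_add)
    finally have "exp x - exp y \<le> exp x * (x - y)" by (simp add: algebra_simps)
    also have "\<dots> \<le> exp x * \<bar>x - y\<bar>" by (intro mult_left_mono) auto
    also have "\<dots> \<le> exp Q * \<bar>x - y\<bar>" using that by (intro mult_right_mono) auto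
    finally show ?thesis .
  qed
  show ?thesis using le[of "- a" "- b"] le[of "- b" "- a"] assms by (simp add: abs_le_iff abs_minus_commute)
qed

lemma tendsto_mult_bounded_zero:
  fixes X Y :: "'b \<Rightarrow> real"
  assumes "(X \<longlongrightarrow> 0) F" "eventually (\<lambda>x. \<bar>Y x\<bar> \<le> B) F"
  shows "((\<lambda>x. X x * Y x) \<longlongrightarrow> 0) F"
proof (rule Lim_null_comparison)
  show "eventually (\<lambda>x. norm (X x * Y x) \<le> \<bar>X x\<bar> * B) F"
    using assms(2) by (rule eventually_mono) (simp add: abs_mult mult_left_mono)
  show "((\<lambda>x. \<bar>X x\<bar> * B) \<longlongrightarrow> 0) F"
    by (intro tendsto_mult_left_zero tendsto_rabs_zero assms(1))
qed

text \<open>\<open>A\<close>, \<open>B\<close> are the increments of the source factor at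
  \<open>h\<close> and \<open>- h\<close>, \<open>C\<close>, \<open>D\<close> those of the exponent,
  \<open>E1\<close>, \<open>E2\<close> the exponentials with central value \<open>e0\<close>, and
  \<open>- e0\<close> is the limit of the slopes \<open>g1\<close>, \<open>g2\<close>. The
  right-hand side isolates the second differences; every other term is a factor tending to 0 times a
  bounded quotient.\<close>

lemma second_diff_algebra:
  fixes h :: real
  assumes "h \<noteq> 0" "S = A + B" "Q = C + D"
  shows "(E1 * A + f * (g1 * C) + (E2 * B + f * (g2 * D)) + f * e0 * W) / h =
    e0 * (S / h) + ((E1 - e0) * (A / h) + (E2 - e0) * (B / h)) +
    f * (- e0 * ((Q - W) / h) + ((g1 - (- e0)) * (C / h) + (g2 - (- e0)) * (D / h)))"
  using assms(1) unfolding assms(2,3) by (simp add: field_simps)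

text \<open>Products of two first increments are of order \<open>h^2\<close>, so only the second
  differences of the factors matter. \<open>W\<close> is the part of the second difference of
  \<open>q\<close> that is not \<open>o(h)\<close>; the exponential passes it on with the factor
  \<open>- F 0 * exp (- q 0)\<close>.\<close>

lemma second_diff_exp_product:
  fixes F q W :: "real \<Rightarrow> real"
  assumes "e > 0" and F: "\<And>h. \<bar>h\<bar> \<le> e \<Longrightarrow> \<bar>F h - F 0\<bar> \<le> L * \<bar>h\<bar>"
    and q: "\<And>h. \<bar>h\<bar> \<le> e \<Longrightarrow> \<bar>q h - q 0\<bar> \<le> K * \<bar>h\<bar>"
    and F2: "((\<lambda>h. second_diff F h / h) \<longlongrightarrow> 0) (at_right 0)"
    and q2: "((\<lambda>h. (second_diff q h - W h) / h) \<longlongrightarrow> 0) (at_right 0)"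
  shows "((\<lambda>h. (second_diff (\<lambda>h. F h * exp (- q h)) h + F 0 * exp (- q 0) * W h) / h) \<longlongrightarrow> 0) (at_right 0)"
proof -
  have "((\<lambda>z :: real. exp (- z)) has_real_derivative - exp (- q 0)) (at (q 0))"
    by (auto intro!: derivative_eq_intros)
  \<comment> \<open>The slope function in Caratheodory's form of the derivative is defined also
    where \<open>q h = q 0\<close>, so there is no division by an increment that may vanish.\<close>
  then obtain g where g: "\<And>z. exp (- z) - exp (- q 0) = g z * (z - q 0)" "isCont g (q 0)" "g (q 0) = - exp (- q 0)"
    unfolding CARAT_DERIV by blast
  have ev: "eventually (\<lambda>h. 0 < h \<and> h \<le> e) (at_right 0)"
    unfolding eventually_at_right_field using \<open>e > 0\<close> by (intro exI[of _ e]) auto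
  have lin: "((\<lambda>h. K * \<bar>h\<bar>) \<longlongrightarrow> 0) (at_right 0)" by (auto intro!: tendsto_eq_intros)
  have "((\<lambda>h. q h - q 0) \<longlongrightarrow> 0) (at_right 0)"
  proof (rule Lim_null_comparison[OF _ lin], rule eventually_mono[OF ev])
    fix h assume "0 < h \<and> h \<le> e"
    then show "norm (q h - q 0) \<le> K * \<bar>h\<bar>" using q[of h] by simp
  qed
  then have qp: "((\<lambda>h. q h) \<longlongrightarrow> q 0) (at_right 0)" by (rule LIM_zero_cancel)
  have "((\<lambda>h. q (- h) - q 0) \<longlongrightarrow> 0) (at_right 0)"
  proof (rule Lim_null_comparison[OF _ lin], rule eventually_mono[OF ev])
    fix h assume "0 < h \<and> h \<le> e"
    then show "norm (q (- h) - q 0) \<le> K * \<bar>h\<bar>" using q[of "- h"] by simp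
  qed
  then have qm: "((\<lambda>h. q (- h)) \<longlongrightarrow> q 0) (at_right 0)" by (rule LIM_zero_cancel)
  have dF: "eventually (\<lambda>h. \<bar>(F h - F 0) / h\<bar> \<le> L) (at_right 0)" "eventually (\<lambda>h. \<bar>(F (- h) - F 0) / h\<bar> \<le> L) (at_right 0)"
  proof -
    have "\<bar>(F h - F 0) / h\<bar> \<le> L \<and> \<bar>(F (- h) - F 0) / h\<bar> \<le> L" if "0 < h \<and> h \<le> e" for h
      using F[of h] F[of "- h"] that by (simp add: pos_divide_le_eq)
    then show "eventually (\<lambda>h. \<bar>(F h - F 0) / h\<bar> \<le> L) (at_right 0)" "eventually (\<lambda>h. \<bar>(F (- h) - F 0) / h\<bar> \<le> L) (at_right 0)"
      by (auto intro!: eventually_mono[OF ev])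
  qed
  have dq: "eventually (\<lambda>h. \<bar>(q h - q 0) / h\<bar> \<le> K) (at_right 0)" "eventually (\<lambda>h. \<bar>(q (- h) - q 0) / h\<bar> \<le> K) (at_right 0)"
  proof -
    have "\<bar>(q h - q 0) / h\<bar> \<le> K \<and> \<bar>(q (- h) - q 0) / h\<bar> \<le> K" if "0 < h \<and> h \<le> e" for h
      using q[of h] q[of "- h"] that by (simp add: pos_divide_le_eq)
    then show "eventually (\<lambda>h. \<bar>(q h - q 0) / h\<bar> \<le> K) (at_right 0)" "eventually (\<lambda>h. \<bar>(q (- h) - q 0) / h\<bar> \<le> K) (at_right 0)"
      by (auto intro!: eventually_mono[OF ev])
  qed
  have eqs: "((\<lambda>h. exp (- q h) - exp (- q 0)) \<longlongrightarrow> 0) (at_right 0)"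
    "((\<lambda>h. exp (- q (- h)) - exp (- q 0)) \<longlongrightarrow> 0) (at_right 0)"
    by (intro LIM_zero tendsto_intros qp qm)+
  have gs: "((\<lambda>h. g (q h) - g (q 0)) \<longlongrightarrow> 0) (at_right 0)"
    "((\<lambda>h. g (q (- h)) - g (q 0)) \<longlongrightarrow> 0) (at_right 0)"
    by (intro LIM_zero isCont_tendsto_compose[OF g(2)] qp qm)+
  let ?R = "\<lambda>h. exp (- q 0) * (second_diff F h / h)
      + ((exp (- q h) - exp (- q 0)) * ((F h - F 0) / h) + (exp (- q (- h)) - exp (- q 0)) * ((F (- h) - F 0) / h))
      + F 0 * (- exp (- q 0) * ((second_diff q h - W h) / h)
        + ((g (q h) - g (q 0)) * ((q h - q 0) / h) + (g (q (- h)) - g (q 0)) * ((q (- h) - q 0) / h)))"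
  have "(?R \<longlongrightarrow> exp (- q 0) * 0 + (0 + 0) + F 0 * (- exp (- q 0) * 0 + (0 + 0))) (at_right 0)"
    by (intro tendsto_intros F2 q2 tendsto_mult_bounded_zero[OF eqs(1) dF(1)] tendsto_mult_bounded_zero[OF eqs(2) dF(2)]
        tendsto_mult_bounded_zero[OF gs(1) dq(1)] tendsto_mult_bounded_zero[OF gs(2) dq(2)])
  moreover have "?R h = (second_diff (\<lambda>h. F h * exp (- q h)) h + F 0 * exp (- q 0) * W h) / h" if "h \<noteq> 0" for h
  proof -
    have "F h * exp (- q h) - F 0 * exp (- q 0) = exp (- q h) * (F h - F 0) + F 0 * (g (q h) * (q h - q 0))"
      unfolding g(1)[symmetric] by (simp add: algebra_simps)
    moreover have "F (- h) * exp (- q (- h)) - F 0 * exp (- q 0) = exp (- q (- h)) * (F (- h) - F 0) + F 0 * (g (q (- h)) * (q (- h) - q 0))"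
      unfolding g(1)[symmetric] by (simp add: algebra_simps)
    ultimately have "second_diff (\<lambda>h. F h * exp (- q h)) h =
        exp (- q h) * (F h - F 0) + F 0 * (g (q h) * (q h - q 0)) +
        (exp (- q (- h)) * (F (- h) - F 0) + F 0 * (g (q (- h)) * (q (- h) - q 0)))"
      unfolding second_diff_def by linarith
    then show ?thesis
      unfolding g(3) by (simp only:) (rule second_diff_algebra[OF that, symmetric], simp_all add: second_diff_def)
  qed
  then have "eventually (\<lambda>h. ?R h = (second_diff (\<lambda>h. F h * exp (- q h)) h + F 0 * exp (- q 0) * W h) / h) (at_right 0)"
    unfolding eventually_at_right_field by (intro exI[of _ 1]) auto
  ultimately show ?thesis by (auto intro: Lim_transform_eventually)
qed

lemma integrable_const_indicator_Icc: "integrable lborel (\<lambda>t. c * indicator {a..b :: real} t :: real)"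
  by (intro integrable_mult_right integrable_real_indicator) (simp_all add: emeasure_lborel_Icc_eq)

lemma line_far:
  fixes p \<theta> :: plane
  assumes "norm \<theta> = 1" "\<bar>t\<bar> \<ge> R + norm p"
  shows "norm (p + t *\<^sub>R \<theta>) \<ge> R"
  using norm_triangle_ineq2[of "t *\<^sub>R \<theta>" "- p"] assms by (simp add: add.commute)

lemma integrable_radon:
  assumes f: "C1_compact_support f" and \<theta>: "norm \<theta> = 1"
    and q: "q \<in> borel_measurable borel" "\<And>t. \<bar>q t\<bar> \<le> Q"
  shows "integrable lborel (\<lambda>t. f (p + t *\<^sub>R \<theta>) * exp (- q t))"
proof -
  obtain M L R where M: "M > 0" "R > 0" "\<And>x. \<bar>f x\<bar> \<le> M" "\<And>x. norm x \<ge> R \<Longrightarrow> f x = 0"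
    by (rule C1_compact_support_bounds[OF f]) blast
  define T where "T = R + norm p"
  have fm: "(\<lambda>t. f (p + t *\<^sub>R \<theta>)) \<in> borel_measurable borel"
    by (intro borel_measurable_continuous_onI continuous_on_compose2[OF C1_compact_support_continuous[OF f, of UNIV]]
        continuous_intros) auto
  show ?thesis
  proof (rule Bochner_Integration.integrable_bound[where f = "\<lambda>t. (M * exp Q) * indicator {-T..T} t"])
    show "integrable lborel (\<lambda>t. (M * exp Q) * indicator {-T..T} t :: real)"
      by (rule integrable_const_indicator_Icc)
    show "(\<lambda>t. f (p + t *\<^sub>R \<theta>) * exp (- q t)) \<in> borel_measurable lborel"
      using fm q(1) by simp
    show "AE t in lborel. norm (f (p + t *\<^sub>R \<theta>) * exp (- q t)) \<le> norm ((M * exp Q) * indicator {-T..T} t)"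
    proof (rule AE_I2)
      fix t
      show "norm (f (p + t *\<^sub>R \<theta>) * exp (- q t)) \<le> norm ((M * exp Q) * indicator {-T..T} t)"
      proof (cases "\<bar>t\<bar> \<ge> T")
        case True
        then have "f (p + t *\<^sub>R \<theta>) = 0" using M(4) line_far[OF \<theta>] unfolding T_def by blast
        then show ?thesis by simp
      next
        case False
        have "exp (- q t) \<le> exp Q" using q(2)[of t] by simp
        then have "\<bar>f (p + t *\<^sub>R \<theta>)\<bar> * exp (- q t) \<le> M * exp Q" using M by (intro mult_mono) auto
        moreover have "t \<in> {-T..T}" using False by auto
        ultimately show ?thesis using M(1) by (simp add: abs_mult)
      qed
    qed
  qed
qed

context
  fixes f :: "plane \<Rightarrow> real" and p n \<theta> :: plane and q :: "real \<Rightarrow> real \<Rightarrow> real" and Q K e :: real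
  assumes f: "C1_compact_support f" and \<theta>: "norm \<theta> = 1" and n: "norm n = 1"
    and q_meas: "\<And>h. q h \<in> borel_measurable borel" and q_bound: "\<And>h t. \<bar>q h t\<bar> \<le> Q"
    and K: "K \<ge> 0" "e > 0" and q_lip: "\<And>h t. \<bar>h\<bar> \<le> e \<Longrightarrow> \<bar>q h t - q 0 t\<bar> \<le> K * \<bar>h\<bar>"
begin

lemma radon_integrand_lipschitz:
  obtains B T where "B \<ge> 0" "T \<ge> 0" "\<And>h t. \<bar>h\<bar> \<le> e \<Longrightarrow>
    \<bar>f (p + h *\<^sub>R n + t *\<^sub>R \<theta>) * exp (- q h t) - f (p + 0 *\<^sub>R n + t *\<^sub>R \<theta>) * exp (- q 0 t)\<bar> \<le> (B * \<bar>h\<bar>) * indicator {-T..T} t"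
   "\<And>h t. \<bar>h\<bar> \<le> e \<Longrightarrow> \<bar>f (p + h *\<^sub>R n + t *\<^sub>R \<theta>) * exp (- q h t)\<bar> \<le> B * indicator {-T..T} t"
proof -
  obtain M L R where M: "M > 0" "L > 0" "R > 0" "\<And>x. \<bar>f x\<bar> \<le> M" "\<And>x y. \<bar>f x - f y\<bar> \<le> L * norm (x - y)"
      "\<And>x. norm x \<ge> R \<Longrightarrow> f x = 0"
    by (rule C1_compact_support_bounds[OF f]) blast
  \<comment> \<open>No line displaced by at most \<open>e\<close> meets the support of
    \<open>f\<close> at a parameter outside \<open>{-T..T}\<close>. In \<open>B\<close> the summand
    \<open>M * exp Q\<close> serves the plain bound of the second claim, the others the Lipschitz
    bound of the first.\<close>
  define T where "T = R + (norm p + e)"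
  define B where "B = exp Q * L + M * (exp Q * K) + M * exp Q"
  have Q: "Q \<ge> 0" using q_bound[of 0 0] by simp
  have far: "f (p + h *\<^sub>R n + t *\<^sub>R \<theta>) = 0" if "\<bar>h\<bar> \<le> e" "t \<notin> {-T..T}" for h t
  proof (rule M(6), rule line_far[OF \<theta>])
    have "norm (p + h *\<^sub>R n) \<le> norm p + e" using norm_triangle_ineq[of p "h *\<^sub>R n"] n that(1) by simp
    then show "R + norm (p + h *\<^sub>R n) \<le> \<bar>t\<bar>" using that(2) unfolding T_def by auto
  qed
  have expQ: "exp (- q h t) \<le> exp Q" for h t using q_bound[of h t] by simp
  have main: "\<bar>f (p + h *\<^sub>R n + t *\<^sub>R \<theta>) * exp (- q h t) - f (p + 0 *\<^sub>R n + t *\<^sub>R \<theta>) * exp (- q 0 t)\<bar> \<le> (B * \<bar>h\<bar>) * indicator {-T..T} t"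
    if h: "\<bar>h\<bar> \<le> e" for h t
  proof (cases "t \<in> {-T..T}")
    case False
    then show ?thesis using far[OF h] far[of 0] K(2) by simp
  next
    case True
    let ?x = "f (p + h *\<^sub>R n + t *\<^sub>R \<theta>)" let ?y = "f (p + 0 *\<^sub>R n + t *\<^sub>R \<theta>)"
    have "?x * exp (- q h t) - ?y * exp (- q 0 t) = exp (- q h t) * (?x - ?y) + ?y * (exp (- q h t) - exp (- q 0 t))"
      by (simp add: algebra_simps)
    then have "\<bar>?x * exp (- q h t) - ?y * exp (- q 0 t)\<bar> \<le> exp (- q h t) * \<bar>?x - ?y\<bar> + \<bar>?y\<bar> * \<bar>exp (- q h t) - exp (- q 0 t)\<bar>"
      using abs_triangle_ineq[of "exp (- q h t) * (?x - ?y)" "?y * (exp (- q h t) - exp (- q 0 t))"]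
      by (simp add: abs_mult)
    also have "\<dots> \<le> exp Q * (L * \<bar>h\<bar>) + M * (exp Q * (K * \<bar>h\<bar>))"
    proof (intro add_mono mult_mono expQ M(4))
      show "\<bar>?x - ?y\<bar> \<le> L * \<bar>h\<bar>"
        using M(5)[of "p + h *\<^sub>R n + t *\<^sub>R \<theta>" "p + 0 *\<^sub>R n + t *\<^sub>R \<theta>"] n by simp
      show "\<bar>exp (- q h t) - exp (- q 0 t)\<bar> \<le> exp Q * (K * \<bar>h\<bar>)"
        using exp_diff_le[OF q_bound q_bound] q_lip[OF h]
        by (meson exp_ge_zero mult_left_mono order_trans)
    qed (use M in auto)
    also have "\<dots> \<le> B * \<bar>h\<bar>" using M(1) by (simp add: B_def algebra_simps)
    finally show ?thesis using True by simp
  qed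
  have bd: "\<bar>f (p + h *\<^sub>R n + t *\<^sub>R \<theta>) * exp (- q h t)\<bar> \<le> B * indicator {-T..T} t" if h: "\<bar>h\<bar> \<le> e" for h t
  proof (cases "t \<in> {-T..T}")
    case False
    then show ?thesis using far[OF h] by simp
  next
    case True
    have "\<bar>f (p + h *\<^sub>R n + t *\<^sub>R \<theta>)\<bar> * exp (- q h t) \<le> M * exp Q"
      using M expQ by (intro mult_mono) auto
    also have "\<dots> \<le> B" using M K by (simp add: B_def)
    finally show ?thesis using True by (simp add: abs_mult)
  qed
  have "B \<ge> 0" "T \<ge> 0" using M K by (auto simp: B_def T_def)
  then show thesis using that main bd by blast
qed

lemma radon_lipschitz:
  obtains B where "B \<ge> 0" "\<And>h. \<bar>h\<bar> \<le> e \<Longrightarrow>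
    \<bar>(LINT t|lborel. f (p + h *\<^sub>R n + t *\<^sub>R \<theta>) * exp (- q h t)) - (LINT t|lborel. f (p + 0 *\<^sub>R n + t *\<^sub>R \<theta>) * exp (- q 0 t))\<bar> \<le> B * \<bar>h\<bar>"
proof -
  obtain B T where B: "B \<ge> 0" "T \<ge> 0" "\<And>h t. \<bar>h\<bar> \<le> e \<Longrightarrow>
    \<bar>f (p + h *\<^sub>R n + t *\<^sub>R \<theta>) * exp (- q h t) - f (p + 0 *\<^sub>R n + t *\<^sub>R \<theta>) * exp (- q 0 t)\<bar> \<le> (B * \<bar>h\<bar>) * indicator {-T..T} t"
    by (rule radon_integrand_lipschitz) blast
  note int = integrable_radon[OF f \<theta> q_meas q_bound]
  show thesis
  proof (rule that[of "B * (2 * T)"])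
    fix h assume h: "\<bar>h\<bar> \<le> e"
    let ?A = "\<lambda>t. f (p + h *\<^sub>R n + t *\<^sub>R \<theta>) * exp (- q h t)"
    let ?B = "\<lambda>t. f (p + 0 *\<^sub>R n + t *\<^sub>R \<theta>) * exp (- q 0 t)"
    have iA: "integrable lborel ?A" and iB: "integrable lborel ?B" by (rule int)+
    have "\<bar>integral\<^sup>L lborel ?A - integral\<^sup>L lborel ?B\<bar> = \<bar>LINT t|lborel. ?A t - ?B t\<bar>"
      by (subst Bochner_Integration.integral_diff[OF iA iB]) simp
    also have "\<dots> \<le> (LINT t|lborel. \<bar>?A t - ?B t\<bar>)" by (rule integral_abs_bound)
    also have "\<dots> \<le> (LINT t|lborel. (B * \<bar>h\<bar>) * indicator {-T..T} t)"
      by (intro integral_mono integrable_abs Bochner_Integration.integrable_diff iA iB B(3)[OF h]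
          integrable_const_indicator_Icc)
    also have "\<dots> = B * (2 * T) * \<bar>h\<bar>" using B(2) by simp
    finally show "\<bar>integral\<^sup>L lborel ?A - integral\<^sup>L lborel ?B\<bar> \<le> B * (2 * T) * \<bar>h\<bar>" .
  qed (use B in simp)
qed

text \<open>Dominated convergence, stated along sequences for that reason; the Lipschitz bound on
  the integrands majorises the second difference quotients. The indicator of \<open>{..<t0}\<close>
  records that only positions before \<open>t0\<close> look through the corner, which adds
  \<open>w\<close> to the second difference of the depth.\<close>

lemma radon_second_diff:
  fixes w :: "real \<Rightarrow> real" and X :: "nat \<Rightarrow> real"
  assumes w: "\<And>h. \<bar>h\<bar> \<le> e \<Longrightarrow> \<bar>w h\<bar> \<le> K * \<bar>h\<bar>"
    and lim: "AE t in lborel. ((\<lambda>h. (second_diff (\<lambda>h. q h t) h - w h * indicator {..<t0} t) / h) \<longlongrightarrow> 0) (at_right 0)"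
    and X: "\<And>k. 0 < X k" "\<And>k. X k \<le> e" "X \<longlonglongrightarrow> 0"
  shows "(\<lambda>k. (second_diff (\<lambda>h. LINT t|lborel. f (p + h *\<^sub>R n + t *\<^sub>R \<theta>) * exp (- q h t)) (X k)
            + w (X k) * (LINT t|lborel. indicator {..<t0} t * (f (p + 0 *\<^sub>R n + t *\<^sub>R \<theta>) * exp (- q 0 t)))) / X k) \<longlonglongrightarrow> 0"
proof -
  define \<Phi> where "\<Phi> h t = f (p + h *\<^sub>R n + t *\<^sub>R \<theta>) * exp (- q h t)" for h t
  obtain M L R where M: "M > 0" "L > 0" "R > 0" "\<And>x. \<bar>f x\<bar> \<le> M" "\<And>x y. \<bar>f x - f y\<bar> \<le> L * norm (x - y)"
      "\<And>x. norm x \<ge> R \<Longrightarrow> f x = 0"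
    by (rule C1_compact_support_bounds[OF f]) blast
  obtain B T where B: "B \<ge> 0" "T \<ge> 0" "\<And>h t. \<bar>h\<bar> \<le> e \<Longrightarrow> \<bar>\<Phi> h t - \<Phi> 0 t\<bar> \<le> (B * \<bar>h\<bar>) * indicator {-T..T} t"
    "\<And>h t. \<bar>h\<bar> \<le> e \<Longrightarrow> \<bar>\<Phi> h t\<bar> \<le> B * indicator {-T..T} t"
    unfolding \<Phi>_def by (rule radon_integrand_lipschitz) blast
  have int: "integrable lborel (\<Phi> h)" for h
    unfolding \<Phi>_def by (rule integrable_radon[OF f \<theta> q_meas q_bound])
  have inti: "integrable lborel (\<lambda>t. indicator {..<t0} t * \<Phi> 0 t)"
    using integrable_mult_indicator[of "{..<t0}" lborel "\<Phi> 0", OF _ int] by simp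
  define D where "D k t = (second_diff (\<lambda>h. \<Phi> h t) (X k) + w (X k) * (indicator {..<t0} t * \<Phi> 0 t)) / X k" for k t
  have Xlim: "filterlim X (at_right 0) sequentially"
    unfolding filterlim_at using X by (auto intro!: always_eventually simp: less_imp_neq[symmetric])
  have "(\<lambda>k. integral\<^sup>L lborel (D k)) \<longlonglongrightarrow> (LINT (t :: real)|lborel. 0 :: real)"
  proof (rule Bochner_Integration.integral_dominated_convergence[where w = "\<lambda>t. (2 * B + K * B) * indicator {-T..T} t"])
    have i: "integrable lborel (D k)" for k
      unfolding D_def second_diff_def by (intro integrable_divide Bochner_Integration.integrable_add Bochner_Integration.integrable_diff integrable_mult_right int inti)
    then show "D k \<in> borel_measurable lborel" for k by blast
    show "integrable lborel (\<lambda>t. (2 * B + K * B) * indicator {-T..T} t)"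
      by (rule integrable_const_indicator_Icc)
    show "AE t in lborel. norm (D k t) \<le> (2 * B + K * B) * indicator {-T..T} t" for k
    proof (rule AE_I2)
      fix t
      have h: "\<bar>X k\<bar> \<le> e" "\<bar>- X k\<bar> \<le> e" "0 < X k" "\<bar>0\<bar> \<le> e" using X(1,2)[of k] K by auto
      have "\<bar>second_diff (\<lambda>h. \<Phi> h t) (X k)\<bar> \<le> \<bar>\<Phi> (X k) t - \<Phi> 0 t\<bar> + \<bar>\<Phi> (- X k) t - \<Phi> 0 t\<bar>"
        unfolding second_diff_def by linarith
      also have "\<dots> \<le> (2 * B * X k) * indicator {-T..T} t"
        using B(3)[OF h(1), of t] B(3)[OF h(2), of t] h(3) by simp
      finally have 1: "\<bar>second_diff (\<lambda>h. \<Phi> h t) (X k)\<bar> \<le> (2 * B * X k) * indicator {-T..T} t" .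
      have "\<bar>w (X k) * (indicator {..<t0} t * \<Phi> 0 t)\<bar> \<le> (K * X k) * (B * indicator {-T..T} t)"
        unfolding abs_mult
      proof (rule mult_mono)
        show "\<bar>w (X k)\<bar> \<le> K * X k" using w[OF h(1)] h(3) by simp
        show "\<bar>indicator {..<t0} t\<bar> * \<bar>\<Phi> 0 t\<bar> \<le> B * indicator {-T..T} t"
          using B(4)[OF h(4), of t] B(1) by (auto simp: indicator_def split: if_splits)
      qed (use K h in auto)
      with 1 have "\<bar>second_diff (\<lambda>h. \<Phi> h t) (X k) + w (X k) * (indicator {..<t0} t * \<Phi> 0 t)\<bar> \<le> ((2 * B + K * B) * indicator {-T..T} t) * X k"
        by (simp add: algebra_simps)
      then show "norm (D k t) \<le> (2 * B + K * B) * indicator {-T..T} t"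
        unfolding D_def using h(3) by (simp add: pos_divide_le_eq)
    qed
    show "AE t in lborel. (\<lambda>k. D k t) \<longlonglongrightarrow> 0"
      using lim
    proof eventually_elim
      fix t assume t: "((\<lambda>h. (second_diff (\<lambda>h. q h t) h - w h * indicator {..<t0} t) / h) \<longlongrightarrow> 0) (at_right 0)"
      have pt: "p + h *\<^sub>R n + t *\<^sub>R \<theta> = (p + t *\<^sub>R \<theta>) + h *\<^sub>R n" for h by simp
      have "((\<lambda>h. (second_diff (\<lambda>h. f (p + h *\<^sub>R n + t *\<^sub>R \<theta>) * exp (- q h t)) h +
            f (p + 0 *\<^sub>R n + t *\<^sub>R \<theta>) * exp (- q 0 t) * (w h * indicator {..<t0} t)) / h) \<longlongrightarrow> 0) (at_right 0)"
      proof (rule second_diff_exp_product[OF K(2) _ _ _ t])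
        show "\<bar>f (p + h *\<^sub>R n + t *\<^sub>R \<theta>) - f (p + 0 *\<^sub>R n + t *\<^sub>R \<theta>)\<bar> \<le> L * \<bar>h\<bar>" for h
          using M(5)[of "p + h *\<^sub>R n + t *\<^sub>R \<theta>" "p + 0 *\<^sub>R n + t *\<^sub>R \<theta>"] n by simp
        show "((\<lambda>h. second_diff (\<lambda>h. f (p + h *\<^sub>R n + t *\<^sub>R \<theta>)) h / h) \<longlongrightarrow> 0) (at_right 0)"
          unfolding pt by (rule C1_second_diff[OF f])
      qed (rule q_lip)
      from filterlim_compose[OF this Xlim] show "(\<lambda>k. D k t) \<longlonglongrightarrow> 0"
        unfolding D_def \<Phi>_def by (simp add: mult_ac)
    qed
  qed simp
  moreover have "integral\<^sup>L lborel (D k) = (second_diff (\<lambda>h. integral\<^sup>L lborel (\<Phi> h)) (X k)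
      + w (X k) * (LINT t|lborel. indicator {..<t0} t * \<Phi> 0 t)) / X k" for k
    unfolding D_def second_diff_def
    by (simp add: Bochner_Integration.integral_add Bochner_Integration.integral_diff int inti
        Bochner_Integration.integrable_add Bochner_Integration.integrable_diff)
  ultimately show ?thesis unfolding \<Phi>_def by simp
qed

end

text \<open>Fubini in the rotated coordinates \<open>(s, t)\<close>. The rotation preserves null
  sets because it is linear; measurability of the two compositions leads back from Lebesgue null
  sets to Borel ones.\<close>

lemma AE_lines:
  fixes a b :: "plane \<Rightarrow> real"
  assumes a: "a \<in> borel_measurable borel" and b: "b \<in> borel_measurable borel"
    and ae: "AE x in lborel. a x = b x" and \<theta>: "norm \<theta> = 1"
  shows "AE s in lborel. AE t in lborel. a (s *\<^sub>R perp \<theta> + t *\<^sub>R \<theta>) = b (s *\<^sub>R perp \<theta> + t *\<^sub>R \<theta>)"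
proof -
  let ?N = "{x. a x \<noteq> b x}"
  let ?G = "\<lambda>x. (x \<bullet> perp \<theta>, x \<bullet> \<theta>)"
  let ?H = "\<lambda>z. fst z *\<^sub>R perp \<theta> + snd z *\<^sub>R \<theta>"
  let ?M = "{z. a (?H z) \<noteq> b (?H z)}"
  have fr: "norm (perp \<theta>) = 1" "norm \<theta> = 1" "perp \<theta> \<bullet> \<theta> = 0" using \<theta> by simp_all
  have "?N \<in> sets lborel" using a b by measurable
  moreover have "?N \<in> null_sets lborel"
    using ae calculation by (auto simp: AE_iff_null)
  ultimately have "?N \<in> null_sets lebesgue" by (simp add: null_sets_completion_iff)
  then have "negligible ?N" by (simp add: negligible_iff_null_sets)
  then have "negligible (?G ` ?N)"
    by (intro negligible_differentiable_image_negligible)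
       (auto intro!: derivative_intros linear_imp_differentiable_on simp: linear_iff inner_add_left)
  moreover have "?M \<subseteq> ?G ` ?N"
  proof
    fix z assume "z \<in> ?M"
    moreover have "?G (?H z) = z"
      using frame_inner[OF fr] fr(3) by (simp add: inner_add_left)
    ultimately show "z \<in> ?G ` ?N" by (metis (mono_tags, lifting) image_eqI mem_Collect_eq)
  qed
  ultimately have "negligible ?M" by (rule negligible_subset)
  then have "?M \<in> null_sets lebesgue" by (simp add: negligible_iff_null_sets)
  moreover have Hm: "?H \<in> borel_measurable borel" by (intro borel_measurable_continuous_onI continuous_intros)
  have am: "(\<lambda>z. a (?H z)) \<in> borel_measurable borel" and bm: "(\<lambda>z. b (?H z)) \<in> borel_measurable borel"
    by (rule measurable_compose[OF Hm a] measurable_compose[OF Hm b])+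
  then have "?M \<in> sets lborel" by measurable
  ultimately have "?M \<in> null_sets lborel" by (simp add: null_sets_completion_iff)
  then have "AE z in lborel. a (?H z) = b (?H z)" by (intro AE_I'[of ?M]) auto
  then have "AE z in lborel \<Otimes>\<^sub>M lborel. a (?H z) = b (?H z)" unfolding lborel_prod .
  from lborel_pair.AE_pair[OF this] show ?thesis by simp
qed

section \<open>Nested layers\<close>

text \<open>Layers are required to be nonempty because an empty one could carry any coefficient and
  would make the number of layers ambiguous. \<open>nicely_multi_bang_layers\<close> arranges
  this.\<close>

locale nested_layers =
  fixes N :: nat and c :: "nat \<Rightarrow> real" and C :: "nat \<Rightarrow> plane set"
  assumes c_nz: "j \<in> {1..N} \<Longrightarrow> c j \<noteq> 0"
    and convex_C: "j \<in> {1..N} \<Longrightarrow> convex (C j)"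
    and bounded_C: "j \<in> {1..N} \<Longrightarrow> bounded (C j)"
    and open_C: "j \<in> {1..N} \<Longrightarrow> open (C j)"
    and ne_C: "j \<in> {1..N} \<Longrightarrow> C j \<noteq> {}"
    and smooth_C: "j \<in> {1..N} \<Longrightarrow> smooth_boundary_with_corners (C j)"
    and nested: "j \<in> {2..N} \<Longrightarrow> closure (C j) \<subseteq> C (j - 1)"
begin

lemma nested_less:
  assumes "i < j" "1 \<le> i" "j \<le> N" shows "closure (C j) \<subseteq> C i"
  using assms
proof (induction "j - i" arbitrary: j)
  case 0
  then show ?case by simp
next
  case (Suc k)
  have s: "closure (C j) \<subseteq> C (j - 1)" using nested[of j] Suc.prems by simp
  show ?case
  proof (cases "j - 1 = i")
    case False
    then have "closure (C (j - 1)) \<subseteq> C i" using Suc by simp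
    then show ?thesis using s closure_subset by blast
  qed (use s in simp)
qed

lemma nested_le: "i \<le> j \<Longrightarrow> 1 \<le> i \<Longrightarrow> j \<le> N \<Longrightarrow> C j \<subseteq> C i"
  using nested_less[of i j] closure_subset[of "C j"] by (cases "i = j") auto

definition layered :: "plane \<Rightarrow> real" where
  "layered x = (\<Sum>j\<in>{1..N}. c j * indicator (C j) x)"

lemma layered_measurable: "layered \<in> borel_measurable borel"
proof -
  have "(\<lambda>x. \<Sum>j\<in>{1..N}. c j * indicator (C j) x) \<in> borel_measurable borel"
    using open_C by (intro borel_measurable_sum borel_measurable_times borel_measurable_const borel_measurable_indicator) auto
  then show ?thesis unfolding layered_def[abs_def] .
qed

lemma slice_layer:
  assumes "norm n = 1" "norm \<theta> = 1" "n \<bullet> \<theta> = 0" "j \<in> {1..N}"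
  shows "convex_body (slice (C j) x n \<theta>)"
  by (rule slice_body[OF assms(1-3) convex_C open_C bounded_C]) (rule assms(4))+

lemma optical_depth_slice:
  "optical_depth N c C (p + h *\<^sub>R n) \<theta> t = (\<Sum>j\<in>{1..N}. c j * ray_meas (slice (C j) p n \<theta>) h t)"
  by (simp add: optical_depth_def measure_ray_eq_ray_meas)

context
  fixes \<theta> n :: plane
  assumes frame: "norm n = 1" "norm \<theta> = 1" "n \<bullet> \<theta> = 0"
begin

lemma optical_depth_measurable: "optical_depth N c C p \<theta> \<in> borel_measurable borel"
proof -
  have "(\<lambda>t. ray_meas (slice (C j) p n \<theta>) 0 t) \<in> borel_measurable borel" if j: "j \<in> {1..N}" for j
    by (rule convex_body.ray_meas_measurable[OF slice_layer[OF frame j]])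
  then have "(\<lambda>t. \<Sum>j\<in>{1..N}. c j * ray_meas (slice (C j) p n \<theta>) 0 t) \<in> borel_measurable borel"
    by (intro borel_measurable_sum borel_measurable_times borel_measurable_const)
  then show ?thesis using optical_depth_slice[of p 0 n \<theta>] by (simp add: fun_eq_iff cong: measurable_cong)
qed

lemma optical_depth_bounded:
  obtains Q where "\<And>h t. \<bar>optical_depth N c C (p + h *\<^sub>R n) \<theta> t\<bar> \<le> Q"
proof -
  have "\<exists>M. \<forall>h t. ray_meas (slice (C j) p n \<theta>) h t \<le> M" if "j \<in> {1..N}" for j
    by (rule convex_body.ray_meas_bound[OF slice_layer[OF frame that]])
  then obtain M where M: "\<And>j h t. j \<in> {1..N} \<Longrightarrow> ray_meas (slice (C j) p n \<theta>) h t \<le> M j"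
    by metis
  show thesis
  proof (rule that[of "\<Sum>j\<in>{1..N}. \<bar>c j\<bar> * M j"])
    fix h t
    have "\<bar>optical_depth N c C (p + h *\<^sub>R n) \<theta> t\<bar> \<le> (\<Sum>j\<in>{1..N}. \<bar>c j * ray_meas (slice (C j) p n \<theta>) h t\<bar>)"
      unfolding optical_depth_slice by (rule sum_abs)
    also have "\<dots> \<le> (\<Sum>j\<in>{1..N}. \<bar>c j\<bar> * M j)"
    proof (rule sum_mono)
      fix j assume j: "j \<in> {1..N}"
      then show "\<bar>c j * ray_meas (slice (C j) p n \<theta>) h t\<bar> \<le> \<bar>c j\<bar> * M j"
        using M[OF j] convex_body.ray_meas_nonneg[OF slice_layer[OF frame j]]
        by (simp add: abs_mult mult_left_mono)
    qed
    finally show "\<bar>optical_depth N c C (p + h *\<^sub>R n) \<theta> t\<bar> \<le> (\<Sum>j\<in>{1..N}. \<bar>c j\<bar> * M j)" .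
  qed
qed

lemma sum_ray_lipschitz:
  assumes "finite J" "J \<subseteq> {1..N}"
    and "\<And>j. j \<in> J \<Longrightarrow> (\<exists>t. p + t *\<^sub>R \<theta> \<in> C j) \<or> (\<forall>t. p + t *\<^sub>R \<theta> \<notin> closure (C j))"
  shows "\<exists>K e. K \<ge> 0 \<and> e > 0 \<and> (\<forall>h t. \<bar>h\<bar> \<le> e \<longrightarrow>
    \<bar>(\<Sum>j\<in>J. c j * ray_meas (slice (C j) p n \<theta>) h t) - (\<Sum>j\<in>J. c j * ray_meas (slice (C j) p n \<theta>) 0 t)\<bar> \<le> K * \<bar>h\<bar>)"
  using assms
proof (induction J rule: finite_induct)
  case empty
  show ?case by (intro exI[of _ 0] exI[of _ 1]) auto
next
  case (insert j J)
  then obtain K e where Ke: "K \<ge> 0" "e > 0" "\<And>h t. \<bar>h\<bar> \<le> e \<Longrightarrow>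
    \<bar>(\<Sum>j\<in>J. c j * ray_meas (slice (C j) p n \<theta>) h t) - (\<Sum>j\<in>J. c j * ray_meas (slice (C j) p n \<theta>) 0 t)\<bar> \<le> K * \<bar>h\<bar>"
    by auto
  have j: "j \<in> {1..N}" using insert.prems by simp
  have reg: "(\<exists>p0. (0, p0) \<in> slice (C j) p n \<theta>) \<or> (\<forall>t. (0, t) \<notin> closure (slice (C j) p n \<theta>))"
    using insert.prems(2)[of j] by (simp add: mem_slice mem_closure_slice[OF frame])
  obtain K' e' where Ke': "K' \<ge> 0" "e' > 0" "\<And>h t. \<bar>h\<bar> \<le> e' \<Longrightarrow>
     \<bar>ray_meas (slice (C j) p n \<theta>) h t - ray_meas (slice (C j) p n \<theta>) 0 t\<bar> \<le> K' * \<bar>h\<bar>"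
    by (rule convex_body.ray_meas_lipschitz[OF slice_layer[OF frame j] reg]) (rule that)
  show ?case
  proof (intro exI conjI allI impI)
    show "0 \<le> K + \<bar>c j\<bar> * K'" "min e e' > 0" using Ke Ke' by auto
    fix h t :: real assume h: "\<bar>h\<bar> \<le> min e e'"
    have "\<bar>c j * ray_meas (slice (C j) p n \<theta>) h t - c j * ray_meas (slice (C j) p n \<theta>) 0 t\<bar> \<le> \<bar>c j\<bar> * K' * \<bar>h\<bar>"
      using mult_left_mono[OF Ke'(3)[of h t], of "\<bar>c j\<bar>"] h
      by (simp add: abs_mult right_diff_distrib[symmetric] mult.assoc)
    then show "\<bar>(\<Sum>j\<in>insert j J. c j * ray_meas (slice (C j) p n \<theta>) h t) - (\<Sum>j\<in>insert j J. c j * ray_meas (slice (C j) p n \<theta>) 0 t)\<bar>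
      \<le> (K + \<bar>c j\<bar> * K') * \<bar>h\<bar>"
      using Ke(3)[of h t] h insert.hyps by (simp add: distrib_right)
  qed
qed

lemma optical_depth_lipschitz:
  assumes "regular_line N C p \<theta>"
  obtains K e where "K \<ge> 0" "e > 0"
    "\<And>h t. \<bar>h\<bar> \<le> e \<Longrightarrow> \<bar>optical_depth N c C (p + h *\<^sub>R n) \<theta> t - optical_depth N c C (p + 0 *\<^sub>R n) \<theta> t\<bar> \<le> K * \<bar>h\<bar>"
  using sum_ray_lipschitz[of "{1..N}" p] assms unfolding regular_line_def optical_depth_slice by auto

lemma layered_radon_lipschitz:
  assumes f: "C1_compact_support f" and reg: "regular_line N C p \<theta>"
  obtains B e where "B \<ge> 0" "e > 0"
    "\<And>h. \<bar>h\<bar> \<le> e \<Longrightarrow> \<bar>layered_radon N c C f (p + h *\<^sub>R n) \<theta> - layered_radon N c C f p \<theta>\<bar> \<le> B * \<bar>h\<bar>"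
proof -
  obtain K e where K: "K \<ge> 0" "e > 0"
    "\<And>h t. \<bar>h\<bar> \<le> e \<Longrightarrow> \<bar>optical_depth N c C (p + h *\<^sub>R n) \<theta> t - optical_depth N c C (p + 0 *\<^sub>R n) \<theta> t\<bar> \<le> K * \<bar>h\<bar>"
    by (rule optical_depth_lipschitz[OF reg]) (rule that)
  obtain Q where Q: "\<And>h t. \<bar>optical_depth N c C (p + h *\<^sub>R n) \<theta> t\<bar> \<le> Q" by (rule optical_depth_bounded) (rule that)
  obtain B where "B \<ge> 0" "\<And>h. \<bar>h\<bar> \<le> e \<Longrightarrow>
    \<bar>(LINT t|lborel. f (p + h *\<^sub>R n + t *\<^sub>R \<theta>) * exp (- optical_depth N c C (p + h *\<^sub>R n) \<theta> t)) -
     (LINT t|lborel. f (p + 0 *\<^sub>R n + t *\<^sub>R \<theta>) * exp (- optical_depth N c C (p + 0 *\<^sub>R n) \<theta> t))\<bar> \<le> B * \<bar>h\<bar>"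
  proof (rule radon_lipschitz[where p = p and n = n and q = "\<lambda>h. optical_depth N c C (p + h *\<^sub>R n) \<theta>" and Q = Q and K = K and e = e])
    show "optical_depth N c C (p + h *\<^sub>R n) \<theta> \<in> borel_measurable borel" for h
      by (rule optical_depth_measurable)
  qed (rule f frame Q K that; assumption?)+
  then show thesis using that[of B e] K(2) by (simp add: layered_radon_def)
qed

end

text \<open>Translation invariance of Lebesgue measure. The base point, often a boundary point, can
  so be replaced by the foot \<open>s *\<^sub>R perp \<theta>\<close> that the attenuated Radon
  transform uses.\<close>

lemma layered_radon_shift:
  "layered_radon N c C f (p + u *\<^sub>R \<theta>) \<theta> = layered_radon N c C f p \<theta>"
proof -
  have m: "measure lborel {r. t \<le> r \<and> (p + u *\<^sub>R \<theta>) + r *\<^sub>R \<theta> \<in> A} = measure lborel {r. u + t \<le> r \<and> p + r *\<^sub>R \<theta> \<in> A}"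
    if "open A" for t and A :: "plane set"
  proof -
    let ?S = "{r. u + t \<le> r \<and> p + r *\<^sub>R \<theta> \<in> A}"
    have "open ((\<lambda>r. p + r *\<^sub>R \<theta>) -` A)" by (rule open_vimage[OF that]) (intro continuous_intros)
    then have "open {r. p + r *\<^sub>R \<theta> \<in> A}" by (simp add: vimage_def)
    from this have "{u + t..} \<inter> {r. p + r *\<^sub>R \<theta> \<in> A} \<in> sets borel" by (intro sets.Int) auto
    moreover have "{u + t..} \<inter> {r. p + r *\<^sub>R \<theta> \<in> A} = ?S" by auto
    ultimately have S: "?S \<in> sets borel" by simp
    have eq: "{r. t \<le> r \<and> (p + u *\<^sub>R \<theta>) + r *\<^sub>R \<theta> \<in> A} = (+) u -` ?S"
      by (auto simp: algebra_simps)
    have "measure (distr lborel borel ((+) u)) ?S = measure lborel ?S" by (simp add: lborel_distr_plus)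
    then show ?thesis unfolding eq using S by (subst (asm) measure_distr) auto
  qed
  have od: "optical_depth N c C (p + u *\<^sub>R \<theta>) \<theta> t = optical_depth N c C p \<theta> (u + t)" for t
    unfolding optical_depth_def by (intro sum.cong refl) (simp add: m open_C)
  have "layered_radon N c C f p \<theta> = (LINT t|lborel. f (p + (u + 1 * t) *\<^sub>R \<theta>) * exp (- optical_depth N c C p \<theta> (u + 1 * t)))"
    unfolding layered_radon_def
    by (subst lborel_integral_real_affine[where c = 1 and t = u]) simp_all
  then show ?thesis by (simp add: layered_radon_def od algebra_simps)
qed

lemma attenuated_radon_eq_layered_radon:
  assumes a: "a \<in> borel_measurable borel" and \<theta>: "norm \<theta> = 1"
    and ae: "AE t in lborel. a (x + t *\<^sub>R \<theta>) = layered (x + t *\<^sub>R \<theta>)"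
  shows "beam_transform a (x + t *\<^sub>R \<theta>) \<theta> = optical_depth N c C x \<theta> t"
proof -
  have lm: "(\<lambda>r. x + r *\<^sub>R \<theta>) \<in> borel_measurable borel"
    by (intro borel_measurable_continuous_onI continuous_intros)
  have "beam_transform a (x + t *\<^sub>R \<theta>) \<theta> = (LINT r|lborel. indicator {t..} (t + 1 * r) * a (x + (t + 1 * r) *\<^sub>R \<theta>))"
    unfolding beam_transform_def set_lebesgue_integral_def
    by (intro Bochner_Integration.integral_cong refl) (auto simp: indicator_def algebra_simps)
  also have "\<dots> = (LINT r|lborel. indicator {t..} r * a (x + r *\<^sub>R \<theta>))"
    by (subst lborel_integral_real_affine[where c = 1 and t = t and f = "\<lambda>r. indicator {t..} r * a (x + r *\<^sub>R \<theta>)"]) simp_all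
  also have "\<dots> = (LINT r|lborel. indicator {t..} r * layered (x + r *\<^sub>R \<theta>))"
  proof (rule integral_cong_AE)
    show "AE r in lborel. indicator {t..} r * a (x + r *\<^sub>R \<theta>) = indicator {t..} r * layered (x + r *\<^sub>R \<theta>)"
      using ae by eventually_elim simp
    show "(\<lambda>r. indicator {t..} r * a (x + r *\<^sub>R \<theta>)) \<in> borel_measurable lborel"
      using measurable_compose[OF lm a] by simp
    show "(\<lambda>r. indicator {t..} r * layered (x + r *\<^sub>R \<theta>)) \<in> borel_measurable lborel"
      using measurable_compose[OF lm layered_measurable] by simp
  qed
  also have "\<dots> = (LINT r|lborel. (\<Sum>j\<in>{1..N}. c j * indicator {r. t \<le> r \<and> x + r *\<^sub>R \<theta> \<in> C j} r))"
    by (intro Bochner_Integration.integral_cong refl)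
       (auto simp: layered_def indicator_def sum_distrib_left intro!: sum.cong)
  also have "\<dots> = (\<Sum>j\<in>{1..N}. (LINT r|lborel. c j * indicator {r. t \<le> r \<and> x + r *\<^sub>R \<theta> \<in> C j} r))"
  proof (rule Bochner_Integration.integral_sum)
    fix j assume j: "j \<in> {1..N}"
    have "open ((\<lambda>r. x + r *\<^sub>R \<theta>) -` C j)" by (rule open_vimage[OF open_C[OF j]]) (intro continuous_intros)
    then have "open {r. x + r *\<^sub>R \<theta> \<in> C j}" by (simp add: vimage_def)
    then have "{t..} \<inter> {r. x + r *\<^sub>R \<theta> \<in> C j} \<in> sets borel" by (intro sets.Int) auto
    moreover have "{t..} \<inter> {r. x + r *\<^sub>R \<theta> \<in> C j} = {r. t \<le> r \<and> x + r *\<^sub>R \<theta> \<in> C j}" by auto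
    ultimately have S: "{r. t \<le> r \<and> x + r *\<^sub>R \<theta> \<in> C j} \<in> sets lborel" by simp
    obtain B where B: "\<And>y. y \<in> C j \<Longrightarrow> norm y \<le> B" using bounded_C[OF j] unfolding bounded_iff by blast
    have "norm r \<le> B + norm x" if "x + r *\<^sub>R \<theta> \<in> C j" for r
      using norm_triangle_ineq4[of "x + r *\<^sub>R \<theta>" x] \<theta> B[OF that] by simp
    then have "bounded {r. t \<le> r \<and> x + r *\<^sub>R \<theta> \<in> C j}" unfolding bounded_iff by blast
    then have "emeasure lborel {r. t \<le> r \<and> x + r *\<^sub>R \<theta> \<in> C j} < \<infinity>" by (rule emeasure_bounded_finite)
    then show "integrable lborel (\<lambda>r. c j * indicator {r. t \<le> r \<and> x + r *\<^sub>R \<theta> \<in> C j} r)"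
      by (intro integrable_mult_right integrable_real_indicator S)
  qed
  also have "\<dots> = optical_depth N c C x \<theta> t"
    unfolding optical_depth_def by (intro sum.cong refl) simp
  finally show ?thesis .
qed

end

text \<open>By Fubini the equality of the data passes to the layers on almost every parallel line.
  At a regular line both sides are Lipschitz in the displacement, so the equality is inherited from
  good lines arbitrarily close by.\<close>

lemma layered_radon_eq:
  assumes L: "nested_layers N c C" and L': "nested_layers N' c' C'"
    and a: "a \<in> borel_measurable borel" "AE x in lborel. a x = (\<Sum>j\<in>{1..N}. c j * indicator (C j) x)"
    and a': "a' \<in> borel_measurable borel" "AE x in lborel. a' x = (\<Sum>j\<in>{1..N'}. c' j * indicator (C' j) x)"
    and f: "C1_compact_support f" and f': "C1_compact_support f'"
    and eq: "\<And>s \<theta>. norm \<theta> = 1 \<Longrightarrow> attenuated_radon a f s \<theta> = attenuated_radon a' f' s \<theta>"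
    and \<theta>: "norm \<theta> = 1" and reg: "regular_line N C p \<theta>" "regular_line N' C' p \<theta>"
  shows "layered_radon N c C f p \<theta> = layered_radon N' c' C' f' p \<theta>"
proof -
  interpret L: nested_layers N c C by (rule L)
  interpret L': nested_layers N' c' C' by (rule L')
  have fr: "norm (perp \<theta>) = 1" "norm \<theta> = 1" "perp \<theta> \<bullet> \<theta> = 0" using \<theta> by simp_all
  let ?A = "\<lambda>p. layered_radon N c C f p \<theta>" and ?A' = "\<lambda>p. layered_radon N' c' C' f' p \<theta>"
  define s0 where "s0 = p \<bullet> perp \<theta>"
  have pe: "p = s0 *\<^sub>R perp \<theta> + (p \<bullet> \<theta>) *\<^sub>R \<theta>" using frame_expand[OF fr, of p] by (simp add: s0_def)
  have good: "AE s in lborel. ?A (s *\<^sub>R perp \<theta>) = ?A' (s *\<^sub>R perp \<theta>)"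
    using AE_lines[OF a(1) L.layered_measurable a(2)[folded L.layered_def] \<theta>]
      AE_lines[OF a'(1) L'.layered_measurable a'(2)[folded L'.layered_def] \<theta>]
  proof (eventually_elim)
    fix s
    assume *: "AE t in lborel. a (s *\<^sub>R perp \<theta> + t *\<^sub>R \<theta>) = L.layered (s *\<^sub>R perp \<theta> + t *\<^sub>R \<theta>)"
      "AE t in lborel. a' (s *\<^sub>R perp \<theta> + t *\<^sub>R \<theta>) = L'.layered (s *\<^sub>R perp \<theta> + t *\<^sub>R \<theta>)"
    have "?A (s *\<^sub>R perp \<theta>) = attenuated_radon a f s \<theta>"
      unfolding layered_radon_def attenuated_radon_def
        L.attenuated_radon_eq_layered_radon[OF a(1) \<theta> *(1)] ..
    also have "\<dots> = attenuated_radon a' f' s \<theta>" by (rule eq[OF \<theta>])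
    also have "\<dots> = ?A' (s *\<^sub>R perp \<theta>)"
      unfolding layered_radon_def attenuated_radon_def
        L'.attenuated_radon_eq_layered_radon[OF a'(1) \<theta> *(2)] ..
    finally show "?A (s *\<^sub>R perp \<theta>) = ?A' (s *\<^sub>R perp \<theta>)" .
  qed
  obtain B e where B: "B \<ge> 0" "e > 0" "\<And>h. \<bar>h\<bar> \<le> e \<Longrightarrow> \<bar>?A (p + h *\<^sub>R perp \<theta>) - ?A p\<bar> \<le> B * \<bar>h\<bar>"
    by (rule L.layered_radon_lipschitz[OF fr f reg(1)]) (rule that)
  obtain B' e' where B': "B' \<ge> 0" "e' > 0" "\<And>h. \<bar>h\<bar> \<le> e' \<Longrightarrow> \<bar>?A' (p + h *\<^sub>R perp \<theta>) - ?A' p\<bar> \<le> B' * \<bar>h\<bar>"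
    by (rule L'.layered_radon_lipschitz[OF fr f' reg(2)]) (rule that)
  have le: "\<bar>?A p - ?A' p\<bar> \<le> (B + B') * d" if d: "0 < d" "d \<le> e" "d \<le> e'" for d
  proof -
    have "\<exists>s\<in>{s0<..<s0 + d}. ?A (s *\<^sub>R perp \<theta>) = ?A' (s *\<^sub>R perp \<theta>)"
    proof (rule ccontr)
      assume no: "\<not> ?thesis"
      have "AE s in lborel. s \<notin> {s0<..<s0 + d}" using good by eventually_elim (use no in blast)
      then have "emeasure lborel {s0<..<s0 + d} = 0"
        by (subst (asm) AE_iff_measurable[of "{s0<..<s0 + d}"]) auto
      then show False using d(1) by simp
    qed
    then obtain s where s: "s0 < s" "s < s0 + d" "?A (s *\<^sub>R perp \<theta>) = ?A' (s *\<^sub>R perp \<theta>)" by auto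
    have ps: "p + (s - s0) *\<^sub>R perp \<theta> = s *\<^sub>R perp \<theta> + (p \<bullet> \<theta>) *\<^sub>R \<theta>"
      by (subst pe) (simp add: algebra_simps)
    have "?A (p + (s - s0) *\<^sub>R perp \<theta>) = ?A' (p + (s - s0) *\<^sub>R perp \<theta>)"
      unfolding ps L.layered_radon_shift L'.layered_radon_shift by (rule s(3))
    moreover have "\<bar>?A (p + (s - s0) *\<^sub>R perp \<theta>) - ?A p\<bar> \<le> B * \<bar>s - s0\<bar>" using s d by (intro B(3)) auto
    moreover have "\<bar>?A' (p + (s - s0) *\<^sub>R perp \<theta>) - ?A' p\<bar> \<le> B' * \<bar>s - s0\<bar>" using s d by (intro B'(3)) auto
    ultimately have "\<bar>?A p - ?A' p\<bar> \<le> (B + B') * \<bar>s - s0\<bar>" by (simp add: distrib_right)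
    also have "\<dots> \<le> (B + B') * d" using s d B(1) B'(1) by (intro mult_left_mono) auto
    finally show ?thesis .
  qed
  have "\<bar>?A p - ?A' p\<bar> \<le> 0"
  proof (rule field_le_epsilon)
    fix \<epsilon> :: real assume "\<epsilon> > 0"
    define d where "d = min (min e e') (\<epsilon> / (B + B' + 1))"
    have d: "0 < d" "d \<le> e" "d \<le> e'" using B B' \<open>\<epsilon> > 0\<close> by (auto simp: d_def)
    have "(B + B') * d \<le> (B + B' + 1) * (\<epsilon> / (B + B' + 1))"
      using B B' d(1) by (intro mult_mono) (auto simp: d_def)
    then show "\<bar>?A p - ?A' p\<bar> \<le> 0 + \<epsilon>" using le[OF d] B(1) B'(1) by simp
  qed
  then show ?thesis by simp
qed

section \<open>Visible boundary points\<close>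

text \<open>The one-dimensional Sard theorem: \<open>baby_Sard\<close> with a derivative of rank 0.
  The passage to \<open>real^1\<close> is made because \<open>baby_Sard\<close> is about
  vectors.\<close>

lemma negligible_image_zero_derivative:
  fixes g :: "real \<Rightarrow> real"
  assumes "\<And>t. t \<in> T \<Longrightarrow> (g has_real_derivative 0) (at t)"
  shows "negligible (g ` T)"
proof -
  let ?f = "\<lambda>x :: real^1. vec (g (x $ 1)) :: real^1"
  let ?S = "{x :: real^1. x $ 1 \<in> T}"
  have neg: "negligible (?f ` ?S)"
  proof (rule baby_Sard)
    show "CARD(1) \<le> CARD(1)" by simp
    fix x :: "real^1" assume "x \<in> ?S"
    then have "(g has_derivative (\<lambda>_. 0)) (at (x $ 1))"
      using assms[of "x $ 1"] unfolding has_field_derivative_def by (simp add: lambda_zero)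
    moreover have "((\<lambda>x :: real^1. x $ 1) has_derivative (\<lambda>x. x $ 1)) (at x)"
      by (intro bounded_linear_imp_has_derivative bounded_linear_vec_nth)
    ultimately have gd: "((\<lambda>x :: real^1. g (x $ 1)) has_derivative (\<lambda>_. 0)) (at x)"
      using has_derivative_compose[of "\<lambda>x :: real^1. x $ 1" "\<lambda>x. x $ 1" x UNIV g "\<lambda>_. 0"] by simp
    have vec_eq: "(vec :: real \<Rightarrow> real^1) = (\<lambda>r. r *\<^sub>R 1)" by (auto simp: vec_eq_iff fun_eq_iff)
    have "bounded_linear (vec :: real \<Rightarrow> real^1)" unfolding vec_eq by (rule bounded_linear_scaleR_left)
    from bounded_linear.has_derivative[OF this gd] have "(?f has_derivative (\<lambda>_. vec 0)) (at x)" .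
    then show "(?f has_derivative (\<lambda>_. 0)) (at x within ?S)"
      unfolding vec_0 by (rule has_derivative_at_withinI)
    have "matrix (\<lambda>_ :: real^1. 0 :: real^1) = 0" by (simp add: matrix_def vec_eq_iff)
    then show "rank (matrix (\<lambda>_ :: real^1. 0 :: real^1)) < CARD(1)"
      by (simp add: rank_eq_0)
  qed
  have dif: "(\<lambda>x :: real^1. x $ 1) differentiable_on (?f ` ?S)"
    by (intro linear_imp_differentiable_on) (simp add: linear_iff)
  have "negligible ((\<lambda>x :: real^1. x $ 1) ` ?f ` ?S)"
    by (rule negligible_differentiable_image_negligible[OF _ neg dif]) simp
  moreover have "g ` T \<subseteq> (\<lambda>x :: real^1. x $ 1) ` ?f ` ?S"
  proof
    fix y assume "y \<in> g ` T"
    then obtain t where t: "t \<in> T" "y = g t" by blast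
    have "(vec t :: real^1) \<in> ?S" using t by simp
    then have "?f (vec t) \<in> ?f ` ?S" by (rule imageI)
    then have "(?f (vec t)) $ 1 \<in> (\<lambda>x :: real^1. x $ 1) ` ?f ` ?S" by (rule imageI)
    then show "y \<in> (\<lambda>x :: real^1. x $ 1) ` ?f ` ?S" using t by simp
  qed
  ultimately show ?thesis by (rule negligible_subset)
qed

lemma smooth_regular_derivatives:
  assumes "smooth_regular_at \<gamma> t"
  shows "(\<gamma> has_vector_derivative velocity \<gamma> t) (at t)" "velocity \<gamma> t \<noteq> 0"
    "(velocity \<gamma> has_vector_derivative acceleration \<gamma> t) (at t)"
proof -
  obtain e where e: "e > 0" "smooth_on {t - e<..<t + e} \<gamma>" and v: "velocity \<gamma> t \<noteq> 0"
    using assms unfolding smooth_regular_at_def by blast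
  obtain D where D: "D 0 = \<gamma>" "\<And>k s. s \<in> {t - e<..<t + e} \<Longrightarrow> (D k has_vector_derivative D (Suc k) s) (at s)"
    using e(2) unfolding smooth_on_def by blast
  have t: "t \<in> {t - e<..<t + e}" using e by simp
  have vel: "velocity \<gamma> s = D 1 s" if "s \<in> {t - e<..<t + e}" for s
    unfolding velocity_def using D(2)[OF that, of 0] D(1) by (simp add: vector_derivative_at)
  show "(\<gamma> has_vector_derivative velocity \<gamma> t) (at t)" using D(2)[OF t, of 0] D(1) vel[OF t] by simp
  show "velocity \<gamma> t \<noteq> 0" by (rule v)
  have "(velocity \<gamma> has_vector_derivative D 2 t) (at t)"
    by (rule has_vector_derivative_transform_within_open[OF D(2)[OF t, of 1, simplified Suc_1] _ t])
       (auto simp: vel)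
  moreover from this have "acceleration \<gamma> t = D 2 t"
    unfolding acceleration_def by (rule vector_derivative_at)
  ultimately show "(velocity \<gamma> has_vector_derivative acceleration \<gamma> t) (at t)" by simp
qed

text \<open>By the quotient rule the derivative of the slope is the numerator of the curvature
  divided by the square of the first velocity component.\<close>

lemma negligible_slopes:
  "negligible ((\<lambda>t. velocity \<gamma> t $ 2 / velocity \<gamma> t $ 1) `
     {t. smooth_regular_at \<gamma> t \<and> velocity \<gamma> t $ 1 \<noteq> 0 \<and> curvature \<gamma> t = 0})"
proof (rule negligible_image_zero_derivative)
  fix t assume t: "t \<in> {t. smooth_regular_at \<gamma> t \<and> velocity \<gamma> t $ 1 \<noteq> 0 \<and> curvature \<gamma> t = 0}"
  let ?v = "velocity \<gamma>" and ?a = "acceleration \<gamma>"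
  have v: "(?v has_vector_derivative ?a t) (at t)" "?v t \<noteq> 0" using smooth_regular_derivatives t by auto
  have d: "((\<lambda>s. ?v s $ i) has_real_derivative ?a t $ i) (at t)" for i
    using bounded_linear.has_vector_derivative[OF bounded_linear_vec_nth[of i] v(1)]
    by (simp add: has_real_derivative_iff_has_vector_derivative)
  have "?v t $ 1 * ?a t $ 2 - ?v t $ 2 * ?a t $ 1 = 0"
    using t v(2) by (auto simp: curvature_def)
  then have "(?a t $ 2 * ?v t $ 1 - ?v t $ 2 * ?a t $ 1) / (?v t $ 1 * ?v t $ 1) = 0"
    by (simp add: mult.commute)
  with DERIV_divide[OF d[of 2] d[of 1]] t
  show "((\<lambda>t. ?v t $ 2 / ?v t $ 1) has_real_derivative 0) (at t)" by simp
qed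

section \<open>Regions of the coefficient next to the boundary of a layer\<close>

lemma open_AE_empty:
  fixes G :: "'a :: euclidean_space set"
  assumes "open G" "AE x in lborel. x \<notin> G"
  shows "G = {}"
proof (rule ccontr)
  assume "G \<noteq> {}"
  have "G \<in> sets lborel" using assms(1) by simp
  then have "G \<in> null_sets lborel" using assms(2) by (simp add: AE_iff_null_sets)
  then have "negligible G" by (simp add: negligible_iff_null_sets null_sets_completionI)
  then show False using open_not_negligible[OF assms(1) \<open>G \<noteq> {}\<close>] by blast
qed

lemma frontier_Int_open_cong:
  assumes "open B" "A \<inter> B = D \<inter> B"
  shows "frontier A \<inter> B = frontier D \<inter> B"
proof -
  have cl: "closure A \<inter> B = closure (A \<inter> B) \<inter> B" for A
    using open_Int_closure_subset[OF assms(1), of A] closure_mono[of "A \<inter> B" A] by (auto simp: Int_commute)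
  have int: "interior A \<inter> B = interior (A \<inter> B)" for A
    using assms(1) by (simp add: interior_open)
  have "closure A \<inter> B = closure D \<inter> B" using cl[of A] cl[of D] assms(2) by simp
  moreover have "interior A \<inter> B = interior D \<inter> B" using int[of A] int[of D] assms(2) by simp
  ultimately show ?thesis unfolding frontier_def by blast
qed

text \<open>Inside \<open>B\<close>, the part of \<open>W\<close> outside \<open>closure D\<close>
  is open and null, hence empty. So \<open>W \<inter> B\<close> is an open subset of
  \<open>closure D\<close>, and \<open>interior (closure D) = D\<close> places it in
  \<open>D\<close>; the other inclusion is symmetric.\<close>

lemma AE_equal_regular_open:
  fixes W D B :: "'a :: euclidean_space set"
  assumes "open B" "open W" "open D" "interior (closure W) = W" "interior (closure D) = D"
    and "AE x in lborel. x \<in> B \<longrightarrow> x \<in> W \<longrightarrow> x \<in> closure D"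
    and "AE x in lborel. x \<in> B \<longrightarrow> x \<in> D \<longrightarrow> x \<in> closure W"
  shows "W \<inter> B = D \<inter> B"
proof -
  have sub: "W \<inter> B \<subseteq> D" if "open W" "interior (closure D) = D"
    and ae: "AE x in lborel. x \<in> B \<longrightarrow> x \<in> W \<longrightarrow> x \<in> closure D" for W D
  proof -
    have "open (W \<inter> B - closure D)" using that(1) assms(1) by (intro open_Diff open_Int) auto
    moreover have "AE x in lborel. x \<notin> W \<inter> B - closure D" using ae by eventually_elim auto
    ultimately have "W \<inter> B - closure D = {}" by (rule open_AE_empty)
    then have "W \<inter> B \<subseteq> interior (closure D)"
      using that(1) assms(1) by (intro interior_maximal open_Int) auto
    then show ?thesis using that(2) by simp
  qed
  show ?thesis using sub[OF assms(2,5,6)] sub[OF assms(3,4,7)] by blast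
qed

context nested_layers begin

lemma interior_closure_C: "j \<in> {1..N} \<Longrightarrow> interior (closure (C j)) = C j"
  using convex_interior_closure[OF convex_C] open_C by (simp add: interior_open)

lemma frontier_C: "j \<in> {1..N} \<Longrightarrow> frontier (C j) = closure (C j) - C j"
  using open_C by (simp add: frontier_def interior_open)

text \<open>Closures are strictly nested, so near the boundary of one layer all outer layers are
  present and all inner ones absent.\<close>

lemma layer_nbhd:
  assumes j: "j \<in> {1..N}"
  obtains B where "open B" "frontier (C j) \<subseteq> B"
    "\<And>x. x \<in> B \<Longrightarrow> layered x = (\<Sum>i\<in>{1..<j}. c i) + (if x \<in> C j then c j else 0)"
proof
  let ?B = "(\<Inter>i\<in>{1..<j}. C i) \<inter> (\<Inter>i\<in>{j<..N}. - closure (C i))"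
  show "open ?B" using open_C j by (intro open_Int open_INT) auto
  show "frontier (C j) \<subseteq> ?B"
  proof
    fix x assume x: "x \<in> frontier (C j)"
    then have cl: "x \<in> closure (C j)" "x \<notin> C j" using frontier_C[OF j] by auto
    have "x \<in> C i" if "i \<in> {1..<j}" for i using nested_less[of i j] that j cl by auto
    moreover have "x \<notin> closure (C i)" if "i \<in> {j<..N}" for i using nested_less[of j i] that j cl by auto
    ultimately show "x \<in> ?B" by auto
  qed
  fix x assume x: "x \<in> ?B"
  have split: "{1..N} = {1..<j} \<union> ({j} \<union> {j<..N})" using j by auto
  have "layered x = (\<Sum>i\<in>{1..<j}. c i * indicator (C i) x) + (c j * indicator (C j) x + (\<Sum>i\<in>{j<..N}. c i * indicator (C i) x))"
  proof -
    let ?g = "\<lambda>i. c i * indicator (C i) x"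
    have "sum ?g ({1..<j} \<union> ({j} \<union> {j<..N})) = sum ?g {1..<j} + sum ?g ({j} \<union> {j<..N})"
      by (rule sum.union_disjoint) auto
    moreover have "sum ?g ({j} \<union> {j<..N}) = sum ?g {j} + sum ?g {j<..N}"
      by (rule sum.union_disjoint) auto
    moreover have "sum ?g {j} = ?g j"
      by (simp only: sum.insert finite.emptyI empty_iff not_False_eq_True sum.empty add_0_right)
    ultimately show ?thesis unfolding layered_def split by (simp only:)
  qed
  also have "(\<Sum>i\<in>{1..<j}. c i * indicator (C i) x) = (\<Sum>i\<in>{1..<j}. c i)"
    using x by (intro sum.cong) auto
  also have "(\<Sum>i\<in>{j<..N}. c i * indicator (C i) x) = 0"
  proof (rule sum.neutral, intro ballI)
    fix i assume "i \<in> {j<..N}"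
    then have "x \<notin> closure (C i)" using x by blast
    then have "x \<notin> C i" using closure_subset by blast
    then show "c i * indicator (C i) x = 0" by simp
  qed
  finally show "layered x = (\<Sum>i\<in>{1..<j}. c i) + (if x \<in> C j then c j else 0)" by simp
qed

text \<open>The tangent and corner conditions speak of the regions of \<open>a\<close>, not of the
  layers. Across \<open>frontier (C j)\<close> the value jumps by \<open>c j \<noteq> 0\<close>, so
  it is non-zero on at least one side, and within \<open>B\<close> that side is a region. The
  frontiers are compared only in \<open>B\<close>, since elsewhere the region may have further
  boundary components.\<close>

lemma layer_region:
  assumes mb: "multi_bang a" and a: "AE x in lborel. a x = layered x" and j: "j \<in> {1..N}"
  obtains W B where "region a W" "smooth_boundary_with_corners W" "open B" "frontier (C j) \<subseteq> B"
    "frontier W \<inter> B = frontier (C j) \<inter> B"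
proof -
  obtain n v \<Omega> where rep: "multi_bang_rep a n v \<Omega>" using mb unfolding multi_bang_def by blast
  have inj: "inj_on v {1..n}" and nz: "\<And>k. k \<in> {1..n} \<Longrightarrow> v k \<noteq> 0" and disj: "disjoint_family_on \<Omega> {1..n}"
    and \<Omega>: "\<And>k. k \<in> {1..n} \<Longrightarrow> open (\<Omega> k) \<and> smooth_boundary_with_corners (\<Omega> k) \<and> interior (closure (\<Omega> k)) = \<Omega> k"
    and aeq: "AE x in lborel. a x = (\<Sum>k\<in>{1..n}. v k * indicator (\<Omega> k) x)"
    using rep unfolding multi_bang_rep_def by blast+
  define S where "S x = (\<Sum>k\<in>{1..n}. v k * indicator (\<Omega> k) x)" for x
  have S_in: "S x = v k" if k: "k \<in> {1..n}" "x \<in> \<Omega> k" for x k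
  proof -
    have "v i * indicator (\<Omega> i) x = (if i = k then v k else 0)" if "i \<in> {1..n}" for i
    proof (cases "i = k")
      case False
      then have "\<Omega> i \<inter> \<Omega> k = {}" using disj that k unfolding disjoint_family_on_def by blast
      then have "x \<notin> \<Omega> i" using k by blast
      then show ?thesis using False by simp
    qed (use k in simp)
    then have "S x = (\<Sum>i\<in>{1..n}. if i = k then v k else 0)" unfolding S_def by (intro sum.cong) auto
    then show ?thesis using k by simp
  qed
  have S_out: "\<exists>k\<in>{1..n}. x \<in> \<Omega> k" if "S x \<noteq> 0" for x
    using that unfolding S_def by (metis (mono_tags, lifting) indicator_simps(2) mult_zero_right sum.neutral)
  obtain B where B: "open B" "frontier (C j) \<subseteq> B"
    "\<And>x. x \<in> B \<Longrightarrow> layered x = (\<Sum>i\<in>{1..<j}. c i) + (if x \<in> C j then c j else 0)"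
    by (rule layer_nbhd[OF j]) (rule that)
  have S_ae: "AE x in lborel. x \<in> B \<longrightarrow> S x = (\<Sum>i\<in>{1..<j}. c i) + (if x \<in> C j then c j else 0)"
    using a aeq by eventually_elim (use B(3) in \<open>auto simp: S_def\<close>)
  have ne: "frontier (C j) \<noteq> {}"
    using frontier_eq_empty[of "C j"] ne_C[OF j] bounded_C[OF j] not_bounded_UNIV by auto
  then obtain x0 where x0: "x0 \<in> frontier (C j)" by blast
  have x0': "x0 \<in> closure (C j)" "x0 \<notin> C j" "x0 \<in> B" using x0 frontier_C[OF j] B(2) by auto
  note concl = that
  \<comment> \<open>\<open>D\<close> is the side of the boundary on which the value is
    \<open>w\<close>. As the values \<open>v\<close> are distinct and \<open>w \<noteq> 0\<close>,
    one single \<open>\<Omega> k\<close> is the whole set where \<open>S\<close> equals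
    \<open>w\<close>.\<close>
  have region_eq: thesis
    if w: "w \<noteq> 0" and D: "open D" "interior (closure D) = D" "frontier D = frontier (C j)" "B \<inter> D \<noteq> {}"
      and ae1: "AE x in lborel. x \<in> B \<longrightarrow> S x = w \<longrightarrow> x \<in> closure D"
      and ae2: "AE x in lborel. x \<in> B \<longrightarrow> x \<in> D \<longrightarrow> S x = w" for w D
  proof -
    obtain y where y: "y \<in> D" "S y = w"
    proof (rule ccontr)
      assume "\<not> thesis"
      then have no: "y \<notin> D \<or> S y \<noteq> w" for y using that by blast
      have "AE x in lborel. x \<notin> B \<inter> D" using ae2 by eventually_elim (use no in blast)
      then show False using open_AE_empty[of "B \<inter> D"] D(1,4) B(1) by blast
    qed
    obtain k where k: "k \<in> {1..n}" "y \<in> \<Omega> k" using S_out[of y] y w by auto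
    have vk: "v k = w" using S_in[OF k] y by simp
    have iff: "x \<in> \<Omega> k \<longleftrightarrow> S x = w" for x
    proof
      assume "S x = w"
      then obtain i where i: "i \<in> {1..n}" "x \<in> \<Omega> i" using S_out[of x] w by auto
      then have "v i = v k" using S_in[OF i] \<open>S x = w\<close> vk by simp
      then show "x \<in> \<Omega> k" using inj i k by (auto dest: inj_onD)
    qed (use S_in[OF k(1)] vk in simp)
    have "\<Omega> k \<inter> B = D \<inter> B"
    proof (rule AE_equal_regular_open)
      show "AE x in lborel. x \<in> B \<longrightarrow> x \<in> \<Omega> k \<longrightarrow> x \<in> closure D" using ae1 unfolding iff .
      show "AE x in lborel. x \<in> B \<longrightarrow> x \<in> D \<longrightarrow> x \<in> closure (\<Omega> k)"
        using ae2 by eventually_elim (use iff closure_subset in blast)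
    qed (use \<Omega>[OF k(1)] D B in auto)
    from frontier_Int_open_cong[OF B(1) this] have "frontier (\<Omega> k) \<inter> B = frontier (C j) \<inter> B"
      unfolding D(3) .
    moreover have "region a (\<Omega> k)" unfolding region_def using rep k(1) by blast
    ultimately show thesis using concl[of "\<Omega> k" B] \<Omega>[OF k(1)] B(1,2) by blast
  qed
  show thesis
  proof (cases "(\<Sum>i\<in>{1..<j}. c i) + c j = 0")
    case False
    show thesis
    proof (rule region_eq[OF False])
      show "B \<inter> C j \<noteq> {}" using x0' B(1) by (metis Int_commute open_Int_closure_eq_empty IntI empty_iff)
      show "AE x in lborel. x \<in> B \<longrightarrow> S x = (\<Sum>i\<in>{1..<j}. c i) + c j \<longrightarrow> x \<in> closure (C j)"
        using S_ae by eventually_elim (use c_nz[OF j] closure_subset[of "C j"] in \<open>auto split: if_splits\<close>)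
      show "AE x in lborel. x \<in> B \<longrightarrow> x \<in> C j \<longrightarrow> S x = (\<Sum>i\<in>{1..<j}. c i) + c j"
        using S_ae by eventually_elim auto
    qed (use open_C[OF j] interior_closure_C[OF j] in auto)
  next
    case True
    \<comment> \<open>The value inside is 0 here, so outside it is \<open>- c j\<close>. The
      complement of the closure is again regular open and has the same frontier.\<close>
    let ?D = "- closure (C j)"
    have w: "(\<Sum>i\<in>{1..<j}. c i) \<noteq> 0" using True c_nz[OF j] by auto
    have clD: "closure ?D = - C j" using interior_closure_C[OF j] by (simp add: closure_complement)
    show thesis
    proof (rule region_eq[OF w])
      show "open ?D" by (rule open_Compl) (rule closed_closure)
      show "interior (closure ?D) = ?D" unfolding clD by (simp add: interior_complement)
      show "frontier ?D = frontier (C j)"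
        unfolding frontier_def clD using open_C[OF j] by (auto simp: interior_open interior_complement)
      show "B \<inter> ?D \<noteq> {}"
      proof
        assume "B \<inter> ?D = {}"
        then have "B \<subseteq> interior (closure (C j))" using B(1) by (intro interior_maximal) auto
        then show False using x0' interior_closure_C[OF j] by auto
      qed
      show "AE x in lborel. x \<in> B \<longrightarrow> S x = (\<Sum>i\<in>{1..<j}. c i) \<longrightarrow> x \<in> closure ?D"
        unfolding clD using S_ae by eventually_elim (use c_nz[OF j] in auto)
      show "AE x in lborel. x \<in> B \<longrightarrow> x \<in> ?D \<longrightarrow> S x = (\<Sum>i\<in>{1..<j}. c i)"
        using S_ae by eventually_elim (use closure_subset[of "C j"] in auto)
    qed
  qed
qed

end

section \<open>Supporting normals at points of boundary curves\<close>

lemma periodic_unit_representative: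
  fixes \<gamma> :: "real \<Rightarrow> 'a"
  assumes "\<And>t. \<gamma> (t + 1) = \<gamma> t"
  obtains s where "0 \<le> s" "s < 1" "\<gamma> s = \<gamma> t"
proof -
  have n: "\<gamma> (t + real k) = \<gamma> t" for t k
  proof (induction k)
    case (Suc k)
    then show ?case using assms[of "t + real k"] by (simp add: add_ac)
  qed simp
  have "\<gamma> (frac t) = \<gamma> t"
  proof (cases "0 \<le> \<lfloor>t\<rfloor>")
    case True
    then show ?thesis using n[of "frac t" "nat \<lfloor>t\<rfloor>"] by (simp add: frac_def)
  next
    case False
    then show ?thesis using n[of t "nat (- \<lfloor>t\<rfloor>)"] by (simp add: frac_def)
  qed
  then show thesis using that[of "frac t"] frac_ge_0 frac_lt_1 by blast
qed

lemma supporting_point_exists: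
  fixes A :: "'a :: euclidean_space set"
  assumes "bounded A" "A \<noteq> {}"
  obtains x where "x \<in> closure A" "\<And>y. y \<in> closure A \<Longrightarrow> y \<bullet> n \<le> x \<bullet> n"
proof -
  have "compact (closure A)" using assms by simp
  moreover have "closure A \<noteq> {}" using assms by simp
  moreover have "continuous_on (closure A) (\<lambda>y. y \<bullet> n)" by (intro continuous_intros)
  ultimately show thesis using continuous_attains_sup that by metis
qed

lemma open_less_supporting_value:
  fixes A :: "'a :: euclidean_space set"
  assumes "open A" "n \<noteq> 0" "\<And>y. y \<in> A \<Longrightarrow> y \<bullet> n \<le> b" "y \<in> A"
  shows "y \<bullet> n < b"
proof -
  obtain e where e: "e > 0" "ball y e \<subseteq> A" using assms(1,4) openE by blast
  let ?y = "y + (e / (2 * norm n)) *\<^sub>R n"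
  have "?y \<in> ball y e" using e(1) assms(2) by (simp add: dist_norm)
  then have "?y \<bullet> n \<le> b" using e assms(3) by blast
  moreover have "0 < (e / (2 * norm n)) * (n \<bullet> n)" using e(1) assms(2) by simp
  ultimately show ?thesis by (simp add: inner_add_left)
qed

text \<open>The function \<open>\<gamma> u \<bullet> n\<close> has a local maximum at
  \<open>t\<close>.\<close>

lemma velocity_orthogonal_to_normal:
  assumes der: "(\<gamma> has_vector_derivative v) (at t)"
    and ev: "eventually (\<lambda>u. \<gamma> u \<in> A) (at t)" and le: "\<And>y. y \<in> A \<Longrightarrow> y \<bullet> n \<le> \<gamma> t \<bullet> n"
  shows "v \<bullet> n = 0"
proof -
  have d: "((\<lambda>u. \<gamma> u \<bullet> n) has_real_derivative v \<bullet> n) (at t)"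
    using bounded_linear.has_vector_derivative[OF bounded_linear_inner_left[of n] der]
    by (simp add: has_real_derivative_iff_has_vector_derivative)
  obtain d where d': "d > 0" "\<And>u. u \<noteq> t \<Longrightarrow> dist u t < d \<Longrightarrow> \<gamma> u \<in> A"
    using ev unfolding eventually_at by auto
  show ?thesis
  proof (rule DERIV_local_max[OF d d'(1)])
    show "\<forall>y. \<bar>t - y\<bar> < d \<longrightarrow> \<gamma> y \<bullet> n \<le> \<gamma> t \<bullet> n"
    proof (intro allI impI)
      fix y assume "\<bar>t - y\<bar> < d"
      then show "\<gamma> y \<bullet> n \<le> \<gamma> t \<bullet> n"
        using le[OF d'(2)[of y]] by (cases "y = t") (auto simp: dist_real_def abs_minus_commute)
    qed
  qed
qed

context nested_layers begin

text \<open>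
  The two alternatives render the tangent condition and the corner condition. At a corner, two
  independent supporting normals take the place of the two branches.
\<close>

definition visible_boundary_point :: "nat \<Rightarrow> (plane \<Rightarrow> real) \<Rightarrow> plane \<Rightarrow> plane \<Rightarrow> bool" where
  "visible_boundary_point j f x n \<longleftrightarrow>
     x \<in> frontier (C j) \<and> n \<noteq> 0 \<and> (\<forall>y\<in>C j. y \<bullet> n \<le> x \<bullet> n) \<and>
     ((\<exists>\<gamma> t v r. \<gamma> t = x \<and> (\<gamma> has_vector_derivative v) (at t) \<and> v \<noteq> 0 \<and> v \<bullet> n = 0 \<and>
         eventually (\<lambda>u. \<gamma> u \<in> closure (C j)) (at t) \<and> f (x + r *\<^sub>R v) > 0) \<or>
      (\<exists>n' z. n $ 1 * n' $ 2 \<noteq> n $ 2 * n' $ 1 \<and> (\<forall>y\<in>C j. y \<bullet> n' \<le> x \<bullet> n') \<and> f z > 0))"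

text \<open>
  The normal direction of a smooth arc is stationary where the curvature vanishes, so by Sard's theorem
  almost every normal in \<open>V\<close> supports the layer at a curved point or at a corner.
\<close>

lemma visible_boundary_point_exists:
  assumes mb: "multi_bang a" and a: "AE x in lborel. a x = layered x" and j: "j \<in> {1..N}"
    and tan: "tangent_condition a f" and cor: "corner_condition a f"
    and V: "open V" "V \<noteq> {}"
  obtains x n where "n \<in> V" "visible_boundary_point j f x n"
proof -
  obtain W B where W: "region a W" "smooth_boundary_with_corners W" and B: "open B" "frontier (C j) \<subseteq> B"
    and WB: "frontier W \<inter> B = frontier (C j) \<inter> B"
    by (rule layer_region[OF mb a j]) (rule that)
  obtain \<Gamma> where \<Gamma>: "boundary_curves W \<Gamma>" using W(2) unfolding smooth_boundary_with_corners_def by blast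
  have fin\<Gamma>: "finite \<Gamma>" and curve: "\<And>\<gamma>. \<gamma> \<in> \<Gamma> \<Longrightarrow> closed_curve_with_corners \<gamma>" and fW: "frontier W = (\<Union>\<gamma>\<in>\<Gamma>. range \<gamma>)"
    using \<Gamma> unfolding boundary_curves_def by auto
  have fsub: "frontier (C j) \<subseteq> frontier W" using WB B(2) by blast
  have rep: "\<exists>\<gamma>\<in>\<Gamma>. \<exists>t. 0 \<le> t \<and> t < 1 \<and> \<gamma> t = x \<and> (smooth_regular_at \<gamma> t \<or> corner_at \<gamma> t)" if xf: "x \<in> frontier (C j)" for x
  proof -
    obtain \<gamma> u where g: "\<gamma> \<in> \<Gamma>" "x = \<gamma> u" using xf fsub fW by blast
    obtain t where "0 \<le> t" "t < 1" "\<gamma> t = \<gamma> u"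
      by (rule periodic_unit_representative[of \<gamma> u]) (use curve[OF g(1)] in \<open>auto simp: closed_curve_with_corners_def\<close>)
    then show ?thesis using g curve[OF g(1)] unfolding closed_curve_with_corners_def by metis
  qed
  \<comment> \<open>\<open>V\<close> is open, so a normal in it can be tilted off the first axis;
    this allows normals to be indexed by slopes below.\<close>
  obtain n0 where n0: "n0 \<in> V" "n0 $ 2 \<noteq> 0"
  proof -
    obtain w where w: "w \<in> V" using V by blast
    obtain e where e: "e > 0" "ball w e \<subseteq> V" using V(1) w openE by blast
    show thesis
    proof (cases "w $ 2 = 0")
      case True
      let ?w = "w + (e / 2) *\<^sub>R axis 2 1"
      have "?w \<in> ball w e" using e(1) by (simp add: dist_norm)
      then show thesis using that[of ?w] e True by (auto simp: axis_def)
    qed (use w that in blast)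
  qed
  define b where "b = n0 $ 2"
  have b: "b \<noteq> 0" using n0 by (simp add: b_def)
  \<comment> \<open>\<open>\<nu> m\<close> is orthogonal to the directions of slope
    \<open>m\<close>, so the slope of the boundary at a smooth supporting point is the parameter
    \<open>m\<close> itself. The fixed second component \<open>b\<close> makes the family pass
    through \<open>n0\<close>.\<close>
  define \<nu> :: "real \<Rightarrow> plane" where "\<nu> m = vector [- m * b, b]" for m
  have \<nu>_eq: "\<nu> m = (- m * b) *\<^sub>R axis 1 1 + b *\<^sub>R axis 2 1" for m
    by (auto simp: \<nu>_def vec_eq_iff forall_2 axis_def)
  have \<nu>nz: "\<nu> m \<noteq> 0" for m using b by (auto simp: \<nu>_def vec_eq_iff forall_2)
  define J where "J = \<nu> -` V"
  have Jopen: "open J" unfolding J_def \<nu>_eq by (rule open_vimage[OF V(1)]) (intro continuous_intros)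
  have "\<nu> (- (n0 $ 1) / b) = n0" using b by (auto simp: \<nu>_def b_def vec_eq_iff forall_2)
  then have Jne: "J \<noteq> {}" using n0 unfolding J_def by (metis empty_iff vimage_eq)
  have "\<exists>x. x \<in> frontier (C j) \<and> (\<forall>y\<in>closure (C j). y \<bullet> \<nu> m \<le> x \<bullet> \<nu> m)" for m
  proof -
    obtain x where x: "x \<in> closure (C j)" "\<And>y. y \<in> closure (C j) \<Longrightarrow> y \<bullet> \<nu> m \<le> x \<bullet> \<nu> m"
      by (rule supporting_point_exists[OF bounded_C[OF j] ne_C[OF j]]) (rule that)
    have "x \<notin> C j"
      using open_less_supporting_value[OF open_C[OF j] \<nu>nz, of m "x \<bullet> \<nu> m" x] x(2) closure_subset by blast
    then show ?thesis using x frontier_C[OF j] by blast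
  qed
  then obtain X where X: "\<And>m. X m \<in> frontier (C j)" "\<And>m y. y \<in> closure (C j) \<Longrightarrow> y \<bullet> \<nu> m \<le> X m \<bullet> \<nu> m"
    by metis
  obtain g \<tau> where g: "\<And>m. g m \<in> \<Gamma>" "\<And>m. 0 \<le> \<tau> m \<and> \<tau> m < 1" "\<And>m. g m (\<tau> m) = X m"
      "\<And>m. smooth_regular_at (g m) (\<tau> m) \<or> corner_at (g m) (\<tau> m)"
    using rep[OF X(1)] by metis
  have bc: "is_boundary_curve W (g m)" for m unfolding is_boundary_curve_def using \<Gamma> g(1) by blast
  have le: "\<forall>y\<in>C j. y \<bullet> \<nu> m \<le> X m \<bullet> \<nu> m" for m using X(2) closure_subset by blast
  have near: "eventually (\<lambda>u. g m u \<in> closure (C j)) (at (\<tau> m))" if s: "smooth_regular_at (g m) (\<tau> m)" for m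
  proof -
    have "isCont (g m) (\<tau> m)"
      using smooth_regular_derivatives(1)[OF s] by (rule has_vector_derivative_continuous)
    then have "((g m) \<longlongrightarrow> X m) (at (\<tau> m))" by (simp add: isCont_def g(3))
    moreover have "X m \<in> B" using X(1) B(2) by blast
    ultimately have "eventually (\<lambda>u. g m u \<in> B) (at (\<tau> m))" using B(1) by (rule_tac topological_tendstoD)
    then show ?thesis
    proof (rule eventually_mono)
      fix u assume "g m u \<in> B"
      moreover have "g m u \<in> frontier W" using g(1) fW by blast
      ultimately have "g m u \<in> frontier (C j)" using WB by blast
      then show "g m u \<in> closure (C j)" by (simp add: frontier_def)
    qed
  qed
  have orth: "velocity (g m) (\<tau> m) \<bullet> \<nu> m = 0" if s: "smooth_regular_at (g m) (\<tau> m)" for m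
    by (rule velocity_orthogonal_to_normal[OF smooth_regular_derivatives(1)[OF s] near[OF s]]) (simp add: g(3) X(2))
  show thesis
  proof (cases "\<exists>m\<in>J. smooth_regular_at (g m) (\<tau> m) \<and> curvature (g m) (\<tau> m) \<noteq> 0")
    case True
    then obtain m where m: "m \<in> J" "smooth_regular_at (g m) (\<tau> m)" "curvature (g m) (\<tau> m) \<noteq> 0" by blast
    have "X m \<in> curved_points a"
      unfolding curved_points_def boundary_nonzero_curvature_at_def
      using W(1) X(1)[of m] fsub m bc[of m] g(3)[of m] by blast
    moreover have "is_boundary_tangent W (X m) (range (\<lambda>r. X m + r *\<^sub>R velocity (g m) (\<tau> m)))"
      unfolding is_boundary_tangent_def using bc[of m] g(3)[of m] m(2) by blast
    ultimately have "range (\<lambda>r. X m + r *\<^sub>R velocity (g m) (\<tau> m)) \<inter> {y. f y > 0} \<noteq> {}"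
      using tan W(1) unfolding tangent_condition_def by blast
    then obtain r where "f (X m + r *\<^sub>R velocity (g m) (\<tau> m)) > 0" by blast
    then have "visible_boundary_point j f (X m) (\<nu> m)"
      unfolding visible_boundary_point_def
      using X(1) \<nu>nz le smooth_regular_derivatives[OF m(2)] near[OF m(2)] orth[OF m(2)] g(3)[of m] by blast
    then show thesis using that m(1) unfolding J_def by blast
  next
    case False
    \<comment> \<open>\<open>K\<close> collects the parameters whose supporting point is a corner of
      the chosen curve. If two of them share that point, it has two independent supporting normals;
      otherwise \<open>K\<close> injects into the finite set of corners.\<close>
    define K where "K = {m \<in> J. corner_at (g m) (\<tau> m)}"
    show thesis
    proof (cases "inj_on X K")
      case False
      then obtain m m' where m: "m \<in> K" "m' \<in> K" "m \<noteq> m'" "X m = X m'" unfolding inj_on_def by blast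
      have "X m \<in> corner_points a"
        unfolding corner_points_def boundary_corner_at_def
        using W(1) X(1)[of m] fsub m(1) bc[of m] g(3)[of m] unfolding K_def by blast
      then obtain z where z: "f z > 0" using cor unfolding corner_condition_def by blast
      have "\<nu> m $ 1 * \<nu> m' $ 2 \<noteq> \<nu> m $ 2 * \<nu> m' $ 1" using b m(3) by (simp add: \<nu>_def)
      then have "visible_boundary_point j f (X m) (\<nu> m)"
        unfolding visible_boundary_point_def using X(1) \<nu>nz le[of m] le[of m'] m(4) z by metis
      then show thesis using that m(1) unfolding J_def K_def by blast
    next
      case True
      define Z where "Z = (\<Union>\<gamma>\<in>\<Gamma>. \<gamma> ` {t \<in> {0..<1}. corner_at \<gamma> t})"
      have "finite Z" unfolding Z_def using fin\<Gamma> curve by (auto simp: closed_curve_with_corners_def)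
      moreover have "X ` K \<subseteq> Z"
      proof
        fix x assume "x \<in> X ` K"
        then obtain m where m: "m \<in> K" "x = X m" by blast
        then have \<tau>: "\<tau> m \<in> {t \<in> {0..<1}. corner_at (g m) t}" using g(2)[of m] unfolding K_def by auto
        then have "g m (\<tau> m) \<in> g m ` {t \<in> {0..<1}. corner_at (g m) t}" by (rule imageI)
        then have "g m (\<tau> m) \<in> Z" unfolding Z_def by (rule UN_I[OF g(1)])
        then show "x \<in> Z" using m(2) g(3) by simp
      qed
      ultimately have "finite K" using True by (meson finite_imageD finite_subset)
      \<comment> \<open>Outside \<open>K\<close> every supporting point is smooth with curvature
        zero, so its slope \<open>m\<close> lies in this null set. Then \<open>J\<close> would be
        null although it is open and nonempty.\<close>
      define SL where "SL = (\<Union>\<gamma>\<in>\<Gamma>. (\<lambda>t. velocity \<gamma> t $ 2 / velocity \<gamma> t $ 1) `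
         {t. smooth_regular_at \<gamma> t \<and> velocity \<gamma> t $ 1 \<noteq> 0 \<and> curvature \<gamma> t = 0})"
      have "negligible SL" unfolding SL_def
        by (rule negligible_Union) (use fin\<Gamma> negligible_slopes in auto)
      moreover have "J - K \<subseteq> SL"
      proof
        fix m assume m: "m \<in> J - K"
        then have s: "smooth_regular_at (g m) (\<tau> m)" using g(4)[of m] unfolding K_def by blast
        have c: "curvature (g m) (\<tau> m) = 0" using False m s by blast
        let ?v = "velocity (g m) (\<tau> m)"
        have "?v $ 1 * (- m * b) + ?v $ 2 * b = 0" using orth[OF s] by (simp add: inner_plane \<nu>_def)
        then have "b * (?v $ 2 - m * ?v $ 1) = 0" by (simp add: algebra_simps)
        then have e: "?v $ 2 = m * ?v $ 1" using b by simp
        have v1: "?v $ 1 \<noteq> 0"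
          using smooth_regular_derivatives(2)[OF s] e by (auto simp: vec_eq_iff forall_2)
        have mem: "\<tau> m \<in> {t. smooth_regular_at (g m) t \<and> velocity (g m) t $ 1 \<noteq> 0 \<and> curvature (g m) t = 0}"
          using s c v1 by simp
        have "m = ?v $ 2 / ?v $ 1" using e v1 by simp
        from this mem have "m \<in> (\<lambda>t. velocity (g m) t $ 2 / velocity (g m) t $ 1) `
            {t. smooth_regular_at (g m) t \<and> velocity (g m) t $ 1 \<noteq> 0 \<and> curvature (g m) t = 0}"
          by (rule image_eqI)
        then show "m \<in> SL" unfolding SL_def by (rule UN_I[OF g(1)])
      qed
      ultimately have "negligible (J - K)" by (rule negligible_subset)
      then have "negligible ((J - K) \<union> K)" using negligible_finite[OF \<open>finite K\<close>] by (rule negligible_Un)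
      then have "negligible J" by (rule negligible_subset) blast
      then show thesis using open_not_negligible[OF Jopen Jne] by blast
    qed
  qed
qed

end

section \<open>Supporting lines and corners\<close>

context convex_body begin

text \<open>The cone with apex \<open>(0, 0)\<close> over a short segment in one section of
  \<open>S\<close> has, at distance \<open>h\<close> from the apex, a chord of length proportional
  to \<open>h\<close>, and for small \<open>h\<close> this chord lies ahead of
  \<open>t1 < 0\<close>.\<close>

lemma ray_meas_linear_growth:
  assumes neg: "\<And>h t. (h, t) \<in> S \<Longrightarrow> h < 0" and z: "(0, 0) \<in> closure S" and t1: "t1 < 0"
  obtains k e where "k > 0" "e > 0" "\<And>h. 0 < h \<Longrightarrow> h \<le> e \<Longrightarrow> k * h \<le> ray_meas S (- h) t1"
    "\<And>h. 0 < h \<Longrightarrow> h \<le> e \<Longrightarrow> \<exists>t. (- h, t) \<in> S"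
proof -
  have "S \<noteq> {}" using z by auto
  then obtain h0 r where hr: "(h0, r) \<in> S" by fastforce
  define d where "d = - h0"
  have d: "d > 0" "(- d, r) \<in> S" using neg[OF hr] hr by (auto simp: d_def)
  obtain \<epsilon> where \<epsilon>: "\<epsilon> > 0" "\<And>y. dist y r < \<epsilon> \<Longrightarrow> (- d, y) \<in> S"
    using chord_open[of "- d"] d(2) unfolding open_dist by blast
  have d2: "(- d, r + \<epsilon> / 2) \<in> S" using \<epsilon> by (intro \<epsilon>(2)) (simp add: dist_real_def)
  \<comment> \<open>\<open>- R1\<close> bounds the slope \<open>r / d\<close> of the lower edge of
    the cone from below, so \<open>h * R1 \<le> - t1\<close> keeps that edge at or beyond
    \<open>t1\<close>.\<close>
  define R1 where "R1 = \<bar>r / d\<bar> + 1"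
  have R1: "R1 > 0" "- R1 \<le> r / d" unfolding R1_def using abs_ge_minus_self[of "r / d"] by linarith+
  define e where "e = min (d / 2) (- t1 / R1)"
  have "0 < - t1 / R1" using t1 R1 by (intro divide_pos_pos) auto
  then have e: "e > 0" using d by (simp add: e_def)
  have main: "(- h, h * (r / d)) \<in> S \<and> (\<epsilon> / (2 * d)) * h \<le> ray_meas S (- h) t1" if h: "0 < h" "h \<le> e" for h
  proof -
    have hd: "h < d" using h d by (simp add: e_def)
    have m: "(- h, h * (r / d)) \<in> S" "(- h, h * ((r + \<epsilon> / 2) / d)) \<in> S"
      using wedge_mem[OF z d(2) h(1) hd] wedge_mem[OF z d2 h(1) hd] by auto
    have "h \<le> - t1 / R1" using h(2) by (simp add: e_def)
    then have "h * R1 \<le> - t1" by (rule pos_le_divide_eq[THEN iffD1, OF R1(1)])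
    moreover have "h * (- R1) \<le> h * (r / d)" by (rule mult_left_mono[OF R1(2)]) (use h in simp)
    ultimately have "t1 \<le> h * (r / d)" by simp
    from ray_meas_ge[OF m this] have "h * ((r + \<epsilon> / 2) / d) - h * (r / d) \<le> ray_meas S (- h) t1" .
    moreover have "h * ((r + \<epsilon> / 2) / d) - h * (r / d) = (\<epsilon> / (2 * d)) * h"
      using d by (simp add: field_simps)
    ultimately show ?thesis using m by simp
  qed
  have "\<epsilon> / (2 * d) > 0" using \<epsilon> d by simp
  from this e show thesis by (rule that) (use main in blast)+
qed

text \<open>A curve in the closure that passes through \<open>(0, 0)\<close> in the direction of the
  line has points whose displacement is tiny compared with their position. They give cones as in
  \<open>ray_meas_linear_growth\<close> whose upper edge is as steep as desired.\<close>

lemma ray_meas_superlinear_growth: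
  assumes neg: "\<And>h t. (h, t) \<in> S \<Longrightarrow> h < 0" and z: "(0, 0) \<in> closure S" and t1: "t1 < 0"
    and cs: "(cs has_real_derivative 0) (at u0)" "cs u0 = 0"
    and ct: "(ct has_real_derivative v) (at u0)" "v \<noteq> 0" "ct u0 = 0"
    and ev: "eventually (\<lambda>u. (cs u, ct u) \<in> closure S) (at u0)"
  obtains e where "e > 0" "\<And>h. 0 < h \<Longrightarrow> h \<le> e \<Longrightarrow> K * h \<le> ray_meas S (- h) t1"
proof -
  have "S \<noteq> {}" using z by auto
  then obtain h0 r where hr: "(h0, r) \<in> S" by fastforce
  define d where "d = - h0"
  have d: "d > 0" "(- d, r) \<in> S" using neg[OF hr] hr by (auto simp: d_def)
  \<comment> \<open>The slope demanded of the upper edge: after subtraction of the slope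
    \<open>r / d\<close> of the lower edge at least \<open>K\<close> remains.\<close>
  define M where "M = \<bar>K\<bar> + \<bar>r / d\<bar> + 1"
  have M: "M > 0" unfolding M_def using abs_ge_zero[of K] abs_ge_zero[of "r / d"] by linarith
  have "((\<lambda>u. ((cs u - cs u0) / (u - u0)) / ((ct u - ct u0) / (u - u0))) \<longlongrightarrow> 0 / v) (at u0)"
    using cs ct unfolding has_field_derivative_iff by (intro tendsto_divide)
  moreover have "eventually (\<lambda>u. ((cs u - cs u0) / (u - u0)) / ((ct u - ct u0) / (u - u0)) = cs u / ct u) (at u0)"
    unfolding eventually_at by (intro exI[of _ 1]) (auto simp: cs ct)
  ultimately have "((\<lambda>u. cs u / ct u) \<longlongrightarrow> 0) (at u0)" by (auto intro: Lim_transform_eventually)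
  from tendstoD[OF this, of "1 / (2 * M)"] M
  have "eventually (\<lambda>u. \<bar>cs u / ct u\<bar> < 1 / (2 * M)) (at u0)" by (simp add: dist_real_def)
  from small_values_both_signs(1)[OF ct eventually_conj[OF ev this], of 1]
  obtain u where u: "(cs u, ct u) \<in> closure S" "\<bar>cs u / ct u\<bar> < 1 / (2 * M)" "0 < ct u" by auto
  define A where "A = ct u / 2"
  have A: "A > 0" using u by (simp add: A_def)
  have csA: "M * \<bar>cs u\<bar> \<le> A"
  proof -
    have "\<bar>cs u\<bar> / ct u < 1 / (2 * M)" using u(2,3) by (simp add: abs_divide)
    then show ?thesis using u(3) M by (simp add: A_def field_simps)
  qed
  define Bd where "Bd = \<bar>r - M * d\<bar>"
  \<comment> \<open>A step of relative size \<open>s\<close> from the closure point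
    \<open>(cs u, ct u)\<close> towards \<open>(- d, r)\<close> enters \<open>S\<close>. The slope
    there is still at least \<open>M\<close>: the curve point was chosen with twice that slope,
    hence \<open>1 / (2 * M)\<close> and \<open>A = ct u / 2\<close>, and the step costs less than
    \<open>A / 2\<close>.\<close>
  define s where "s = A / (2 * (A + Bd + 1))"
  have Bd: "Bd \<ge> 0" by (simp add: Bd_def)
  have s: "0 < s" "s \<le> 1 / 2" "s * Bd < A / 2"
    using A Bd by (auto simp: s_def field_simps add_pos_pos)
  have p: "((1 - (1 - s)) * (- d) + (1 - s) * cs u, (1 - (1 - s)) * r + (1 - s) * ct u) \<in> S"
    using s by (intro mem_combine_closure[OF d(2) u(1)]) auto
  define d' where "d' = s * d - (1 - s) * cs u"
  define r' where "r' = s * r + (1 - s) * ct u"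
  have p': "(- d', r') \<in> S" using p by (simp add: d'_def r'_def algebra_simps)
  have d': "d' > 0" using neg[OF p'] by simp
  have "d' \<le> s * d + (1 - s) * \<bar>cs u\<bar>"
    using mult_left_mono[OF abs_ge_minus_self[of "cs u"], of "1 - s"] s by (simp add: d'_def)
  then have "M * d' \<le> M * (s * d + (1 - s) * \<bar>cs u\<bar>)" using M by (intro mult_left_mono) auto
  also have "\<dots> = s * (M * d) + (1 - s) * (M * \<bar>cs u\<bar>)" by (simp add: algebra_simps)
  also have "\<dots> \<le> s * (M * d) + (1 - s) * A" using csA s by (intro add_left_mono mult_left_mono) auto
  also have "\<dots> \<le> r'"
  proof -
    have "s * (M * d - r) \<le> s * Bd" using s by (intro mult_left_mono) (auto simp: Bd_def)
    also have "\<dots> \<le> 1 / 2 * A" using s by simp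
    also have "\<dots> \<le> (1 - s) * A" using s A by (intro mult_right_mono) auto
    finally have "s * (M * d - r) \<le> (1 - s) * A" .
    moreover have "ct u = 2 * A" by (simp add: A_def)
    ultimately show ?thesis by (simp add: r'_def algebra_simps)
  qed
  finally have Md: "M \<le> r' / d'" using d' by (simp add: pos_le_divide_eq)
  define R1 where "R1 = \<bar>r / d\<bar> + 1"
  have R1: "R1 > 0" "- R1 \<le> r / d" unfolding R1_def using abs_ge_minus_self[of "r / d"] by linarith+
  define e where "e = min (min (d / 2) (d' / 2)) (- t1 / R1)"
  have "0 < - t1 / R1" using t1 R1 by (intro divide_pos_pos) auto
  then have e: "e > 0" using d d' by (simp add: e_def)
  show thesis
  proof (rule that[OF e])
    fix h assume h: "0 < h" "h \<le> e"
    have hd: "h < d" "h < d'" using h d d' by (auto simp: e_def)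
    have m: "(- h, h * (r / d)) \<in> S" "(- h, h * (r' / d')) \<in> S"
      using wedge_mem[OF z d(2) h(1) hd(1)] wedge_mem[OF z p' h(1) hd(2)] by auto
    have "h \<le> - t1 / R1" using h(2) by (simp add: e_def)
    then have "h * R1 \<le> - t1" by (rule pos_le_divide_eq[THEN iffD1, OF R1(1)])
    moreover have "h * (- R1) \<le> h * (r / d)" by (rule mult_left_mono[OF R1(2)]) (use h in simp)
    ultimately have "t1 \<le> h * (r / d)" by simp
    from ray_meas_ge[OF m this] have "h * (r' / d' - r / d) \<le> ray_meas S (- h) t1"
      by (simp add: right_diff_distrib)
    moreover have "h * K \<le> h * (r' / d' - r / d)"
    proof (rule mult_left_mono)
      show "K \<le> r' / d' - r / d"
        using Md abs_ge_self[of K] abs_ge_self[of "r / d"] unfolding M_def by linarith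
    qed (use h in simp)
    ultimately show "K * h \<le> ray_meas S (- h) t1" by (simp add: mult.commute)
  qed
qed

lemma second_diff_ray_meas_smooth:
  assumes p0: "(0, p0) \<in> S"
    and T: "((\<lambda>h. second_diff (chord_top S) h / h) \<longlongrightarrow> 0) (at_right 0)"
    and B: "((\<lambda>h. second_diff (chord_bot S) h / h) \<longlongrightarrow> 0) (at_right 0)"
  shows "AE t in lborel. ((\<lambda>h. second_diff (\<lambda>h. ray_meas S h t) h / h) \<longlongrightarrow> 0) (at_right 0)"
proof -
  have ae: "AE t in lborel. t \<noteq> chord_top S 0 \<and> t \<noteq> chord_bot S 0"
    using AE_lborel_singleton[of "chord_top S 0"] AE_lborel_singleton[of "chord_bot S 0"] by eventually_elim simp
  show ?thesis using ae
  proof eventually_elim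
    fix t assume t: "t \<noteq> chord_top S 0 \<and> t \<noteq> chord_bot S 0"
    have lt: "chord_bot S 0 < chord_top S 0" using less_chord_top[OF p0] chord_bot_less[OF p0] by simp
    consider "t < chord_bot S 0" | "chord_bot S 0 < t" "t < chord_top S 0" | "chord_top S 0 < t"
      using t by linarith
    then show "((\<lambda>h. second_diff (\<lambda>h. ray_meas S h t) h / h) \<longlongrightarrow> 0) (at_right 0)"
    proof cases
      case 1
      have "((\<lambda>h. (second_diff (chord_top S) h - second_diff (chord_bot S) h) / h) \<longlongrightarrow> 0) (at_right 0)"
        using tendsto_diff[OF T B] by (simp add: diff_divide_distrib)
      then show ?thesis
        by (rule Lim_transform_eventually) (rule eventually_mono[OF second_diff_ray_meas(1)[OF p0 1]], simp)
    next
      case 2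
      show ?thesis
        by (rule Lim_transform_eventually[OF T]) (rule eventually_mono[OF second_diff_ray_meas(2)[OF p0 2]], simp)
    next
      case 3
      show ?thesis
        by (rule Lim_transform_eventually[OF tendsto_const])
           (rule eventually_mono[OF second_diff_ray_meas(3)[OF p0 3]], simp)
    qed
  qed
qed

lemma second_diff_ray_meas_missing:
  assumes "\<And>t. (0, t) \<notin> closure S"
  shows "((\<lambda>h. second_diff (\<lambda>h. ray_meas S h t) h / h) \<longlongrightarrow> 0) (at_right 0)"
proof -
  obtain e where e: "e > 0" "\<And>h t. \<bar>h\<bar> \<le> e \<Longrightarrow> (h, t) \<notin> closure S"
    by (rule missing_nbhd[OF assms]) (rule that)
  have z: "ray_meas S h t = 0" if "\<bar>h\<bar> \<le> e" for h
    by (rule ray_meas_empty) (use e(2)[OF that] closure_subset in blast)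
  have "eventually (\<lambda>h. 0 = second_diff (\<lambda>h. ray_meas S h t) h / h) (at_right 0)"
    unfolding eventually_at_right_field
    by (intro exI[of _ e]) (use e(1) z in \<open>auto simp: second_diff_def\<close>)
  then show ?thesis by (rule Lim_transform_eventually[OF tendsto_const])
qed

text \<open>The chord ends in the corner, at position 0, and every earlier position sees this end
  move: exactly if it lies inside the chord, and up to the \<open>o(h)\<close> of the smooth lower
  end if it lies before it. Hence \<open>w\<close> is the second difference of the upper
  end.\<close>

lemma ray_meas_kink_top:
  assumes p0: "(0, p0) \<in> S" and T0: "chord_top S 0 = 0"
    and B: "((\<lambda>h. second_diff (chord_bot S) h / h) \<longlongrightarrow> 0) (at_right 0)"
    and 1: "\<And>s t. (s, t) \<in> S \<Longrightarrow> t \<le> m1 * s" and 2: "\<And>s t. (s, t) \<in> S \<Longrightarrow> t \<le> m2 * s"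
    and ne: "m1 \<noteq> m2"
  obtains w k K e where "k > 0" "K \<ge> 0" "e > 0" "\<And>h. 0 < h \<Longrightarrow> h \<le> e \<Longrightarrow> w h \<le> - (k * h)"
    "\<And>h. \<bar>h\<bar> \<le> e \<Longrightarrow> \<bar>w h\<bar> \<le> K * \<bar>h\<bar>"
    "AE t in lborel. ((\<lambda>h. (second_diff (\<lambda>h. ray_meas S h t) h - w h * indicator {..<0} t) / h) \<longlongrightarrow> 0) (at_right 0)"
proof -
  obtain K e where T: "K \<ge> 0" "e > 0" "\<And>h. \<bar>h\<bar> \<le> e \<Longrightarrow> (h, p0) \<in> S"
    "\<And>h. \<bar>h\<bar> \<le> e \<Longrightarrow> \<bar>chord_top S h - chord_top S 0\<bar> \<le> K * \<bar>h\<bar>"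
    by (rule chord_top_lipschitz[OF p0]) (rule that)
  have ae: "AE t in lborel. t \<noteq> chord_top S 0 \<and> t \<noteq> chord_bot S 0"
    using AE_lborel_singleton[of "chord_top S 0"] AE_lborel_singleton[of "chord_bot S 0"] by eventually_elim simp
  have lt: "chord_bot S 0 < chord_top S 0" using less_chord_top[OF p0] chord_bot_less[OF p0] by simp
  show thesis
  proof (rule that[of "\<bar>m1 - m2\<bar>" "2 * K" e "second_diff (chord_top S)"])
    show "second_diff (chord_top S) h \<le> - (\<bar>m1 - m2\<bar> * h)" if "0 < h" "h \<le> e" for h
      by (rule second_diff_top_kink[OF T(3) T(3)]) (use that T0 1 2 in auto)
    show "\<bar>second_diff (chord_top S) h\<bar> \<le> 2 * K * \<bar>h\<bar>" if "\<bar>h\<bar> \<le> e" for h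
      using T(4)[of h] T(4)[of "- h"] that by (simp add: second_diff_def)
    show "AE t in lborel. ((\<lambda>h. (second_diff (\<lambda>h. ray_meas S h t) h - second_diff (chord_top S) h * indicator {..<0} t) / h) \<longlongrightarrow> 0) (at_right 0)"
      using ae
    proof eventually_elim
      fix t assume t: "t \<noteq> chord_top S 0 \<and> t \<noteq> chord_bot S 0"
      consider "t < chord_bot S 0" | "chord_bot S 0 < t" "t < chord_top S 0" | "chord_top S 0 < t"
        using t by linarith
      then show "((\<lambda>h. (second_diff (\<lambda>h. ray_meas S h t) h - second_diff (chord_top S) h * indicator {..<0} t) / h) \<longlongrightarrow> 0) (at_right 0)"
      proof cases
        case 1
        have i: "indicator {..<0} t = (1 :: real)" using 1 lt T0 by (simp add: indicator_def)
        have "((\<lambda>h. - (second_diff (chord_bot S) h / h)) \<longlongrightarrow> 0) (at_right 0)"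
          using tendsto_minus[OF B] by simp
        then show ?thesis
          by (rule Lim_transform_eventually) (rule eventually_mono[OF second_diff_ray_meas(1)[OF p0 1]], simp add: i)
      next
        case 2
        have i: "indicator {..<0} t = (1 :: real)" using 2 T0 by (simp add: indicator_def)
        show ?thesis
          by (rule Lim_transform_eventually[OF tendsto_const])
             (rule eventually_mono[OF second_diff_ray_meas(2)[OF p0 2]], simp add: i)
      next
        case 3
        have i: "indicator {..<0} t = (0 :: real)" using 3 T0 by (simp add: indicator_def)
        show ?thesis
          by (rule Lim_transform_eventually[OF tendsto_const])
             (rule eventually_mono[OF second_diff_ray_meas(3)[OF p0 3]], simp add: i)
      qed
    qed
  qed (use T ne in auto)
qed

text \<open>The chord begins in the corner, so positions inside it do not see this end and the
  cutoff is again at 0. The lower end is convex and enters the length with a minus sign, which gives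
  \<open>w\<close> the same sign as at an upper end.\<close>

lemma ray_meas_kink_bot:
  assumes p0: "(0, p0) \<in> S" and B0: "chord_bot S 0 = 0"
    and T: "((\<lambda>h. second_diff (chord_top S) h / h) \<longlongrightarrow> 0) (at_right 0)"
    and 1: "\<And>s t. (s, t) \<in> S \<Longrightarrow> m1 * s \<le> t" and 2: "\<And>s t. (s, t) \<in> S \<Longrightarrow> m2 * s \<le> t"
    and ne: "m1 \<noteq> m2"
  obtains w k K e where "k > 0" "K \<ge> 0" "e > 0" "\<And>h. 0 < h \<Longrightarrow> h \<le> e \<Longrightarrow> w h \<le> - (k * h)"
    "\<And>h. \<bar>h\<bar> \<le> e \<Longrightarrow> \<bar>w h\<bar> \<le> K * \<bar>h\<bar>"
    "AE t in lborel. ((\<lambda>h. (second_diff (\<lambda>h. ray_meas S h t) h - w h * indicator {..<0} t) / h) \<longlongrightarrow> 0) (at_right 0)"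
proof -
  interpret F: convex_body "flip S" by (rule flip_body)
  obtain K e where Bt: "K \<ge> 0" "e > 0" "\<And>h. \<bar>h\<bar> \<le> e \<Longrightarrow> (h, p0) \<in> S"
    "\<And>h. \<bar>h\<bar> \<le> e \<Longrightarrow> \<bar>chord_bot S h - chord_bot S 0\<bar> \<le> K * \<bar>h\<bar>"
    by (rule chord_bot_lipschitz[OF p0]) (rule that)
  have fT0: "chord_top (flip S) 0 = 0" using B0 by (simp add: chord_bot_flip)
  have ae: "AE t in lborel. t \<noteq> chord_top S 0 \<and> t \<noteq> chord_bot S 0"
    using AE_lborel_singleton[of "chord_top S 0"] AE_lborel_singleton[of "chord_bot S 0"] by eventually_elim simp
  show thesis
  proof (rule that[of "\<bar>(- m1) - (- m2)\<bar>" "2 * K" e "\<lambda>h. - second_diff (chord_bot S) h"])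
    show "- second_diff (chord_bot S) h \<le> - (\<bar>(- m1) - (- m2)\<bar> * h)" if "0 < h" "h \<le> e" for h
      unfolding second_diff_bot minus_minus
    proof (rule F.second_diff_top_kink)
      show "(h, - p0) \<in> flip S" "(- h, - p0) \<in> flip S" using Bt(3)[of h] Bt(3)[of "- h"] that by (auto simp: flip_def)
      show "t - chord_top (flip S) 0 \<le> - m1 * s" if "(s, t) \<in> flip S" for s t
        using 1[of s "- t"] that fT0 by (simp add: flip_def)
      show "t - chord_top (flip S) 0 \<le> - m2 * s" if "(s, t) \<in> flip S" for s t
        using 2[of s "- t"] that fT0 by (simp add: flip_def)
    qed (rule that(1))
    show "\<bar>- second_diff (chord_bot S) h\<bar> \<le> 2 * K * \<bar>h\<bar>" if "\<bar>h\<bar> \<le> e" for h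
      using Bt(4)[of h] Bt(4)[of "- h"] that by (simp add: second_diff_def)
    show "AE t in lborel. ((\<lambda>h. (second_diff (\<lambda>h. ray_meas S h t) h - - second_diff (chord_bot S) h * indicator {..<0} t) / h) \<longlongrightarrow> 0) (at_right 0)"
      using ae
    proof eventually_elim
      fix t assume t: "t \<noteq> chord_top S 0 \<and> t \<noteq> chord_bot S 0"
      consider "t < chord_bot S 0" | "chord_bot S 0 < t" "t < chord_top S 0" | "chord_top S 0 < t"
        using t by linarith
      then show "((\<lambda>h. (second_diff (\<lambda>h. ray_meas S h t) h - - second_diff (chord_bot S) h * indicator {..<0} t) / h) \<longlongrightarrow> 0) (at_right 0)"
      proof cases
        case 1
        have i: "indicator {..<0} t = (1 :: real)" using 1 B0 by (simp add: indicator_def)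
        show ?thesis
          by (rule Lim_transform_eventually[OF T]) (rule eventually_mono[OF second_diff_ray_meas(1)[OF p0 1]], simp add: i)
      next
        case 2
        have i: "indicator {..<0} t = (0 :: real)" using 2 B0 by (simp add: indicator_def)
        show ?thesis
          by (rule Lim_transform_eventually[OF T])
             (rule eventually_mono[OF second_diff_ray_meas(2)[OF p0 2]], simp add: i)
      next
        case 3
        have "chord_bot S 0 < t" using 3 less_chord_top[OF p0] chord_bot_less[OF p0] by simp
        then have i: "indicator {..<0} t = (0 :: real)" using B0 by (simp add: indicator_def)
        show ?thesis
          by (rule Lim_transform_eventually[OF tendsto_const])
             (rule eventually_mono[OF second_diff_ray_meas(3)[OF p0 3]], simp add: i)
      qed
    qed
  qed (use Bt ne in auto)
qed

end

text \<open>From \<open>1 + x \<le> exp x\<close> at \<open>x = (b - a) * r\<close>. The bound is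
  linear in \<open>r\<close>, with one constant for all \<open>r \<le> M\<close>.\<close>

lemma exp_diff_ge:
  fixes a b r M :: real
  assumes "a \<le> b" "0 \<le> r" "r \<le> M"
  shows "exp (- (\<bar>b\<bar> * M)) * ((b - a) * r) \<le> exp (- (a * r)) - exp (- (b * r))"
proof -
  have "exp (- (\<bar>b\<bar> * M)) \<le> exp (- (b * r))"
  proof -
    have "b * r \<le> \<bar>b\<bar> * M" using assms by (intro mult_mono) auto
    then show ?thesis by simp
  qed
  moreover have "0 \<le> (b - a) * r" using assms by simp
  ultimately have "exp (- (\<bar>b\<bar> * M)) * ((b - a) * r) \<le> exp (- (b * r)) * ((b - a) * r)"
    by (rule mult_right_mono)
  also have "\<dots> \<le> exp (- (b * r)) * (exp ((b - a) * r) - 1)"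
  proof (rule mult_left_mono)
    show "(b - a) * r \<le> exp ((b - a) * r) - 1" using exp_ge_add_one_self[of "(b - a) * r"] by linarith
  qed simp
  also have "\<dots> = exp (- (a * r)) - exp (- (b * r))"
    by (simp add: right_diff_distrib left_diff_distrib flip: exp_add)
  finally show ?thesis .
qed

text \<open>The integrand has a constant sign, so that the difference cannot be lost by cancellation.\<close>

lemma attenuation_difference_ge:
  fixes f :: "plane \<Rightarrow> real" and q r :: "real \<Rightarrow> real \<Rightarrow> real"
  assumes f: "C1_compact_support f" "\<And>x. f x \<ge> 0" and \<theta>: "norm \<theta> = 1"
    and q: "\<And>h. q h \<in> borel_measurable borel" "\<And>h t. \<bar>q h t\<bar> \<le> Q"
    and r: "\<And>h. r h \<in> borel_measurable borel" "\<And>h t. 0 \<le> r h t" "\<And>h t. r h t \<le> M"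
      "\<And>h s t. s \<le> t \<Longrightarrow> r h t \<le> r h s"
    and pos: "f (x - \<tau> *\<^sub>R \<theta>) > 0" "\<tau> > 0" and ab: "a \<noteq> b" and \<epsilon>0: "\<epsilon>0 > 0"
  obtains \<kappa> \<tau>1 e where "\<kappa> > 0" "\<tau>1 > 0" "\<tau> - \<epsilon>0 < \<tau>1" "e > 0" "\<And>h. \<bar>h\<bar> \<le> e \<Longrightarrow>
    \<kappa> * r h (- \<tau>1) \<le> \<bar>(LINT t|lborel. f (x + h *\<^sub>R n + t *\<^sub>R \<theta>) * exp (- (q h t + a * r h t)))
       - (LINT t|lborel. f (x + h *\<^sub>R n + t *\<^sub>R \<theta>) * exp (- (q h t + b * r h t)))\<bar>"
proof -
  define \<eta> where "\<eta> = f (x - \<tau> *\<^sub>R \<theta>) / 2"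
  have \<eta>: "\<eta> > 0" using pos by (simp add: \<eta>_def)
  have "isCont f (x - \<tau> *\<^sub>R \<theta>)"
    using C1_compact_support_continuous[OF f(1), of UNIV] by (simp add: continuous_on_eq_continuous_at)
  from this[unfolded continuous_at_eps_delta, rule_format, OF \<eta>]
  obtain d where d: "d > 0" "\<And>y. dist y (x - \<tau> *\<^sub>R \<theta>) < d \<Longrightarrow> \<bar>f y - f (x - \<tau> *\<^sub>R \<theta>)\<bar> < \<eta>"
    by (auto simp: dist_real_def)
  \<comment> \<open>Half-width of a window around position \<open>- \<tau>\<close>: small enough for
    \<open>f\<close> to stay above \<open>\<eta>\<close> on nearby lines, for the window to end
    before 0, and for \<open>\<tau>1 = \<tau> - \<epsilon>\<close> to exceed
    \<open>\<tau> - \<epsilon>0\<close>.\<close>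
  define \<epsilon> where "\<epsilon> = min (min (d / 4) (\<tau> / 2)) (\<epsilon>0 / 2)"
  have \<epsilon>: "\<epsilon> > 0" "\<epsilon> \<le> d / 4" "\<epsilon> \<le> \<tau> / 2" and "\<epsilon> \<le> \<epsilon>0 / 2" using d pos \<epsilon>0 by (auto simp: \<epsilon>_def)
  then have \<tau>\<epsilon>: "\<tau> - \<epsilon>0 < \<tau> - \<epsilon>" using \<epsilon>0 by simp
  define e where "e = d / (4 * (norm n + 1))"
  have e: "e > 0" unfolding e_def using d(1) by (intro divide_pos_pos) (auto intro: add_nonneg_pos)
  have big: "\<eta> \<le> f (x + h *\<^sub>R n + t *\<^sub>R \<theta>)" if h: "\<bar>h\<bar> \<le> e" and t: "t \<in> {- \<tau> - \<epsilon>..- \<tau> + \<epsilon>}" for h t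
  proof -
    have "x + h *\<^sub>R n + t *\<^sub>R \<theta> - (x - \<tau> *\<^sub>R \<theta>) = h *\<^sub>R n + (t + \<tau>) *\<^sub>R \<theta>" by (simp add: algebra_simps)
    then have "dist (x + h *\<^sub>R n + t *\<^sub>R \<theta>) (x - \<tau> *\<^sub>R \<theta>) \<le> \<bar>h\<bar> * norm n + \<bar>t + \<tau>\<bar>"
      unfolding dist_norm using norm_triangle_ineq[of "h *\<^sub>R n" "(t + \<tau>) *\<^sub>R \<theta>"] \<theta> by simp
    also have "\<bar>h\<bar> * norm n \<le> e * (norm n + 1)" using h by (intro mult_mono) auto
    also have "e * (norm n + 1) = d / 4"
      using norm_ge_zero[of n] by (simp add: e_def field_simps add_nonneg_eq_0_iff)
    also have "\<bar>t + \<tau>\<bar> \<le> \<epsilon>" using t by (auto simp: abs_le_iff)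
    also have "\<epsilon> \<le> d / 4" by (rule \<epsilon>(2))
    finally have "dist (x + h *\<^sub>R n + t *\<^sub>R \<theta>) (x - \<tau> *\<^sub>R \<theta>) < d" using d(1) by simp
    from d(2)[OF this] show ?thesis by (simp add: \<eta>_def abs_if split: if_splits)
  qed
  have Mn: "M \<ge> 0" using r(2,3)[of 0 0] by simp
  \<comment> \<open>For \<open>a < b\<close> the integrand of the difference is non-negative
    everywhere and is kept only on the window, where \<open>r h t\<close> is at least its value at
    the right end, \<open>r h\<close> being decreasing.\<close>
  have main: "\<exists>\<kappa>>0. \<forall>h. \<bar>h\<bar> \<le> e \<longrightarrow> \<kappa> * r h (- (\<tau> - \<epsilon>)) \<le>
      (LINT t|lborel. f (x + h *\<^sub>R n + t *\<^sub>R \<theta>) * exp (- (q h t + a * r h t)))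
       - (LINT t|lborel. f (x + h *\<^sub>R n + t *\<^sub>R \<theta>) * exp (- (q h t + b * r h t)))" if ab: "a < b" for a b
  proof (intro exI conjI allI impI)
    let ?k = "\<eta> * (exp (- Q) * (exp (- (\<bar>b\<bar> * M)) * (b - a)))"
    show "0 < 2 * \<epsilon> * ?k" using \<eta> \<epsilon> ab by simp
    fix h assume h: "\<bar>h\<bar> \<le> e"
    have intg: "integrable lborel (\<lambda>t. f (x + h *\<^sub>R n + t *\<^sub>R \<theta>) * exp (- (q h t + c * r h t)))" for c
    proof (rule integrable_radon[OF f(1) \<theta>])
      show "(\<lambda>t. q h t + c * r h t) \<in> borel_measurable borel" using q(1)[of h] r(1)[of h] by measurable
      show "\<bar>q h t + c * r h t\<bar> \<le> Q + \<bar>c\<bar> * M" for t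
        using q(2)[of h t] mult_left_mono[OF r(3)[of h t], of "\<bar>c\<bar>"] r(2)[of h t]
        by (intro order_trans[OF abs_triangle_ineq] add_mono) (auto simp: abs_mult)
    qed
    let ?D = "\<lambda>t. f (x + h *\<^sub>R n + t *\<^sub>R \<theta>) * exp (- (q h t + a * r h t)) - f (x + h *\<^sub>R n + t *\<^sub>R \<theta>) * exp (- (q h t + b * r h t))"
    have Dt: "?D t = f (x + h *\<^sub>R n + t *\<^sub>R \<theta>) * (exp (- q h t) * (exp (- (a * r h t)) - exp (- (b * r h t))))" for t
      by (simp add: right_diff_distrib flip: exp_add)
    have pw: "(?k * r h (- (\<tau> - \<epsilon>))) * indicator {- \<tau> - \<epsilon>..- \<tau> + \<epsilon>} t \<le> ?D t" for t
    proof (cases "t \<in> {- \<tau> - \<epsilon>..- \<tau> + \<epsilon>}")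
      case True
      have "\<eta> * (exp (- Q) * (exp (- (\<bar>b\<bar> * M)) * ((b - a) * r h t))) \<le> ?D t"
        unfolding Dt
      proof (intro mult_mono)
        show "exp (- Q) \<le> exp (- q h t)" using q(2)[of h t] by simp
        show "exp (- (\<bar>b\<bar> * M)) * ((b - a) * r h t) \<le> exp (- (a * r h t)) - exp (- (b * r h t))"
          using ab r by (intro exp_diff_ge) auto
        show "0 \<le> exp (- Q) * (exp (- (\<bar>b\<bar> * M)) * ((b - a) * r h t))" using ab r(2) by simp
      qed (use big[OF h True] f(2) \<eta> ab r(2) in auto)
      moreover have "r h (- (\<tau> - \<epsilon>)) \<le> r h t" using True by (intro r(4)) auto
      then have "?k * r h (- (\<tau> - \<epsilon>)) \<le> ?k * r h t" using \<eta> ab by (intro mult_left_mono) auto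
      ultimately show ?thesis using True by (simp add: mult_ac)
    next
      case False
      have "exp (- (b * r h t)) \<le> exp (- (a * r h t))" using ab r(2)[of h t] by (simp add: mult_right_mono)
      then have "0 \<le> ?D t" unfolding Dt using f(2) by simp
      then show ?thesis using False by simp
    qed
    have "2 * \<epsilon> * ?k * r h (- (\<tau> - \<epsilon>)) = (LINT t|lborel. (?k * r h (- (\<tau> - \<epsilon>))) * indicator {- \<tau> - \<epsilon>..- \<tau> + \<epsilon>} t)"
      using \<epsilon>(1) by simp
    also have "\<dots> \<le> integral\<^sup>L lborel ?D"
      by (intro integral_mono integrable_const_indicator_Icc Bochner_Integration.integrable_diff intg pw)
    also have "\<dots> = (LINT t|lborel. f (x + h *\<^sub>R n + t *\<^sub>R \<theta>) * exp (- (q h t + a * r h t)))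
       - (LINT t|lborel. f (x + h *\<^sub>R n + t *\<^sub>R \<theta>) * exp (- (q h t + b * r h t)))"
      by (rule Bochner_Integration.integral_diff) (rule intg)+
    finally show "2 * \<epsilon> * ?k * r h (- (\<tau> - \<epsilon>)) \<le> (LINT t|lborel. f (x + h *\<^sub>R n + t *\<^sub>R \<theta>) * exp (- (q h t + a * r h t)))
       - (LINT t|lborel. f (x + h *\<^sub>R n + t *\<^sub>R \<theta>) * exp (- (q h t + b * r h t)))" .
  qed
  have \<tau>: "\<tau> - \<epsilon> > 0" using \<epsilon> pos by simp
  consider "a < b" | "b < a" using ab by linarith
  then show thesis
  proof cases
    case 1
    from main[OF 1] obtain \<kappa> where k: "\<kappa> > 0" "\<And>h. \<bar>h\<bar> \<le> e \<Longrightarrow> \<kappa> * r h (- (\<tau> - \<epsilon>)) \<le>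
      (LINT t|lborel. f (x + h *\<^sub>R n + t *\<^sub>R \<theta>) * exp (- (q h t + a * r h t)))
       - (LINT t|lborel. f (x + h *\<^sub>R n + t *\<^sub>R \<theta>) * exp (- (q h t + b * r h t)))" by blast
    show thesis by (rule that[OF k(1) \<tau> \<tau>\<epsilon> e]) (rule order_trans[OF k(2) abs_ge_self])
  next
    case 2
    from main[OF 2] obtain \<kappa> where k: "\<kappa> > 0" "\<And>h. \<bar>h\<bar> \<le> e \<Longrightarrow> \<kappa> * r h (- (\<tau> - \<epsilon>)) \<le>
      (LINT t|lborel. f (x + h *\<^sub>R n + t *\<^sub>R \<theta>) * exp (- (q h t + b * r h t)))
       - (LINT t|lborel. f (x + h *\<^sub>R n + t *\<^sub>R \<theta>) * exp (- (q h t + a * r h t)))" by blast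
    show thesis by (rule that[OF k(1) \<tau> \<tau>\<epsilon> e]) (subst abs_minus_commute, rule order_trans[OF k(2) abs_ge_self])
  qed
qed

lemma eventually_at_right_le: "0 < e \<Longrightarrow> eventually (\<lambda>h. 0 < h \<and> h \<le> e) (at_right (0 :: real))"
  unfolding eventually_at_right_field by (intro exI[of _ e]) auto

text \<open>Equal functions have equal second differences, so \<open>(a - b) * w h / h\<close> tends
  to 0, whereas \<open>w h / h\<close> stays below \<open>- k\<close>.\<close>

lemma second_diff_coefficients_eq:
  fixes a b :: real
  assumes w: "k > 0" "e > 0" "\<And>h. 0 < h \<Longrightarrow> h \<le> e \<Longrightarrow> w h \<le> - (k * h)"
    and F: "((\<lambda>h. (second_diff F h + a * w h) / h) \<longlongrightarrow> 0) (at_right 0)"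
    and G: "((\<lambda>h. (second_diff G h + b * w h) / h) \<longlongrightarrow> 0) (at_right 0)"
    and eq: "\<And>h. \<bar>h\<bar> \<le> e \<Longrightarrow> F h = G h"
  shows "a = b"
proof -
  have lim: "((\<lambda>h. \<bar>(second_diff F h + a * w h) / h - (second_diff G h + b * w h) / h\<bar>) \<longlongrightarrow> \<bar>0 - 0\<bar>) (at_right 0)"
    by (intro tendsto_intros F G)
  have low: "\<bar>a - b\<bar> * k \<le> \<bar>(second_diff F h + a * w h) / h - (second_diff G h + b * w h) / h\<bar>" if h: "0 < h \<and> h \<le> e" for h
  proof -
    have sd: "second_diff F h = second_diff G h"
      using eq[of h] eq[of "- h"] eq[of 0] h unfolding second_diff_def by simp
    have "w h / h \<le> - k" using w(3)[of h] h by (simp add: pos_divide_le_eq)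
    then have "k \<le> \<bar>w h / h\<bar>" by linarith
    then have "\<bar>a - b\<bar> * k \<le> \<bar>(a - b) * (w h / h)\<bar>"
      unfolding abs_mult[of "a - b"] by (intro mult_left_mono) auto
    also have "(a - b) * (w h / h) = (second_diff F h + a * w h) / h - (second_diff G h + b * w h) / h"
      unfolding sd by (simp add: diff_divide_distrib[symmetric]) (simp add: algebra_simps)
    finally show ?thesis .
  qed
  have "\<bar>a - b\<bar> * k \<le> \<bar>0 - 0\<bar>"
    by (rule tendsto_lowerbound[OF lim eventually_mono[OF eventually_at_right_le[OF w(2)] low]]) simp_all
  then show ?thesis using w(1) by (simp add: mult_le_0_iff)
qed

lemma sum_second_diff:
  fixes i :: real
  shows "(\<Sum>j\<in>J. c j * ((a j + b j - 2 * z j - w j * i) / h)) =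
    ((\<Sum>j\<in>J. c j * a j) + (\<Sum>j\<in>J. c j * b j) - 2 * (\<Sum>j\<in>J. c j * z j) - (\<Sum>j\<in>J. c j * w j) * i) / h"
proof (induction J rule: infinite_finite_induct)
  case (insert x F)
  then show ?case by (simp add: algebra_simps add_divide_distrib diff_divide_distrib)
qed simp_all

text \<open>This is what the second difference estimates ask of a smooth boundary point: a
  differentiable curve through it, with non-zero velocity, that stays in the closure nearby.\<close>

definition arc_point :: "plane set \<Rightarrow> plane \<Rightarrow> bool" where
  "arc_point A z \<longleftrightarrow> (\<exists>\<gamma> t v. \<gamma> t = z \<and> (\<gamma> has_vector_derivative v) (at t) \<and> v \<noteq> 0 \<and>
     eventually (\<lambda>u. \<gamma> u \<in> closure A) (at t))"

text \<open>A frontier point with a smooth parameter in \<open>{0..<1}\<close> is an arc point by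
  its own boundary curve, and one period contains only finitely many corner parameters.\<close>

lemma finite_non_arc_points:
  assumes "smooth_boundary_with_corners A"
  shows "finite {z \<in> frontier A. \<not> arc_point A z}"
proof -
  obtain \<Gamma> where \<Gamma>: "finite \<Gamma>" "\<And>\<gamma>. \<gamma> \<in> \<Gamma> \<Longrightarrow> closed_curve_with_corners \<gamma>" "frontier A = (\<Union>\<gamma>\<in>\<Gamma>. range \<gamma>)"
    using assms unfolding smooth_boundary_with_corners_def boundary_curves_def by auto
  have "{z \<in> frontier A. \<not> arc_point A z} \<subseteq> (\<Union>\<gamma>\<in>\<Gamma>. \<gamma> ` {t \<in> {0..<1}. corner_at \<gamma> t})"
  proof
    fix z assume z: "z \<in> {z \<in> frontier A. \<not> arc_point A z}"
    then obtain \<gamma> u where g: "\<gamma> \<in> \<Gamma>" "z = \<gamma> u" using \<Gamma>(3) by blast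
    have cc: "\<And>t. \<gamma> (t + 1) = \<gamma> t" "\<And>t. smooth_regular_at \<gamma> t \<or> corner_at \<gamma> t"
      using \<Gamma>(2)[OF g(1)] unfolding closed_curve_with_corners_def by auto
    obtain t where t: "0 \<le> t" "t < 1" "\<gamma> t = \<gamma> u"
      by (rule periodic_unit_representative[where \<gamma> = \<gamma> and t = u, OF cc(1)]) (rule that)
    have "corner_at \<gamma> t"
    proof (rule ccontr)
      assume "\<not> corner_at \<gamma> t"
      then have s: "smooth_regular_at \<gamma> t" using cc(2) by blast
      have "\<gamma> v \<in> closure A" for v using g(1) \<Gamma>(3) by (auto simp: frontier_def)
      then have "eventually (\<lambda>v. \<gamma> v \<in> closure A) (at t)" by simp
      then have "arc_point A z"
        unfolding arc_point_def
        by (intro exI[of _ \<gamma>] exI[of _ t] exI[of _ "velocity \<gamma> t"] conjI smooth_regular_derivatives[OF s])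
           (simp add: t(3) g(2))
      then show False using z by simp
    qed
    then have "t \<in> {t \<in> {0..<1}. corner_at \<gamma> t}" using t by simp
    then have "\<gamma> t \<in> \<gamma> ` {t \<in> {0..<1}. corner_at \<gamma> t}" by (rule imageI)
    then have "\<gamma> t \<in> (\<Union>\<gamma>\<in>\<Gamma>. \<gamma> ` {t \<in> {0..<1}. corner_at \<gamma> t})" by (rule UN_I[OF g(1)])
    then show "z \<in> (\<Union>\<gamma>\<in>\<Gamma>. \<gamma> ` {t \<in> {0..<1}. corner_at \<gamma> t})" using t(3) g(2) by simp
  qed
  moreover have "finite (\<Union>\<gamma>\<in>\<Gamma>. \<gamma> ` {t \<in> {0..<1}. corner_at \<gamma> t})"
    using \<Gamma> by (auto simp: closed_curve_with_corners_def)
  ultimately show ?thesis by (rule finite_subset)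
qed

lemma supporting_normal_exists:
  fixes A :: "'a :: euclidean_space set"
  assumes "convex A" "z \<notin> A"
  obtains n where "n \<noteq> 0" "\<And>y. y \<in> closure A \<Longrightarrow> y \<bullet> n \<le> z \<bullet> n"
proof (cases "A = {}")
  case True
  then show thesis using that[of "SOME b. b \<in> Basis"] nonzero_Basis some_in_eq[of Basis] nonempty_Basis by auto
next
  case False
  obtain a b where ab: "a \<noteq> 0" "a \<bullet> z \<le> b" "\<forall>x\<in>A. a \<bullet> x \<ge> b"
    using separating_hyperplane_sets[of "{z}" A] assms False by auto
  have "A \<subseteq> {y. (- a) \<bullet> y \<le> - b}" using ab(3) by auto
  then have "closure A \<subseteq> {y. (- a) \<bullet> y \<le> - b}" by (rule closure_minimal) (rule closed_halfspace_le)
  then have "y \<bullet> (- a) \<le> z \<bullet> (- a)" if "y \<in> closure A" for y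
    using that ab(2) by (auto simp: inner_commute)
  then show thesis using that[of "- a"] ab(1) by simp
qed

text \<open>If the arc were tangent to the line, a supporting normal at the endpoint would be
  orthogonal to the line, which then could not enter the open set \<open>C\<close>, as it does at
  \<open>p0\<close>.\<close>

lemma chord_endpoint_transversal:
  assumes C: "convex C" "open C" and fr: "norm n = 1" "norm \<theta> = 1" "n \<bullet> \<theta> = 0"
    and cross: "p + p0 *\<^sub>R \<theta> \<in> C" and z: "p + t0 *\<^sub>R \<theta> \<notin> C" "arc_point C (p + t0 *\<^sub>R \<theta>)"
  obtains cs ct vs vt u0 where "(cs has_real_derivative vs) (at u0)" "vs \<noteq> (0 :: real)" "cs u0 = (0 :: real)"
    "(ct has_real_derivative vt) (at u0)" "ct u0 = t0"
    "eventually (\<lambda>u. (cs u, ct u) \<in> closure (slice C p n \<theta>)) (at u0)"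
proof -
  obtain \<gamma> u0 v where g: "\<gamma> u0 = p + t0 *\<^sub>R \<theta>" "(\<gamma> has_vector_derivative v) (at u0)" "v \<noteq> 0"
    "eventually (\<lambda>u. \<gamma> u \<in> closure C) (at u0)"
    using z(2) unfolding arc_point_def by blast
  have d: "((\<lambda>u. (\<gamma> u - p) \<bullet> a) has_real_derivative v \<bullet> a) (at u0)" for a
    using bounded_linear.has_vector_derivative[OF bounded_linear_inner_left[of a] has_vector_derivative_diff_const[THEN iffD2, OF g(2), of p]]
    by (simp add: has_real_derivative_iff_has_vector_derivative)
  have vn: "v \<bullet> n \<noteq> 0"
  proof
    assume vn: "v \<bullet> n = 0"
    have ve: "v = (v \<bullet> \<theta>) *\<^sub>R \<theta>" using frame_expand[OF fr, of v] vn by simp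
    obtain \<nu> where \<nu>: "\<nu> \<noteq> 0" "\<And>y. y \<in> closure C \<Longrightarrow> y \<bullet> \<nu> \<le> (p + t0 *\<^sub>R \<theta>) \<bullet> \<nu>"
      by (rule supporting_normal_exists[OF C(1) z(1)]) (rule that)
    have "v \<bullet> \<nu> = 0" by (rule velocity_orthogonal_to_normal[OF g(2,4)]) (simp add: g(1) \<nu>(2))
    then have "(v \<bullet> \<theta>) * (\<theta> \<bullet> \<nu>) = 0" by (subst (asm) ve) simp
    moreover have "v \<bullet> \<theta> \<noteq> 0" using ve g(3) by auto
    ultimately have "\<theta> \<bullet> \<nu> = 0" by simp
    then have "(p + p0 *\<^sub>R \<theta>) \<bullet> \<nu> = (p + t0 *\<^sub>R \<theta>) \<bullet> \<nu>" by (simp add: inner_add_left)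
    moreover have "(p + p0 *\<^sub>R \<theta>) \<bullet> \<nu> < (p + t0 *\<^sub>R \<theta>) \<bullet> \<nu>"
      by (rule open_less_supporting_value[OF C(2) \<nu>(1) _ cross]) (use \<nu>(2) closure_subset in blast)
    ultimately show False by simp
  qed
  show thesis
  proof (rule that[OF d[of n] vn _ d[of \<theta>]])
    show "(\<gamma> u0 - p) \<bullet> n = 0" "(\<gamma> u0 - p) \<bullet> \<theta> = t0"
      using fr frame_inner[OF fr] by (simp_all add: g(1))
    show "eventually (\<lambda>u. ((\<gamma> u - p) \<bullet> n, (\<gamma> u - p) \<bullet> \<theta>) \<in> closure (slice C p n \<theta>)) (at u0)"
      using g(4) by (rule eventually_mono) (simp add: mem_closure_slice[OF fr] frame_coords[OF fr])
  qed
qed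

context
  fixes C :: "plane set" and n \<theta> :: plane
  assumes C: "convex C" "open C" "bounded C" and fr: "norm n = 1" "norm \<theta> = 1" "n \<bullet> \<theta> = 0"
begin

lemma chord_top_frontier:
  assumes "p + p0 *\<^sub>R \<theta> \<in> C"
  shows "p + chord_top (slice C p n \<theta>) 0 *\<^sub>R \<theta> \<in> frontier C"
proof -
  interpret convex_body "slice C p n \<theta>" by (rule slice_body[OF fr C])
  have m: "(0, p0) \<in> slice C p n \<theta>" using assms by (simp add: mem_slice)
  have "(0, chord_top (slice C p n \<theta>) 0) \<notin> slice C p n \<theta>" using less_chord_top by blast
  then show ?thesis using chord_top_in_closure[OF m] C(2)
    by (simp add: mem_closure_slice[OF fr] mem_slice frontier_def interior_open)
qed

lemma chord_bot_frontier:
  assumes "p + p0 *\<^sub>R \<theta> \<in> C"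
  shows "p + chord_bot (slice C p n \<theta>) 0 *\<^sub>R \<theta> \<in> frontier C"
proof -
  interpret convex_body "slice C p n \<theta>" by (rule slice_body[OF fr C])
  have m: "(0, p0) \<in> slice C p n \<theta>" using assms by (simp add: mem_slice)
  have "(0, chord_bot (slice C p n \<theta>) 0) \<notin> slice C p n \<theta>" using chord_bot_less by blast
  then show ?thesis using chord_bot_in_closure[OF m] C(2)
    by (simp add: mem_closure_slice[OF fr] mem_slice frontier_def interior_open)
qed

lemma second_diff_chord_top_arc:
  assumes cross: "p + p0 *\<^sub>R \<theta> \<in> C" and arc: "arc_point C (p + chord_top (slice C p n \<theta>) 0 *\<^sub>R \<theta>)"
  shows "((\<lambda>h. second_diff (chord_top (slice C p n \<theta>)) h / h) \<longlongrightarrow> 0) (at_right 0)"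
proof -
  interpret convex_body "slice C p n \<theta>" by (rule slice_body[OF fr C])
  have m: "(0, p0) \<in> slice C p n \<theta>" using cross by (simp add: mem_slice)
  have nz: "p + chord_top (slice C p n \<theta>) 0 *\<^sub>R \<theta> \<notin> C"
    using chord_top_frontier[OF cross] C(2) by (simp add: frontier_def interior_open)
  show ?thesis
    by (rule chord_endpoint_transversal[OF C(1,2) fr cross nz arc]) (rule second_diff_top_smooth[OF m])
qed

lemma second_diff_chord_bot_arc:
  assumes cross: "p + p0 *\<^sub>R \<theta> \<in> C" and arc: "arc_point C (p + chord_bot (slice C p n \<theta>) 0 *\<^sub>R \<theta>)"
  shows "((\<lambda>h. second_diff (chord_bot (slice C p n \<theta>)) h / h) \<longlongrightarrow> 0) (at_right 0)"
proof -
  interpret convex_body "slice C p n \<theta>" by (rule slice_body[OF fr C])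
  have m: "(0, p0) \<in> slice C p n \<theta>" using cross by (simp add: mem_slice)
  have nz: "p + chord_bot (slice C p n \<theta>) 0 *\<^sub>R \<theta> \<notin> C"
    using chord_bot_frontier[OF cross] C(2) by (simp add: frontier_def interior_open)
  show ?thesis
    by (rule chord_endpoint_transversal[OF C(1,2) fr cross nz arc]) (rule second_diff_bot_smooth[OF m])
qed

lemma second_diff_ray_meas_arc:
  assumes reg: "(\<exists>t. p + t *\<^sub>R \<theta> \<in> C) \<or> (\<forall>t. p + t *\<^sub>R \<theta> \<notin> closure C)"
    and arc: "\<And>t. p + t *\<^sub>R \<theta> \<in> frontier C \<Longrightarrow> arc_point C (p + t *\<^sub>R \<theta>)"
  shows "AE t in lborel. ((\<lambda>h. second_diff (\<lambda>h. ray_meas (slice C p n \<theta>) h t) h / h) \<longlongrightarrow> 0) (at_right 0)"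
  using reg
proof
  interpret convex_body "slice C p n \<theta>" by (rule slice_body[OF fr C])
  assume "\<exists>t. p + t *\<^sub>R \<theta> \<in> C"
  then obtain p0 where p0: "p + p0 *\<^sub>R \<theta> \<in> C" by blast
  then have m: "(0, p0) \<in> slice C p n \<theta>" by (simp add: mem_slice)
  show ?thesis
    by (rule second_diff_ray_meas_smooth[OF m second_diff_chord_top_arc[OF p0 arc[OF chord_top_frontier[OF p0]]]
          second_diff_chord_bot_arc[OF p0 arc[OF chord_bot_frontier[OF p0]]]])
next
  interpret convex_body "slice C p n \<theta>" by (rule slice_body[OF fr C])
  assume "\<forall>t. p + t *\<^sub>R \<theta> \<notin> closure C"
  then have "\<And>t. (0, t) \<notin> closure (slice C p n \<theta>)" by (simp add: mem_closure_slice[OF fr])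
  then show ?thesis by (intro AE_I2 second_diff_ray_meas_missing)
qed

text \<open>
  Two independent supporting lines at \<open>x\<close> form a roof over the end of the chord, whence the upper bound
  \<open>- (k * h)\<close> for its second difference. The other end is smooth and contributes only \<open>o(h)\<close>.
\<close>

lemma ray_meas_kink:
  assumes cross: "x + p0 *\<^sub>R \<theta> \<in> C" and x: "x \<in> frontier C"
    and n1: "\<And>y. y \<in> C \<Longrightarrow> y \<bullet> n1 \<le> x \<bullet> n1" and n2: "\<And>y. y \<in> C \<Longrightarrow> y \<bullet> n2 \<le> x \<bullet> n2"
    and indep: "n1 $ 1 * n2 $ 2 \<noteq> n1 $ 2 * n2 $ 1"
    and arc: "\<And>t. t \<noteq> 0 \<Longrightarrow> x + t *\<^sub>R \<theta> \<in> frontier C \<Longrightarrow> arc_point C (x + t *\<^sub>R \<theta>)"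
  obtains w k K e where "k > 0" "K \<ge> 0" "e > 0" "\<And>h. 0 < h \<Longrightarrow> h \<le> e \<Longrightarrow> w h \<le> - (k * h)"
    "\<And>h. \<bar>h\<bar> \<le> e \<Longrightarrow> \<bar>w h\<bar> \<le> K * \<bar>h\<bar>"
    "AE t in lborel. ((\<lambda>h. (second_diff (\<lambda>h. ray_meas (slice C x n \<theta>) h t) h - w h * indicator {..<0} t) / h) \<longlongrightarrow> 0) (at_right 0)"
proof -
  let ?S = "slice C x n \<theta>"
  interpret convex_body ?S by (rule slice_body[OF fr C])
  have m: "(0, p0) \<in> ?S" using cross by (simp add: mem_slice)
  have x': "x \<in> closure C" "x \<notin> C" using x C(2) by (auto simp: frontier_def interior_open)
  have z: "(0, 0) \<in> closure ?S" "(0, 0) \<notin> ?S" using x' by (simp_all add: mem_closure_slice[OF fr] mem_slice)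
  have nn: "n1 \<noteq> 0" "n2 \<noteq> 0" using indep by auto
  have str: "(h * (n \<bullet> \<nu>) + t * (\<theta> \<bullet> \<nu>)) < 0"
    if "(h, t) \<in> ?S" "\<nu> \<noteq> 0" "\<And>y. y \<in> C \<Longrightarrow> y \<bullet> \<nu> \<le> x \<bullet> \<nu>" for h t \<nu>
  proof -
    have "(x + h *\<^sub>R n + t *\<^sub>R \<theta>) \<bullet> \<nu> < x \<bullet> \<nu>"
      by (rule open_less_supporting_value[OF C(2) that(2,3)]) (use that(1) in \<open>auto simp: mem_slice\<close>)
    then show ?thesis by (simp add: inner_add_left)
  qed
  let ?a1 = "n \<bullet> n1" and ?a2 = "n \<bullet> n2" and ?b1 = "\<theta> \<bullet> n1" and ?b2 = "\<theta> \<bullet> n2"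
  have b: "p0 * ?b1 < 0" "p0 * ?b2 < 0" using str[OF m nn(1) n1] str[OF m nn(2) n2] by simp_all
  have det: "?a1 * ?b2 \<noteq> ?a2 * ?b1"
  proof
    assume eq: "?a1 * ?b2 = ?a2 * ?b1"
    have e1: "n1 $ i = ?a1 * n $ i + ?b1 * \<theta> $ i" for i
      using arg_cong[OF frame_expand[OF fr, of n1], of "\<lambda>v. v $ i"] by (simp add: inner_commute)
    have e2: "n2 $ i = ?a2 * n $ i + ?b2 * \<theta> $ i" for i
      using arg_cong[OF frame_expand[OF fr, of n2], of "\<lambda>v. v $ i"] by (simp add: inner_commute)
    have "n1 $ 1 * n2 $ 2 - n1 $ 2 * n2 $ 1 = (?a1 * ?b2 - ?a2 * ?b1) * (n $ 1 * \<theta> $ 2 - n $ 2 * \<theta> $ 1)"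
      unfolding e1[of 1] e1[of 2] e2[of 1] e2[of 2] by (simp add: algebra_simps)
    then show False using eq indep by simp
  qed
  \<comment> \<open>Slopes of the two supporting lines in the coordinates of the slice. The
    denominators do not vanish because the line enters \<open>C\<close> at
    \<open>p0\<close>.\<close>
  define m1 where "m1 = - ?a1 / ?b1"
  define m2 where "m2 = - ?a2 / ?b2"
  have bnz: "?b1 \<noteq> 0" "?b2 \<noteq> 0" using b by auto
  have ne: "m1 \<noteq> m2" using det bnz by (simp add: m1_def m2_def frac_eq_eq)
  have T: "0 \<le> chord_top ?S 0" "chord_bot ?S 0 \<le> 0"
    using closure_le_chord_top[OF z(1) m] closure_ge_chord_bot[OF z(1) m] by auto
  have "0 \<notin> {chord_bot ?S 0<..<chord_top ?S 0}" using z(2) chord_eq[OF m] by blast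
  then consider "chord_top ?S 0 = 0" | "chord_bot ?S 0 = 0" using T by force
  then show thesis
  proof cases
    case 1
    have "p0 < 0" using less_chord_top[OF m] 1 by simp
    then have b0: "?b1 > 0" "?b2 > 0" using b by (auto simp: mult_less_0_iff)
    have "chord_bot ?S 0 \<noteq> 0" using chord_bot_less[OF m] \<open>p0 < 0\<close> by simp
    then have B: "((\<lambda>h. second_diff (chord_bot ?S) h / h) \<longlongrightarrow> 0) (at_right 0)"
      by (intro second_diff_chord_bot_arc[OF cross] arc chord_bot_frontier[OF cross])
    show thesis
    proof (rule ray_meas_kink_top[OF m 1 B _ _ ne])
      show "t \<le> m1 * s" if "(s, t) \<in> ?S" for s t
        using str[OF that nn(1) n1] b0 unfolding m1_def by (simp add: field_simps)
      show "t \<le> m2 * s" if "(s, t) \<in> ?S" for s t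
        using str[OF that nn(2) n2] b0 unfolding m2_def by (simp add: field_simps)
    qed (rule that)
  next
    case 2
    have "p0 > 0" using chord_bot_less[OF m] 2 by simp
    then have b0: "?b1 < 0" "?b2 < 0" using b by (auto simp: mult_less_0_iff)
    have "chord_top ?S 0 \<noteq> 0" using less_chord_top[OF m] \<open>p0 > 0\<close> by simp
    then have B: "((\<lambda>h. second_diff (chord_top ?S) h / h) \<longlongrightarrow> 0) (at_right 0)"
      by (intro second_diff_chord_top_arc[OF cross] arc chord_top_frontier[OF cross])
    show thesis
    proof (rule ray_meas_kink_bot[OF m 2 B _ _ ne])
      show "m1 * s \<le> t" if "(s, t) \<in> ?S" for s t
        using str[OF that nn(1) n1] b0 unfolding m1_def by (simp add: field_simps)
      show "m2 * s \<le> t" if "(s, t) \<in> ?S" for s t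
        using str[OF that nn(2) n2] b0 unfolding m2_def by (simp add: field_simps)
    qed (rule that)
  qed
qed

lemma one_sided:
  assumes miss: "\<And>t. p + t *\<^sub>R \<theta> \<notin> C"
  shows "(\<forall>y\<in>C. (y - p) \<bullet> n < 0) \<or> (\<forall>y\<in>C. (y - p) \<bullet> n > 0)"
proof -
  define P where "P = (\<lambda>y. y \<bullet> n) ` C"
  have "convex P" unfolding P_def
    by (rule convex_linear_image[OF _ C(1)]) (simp add: linear_iff inner_add_left)
  then have int: "is_interval P" by (simp add: is_interval_convex_1)
  have s: "p \<bullet> n \<notin> P"
  proof
    assume "p \<bullet> n \<in> P"
    then obtain y where y: "y \<in> C" "y \<bullet> n = p \<bullet> n" unfolding P_def by auto
    have "p + ((y - p) \<bullet> \<theta>) *\<^sub>R \<theta> = y" using frame_coords[OF fr, of p y] y(2) by (simp add: inner_diff_left)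
    then show False using miss y(1) by metis
  qed
  have "(\<forall>y\<in>P. y < p \<bullet> n) \<or> (\<forall>y\<in>P. p \<bullet> n < y)"
  proof (rule ccontr)
    assume "\<not> ?thesis"
    then obtain y z where "y \<in> P" "z \<in> P" "p \<bullet> n \<le> y" "z \<le> p \<bullet> n" by (auto simp: not_less)
    then show False using s mem_is_interval_1_I[OF int] by blast
  qed
  then show ?thesis unfolding P_def by (auto simp: inner_diff_left)
qed

end

section \<open>Lines through several layers\<close>

context nested_layers begin

lemma sublayers: "k \<le> N \<Longrightarrow> nested_layers k c C"
  using c_nz convex_C bounded_C open_C ne_C smooth_C nested by unfold_locales auto

text \<open>Depths add over the layers, so their parts \<open>w j\<close> of order \<open>h\<close>
  add with the weights \<open>c j\<close>. All kinks sit at the base point \<open>p\<close>, which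
  is why one indicator of \<open>{..<0}\<close> serves every layer.\<close>

lemma layered_second_diff:
  assumes fr: "norm n = 1" "norm \<theta> = 1" "n \<bullet> \<theta> = 0" and f: "C1_compact_support f"
    and reg: "regular_line N C p \<theta>"
    and sd: "\<And>j. j \<in> {1..N} \<Longrightarrow> AE t in lborel.
       ((\<lambda>h. (second_diff (\<lambda>h. ray_meas (slice (C j) p n \<theta>) h t) h - w j h * indicator {..<0} t) / h) \<longlongrightarrow> 0) (at_right 0)"
    and w: "e0 > 0" "\<And>j h. j \<in> {1..N} \<Longrightarrow> \<bar>h\<bar> \<le> e0 \<Longrightarrow> \<bar>w j h\<bar> \<le> Kw j * \<bar>h\<bar>"
  shows "((\<lambda>h. (second_diff (\<lambda>h. layered_radon N c C f (p + h *\<^sub>R n) \<theta>) h + (\<Sum>j\<in>{1..N}. c j * w j h) *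
        (LINT t|lborel. indicator {..<0} t * (f (p + t *\<^sub>R \<theta>) * exp (- optical_depth N c C p \<theta> t)))) / h) \<longlongrightarrow> 0) (at_right 0)"
proof -
  obtain K e where K: "K \<ge> 0" "e > 0"
    "\<And>h t. \<bar>h\<bar> \<le> e \<Longrightarrow> \<bar>optical_depth N c C (p + h *\<^sub>R n) \<theta> t - optical_depth N c C (p + 0 *\<^sub>R n) \<theta> t\<bar> \<le> K * \<bar>h\<bar>"
    by (rule optical_depth_lipschitz[OF fr reg]) (rule that)
  obtain Q where Q: "\<And>h t. \<bar>optical_depth N c C (p + h *\<^sub>R n) \<theta> t\<bar> \<le> Q" by (rule optical_depth_bounded[OF fr]) (rule that)
  define W where "W h = (\<Sum>j\<in>{1..N}. c j * w j h)" for h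
  \<comment> \<open>\<open>radon_second_diff\<close> takes one constant for both the increments of
    the depth and the weight \<open>W\<close>.\<close>
  define K' where "K' = K + (\<Sum>j\<in>{1..N}. \<bar>c j\<bar> * \<bar>Kw j\<bar>)"
  define e' where "e' = min e e0"
  have e': "e' > 0" using K w(1) by (simp add: e'_def)
  have K': "K' \<ge> 0" unfolding K'_def using K(1) by (intro add_nonneg_nonneg sum_nonneg) auto
  have KK: "K \<le> K'" unfolding K'_def by (simp add: sum_nonneg)
  have Wb: "\<bar>W h\<bar> \<le> K' * \<bar>h\<bar>" if h: "\<bar>h\<bar> \<le> e'" for h
  proof -
    have "\<bar>W h\<bar> \<le> (\<Sum>j\<in>{1..N}. \<bar>c j * w j h\<bar>)" unfolding W_def by (rule sum_abs)
    also have "\<dots> \<le> (\<Sum>j\<in>{1..N}. \<bar>c j\<bar> * \<bar>Kw j\<bar> * \<bar>h\<bar>)"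
    proof (rule sum_mono)
      fix j assume j: "j \<in> {1..N}"
      have "\<bar>w j h\<bar> \<le> Kw j * \<bar>h\<bar>" using w(2)[OF j, of h] h by (simp add: e'_def)
      also have "\<dots> \<le> \<bar>Kw j\<bar> * \<bar>h\<bar>" by (rule mult_right_mono) auto
      finally show "\<bar>c j * w j h\<bar> \<le> \<bar>c j\<bar> * \<bar>Kw j\<bar> * \<bar>h\<bar>"
        by (simp add: abs_mult mult.assoc mult_left_mono)
    qed
    also have "\<dots> \<le> K' * \<bar>h\<bar>" unfolding K'_def using K(1) by (simp add: sum_distrib_right[symmetric] mult_right_mono)
    finally show ?thesis .
  qed
  have lim: "AE t in lborel. ((\<lambda>h. (second_diff (\<lambda>h. optical_depth N c C (p + h *\<^sub>R n) \<theta> t) h - W h * indicator {..<0} t) / h) \<longlongrightarrow> 0) (at_right 0)"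
  proof -
    have "AE t in lborel. \<forall>j\<in>{1..N}. ((\<lambda>h. (second_diff (\<lambda>h. ray_meas (slice (C j) p n \<theta>) h t) h - w j h * indicator {..<0} t) / h) \<longlongrightarrow> 0) (at_right 0)"
      by (rule AE_finite_allI) (use sd in auto)
    then show ?thesis
    proof eventually_elim
      fix t assume *: "\<forall>j\<in>{1..N}. ((\<lambda>h. (second_diff (\<lambda>h. ray_meas (slice (C j) p n \<theta>) h t) h - w j h * indicator {..<0} t) / h) \<longlongrightarrow> 0) (at_right 0)"
      have "((\<lambda>h. \<Sum>j\<in>{1..N}. c j * ((second_diff (\<lambda>h. ray_meas (slice (C j) p n \<theta>) h t) h - w j h * indicator {..<0} t) / h)) \<longlongrightarrow> (\<Sum>j\<in>{1..N}. c j * 0)) (at_right 0)"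
        by (intro tendsto_sum tendsto_mult_left) (use * in auto)
      moreover have "(\<Sum>j\<in>{1..N}. c j * ((second_diff (\<lambda>h. ray_meas (slice (C j) p n \<theta>) h t) h - w j h * indicator {..<0} t) / h))
          = (second_diff (\<lambda>h. optical_depth N c C (p + h *\<^sub>R n) \<theta> t) h - W h * indicator {..<0} t) / h" for h
        unfolding second_diff_def W_def optical_depth_slice by (rule sum_second_diff)
      ultimately show "((\<lambda>h. (second_diff (\<lambda>h. optical_depth N c C (p + h *\<^sub>R n) \<theta> t) h - W h * indicator {..<0} t) / h) \<longlongrightarrow> 0) (at_right 0)"
        by simp
    qed
  qed
  have lip: "\<bar>optical_depth N c C (p + h *\<^sub>R n) \<theta> t - optical_depth N c C (p + 0 *\<^sub>R n) \<theta> t\<bar> \<le> K' * \<bar>h\<bar>" if "\<bar>h\<bar> \<le> e'" for h t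
    using K(3)[of h t] that mult_right_mono[OF KK, of "\<bar>h\<bar>"] by (simp add: e'_def)
  show ?thesis
  proof (rule tendsto_at_right_sequentially[OF e'])
    fix X :: "nat \<Rightarrow> real" assume X0: "\<And>k. 0 < X k" "\<And>k. X k < e'" "X \<longlonglongrightarrow> 0"
    have X: "\<And>k. 0 < X k" "\<And>k. X k \<le> e'" "X \<longlonglongrightarrow> 0" using X0 less_imp_le by auto
    have "(\<lambda>k. (second_diff (\<lambda>h. LINT t|lborel. f (p + h *\<^sub>R n + t *\<^sub>R \<theta>) * exp (- optical_depth N c C (p + h *\<^sub>R n) \<theta> t)) (X k)
            + W (X k) * (LINT t|lborel. indicator {..<0} t * (f (p + 0 *\<^sub>R n + t *\<^sub>R \<theta>) * exp (- optical_depth N c C (p + 0 *\<^sub>R n) \<theta> t)))) / X k) \<longlonglongrightarrow> 0"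
    proof (rule radon_second_diff[where p = p and n = n and q = "\<lambda>h. optical_depth N c C (p + h *\<^sub>R n) \<theta>" and Q = Q and K = K' and e = e' and w = W and ?t0.0 = 0])
      show "optical_depth N c C (p + h *\<^sub>R n) \<theta> \<in> borel_measurable borel" for h
        by (rule optical_depth_measurable[OF fr])
    qed (rule f fr Q K' e' lip Wb lim X; assumption?)+
    then show "(\<lambda>k. (second_diff (\<lambda>h. layered_radon N c C f (p + h *\<^sub>R n) \<theta>) (X k) + (\<Sum>j\<in>{1..N}. c j * w j (X k)) *
        (LINT t|lborel. indicator {..<0} t * (f (p + t *\<^sub>R \<theta>) * exp (- optical_depth N c C p \<theta> t)))) / X k) \<longlonglongrightarrow> 0"
      by (simp add: layered_radon_def W_def)
  qed
qed

lemma layered_second_diff_smooth: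
  assumes fr: "norm n = 1" "norm \<theta> = 1" "n \<bullet> \<theta> = 0" and f: "C1_compact_support f"
    and reg: "regular_line N C p \<theta>"
    and arc: "\<And>j t. j \<in> {1..N} \<Longrightarrow> p + t *\<^sub>R \<theta> \<in> frontier (C j) \<Longrightarrow> arc_point (C j) (p + t *\<^sub>R \<theta>)"
  shows "((\<lambda>h. second_diff (\<lambda>h. layered_radon N c C f (p + h *\<^sub>R n) \<theta>) h / h) \<longlongrightarrow> 0) (at_right 0)"
proof -
  have sd: "AE t in lborel. ((\<lambda>h. (second_diff (\<lambda>h. ray_meas (slice (C j) p n \<theta>) h t) h - 0 * indicator {..<0} t) / h) \<longlongrightarrow> 0) (at_right 0)"
    if j: "j \<in> {1..N}" for j
  proof -
  have "(\<exists>t. p + t *\<^sub>R \<theta> \<in> C j) \<or> (\<forall>t. p + t *\<^sub>R \<theta> \<notin> closure (C j))"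
    using reg j unfolding regular_line_def by blast
  from second_diff_ray_meas_arc[OF convex_C[OF j] open_C[OF j] bounded_C[OF j] fr this arc[OF j]]
    show ?thesis by simp
  qed
  show ?thesis
    using layered_second_diff[OF fr f reg, of "\<lambda>_ _. 0" 1 "\<lambda>_. 0", OF sd] by simp
qed

lemma regular_line_nbhd:
  assumes fr: "norm n = 1" "norm \<theta> = 1" "n \<bullet> \<theta> = 0" and reg: "regular_line N C p \<theta>"
  obtains e where "e > 0" "\<And>h. \<bar>h\<bar> \<le> e \<Longrightarrow> regular_line N C (p + h *\<^sub>R n) \<theta>"
proof -
  have "\<exists>e>0. \<forall>h. \<bar>h\<bar> \<le> e \<longrightarrow> (\<exists>t. p + h *\<^sub>R n + t *\<^sub>R \<theta> \<in> C j) \<or> (\<forall>t. p + h *\<^sub>R n + t *\<^sub>R \<theta> \<notin> closure (C j))"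
    if j: "j \<in> {1..N}" for j
  proof -
    interpret convex_body "slice (C j) p n \<theta>" by (rule slice_layer[OF fr j])
    consider t where "p + t *\<^sub>R \<theta> \<in> C j" | "\<forall>t. p + t *\<^sub>R \<theta> \<notin> closure (C j)"
      using reg j unfolding regular_line_def by blast
    then show ?thesis
    proof cases
      case 1
      then have "(0, t) \<in> slice (C j) p n \<theta>" by (simp add: mem_slice)
      then obtain e where "e > 0" "\<And>h. \<bar>h\<bar> \<le> e \<Longrightarrow> (h, t) \<in> slice (C j) p n \<theta>"
        by (rule crossing_nbhd) (rule that)
      then show ?thesis unfolding mem_slice by blast
    next
      case 2
      then have m: "\<And>t. (0, t) \<notin> closure (slice (C j) p n \<theta>)" by (simp add: mem_closure_slice[OF fr])
      obtain e where "e > 0" "\<And>h t. \<bar>h\<bar> \<le> e \<Longrightarrow> (h, t) \<notin> closure (slice (C j) p n \<theta>)"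
        by (rule missing_nbhd[OF m]) (rule that)
      then show ?thesis unfolding mem_closure_slice[OF fr] by blast
    qed
  qed
  then obtain E where E: "\<And>j. j \<in> {1..N} \<Longrightarrow> E j > 0" "\<And>j h. j \<in> {1..N} \<Longrightarrow> \<bar>h\<bar> \<le> E j \<Longrightarrow>
     (\<exists>t. p + h *\<^sub>R n + t *\<^sub>R \<theta> \<in> C j) \<or> (\<forall>t. p + h *\<^sub>R n + t *\<^sub>R \<theta> \<notin> closure (C j))" by metis
  define e where "e = Min (insert 1 (E ` {1..N}))"
  have "e > 0" unfolding e_def using E(1) by (subst Min_gr_iff) auto
  moreover have "e \<le> E j" if "j \<in> {1..N}" for j unfolding e_def by (rule Min_le) (use that in auto)
  then have "regular_line N C (p + h *\<^sub>R n) \<theta>" if "\<bar>h\<bar> \<le> e" for h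
    unfolding regular_line_def using E(2) that by (meson order_trans)
  ultimately show thesis by (rule that)
qed

text \<open>Parallel lines close to the given one miss the inner layers too, so their terms vanish.
  Nothing is assumed about the position of the line relative to \<open>C m\<close>, to which it may
  be tangent.\<close>

lemma optical_depth_split:
  assumes fr: "norm n = 1" "norm \<theta> = 1" "n \<bullet> \<theta> = 0" and m: "m \<in> {1..N}"
    and miss: "\<And>i t. i \<in> {m<..N} \<Longrightarrow> p + t *\<^sub>R \<theta> \<notin> closure (C i)"
  obtains e where "e > 0" "\<And>h t. \<bar>h\<bar> \<le> e \<Longrightarrow> optical_depth N c C (p + h *\<^sub>R n) \<theta> t =
     optical_depth (m - 1) c C (p + h *\<^sub>R n) \<theta> t + c m * ray_meas (slice (C m) p n \<theta>) h t"
proof -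
  have "\<exists>e>0. \<forall>h t. \<bar>h\<bar> \<le> e \<longrightarrow> ray_meas (slice (C j) p n \<theta>) h t = 0" if j: "j \<in> {m<..N}" for j
  proof -
    have "j \<in> {1..N}" using j by auto
    then interpret convex_body "slice (C j) p n \<theta>" by (rule slice_layer[OF fr])
    have m: "\<And>t. (0, t) \<notin> closure (slice (C j) p n \<theta>)" using miss[OF j] by (simp add: mem_closure_slice[OF fr])
    obtain e where e: "e > 0" "\<And>h t. \<bar>h\<bar> \<le> e \<Longrightarrow> (h, t) \<notin> closure (slice (C j) p n \<theta>)"
      by (rule missing_nbhd[OF m]) (rule that)
    have "ray_meas (slice (C j) p n \<theta>) h t = 0" if "\<bar>h\<bar> \<le> e" for h t
      by (rule ray_meas_empty) (use e(2)[OF that] closure_subset in blast)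
    then show ?thesis using e(1) by blast
  qed
  then obtain E where E: "\<And>j. j \<in> {m<..N} \<Longrightarrow> E j > 0"
    "\<And>j h t. j \<in> {m<..N} \<Longrightarrow> \<bar>h\<bar> \<le> E j \<Longrightarrow> ray_meas (slice (C j) p n \<theta>) h t = 0" by metis
  define e where "e = Min (insert 1 (E ` {m<..N}))"
  have e: "e > 0" unfolding e_def using E(1) by (subst Min_gr_iff) auto
  have le: "e \<le> E j" if "j \<in> {m<..N}" for j unfolding e_def by (rule Min_le) (use that in auto)
  show thesis
  proof (rule that[OF e])
    fix h t :: real assume h: "\<bar>h\<bar> \<le> e"
    let ?g = "\<lambda>j. c j * ray_meas (slice (C j) p n \<theta>) h t"
    have "{1..N} = {1..m - 1} \<union> ({m} \<union> {m<..N})" using m by auto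
    moreover have "sum ?g ({1..m - 1} \<union> ({m} \<union> {m<..N})) = sum ?g {1..m - 1} + sum ?g ({m} \<union> {m<..N})"
      using m by (intro sum.union_disjoint) auto
    moreover have "sum ?g ({m} \<union> {m<..N}) = sum ?g {m} + sum ?g {m<..N}"
      by (intro sum.union_disjoint) auto
    moreover have "sum ?g {m<..N} = 0"
    proof (rule sum.neutral, intro ballI)
      fix j assume j: "j \<in> {m<..N}"
      show "?g j = 0" using E(2)[OF j, of h t] le[OF j] h by simp
    qed
    ultimately have "sum ?g {1..N} = sum ?g {1..m - 1} + ?g m" by simp
    then show "optical_depth N c C (p + h *\<^sub>R n) \<theta> t =
     optical_depth (m - 1) c C (p + h *\<^sub>R n) \<theta> t + c m * ray_meas (slice (C m) p n \<theta>) h t"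
      unfolding optical_depth_def measure_ray_eq_ray_meas .
  qed
qed

end

text \<open>The points \<open>y\<close> whose line through \<open>x\<close> meets \<open>A\<close>
  form an open set. Either the current neighbourhood avoids it, or the neighbourhood is shrunk to
  the intersection; this is repeated for each of the finitely many sets.\<close>

lemma finite_generic_open:
  fixes x :: plane
  assumes "finite \<A>" "\<forall>A\<in>\<A>. open A" "open U" "U \<noteq> {}"
  shows "\<exists>U'. open U' \<and> U' \<noteq> {} \<and> U' \<subseteq> U \<and>
    (\<forall>A\<in>\<A>. (\<forall>y\<in>U'. \<exists>t. x + t *\<^sub>R (y - x) \<in> A) \<or> (\<forall>y\<in>U'. \<forall>t. x + t *\<^sub>R (y - x) \<notin> A))"
  using assms
proof (induction \<A> rule: finite_induct)
  case empty
  then show ?case by blast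
next
  case (insert A \<A>)
  then obtain U' where U': "open U'" "U' \<noteq> {}" "U' \<subseteq> U"
    "\<forall>A\<in>\<A>. (\<forall>y\<in>U'. \<exists>t. x + t *\<^sub>R (y - x) \<in> A) \<or> (\<forall>y\<in>U'. \<forall>t. x + t *\<^sub>R (y - x) \<notin> A)" by auto
  let ?M = "\<Union>t. (\<lambda>y. x + t *\<^sub>R (y - x)) -` A"
  have "open ?M"
  proof (rule open_UN, rule ballI)
    fix t show "open ((\<lambda>y. x + t *\<^sub>R (y - x)) -` A)"
      using insert.prems(1) by (intro open_vimage continuous_intros) simp
  qed
  show ?case
  proof (cases "U' \<inter> ?M = {}")
    case True
    then have no: "\<forall>y\<in>U'. \<forall>t. x + t *\<^sub>R (y - x) \<notin> A" by auto
    show ?thesis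
    proof (intro exI[of _ U'] conjI ballI U'(1-3))
      fix A' assume A': "A' \<in> insert A \<A>"
      show "(\<forall>y\<in>U'. \<exists>t. x + t *\<^sub>R (y - x) \<in> A') \<or> (\<forall>y\<in>U'. \<forall>t. x + t *\<^sub>R (y - x) \<notin> A')"
      proof (cases "A' = A")
        case False
        then show ?thesis using A' U'(4) by simp
      qed (use no in simp)
    qed
  next
    case False
    have meet: "\<forall>y\<in>U' \<inter> ?M. \<exists>t. x + t *\<^sub>R (y - x) \<in> A" by auto
    show ?thesis
    proof (intro exI[of _ "U' \<inter> ?M"] conjI ballI False)
      show "open (U' \<inter> ?M)" using U'(1) \<open>open ?M\<close> by (rule open_Int)
      show "U' \<inter> ?M \<subseteq> U" using U'(3) by blast
      fix A' assume A': "A' \<in> insert A \<A>"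
      show "(\<forall>y\<in>U' \<inter> ?M. \<exists>t. x + t *\<^sub>R (y - x) \<in> A') \<or> (\<forall>y\<in>U' \<inter> ?M. \<forall>t. x + t *\<^sub>R (y - x) \<notin> A')"
      proof (cases "A' = A")
        case False
        then have "(\<forall>y\<in>U'. \<exists>t. x + t *\<^sub>R (y - x) \<in> A') \<or> (\<forall>y\<in>U'. \<forall>t. x + t *\<^sub>R (y - x) \<notin> A')"
          using A' U'(4) by simp
        then show ?thesis by (meson IntD1)
      qed (use meet in simp)
    qed
  qed
qed

text \<open>By \<open>finite_generic_open\<close> each set in \<open>\<A>\<close> is met by all or
  by none of the lines from \<open>x\<close> to a smaller open set, and the finitely many lines
  joining \<open>x\<close> to points of \<open>Z\<close> are null. The direction puts the point of
  \<open>U\<close> at the negative parameter \<open>- \<tau>\<close>.\<close>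

lemma generic_line_through:
  fixes x :: plane
  assumes \<A>: "finite \<A>" "\<And>A. A \<in> \<A> \<Longrightarrow> open A" "\<And>A. A \<in> \<A> \<Longrightarrow> x \<notin> closure A"
    and Z: "finite Z" and U: "open U" "U \<noteq> {}"
  obtains \<theta> \<tau> where "norm \<theta> = 1" "\<tau> > 0" "x - \<tau> *\<^sub>R \<theta> \<in> U"
    "\<And>z t. z \<in> Z \<Longrightarrow> z \<noteq> x \<Longrightarrow> x + t *\<^sub>R \<theta> \<noteq> z"
    "\<And>A. A \<in> \<A> \<Longrightarrow> (\<exists>t. x + t *\<^sub>R \<theta> \<in> A) \<or> (\<forall>t. x + t *\<^sub>R \<theta> \<notin> closure A)"
proof -
  have opA: "\<forall>A\<in>\<A>. open A" using \<A>(2) by blast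
  obtain U' where U': "open U'" "U' \<noteq> {}" "U' \<subseteq> U"
    "\<forall>A\<in>\<A>. (\<forall>y\<in>U'. \<exists>t. x + t *\<^sub>R (y - x) \<in> A) \<or> (\<forall>y\<in>U'. \<forall>t. x + t *\<^sub>R (y - x) \<notin> A)"
    using finite_generic_open[OF \<A>(1) opA U, of x] by (elim exE conjE) (rule that)
  let ?H = "\<lambda>z. {y. perp (z - x) \<bullet> y = perp (z - x) \<bullet> x}"
  have "negligible ({x} \<union> (\<Union>z\<in>Z - {x}. ?H z))"
  proof (intro negligible_Un negligible_Union)
    show "finite (?H ` (Z - {x}))" using Z by simp
    fix T assume "T \<in> ?H ` (Z - {x})"
    then obtain z where z: "z \<noteq> x" "T = ?H z" by blast
    then have "perp (z - x) \<noteq> 0" using norm_perp[of "z - x"] by (metis norm_eq_zero right_minus_eq)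
    then show "negligible T" unfolding z(2) by (intro negligible_hyperplane) simp
  qed simp
  then have "\<not> U' \<subseteq> {x} \<union> (\<Union>z\<in>Z - {x}. ?H z)"
    using open_not_negligible[OF U'(1,2)] negligible_subset by blast
  then obtain y where y: "y \<in> U'" "y \<noteq> x" "\<And>z. z \<in> Z \<Longrightarrow> z \<noteq> x \<Longrightarrow> perp (z - x) \<bullet> y \<noteq> perp (z - x) \<bullet> x" by blast
  define \<tau> where "\<tau> = norm (x - y)"
  define \<theta> where "\<theta> = (x - y) /\<^sub>R \<tau>"
  have \<tau>: "\<tau> > 0" using y(2) by (simp add: \<tau>_def)
  have \<theta>: "norm \<theta> = 1" using \<tau> by (simp add: \<theta>_def \<tau>_def)
  have yx: "y = x - \<tau> *\<^sub>R \<theta>" using \<tau> by (simp add: \<theta>_def)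
  have par: "x + t *\<^sub>R \<theta> = x + (- t / \<tau>) *\<^sub>R (y - x)" for t
    by (simp add: \<theta>_def algebra_simps divide_inverse)
  show thesis
  proof (rule that[OF \<theta> \<tau>])
    show "x - \<tau> *\<^sub>R \<theta> \<in> U" using y(1) U'(3) yx by auto
    show "x + t *\<^sub>R \<theta> \<noteq> z" if z: "z \<in> Z" "z \<noteq> x" for z t
    proof
      assume e: "x + t *\<^sub>R \<theta> = z"
      then have "z - x = t *\<^sub>R \<theta>" by auto
      then have "perp (z - x) = t *\<^sub>R perp \<theta>" by (simp add: perp_def vec_eq_iff forall_2)
      then have "perp (z - x) \<bullet> y = perp (z - x) \<bullet> x" unfolding yx by (simp add: inner_diff_right)
      then show False using y(3)[OF z] by simp
    qed
    show "(\<exists>t. x + t *\<^sub>R \<theta> \<in> A) \<or> (\<forall>t. x + t *\<^sub>R \<theta> \<notin> closure A)" if A: "A \<in> \<A>" for A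
      using bspec[OF U'(4) A]
    proof
      assume "\<forall>y\<in>U'. \<exists>t. x + t *\<^sub>R (y - x) \<in> A"
      then obtain t where "x + t *\<^sub>R (y - x) \<in> A" using y(1) by blast
      moreover have "x + t *\<^sub>R (y - x) = x + (- t * \<tau>) *\<^sub>R \<theta>" unfolding yx by simp
      ultimately show ?thesis by metis
    next
      assume no: "\<forall>y\<in>U'. \<forall>t. x + t *\<^sub>R (y - x) \<notin> A"
      have "x + t *\<^sub>R (y - x) \<notin> closure A" for t
      proof
        assume cl: "x + t *\<^sub>R (y - x) \<in> closure A"
        have t: "t \<noteq> 0" using cl \<A>(3)[OF A] by auto
        \<comment> \<open>If the line met only the closure of \<open>A\<close>, a point
          \<open>w\<close> of \<open>A\<close> close to the contact would be joined to
          \<open>x\<close> by a line through the point \<open>?g w\<close> of \<open>U'\<close>, and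
          that line meets \<open>A\<close>. Division by \<open>t\<close> is possible because
          \<open>x\<close> is not in the closure.\<close>
        let ?g = "\<lambda>w. x + (1 / t) *\<^sub>R (w - x)"
        have "open (?g -` U')" by (rule open_vimage[OF U'(1)]) (intro continuous_intros)
        moreover have "x + t *\<^sub>R (y - x) \<in> ?g -` U'" using t y(1) by simp
        ultimately have "A \<inter> ?g -` U' \<noteq> {}"
          using cl open_Int_closure_eq_empty[of "?g -` U'" A] by blast
        then obtain w where w: "w \<in> A" "?g w \<in> U'" by blast
        have "x + t *\<^sub>R (?g w - x) = w" using t by simp
        then show False using no w by metis
      qed
      then show ?thesis unfolding par by blast
    qed
  qed
qed

text \<open>For a fixed \<open>x\<close>, compactness of \<open>K\<close> turns the strict
  inequality into one with a margin \<open>s\<close>, which survives a change of the normal by less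
  than \<open>s / B\<close>.\<close>

lemma open_separating_normals:
  fixes K :: "'a :: euclidean_space set"
  assumes "compact K"
  shows "open {n. \<exists>x\<in>A. \<forall>y\<in>K. y \<bullet> n < x \<bullet> n}"
proof -
  have "open {n. \<forall>y\<in>K. y \<bullet> n < x \<bullet> n}" for x
  proof (cases "K = {}")
    case False
    show ?thesis unfolding open_contains_ball
    proof
      fix n assume n: "n \<in> {n. \<forall>y\<in>K. y \<bullet> n < x \<bullet> n}"
      have "continuous_on K (\<lambda>y. (y - x) \<bullet> n)" by (intro continuous_intros)
      then obtain y0 where y0: "y0 \<in> K" "\<And>y. y \<in> K \<Longrightarrow> (y - x) \<bullet> n \<le> (y0 - x) \<bullet> n"
        using continuous_attains_sup[OF assms False] by metis
      define s where "s = - ((y0 - x) \<bullet> n)"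
      have s: "s > 0" using n y0(1) by (simp add: s_def inner_diff_left)
      have "bounded ((\<lambda>y. y - x) ` K)"
        using assms by (intro compact_imp_bounded compact_continuous_image continuous_intros)
      then obtain B where B: "B > 0" "\<And>y. y \<in> K \<Longrightarrow> norm (y - x) \<le> B" unfolding bounded_pos by auto
      have "ball n (s / B) \<subseteq> {n. \<forall>y\<in>K. y \<bullet> n < x \<bullet> n}"
      proof (intro subsetI CollectI ballI)
        fix n' y assume n': "n' \<in> ball n (s / B)" and y: "y \<in> K"
        have "(y - x) \<bullet> (n' - n) \<le> norm (y - x) * norm (n' - n)" by (rule norm_cauchy_schwarz)
        also have "\<dots> \<le> B * norm (n' - n)" by (rule mult_right_mono[OF B(2)[OF y]]) simp
        also have "\<dots> < B * (s / B)"
          using n' B(1) by (intro mult_strict_left_mono) (simp_all add: dist_norm norm_minus_commute)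
        finally have "(y - x) \<bullet> n' < (y - x) \<bullet> n + s" using B(1) by (simp add: inner_diff_right)
        also have "\<dots> \<le> 0" using y0(2)[OF y] by (simp add: s_def)
        finally show "y \<bullet> n' < x \<bullet> n'" by (simp add: inner_diff_left)
      qed
      then show "\<exists>e>0. ball n e \<subseteq> {n. \<forall>y\<in>K. y \<bullet> n < x \<bullet> n}" using s B(1) by (intro exI[of _ "s / B"]) simp
    qed
  qed simp
  then have "open (\<Union>x\<in>A. {n. \<forall>y\<in>K. y \<bullet> n < x \<bullet> n})" by blast
  moreover have "(\<Union>x\<in>A. {n. \<forall>y\<in>K. y \<bullet> n < x \<bullet> n}) = {n. \<exists>x\<in>A. \<forall>y\<in>K. y \<bullet> n < x \<bullet> n}" by auto
  ultimately show ?thesis by simp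
qed

text \<open>Attenuating the half line \<open>t < 0\<close> by the factor \<open>e\<^sup>-\<^sup>1\<close> changes the integral, so its contribution is not zero.\<close>

lemma half_line_integral_pos:
  assumes f: "C1_compact_support f" "\<And>x. f x \<ge> 0" and \<theta>: "norm \<theta> = 1"
    and q: "q \<in> borel_measurable borel" "\<And>t. \<bar>q t\<bar> \<le> Q"
    and pos: "f (x - \<tau> *\<^sub>R \<theta>) > 0" "\<tau> > 0"
  shows "0 < (LINT t|lborel. indicator {..<0} t * (f (x + t *\<^sub>R \<theta>) * exp (- q t)))"
proof -
  let ?r = "\<lambda>(h :: real) (t :: real). indicator {..<0} t :: real"
  let ?P = "LINT t|lborel. indicator {..<0} t * (f (x + t *\<^sub>R \<theta>) * exp (- q t))"
  obtain \<kappa> \<tau>1 e where k: "\<kappa> > 0" "\<tau>1 > 0" "\<tau> - 1 < \<tau>1" "e > 0" "\<And>h. \<bar>h\<bar> \<le> e \<Longrightarrow>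
    \<kappa> * ?r h (- \<tau>1) \<le> \<bar>(LINT t|lborel. f (x + h *\<^sub>R 0 + t *\<^sub>R \<theta>) * exp (- (q t + 0 * ?r h t)))
       - (LINT t|lborel. f (x + h *\<^sub>R 0 + t *\<^sub>R \<theta>) * exp (- (q t + 1 * ?r h t)))\<bar>"
  proof (rule attenuation_difference_ge[where n = 0 and q = "\<lambda>h. q" and r = ?r and Q = Q and M = 1 and a = 0 and b = 1 and ?\<epsilon>0.0 = 1])
    show "?r h \<in> borel_measurable borel" for h by simp
    show "?r h t \<le> ?r h s" if "s \<le> t" for h s t using that by (auto simp: indicator_def)
  qed (rule f \<theta> q pos that zero_neq_one zero_less_one indicator_pos_le indicator_le_1; assumption?)+
  have int: "integrable lborel (\<lambda>t. f (x + t *\<^sub>R \<theta>) * exp (- (q t + a * indicator {..<0} t)))" if "0 \<le> a" for a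
  proof (rule integrable_radon[OF f(1) \<theta>])
    show "(\<lambda>t. q t + a * indicator {..<0} t) \<in> borel_measurable borel" using q(1) by simp
    show "\<bar>q t + a * indicator {..<0} t\<bar> \<le> Q + a" for t
      using q(2)[of t] that by (auto simp: indicator_def)
  qed
  have "(LINT t|lborel. f (x + t *\<^sub>R \<theta>) * exp (- (q t + 0 * indicator {..<0} t)))
       - (LINT t|lborel. f (x + t *\<^sub>R \<theta>) * exp (- (q t + 1 * indicator {..<0} t)))
      = (LINT t|lborel. f (x + t *\<^sub>R \<theta>) * exp (- (q t + 0 * indicator {..<0} t)) - f (x + t *\<^sub>R \<theta>) * exp (- (q t + 1 * indicator {..<0} t)))"
    by (rule Bochner_Integration.integral_diff[symmetric]) (rule int, simp)+
  also have "\<dots> = (LINT t|lborel. (1 - exp (- 1)) * (indicator {..<0} t * (f (x + t *\<^sub>R \<theta>) * exp (- q t))))"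
    by (intro Bochner_Integration.integral_cong refl) (auto simp: indicator_def algebra_simps exp_diff exp_minus field_simps exp_add)
  also have "\<dots> = (1 - exp (- 1)) * ?P" by simp
  finally have "\<kappa> * ?r 0 (- \<tau>1) \<le> \<bar>(1 - exp (- 1)) * ?P\<bar>" using k(5)[of 0] k(4) by simp
  then have "?P \<noteq> 0" using k(1,2) by (auto simp: indicator_def)
  moreover have "0 \<le> ?P" using f(2) by (intro Bochner_Integration.integral_nonneg) simp
  ultimately show ?thesis by simp
qed

section \<open>Equality of the layers\<close>

text \<open>Visibility is assumed for the first pair only, so the locale is not symmetric; the
  reverse inclusions of layers come from a second instance with the pairs exchanged.\<close>

locale layered_pair = L: nested_layers N c C + L': nested_layers N' c' C'
  for N c C N' c' C' +
  fixes f f' :: "plane \<Rightarrow> real"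
  assumes f: "C1_compact_support f" "\<And>x. f x \<ge> 0" and f': "C1_compact_support f'" "\<And>x. f' x \<ge> 0"
    and data: "\<And>p \<theta>. norm \<theta> = 1 \<Longrightarrow> regular_line N C p \<theta> \<Longrightarrow> regular_line N' C' p \<theta> \<Longrightarrow>
       layered_radon N c C f p \<theta> = layered_radon N' c' C' f' p \<theta>"
    and visible: "\<And>j V. j \<in> {1..N} \<Longrightarrow> open V \<Longrightarrow> V \<noteq> {} \<Longrightarrow> \<exists>x n. n \<in> V \<and> L.visible_boundary_point j f x n"
begin

text \<open>The supporting line touches \<open>C m\<close> and so is not regular itself. The outer
  layers contain \<open>x\<close>, the closures of the inner ones lie in \<open>C m\<close>, which
  the line misses, and after a small displacement the line either enters \<open>C m\<close> or
  leaves its closure, depending on the sign of \<open>h\<close>.\<close>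

lemma regular_line_near_support:
  assumes m: "m \<in> {1..N}" and fr: "norm n = 1" "norm \<theta> = 1" "n \<bullet> \<theta> = 0"
    and x: "x \<in> frontier (C m)" and side: "\<forall>y\<in>C m. (y - x) \<bullet> n < 0"
  shows "regular_line (m - 1) C x \<theta>" "\<forall>i\<in>{m<..N}. \<forall>t. x + t *\<^sub>R \<theta> \<notin> closure (C i)"
    "\<exists>e>0. \<forall>h. 0 < \<bar>h\<bar> \<longrightarrow> \<bar>h\<bar> \<le> e \<longrightarrow> regular_line N C (x + h *\<^sub>R n) \<theta>"
proof -
  have xc: "x \<in> closure (C m)" using x by (simp add: frontier_def)
  have xi: "x \<in> C i" if "i \<in> {1..<m}" for i using L.nested_less[of i m] that m xc by auto
  show reg0: "regular_line (m - 1) C x \<theta>"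
    unfolding regular_line_def
  proof
    fix i assume "i \<in> {1..m - 1}"
    then have "x \<in> C i" using m by (intro xi) auto
    then have "x + 0 *\<^sub>R \<theta> \<in> C i" by simp
    then show "(\<exists>t. x + t *\<^sub>R \<theta> \<in> C i) \<or> (\<forall>t. x + t *\<^sub>R \<theta> \<notin> closure (C i))" by blast
  qed
  have nm: "x + t *\<^sub>R \<theta> \<notin> C m" for t
    using bspec[OF side, of "x + t *\<^sub>R \<theta>"] fr(3) by (auto simp: inner_commute)
  have miss: "x + t *\<^sub>R \<theta> \<notin> closure (C i)" if "i \<in> {m<..N}" for i t
    using L.nested_less[of m i] that m nm by auto
  then show "\<forall>i\<in>{m<..N}. \<forall>t. x + t *\<^sub>R \<theta> \<notin> closure (C i)" by blast
  interpret S: convex_body "slice (C m) x n \<theta>" by (rule L.slice_layer[OF fr m])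
  have neg: "h < 0" if "(h, t) \<in> slice (C m) x n \<theta>" for h t
    using bspec[OF side, of "x + h *\<^sub>R n + t *\<^sub>R \<theta>"] that frame_inner[OF fr] by (simp add: mem_slice inner_add_left)
  have z: "(0, 0) \<in> closure (slice (C m) x n \<theta>)" using xc by (simp add: mem_closure_slice[OF fr])
  obtain k0 e1 where "k0 > 0" and e1: "e1 > 0"
    and "\<And>h. 0 < h \<Longrightarrow> h \<le> e1 \<Longrightarrow> k0 * h \<le> ray_meas (slice (C m) x n \<theta>) (- h) (- 1)"
    and e1': "\<And>h. 0 < h \<Longrightarrow> h \<le> e1 \<Longrightarrow> \<exists>t. (- h, t) \<in> slice (C m) x n \<theta>"
    by (rule S.ray_meas_linear_growth[where ?t1.0 = "- 1", OF neg z]) (assumption, simp, rule that)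
  have "m - 1 \<le> N" using m by auto
  then obtain e2 where e2: "e2 > 0" "\<And>h. \<bar>h\<bar> \<le> e2 \<Longrightarrow> regular_line (m - 1) C (x + h *\<^sub>R n) \<theta>"
    by (rule nested_layers.regular_line_nbhd[OF L.sublayers fr reg0]) (rule that)
  have "\<exists>e>0. \<forall>h. \<bar>h\<bar> \<le> e \<longrightarrow> (\<forall>i\<in>{m<..N}. \<forall>t. x + h *\<^sub>R n + t *\<^sub>R \<theta> \<notin> closure (C i))"
  proof (cases "m + 1 \<le> N")
    case True
    then have j: "m + 1 \<in> {1..N}" by simp
    interpret S1: convex_body "slice (C (m + 1)) x n \<theta>" by (rule L.slice_layer[OF fr j])
    have mi: "\<And>t. (0, t) \<notin> closure (slice (C (m + 1)) x n \<theta>)" using miss[of "m + 1"] True by (simp add: mem_closure_slice[OF fr])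
    obtain e where e: "e > 0" "\<And>h t. \<bar>h\<bar> \<le> e \<Longrightarrow> (h, t) \<notin> closure (slice (C (m + 1)) x n \<theta>)"
      by (rule S1.missing_nbhd[OF mi]) (rule that)
    have "closure (C i) \<subseteq> closure (C (m + 1))" if "i \<in> {m<..N}" for i
      using L.nested_le[of "m + 1" i] that by (intro closure_mono) auto
    then show ?thesis using e unfolding mem_closure_slice[OF fr] by blast
  next
    case False
    then have "{m<..N} = {}" by auto
    then show ?thesis by (intro exI[of _ 1]) simp
  qed
  then obtain e3 where e3: "e3 > 0" "\<And>h i t. \<bar>h\<bar> \<le> e3 \<Longrightarrow> i \<in> {m<..N} \<Longrightarrow> x + h *\<^sub>R n + t *\<^sub>R \<theta> \<notin> closure (C i)"
    by blast
  show "\<exists>e>0. \<forall>h. 0 < \<bar>h\<bar> \<longrightarrow> \<bar>h\<bar> \<le> e \<longrightarrow> regular_line N C (x + h *\<^sub>R n) \<theta>"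
  proof (intro exI[of _ "min e1 (min e2 e3)"] conjI allI impI)
    show "0 < min e1 (min e2 e3)" using e1 e2 e3 by simp
    fix h :: real assume h: "0 < \<bar>h\<bar>" "\<bar>h\<bar> \<le> min e1 (min e2 e3)"
    show "regular_line N C (x + h *\<^sub>R n) \<theta>"
      unfolding regular_line_def
    proof
      fix i assume i: "i \<in> {1..N}"
      consider "i \<in> {1..m - 1}" | "i = m" "h < 0" | "i = m" "h > 0" | "i \<in> {m<..N}" using i h by force
      then show "(\<exists>t. x + h *\<^sub>R n + t *\<^sub>R \<theta> \<in> C i) \<or> (\<forall>t. x + h *\<^sub>R n + t *\<^sub>R \<theta> \<notin> closure (C i))"
      proof cases
        case 1
        then show ?thesis using e2(2)[of h] h unfolding regular_line_def by auto
      next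
        case 2
        then show ?thesis using e1'[of "- h"] h by (auto simp: mem_slice)
      next
        case 3
        have "C m \<subseteq> {y. n \<bullet> y \<le> n \<bullet> x}"
        proof
          fix y assume "y \<in> C m"
          from bspec[OF side this] show "y \<in> {y. n \<bullet> y \<le> n \<bullet> x}"
            by (simp add: inner_diff_left inner_diff_right inner_commute)
        qed
        then have "closure (C m) \<subseteq> {y. n \<bullet> y \<le> n \<bullet> x}" by (rule closure_minimal) (rule closed_halfspace_le)
        moreover have "n \<bullet> (x + h *\<^sub>R n + t *\<^sub>R \<theta>) > n \<bullet> x" for t
          using 3 fr(3) frame_inner[OF fr] by (simp add: inner_add_right)
        ultimately show ?thesis using 3(1) by (meson mem_Collect_eq not_le subsetD)
      next
        case 4
        then show ?thesis using e3(2)[of h i] h by auto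
      qed
    qed
  qed
qed

text \<open>On the outer side \<open>C m\<close> contributes nothing and the data are those of the
  first \<open>m - 1\<close> layers; on the inner side they differ from these by at least a multiple
  of the length of the chord ahead of \<open>- \<tau>1\<close>. The data of the second pair stand in
  for those of the first on both sides.\<close>

lemma supporting_line:
  assumes m: "m \<in> {1..N}" and fr: "norm n = 1" "norm \<theta> = 1" "n \<bullet> \<theta> = 0"
    and x: "x \<in> frontier (C m)" and side: "\<forall>y\<in>C m. (y - x) \<bullet> n < 0"
    and pos: "f (x - \<tau> *\<^sub>R \<theta>) > 0" "\<tau> > 0" and reg': "regular_line N' C' x \<theta>"
  obtains \<kappa> \<tau>1 e where "\<kappa> > 0" "\<tau>1 > 0" "e > 0"
    "\<And>h. 0 < h \<Longrightarrow> h \<le> e \<Longrightarrow> \<kappa> * ray_meas (slice (C m) x n \<theta>) (- h) (- \<tau>1) \<le>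
       \<bar>layered_radon N' c' C' f' (x + (- h) *\<^sub>R n) \<theta> - layered_radon (m - 1) c C f (x + (- h) *\<^sub>R n) \<theta>\<bar>"
    "\<And>h. 0 < h \<Longrightarrow> h \<le> e \<Longrightarrow> layered_radon (m - 1) c C f (x + h *\<^sub>R n) \<theta> = layered_radon N' c' C' f' (x + h *\<^sub>R n) \<theta>"
proof -
  let ?S = "slice (C m) x n \<theta>"
  interpret S: convex_body ?S by (rule L.slice_layer[OF fr m])
  have m1: "m - 1 \<le> N" using m by auto
  interpret L0: nested_layers "m - 1" c C by (rule L.sublayers[OF m1])
  note near = regular_line_near_support[OF m fr x side]
  obtain e1 where e1: "e1 > 0" "\<And>h. 0 < \<bar>h\<bar> \<Longrightarrow> \<bar>h\<bar> \<le> e1 \<Longrightarrow> regular_line N C (x + h *\<^sub>R n) \<theta>"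
    using near(3) by blast
  obtain e2 where e2: "e2 > 0" "\<And>h. \<bar>h\<bar> \<le> e2 \<Longrightarrow> regular_line N' C' (x + h *\<^sub>R n) \<theta>"
    by (rule L'.regular_line_nbhd[OF fr reg']) (rule that)
  obtain e3 where e3: "e3 > 0" "\<And>h t. \<bar>h\<bar> \<le> e3 \<Longrightarrow> optical_depth N c C (x + h *\<^sub>R n) \<theta> t =
     optical_depth (m - 1) c C (x + h *\<^sub>R n) \<theta> t + c m * ray_meas ?S h t"
    by (rule L.optical_depth_split[OF fr m near(2)[rule_format]]) (assumption, rule that)
  obtain Q where Q: "\<And>h t. \<bar>optical_depth (m - 1) c C (x + h *\<^sub>R n) \<theta> t\<bar> \<le> Q"
    by (rule L0.optical_depth_bounded[OF fr]) (rule that)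
  obtain M where M: "\<And>h t. ray_meas ?S h t \<le> M" using S.ray_meas_bound by blast
  have neg: "h < 0" if "(h, t) \<in> ?S" for h t
    using bspec[OF side, of "x + h *\<^sub>R n + t *\<^sub>R \<theta>"] that frame_inner[OF fr] by (simp add: mem_slice inner_add_left)
  obtain \<kappa> \<tau>1 e4 where k: "\<kappa> > 0" "\<tau>1 > 0" "\<tau> - 1 < \<tau>1" "e4 > 0" "\<And>h. \<bar>h\<bar> \<le> e4 \<Longrightarrow>
    \<kappa> * ray_meas ?S h (- \<tau>1) \<le> \<bar>(LINT t|lborel. f (x + h *\<^sub>R n + t *\<^sub>R \<theta>) * exp (- (optical_depth (m - 1) c C (x + h *\<^sub>R n) \<theta> t + c m * ray_meas ?S h t)))
       - (LINT t|lborel. f (x + h *\<^sub>R n + t *\<^sub>R \<theta>) * exp (- (optical_depth (m - 1) c C (x + h *\<^sub>R n) \<theta> t + 0 * ray_meas ?S h t)))\<bar>"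
  proof (rule attenuation_difference_ge[where n = n and q = "\<lambda>h. optical_depth (m - 1) c C (x + h *\<^sub>R n) \<theta>" and r = "ray_meas ?S" and Q = Q and M = M and a = "c m" and b = 0 and ?\<epsilon>0.0 = 1])
    show "optical_depth (m - 1) c C (x + h *\<^sub>R n) \<theta> \<in> borel_measurable borel" for h
      by (rule L0.optical_depth_measurable[OF fr])
    show "c m \<noteq> 0" by (rule L.c_nz[OF m])
  qed (rule f fr pos Q M S.ray_meas_nonneg S.ray_meas_antimono S.ray_meas_measurable zero_less_one that; assumption?)+
  define e where "e = min (min e1 e2) (min e3 e4)"
  have e: "e > 0" using e1 e2 e3 k by (simp add: e_def)
  have F0: "layered_radon (m - 1) c C f (x + h *\<^sub>R n) \<theta> =
      (LINT t|lborel. f (x + h *\<^sub>R n + t *\<^sub>R \<theta>) * exp (- (optical_depth (m - 1) c C (x + h *\<^sub>R n) \<theta> t + 0 * ray_meas ?S h t)))" for h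
    by (simp add: layered_radon_def)
  have F: "layered_radon N c C f (x + h *\<^sub>R n) \<theta> =
      (LINT t|lborel. f (x + h *\<^sub>R n + t *\<^sub>R \<theta>) * exp (- (optical_depth (m - 1) c C (x + h *\<^sub>R n) \<theta> t + c m * ray_meas ?S h t)))"
    if "\<bar>h\<bar> \<le> e" for h
    using that by (simp add: layered_radon_def e3(2) e_def)
  have dat: "layered_radon N c C f (x + h *\<^sub>R n) \<theta> = layered_radon N' c' C' f' (x + h *\<^sub>R n) \<theta>" if "0 < \<bar>h\<bar>" "\<bar>h\<bar> \<le> e" for h
    using that by (intro data fr e1(2) e2(2)) (auto simp: e_def)
  show thesis
  proof (rule that[OF k(1,2) e])
    fix h assume h: "0 < h" "h \<le> e"
    have a: "0 < \<bar>- h\<bar>" "\<bar>- h\<bar> \<le> e" "\<bar>- h\<bar> \<le> e4" using h by (auto simp: e_def)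
    show "\<kappa> * ray_meas ?S (- h) (- \<tau>1) \<le>
       \<bar>layered_radon N' c' C' f' (x + (- h) *\<^sub>R n) \<theta> - layered_radon (m - 1) c C f (x + (- h) *\<^sub>R n) \<theta>\<bar>"
      using k(5)[OF a(3)] unfolding F0 F[OF a(2), symmetric] dat[OF a(1,2), symmetric] .
  next
    fix h assume h: "0 < h" "h \<le> e"
    then have a: "0 < \<bar>h\<bar>" "\<bar>h\<bar> \<le> e" by auto
    have "ray_meas ?S h t = 0" for t
      by (rule S.ray_meas_empty) (use neg h in fastforce)
    then show "layered_radon (m - 1) c C f (x + h *\<^sub>R n) \<theta> = layered_radon N' c' C' f' (x + h *\<^sub>R n) \<theta>"
      unfolding F0 dat[OF a, symmetric] F[OF a(2)] by simp
  qed
qed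

end

context nested_layers begin

lemma corner_crossing_second_diff:
  assumes f: "C1_compact_support f" and m: "m \<in> {1..N}" and fr: "norm n = 1" "norm \<theta> = 1" "n \<bullet> \<theta> = 0"
    and reg: "regular_line N C x \<theta>"
    and arc: "\<And>j t. j \<in> {1..N} \<Longrightarrow> j \<noteq> m \<Longrightarrow> x + t *\<^sub>R \<theta> \<in> frontier (C j) \<Longrightarrow> arc_point (C j) (x + t *\<^sub>R \<theta>)"
    and w: "e0 > 0" "\<And>h. \<bar>h\<bar> \<le> e0 \<Longrightarrow> \<bar>w h\<bar> \<le> Kw * \<bar>h\<bar>"
      "AE t in lborel. ((\<lambda>h. (second_diff (\<lambda>h. ray_meas (slice (C m) x n \<theta>) h t) h - w h * indicator {..<0} t) / h) \<longlongrightarrow> 0) (at_right 0)"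
  shows "((\<lambda>h. (second_diff (\<lambda>h. layered_radon N c C f (x + h *\<^sub>R n) \<theta>) h + c m * w h *
        (LINT t|lborel. indicator {..<0} t * (f (x + t *\<^sub>R \<theta>) * exp (- optical_depth N c C x \<theta> t)))) / h) \<longlongrightarrow> 0) (at_right 0)"
proof -
  let ?w = "\<lambda>j h. if j = m then w h else 0"
  have sd: "AE t in lborel. ((\<lambda>h. (second_diff (\<lambda>h. ray_meas (slice (C j) x n \<theta>) h t) h - ?w j h * indicator {..<0} t) / h) \<longlongrightarrow> 0) (at_right 0)"
    if j: "j \<in> {1..N}" for j
  proof (cases "j = m")
    case True
    then show ?thesis using w(3) by simp
  next
    case False
    have "(\<exists>t. x + t *\<^sub>R \<theta> \<in> C j) \<or> (\<forall>t. x + t *\<^sub>R \<theta> \<notin> closure (C j))"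
      using reg j unfolding regular_line_def by blast
    from second_diff_ray_meas_arc[OF convex_C[OF j] open_C[OF j] bounded_C[OF j] fr this arc[OF j False]]
    show ?thesis using False by simp
  qed
  have wb: "\<bar>?w j h\<bar> \<le> (if j = m then Kw else 0) * \<bar>h\<bar>" if "\<bar>h\<bar> \<le> e0" for j h
    using w(2)[OF that] by simp
  have s: "(\<Sum>j\<in>{1..N}. c j * ?w j h) = c m * w h" for h
  proof -
    have "(\<Sum>j\<in>{1..N}. c j * ?w j h) = (\<Sum>j\<in>{1..N}. if j = m then c m * w h else 0)"
      by (intro sum.cong) auto
    then show ?thesis using m by simp
  qed
  show ?thesis
    using layered_second_diff[OF fr f reg sd w(1) wb] unfolding s .
qed

end

section \<open>Contradictions at supporting points and inclusion of the layers\<close>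

context layered_pair begin

text \<open>The difference of \<open>?F'\<close> and \<open>?F0\<close> vanishes for small
  \<open>h > 0\<close> and both are Lipschitz at 0, so it is \<open>O(h)\<close> for
  \<open>h < 0\<close> as well. An arc tangent to the line makes the chords of \<open>C m\<close>
  exceed every multiple of \<open>h\<close>.\<close>

lemma no_smooth_tangent:
  assumes m: "m \<in> {1..N}" and fr: "norm n = 1" "norm \<theta> = 1" "n \<bullet> \<theta> = 0"
    and x: "x \<in> frontier (C m)" and side: "\<forall>y\<in>C m. (y - x) \<bullet> n < 0"
    and pos: "f (x - \<tau> *\<^sub>R \<theta>) > 0" "\<tau> > 0" and reg': "regular_line N' C' x \<theta>"
    and \<gamma>: "\<gamma> u0 = x" "(\<gamma> has_vector_derivative v) (at u0)" "v \<noteq> 0" "v \<bullet> n = 0"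
      "eventually (\<lambda>u. \<gamma> u \<in> closure (C m)) (at u0)"
  shows False
proof -
  let ?S = "slice (C m) x n \<theta>"
  let ?F0 = "\<lambda>h. layered_radon (m - 1) c C f (x + h *\<^sub>R n) \<theta>"
  let ?F' = "\<lambda>h. layered_radon N' c' C' f' (x + h *\<^sub>R n) \<theta>"
  interpret S: convex_body ?S by (rule L.slice_layer[OF fr m])
  have m1: "m - 1 \<le> N" using m by auto
  interpret L0: nested_layers "m - 1" c C by (rule L.sublayers[OF m1])
  obtain \<kappa> \<tau>1 e where k: "\<kappa> > 0" "\<tau>1 > 0" "e > 0"
    "\<And>h. 0 < h \<Longrightarrow> h \<le> e \<Longrightarrow> \<kappa> * ray_meas ?S (- h) (- \<tau>1) \<le> \<bar>?F' (- h) - ?F0 (- h)\<bar>"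
    "\<And>h. 0 < h \<Longrightarrow> h \<le> e \<Longrightarrow> ?F0 h = ?F' h"
    by (rule supporting_line[OF m fr x side pos reg']) (rule that)
  obtain B e1 where B: "B \<ge> 0" "e1 > 0" "\<And>h. \<bar>h\<bar> \<le> e1 \<Longrightarrow> \<bar>?F0 h - layered_radon (m - 1) c C f x \<theta>\<bar> \<le> B * \<bar>h\<bar>"
    by (rule L0.layered_radon_lipschitz[OF fr f(1) regular_line_near_support(1)[OF m fr x side]]) (rule that)
  obtain B' e2 where B': "B' \<ge> 0" "e2 > 0" "\<And>h. \<bar>h\<bar> \<le> e2 \<Longrightarrow> \<bar>?F' h - layered_radon N' c' C' f' x \<theta>\<bar> \<le> B' * \<bar>h\<bar>"
    by (rule L'.layered_radon_lipschitz[OF fr f'(1) reg']) (rule that)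
  have neg: "h < 0" if "(h, t) \<in> ?S" for h t
    using bspec[OF side, of "x + h *\<^sub>R n + t *\<^sub>R \<theta>"] that frame_inner[OF fr] by (simp add: mem_slice inner_add_left)
  have z: "(0, 0) \<in> closure ?S" using x by (simp add: mem_closure_slice[OF fr] frontier_def)
  have d: "((\<lambda>u. (\<gamma> u - x) \<bullet> a) has_real_derivative v \<bullet> a) (at u0)" for a
    using bounded_linear.has_vector_derivative[OF bounded_linear_inner_left[of a] has_vector_derivative_diff_const[THEN iffD2, OF \<gamma>(2), of x]]
    by (simp add: has_real_derivative_iff_has_vector_derivative)
  have v\<theta>: "v \<bullet> \<theta> \<noteq> 0" using frame_expand[OF fr, of v] \<gamma>(3,4) by auto
  \<comment> \<open>After multiplication by \<open>\<kappa>\<close> the chord contributes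
    \<open>(2 * (B + B') + 1) * h\<close>, which is \<open>h\<close> more than the Lipschitz bounds
    allow.\<close>
  obtain e3 where e3: "e3 > 0" "\<And>h. 0 < h \<Longrightarrow> h \<le> e3 \<Longrightarrow> ((2 * (B + B') + 1) / \<kappa>) * h \<le> ray_meas ?S (- h) (- \<tau>1)"
  proof (rule S.ray_meas_superlinear_growth[where ?t1.0 = "- \<tau>1" and K = "(2 * (B + B') + 1) / \<kappa>", OF neg z])
    show "((\<lambda>u. (\<gamma> u - x) \<bullet> n) has_real_derivative 0) (at u0)" using d[of n] \<gamma>(4) by simp
    show "((\<lambda>u. (\<gamma> u - x) \<bullet> \<theta>) has_real_derivative v \<bullet> \<theta>) (at u0)" by (rule d)
    show "eventually (\<lambda>u. ((\<gamma> u - x) \<bullet> n, (\<gamma> u - x) \<bullet> \<theta>) \<in> closure ?S) (at u0)"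
      using \<gamma>(5) by (rule eventually_mono) (simp add: mem_closure_slice[OF fr] frame_coords[OF fr])
  qed (use \<gamma>(1) v\<theta> k(2) that in auto)
  define h where "h = min (min e e1) (min e2 e3)"
  have h: "0 < h" "h \<le> e" "h \<le> e1" "h \<le> e2" "h \<le> e3" using k B B' e3 by (auto simp: h_def)
  have "(2 * (B + B') + 1) * h = \<kappa> * (((2 * (B + B') + 1) / \<kappa>) * h)" using k(1) by simp
  also have "\<dots> \<le> \<kappa> * ray_meas ?S (- h) (- \<tau>1)" using e3(2)[OF h(1,5)] k(1) by (intro mult_left_mono) auto
  also have "\<dots> \<le> \<bar>?F' (- h) - ?F0 (- h)\<bar>" by (rule k(4)[OF h(1,2)])
  also have "\<dots> \<le> 2 * (B + B') * h"
  proof -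
    have "\<bar>?F0 h - layered_radon (m - 1) c C f x \<theta>\<bar> \<le> B * h" "\<bar>?F0 (- h) - layered_radon (m - 1) c C f x \<theta>\<bar> \<le> B * h"
      "\<bar>?F' h - layered_radon N' c' C' f' x \<theta>\<bar> \<le> B' * h" "\<bar>?F' (- h) - layered_radon N' c' C' f' x \<theta>\<bar> \<le> B' * h"
      using B(3)[of h] B(3)[of "- h"] B'(3)[of h] B'(3)[of "- h"] h by simp_all
    moreover have "?F0 h = ?F' h" by (rule k(5)[OF h(1,2)])
    moreover have "2 * (B + B') * h = B * h + B * h + (B' * h + B' * h)" by (simp add: algebra_simps)
    ultimately show ?thesis unfolding abs_le_iff by linarith
  qed
  finally show False using h(1) by (simp add: algebra_simps)
qed

text \<open>Linear growth of the chords is compatible with Lipschitz data. However,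
  \<open>?F0\<close> and \<open>?F'\<close> agree at \<open>h > 0\<close> and by continuity at 0, so
  their difference at \<open>- h\<close> equals the difference of their second differences, and this
  is \<open>o(h)\<close> because the line meets the layers entering \<open>?F0\<close> and
  \<open>?F'\<close> in arc points only.\<close>

lemma no_corner_support:
  assumes m: "m \<in> {1..N}" and fr: "norm n = 1" "norm \<theta> = 1" "n \<bullet> \<theta> = 0"
    and x: "x \<in> frontier (C m)" and side: "\<forall>y\<in>C m. (y - x) \<bullet> n < 0"
    and pos: "f (x - \<tau> *\<^sub>R \<theta>) > 0" "\<tau> > 0" and reg': "regular_line N' C' x \<theta>"
    and arc: "\<And>j t. j \<in> {1..m - 1} \<Longrightarrow> x + t *\<^sub>R \<theta> \<in> frontier (C j) \<Longrightarrow> arc_point (C j) (x + t *\<^sub>R \<theta>)"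
    and arc': "\<And>j t. j \<in> {1..N'} \<Longrightarrow> x + t *\<^sub>R \<theta> \<in> frontier (C' j) \<Longrightarrow> arc_point (C' j) (x + t *\<^sub>R \<theta>)"
  shows False
proof -
  let ?S = "slice (C m) x n \<theta>"
  let ?F0 = "\<lambda>h. layered_radon (m - 1) c C f (x + h *\<^sub>R n) \<theta>"
  let ?F' = "\<lambda>h. layered_radon N' c' C' f' (x + h *\<^sub>R n) \<theta>"
  interpret S: convex_body ?S by (rule L.slice_layer[OF fr m])
  have m1: "m - 1 \<le> N" using m by auto
  interpret L0: nested_layers "m - 1" c C by (rule L.sublayers[OF m1])
  note reg0 = regular_line_near_support(1)[OF m fr x side]
  obtain \<kappa> \<tau>1 e where k: "\<kappa> > 0" "\<tau>1 > 0" "e > 0"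
    "\<And>h. 0 < h \<Longrightarrow> h \<le> e \<Longrightarrow> \<kappa> * ray_meas ?S (- h) (- \<tau>1) \<le> \<bar>?F' (- h) - ?F0 (- h)\<bar>"
    "\<And>h. 0 < h \<Longrightarrow> h \<le> e \<Longrightarrow> ?F0 h = ?F' h"
    by (rule supporting_line[OF m fr x side pos reg']) (rule that)
  obtain B e1 where B: "B \<ge> 0" "e1 > 0" "\<And>h. \<bar>h\<bar> \<le> e1 \<Longrightarrow> \<bar>?F0 h - layered_radon (m - 1) c C f x \<theta>\<bar> \<le> B * \<bar>h\<bar>"
    by (rule L0.layered_radon_lipschitz[OF fr f(1) reg0]) (rule that)
  obtain B' e2 where B': "B' \<ge> 0" "e2 > 0" "\<And>h. \<bar>h\<bar> \<le> e2 \<Longrightarrow> \<bar>?F' h - layered_radon N' c' C' f' x \<theta>\<bar> \<le> B' * \<bar>h\<bar>"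
    by (rule L'.layered_radon_lipschitz[OF fr f'(1) reg']) (rule that)
  have F0: "((\<lambda>h. second_diff ?F0 h / h) \<longlongrightarrow> 0) (at_right 0)"
    by (rule L0.layered_second_diff_smooth[OF fr f(1) reg0 arc])
  have F': "((\<lambda>h. second_diff ?F' h / h) \<longlongrightarrow> 0) (at_right 0)"
    by (rule L'.layered_second_diff_smooth[OF fr f'(1) reg' arc'])
  have neg: "h < 0" if "(h, t) \<in> ?S" for h t
    using bspec[OF side, of "x + h *\<^sub>R n + t *\<^sub>R \<theta>"] that frame_inner[OF fr] by (simp add: mem_slice inner_add_left)
  have z: "(0, 0) \<in> closure ?S" using x by (simp add: mem_closure_slice[OF fr] frontier_def)
  have t1: "- \<tau>1 < 0" using k(2) by simp
  obtain k0 e5 where k0: "k0 > 0" and e5: "e5 > 0" "\<And>h. 0 < h \<Longrightarrow> h \<le> e5 \<Longrightarrow> k0 * h \<le> ray_meas ?S (- h) (- \<tau>1)"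
    and "\<And>h. 0 < h \<Longrightarrow> h \<le> e5 \<Longrightarrow> \<exists>t. (- h, t) \<in> ?S"
    by (rule S.ray_meas_linear_growth[OF neg z t1]) (assumption, rule that)
  define E where "E = min (min e e1) (min e2 e5)"
  have E: "E > 0" using k B B' e5 by (simp add: E_def)
  have EE: "E \<le> e" "E \<le> e1" "E \<le> e2" "E \<le> e5" by (auto simp: E_def)
  note ev = eventually_at_right_le[OF E]
  have eq0: "?F0 0 = ?F' 0"
  proof -
    have "((\<lambda>h. B * h + B' * h) \<longlongrightarrow> B * 0 + B' * 0) (at_right 0)" by (intro tendsto_intros)
    moreover have "\<bar>?F0 0 - ?F' 0\<bar> \<le> B * h + B' * h" if h: "0 < h \<and> h \<le> E" for h
    proof -
      have "\<bar>?F0 h - ?F0 0\<bar> \<le> B * h" "\<bar>?F' h - ?F' 0\<bar> \<le> B' * h" "?F0 h = ?F' h"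
        using B(3)[of h] B'(3)[of h] k(5)[of h] h EE by auto
      then show ?thesis by linarith
    qed
    then have "eventually (\<lambda>h. \<bar>?F0 0 - ?F' 0\<bar> \<le> B * h + B' * h) (at_right 0)" by (rule eventually_mono[OF ev])
    ultimately have "\<bar>?F0 0 - ?F' 0\<bar> \<le> B * 0 + B' * 0" by (rule tendsto_lowerbound) simp
    then show ?thesis by simp
  qed
  have "((\<lambda>h. \<bar>second_diff ?F' h / h - second_diff ?F0 h / h\<bar>) \<longlongrightarrow> \<bar>0 - 0\<bar>) (at_right 0)"
    by (intro tendsto_intros F0 F')
  moreover have "\<kappa> * k0 \<le> \<bar>second_diff ?F' h / h - second_diff ?F0 h / h\<bar>" if h: "0 < h \<and> h \<le> E" for h
  proof -
    have h': "0 < h" "h \<le> e" "h \<le> e5" using h EE by auto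
    have "\<kappa> * (k0 * h) \<le> \<kappa> * ray_meas ?S (- h) (- \<tau>1)"
      using e5(2)[OF h'(1,3)] k(1) by (intro mult_left_mono) auto
    also have "\<dots> \<le> \<bar>?F' (- h) - ?F0 (- h)\<bar>" by (rule k(4)[OF h'(1,2)])
    also have "?F' (- h) - ?F0 (- h) = second_diff ?F' h - second_diff ?F0 h"
      using k(5)[OF h'(1,2)] eq0 unfolding second_diff_def by simp
    finally have "\<kappa> * k0 * h \<le> \<bar>second_diff ?F' h - second_diff ?F0 h\<bar>" by (simp add: mult.assoc)
    then show ?thesis using h'(1) by (simp add: diff_divide_distrib[symmetric] abs_divide pos_le_divide_eq)
  qed
  then have "eventually (\<lambda>h. \<kappa> * k0 \<le> \<bar>second_diff ?F' h / h - second_diff ?F0 h / h\<bar>) (at_right 0)"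
    by (rule eventually_mono[OF ev])
  ultimately have "\<kappa> * k0 \<le> \<bar>0 - 0\<bar>" by (rule tendsto_lowerbound) simp
  then show False using k(1) k0 by (simp add: mult_le_0_iff)
qed

text \<open>The visible point \<open>x\<close> belongs to a normal that separates it from
  \<open>closure (C' m)\<close>, so lines through \<open>x\<close> can be regular for the second
  pair. Three situations are refuted: a tangent to a smooth arc, a line through a corner that misses
  \<open>C m\<close>, and one that crosses \<open>C m\<close>.\<close>

lemma layer_contained:
  assumes m: "m \<in> {1..N}" and prev: "\<And>i. i \<in> {1..<m} \<Longrightarrow> i \<le> N' \<and> C' i = C i"
  shows "m \<le> N' \<and> closure (C m) \<subseteq> closure (C' m)"
proof (rule ccontr)
  assume contr: "\<not> ?thesis"
  \<comment> \<open>With the empty set in place of an absent layer, a smaller number of layers in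
    the second pair is handled like a failed inclusion.\<close>
  define K where "K = (if m \<le> N' then closure (C' m) else {})"
  have m': "m \<in> {1..N'}" if "m \<le> N'" using that m by simp
  have K: "compact K" "convex K"
    using L'.bounded_C[OF m'] L'.convex_C[OF m'] by (auto simp: K_def)
  have "\<not> C m \<subseteq> K"
  proof
    assume "C m \<subseteq> K"
    moreover have "m \<le> N'" using \<open>C m \<subseteq> K\<close> L.ne_C[OF m] by (auto simp: K_def split: if_splits)
    ultimately show False using contr by (simp add: K_def closure_minimal)
  qed
  then obtain p where p: "p \<in> C m" "p \<notin> K" by blast
  define V where "V = {n. \<exists>x\<in>C m. \<forall>y\<in>K. y \<bullet> n < x \<bullet> n}"
  have V: "open V" unfolding V_def by (rule open_separating_normals[OF K(1)])
  obtain a b where ab: "a \<bullet> p < b" "\<forall>y\<in>K. b < a \<bullet> y"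
    using separating_hyperplane_closed_point[OF K(2) compact_imp_closed[OF K(1)] p(2)] by blast
  have "y \<bullet> (- a) < p \<bullet> (- a)" if "y \<in> K" for y
    using ab(1) bspec[OF ab(2) that] by (simp add: inner_commute)
  then have "- a \<in> V" unfolding V_def using p(1) by blast
  then have "V \<noteq> {}" by blast
  then obtain x n where xn: "n \<in> V" "L.visible_boundary_point m f x n" using visible[OF m V] by blast
  have x: "x \<in> frontier (C m)" and n: "n \<noteq> 0" and nx: "\<And>y. y \<in> C m \<Longrightarrow> y \<bullet> n \<le> x \<bullet> n"
    using xn(2) unfolding L.visible_boundary_point_def by auto
  have Kn: "y \<bullet> n < x \<bullet> n" if y: "y \<in> K" for y
  proof -
    obtain x' where "x' \<in> C m" "y \<bullet> n < x' \<bullet> n" using xn(1) y unfolding V_def by blast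
    then show ?thesis using nx[of x'] by simp
  qed
  have xK: "x \<notin> K" using Kn by blast
  have xc: "x \<in> closure (C m)" "x \<notin> C m" using x L.frontier_C[OF m] by auto
  have xi: "x \<in> C i" if "i \<in> {1..<m}" for i using L.nested_less[of i m] that m xc by auto
  have KC': "closure (C' i) \<subseteq> K" if i: "i \<in> {m..N'}" for i
  proof -
    have "C' i \<subseteq> C' m" using L'.nested_le[of m i] i m by simp
    then show ?thesis using i by (simp add: K_def closure_mono)
  qed
  have reg': "regular_line N' C' x \<theta>"
    if "\<And>i. i \<in> {m..N'} \<Longrightarrow> (\<exists>t. x + t *\<^sub>R \<theta> \<in> C' i) \<or> (\<forall>t. x + t *\<^sub>R \<theta> \<notin> closure (C' i))" for \<theta>
    unfolding regular_line_def
  proof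
    fix i assume i: "i \<in> {1..N'}"
    show "(\<exists>t. x + t *\<^sub>R \<theta> \<in> C' i) \<or> (\<forall>t. x + t *\<^sub>R \<theta> \<notin> closure (C' i))"
    proof (cases "i < m")
      case True
      then have "x + 0 *\<^sub>R \<theta> \<in> C' i" using xi[of i] prev[of i] i by simp
      then show ?thesis by blast
    qed (use that i in auto)
  qed
  consider \<gamma> t v r where "\<gamma> t = x" "(\<gamma> has_vector_derivative v) (at t)" "v \<noteq> 0" "v \<bullet> n = 0"
      "eventually (\<lambda>u. \<gamma> u \<in> closure (C m)) (at t)" "f (x + r *\<^sub>R v) > 0"
    | n' z where "n $ 1 * n' $ 2 \<noteq> n $ 2 * n' $ 1" "\<forall>y\<in>C m. y \<bullet> n' \<le> x \<bullet> n'" "f z > 0"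
    using xn(2) unfolding L.visible_boundary_point_def by blast
  then show False
  proof cases
    case 1
    define n0 where "n0 = n /\<^sub>R norm n"
    define \<theta>0 where "\<theta>0 = v /\<^sub>R norm v"
    have n0: "norm n0 = 1" "norm \<theta>0 = 1" "n0 \<bullet> \<theta>0 = 0" "v \<bullet> n0 = 0"
      using n 1(3,4) by (simp_all add: n0_def \<theta>0_def inner_commute)
    \<comment> \<open>If the visible point of the tangent is \<open>x\<close> itself, continuity of
      \<open>f\<close> supplies another one at a non-zero parameter.\<close>
    obtain \<tau> where \<tau>: "\<tau> \<noteq> 0" "f (x + \<tau> *\<^sub>R \<theta>0) > 0"
    proof (cases "r = 0")
      case False
      have "(r * norm v) *\<^sub>R \<theta>0 = r *\<^sub>R v" using 1(3) by (simp add: \<theta>0_def)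
      then show thesis using that[of "r * norm v"] 1(3,6) False by simp
    next
      case True
      have "isCont f x"
        using C1_compact_support_continuous[OF f(1), of UNIV] by (simp add: continuous_on_eq_continuous_at)
      moreover have "f x > 0" using 1(6) True by simp
      ultimately obtain d where d: "d > 0" "\<And>y. dist y x < d \<Longrightarrow> \<bar>f y - f x\<bar> < f x"
        unfolding continuous_at_eps_delta dist_real_def by blast
      have "\<bar>f (x + (d / 2) *\<^sub>R \<theta>0) - f x\<bar> < f x"
        by (rule d(2)) (use d(1) n0(2) in \<open>simp add: dist_norm\<close>)
      then show thesis using that[of "d / 2"] d(1) by simp
    qed
    \<comment> \<open>The orientation that puts the visible point behind \<open>x\<close>, so that
      nearby chords of \<open>C m\<close> attenuate it.\<close>
    define \<theta> where "\<theta> = (if \<tau> > 0 then - \<theta>0 else \<theta>0)"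
    have fr: "norm n0 = 1" "norm \<theta> = 1" "n0 \<bullet> \<theta> = 0" using n0 by (auto simp: \<theta>_def)
    have pos: "f (x - \<bar>\<tau>\<bar> *\<^sub>R \<theta>) > 0" "\<bar>\<tau>\<bar> > 0" using \<tau> by (auto simp: \<theta>_def)
    have side: "\<forall>y\<in>C m. (y - x) \<bullet> n0 < 0"
    proof
      fix y assume y: "y \<in> C m"
      have "y \<bullet> n < x \<bullet> n" by (rule open_less_supporting_value[OF L.open_C[OF m] n nx y])
      then have "(y - x) \<bullet> n < 0" by (simp add: inner_diff_left)
      then show "(y - x) \<bullet> n0 < 0" using n by (simp add: n0_def mult_pos_neg)
    qed
    have "n \<bullet> \<theta> = 0" using fr(3) n by (simp add: n0_def)
    then have "x + t *\<^sub>R \<theta> \<notin> K" for t using Kn[of "x + t *\<^sub>R \<theta>"] by (auto simp: inner_add_left inner_add_right inner_commute)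
    then have "regular_line N' C' x \<theta>" by (intro reg') (use KC' in blast)
    from no_smooth_tangent[OF m fr x side pos this 1(1-3) n0(4) 1(5)] show False .
  next
    case 2
    define Z where "Z = (\<Union>j\<in>{1..N}. {z \<in> frontier (C j). \<not> arc_point (C j) z}) \<union>
      (\<Union>j\<in>{1..N'}. {z \<in> frontier (C' j). \<not> arc_point (C' j) z})"
    have Z: "finite Z" unfolding Z_def
      by (intro finite_UnI finite_UN_I finite_non_arc_points L.smooth_C L'.smooth_C) auto
    \<comment> \<open>Layers of index below \<open>m\<close> contain \<open>x\<close> and are
      crossed by every line through it. \<open>C m\<close> is left out because \<open>x\<close> lies
      in its closure; whether the line crosses it is decided by cases below.\<close>
    define \<A> where "\<A> = C ` {m<..N} \<union> C' ` {m..N'}"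
    have \<A>: "finite \<A>" "\<And>A. A \<in> \<A> \<Longrightarrow> open A" "\<And>A. A \<in> \<A> \<Longrightarrow> x \<notin> closure A"
    proof -
      show "finite \<A>" by (simp add: \<A>_def)
      show "open A" if "A \<in> \<A>" for A using that L.open_C L'.open_C m by (auto simp: \<A>_def)
      show "x \<notin> closure A" if A: "A \<in> \<A>" for A
      proof -
        consider i where "i \<in> {m<..N}" "A = C i" | i where "i \<in> {m..N'}" "A = C' i"
          using A unfolding \<A>_def by blast
        then show ?thesis
        proof cases
          case 1
          then have "closure A \<subseteq> C m" using L.nested_less[of m i] m by simp
          then show ?thesis using xc(2) by blast
        next
          case 2
          then have "closure A \<subseteq> K" using KC' by simp
          then show ?thesis using xK by blast
        qed
      qed
    qed
    have U: "open {y. f y > 0}" "{y. f y > 0} \<noteq> {}"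
      using 2(3) C1_compact_support_continuous[OF f(1), of UNIV] by (auto intro!: open_Collect_less continuous_intros)
    obtain \<theta> \<tau> where \<theta>: "norm \<theta> = 1" and \<tau>: "\<tau> > 0" "x - \<tau> *\<^sub>R \<theta> \<in> {y. f y > 0}"
      and gz: "\<And>z t. z \<in> Z \<Longrightarrow> z \<noteq> x \<Longrightarrow> x + t *\<^sub>R \<theta> \<noteq> z"
      and gA: "\<And>A. A \<in> \<A> \<Longrightarrow> (\<exists>t. x + t *\<^sub>R \<theta> \<in> A) \<or> (\<forall>t. x + t *\<^sub>R \<theta> \<notin> closure A)"
      by (rule generic_line_through[OF \<A> Z U]) (assumption, assumption, rule that)
    have pos: "f (x - \<tau> *\<^sub>R \<theta>) > 0" using \<tau>(2) by simp
    have r': "regular_line N' C' x \<theta>" by (rule reg', rule gA) (auto simp: \<A>_def)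
    have arc': "arc_point (C' j) (x + t *\<^sub>R \<theta>)" if j: "j \<in> {1..N'}" "x + t *\<^sub>R \<theta> \<in> frontier (C' j)" for j t
    proof (rule ccontr)
      assume "\<not> ?thesis"
      then have "x + t *\<^sub>R \<theta> \<in> Z" using j by (auto simp: Z_def)
      then have e: "x + t *\<^sub>R \<theta> = x" using gz by blast
      have xf: "x \<in> frontier (C' j)" using j(2) unfolding e .
      show False
      proof (cases "j < m")
        case True
        then show False using xf xi[of j] prev[of j] j(1) L'.frontier_C[OF j(1)] by auto
      next
        case False
        then show False using xf KC'[of j] xK j(1) by (auto simp: frontier_def)
      qed
    qed
    have arc: "arc_point (C j) (x + t *\<^sub>R \<theta>)"
      if j: "j \<in> {1..N}" "x + t *\<^sub>R \<theta> \<in> frontier (C j)" "j \<noteq> m \<or> t \<noteq> 0" for j t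
    proof (rule ccontr)
      assume "\<not> ?thesis"
      then have "x + t *\<^sub>R \<theta> \<in> Z" using j by (auto simp: Z_def)
      then have e: "x + t *\<^sub>R \<theta> = x" using gz by blast
      have xf: "x \<in> frontier (C j)" using j(2) unfolding e .
      have "t = 0" using e \<theta> by auto
      then consider "j < m" | "j > m" using j(3) by linarith
      then show False
      proof cases
        case 1
        then show False using xf xi[of j] j(1) L.frontier_C[OF j(1)] by auto
      next
        case 2
        then show False using xf L.nested_less[of m j] xc(2) j(1) m by (auto simp: frontier_def)
      qed
    qed
    show False
    proof (cases "\<exists>t. x + t *\<^sub>R \<theta> \<in> C m")
      case False
      define s where "s = (if \<forall>y\<in>C m. (y - x) \<bullet> perp \<theta> < 0 then 1 else - 1 :: real)"
      have "(\<forall>y\<in>C m. (y - x) \<bullet> perp \<theta> < 0) \<or> (\<forall>y\<in>C m. (y - x) \<bullet> perp \<theta> > 0)"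
        using one_sided[OF L.convex_C[OF m] L.open_C[OF m] L.bounded_C[OF m], of "perp \<theta>" \<theta> x] \<theta> False by auto
      then have side: "\<forall>y\<in>C m. (y - x) \<bullet> (s *\<^sub>R perp \<theta>) < 0" by (auto simp: s_def)
      have fr: "norm (s *\<^sub>R perp \<theta>) = 1" "norm \<theta> = 1" "(s *\<^sub>R perp \<theta>) \<bullet> \<theta> = 0" using \<theta> by (auto simp: s_def)
      show False
      proof (rule no_corner_support[OF m fr x side pos \<tau>(1) r'])
        show "arc_point (C j) (x + t *\<^sub>R \<theta>)" if "j \<in> {1..m - 1}" "x + t *\<^sub>R \<theta> \<in> frontier (C j)" for j t
          using that m by (intro arc) auto
      qed (rule arc')
    next
      case True
      then obtain p0 where p0: "x + p0 *\<^sub>R \<theta> \<in> C m" by blast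
      have fr: "norm (perp \<theta>) = 1" "norm \<theta> = 1" "perp \<theta> \<bullet> \<theta> = 0" using \<theta> by auto
      have reg: "regular_line N C x \<theta>"
        unfolding regular_line_def
      proof
        fix i assume i: "i \<in> {1..N}"
        consider "i < m" | "i = m" | "i > m" by linarith
        then show "(\<exists>t. x + t *\<^sub>R \<theta> \<in> C i) \<or> (\<forall>t. x + t *\<^sub>R \<theta> \<notin> closure (C i))"
        proof cases
          case 1
          then have "x + 0 *\<^sub>R \<theta> \<in> C i" using xi[of i] i by simp
          then show ?thesis by blast
        next
          case 3
          then show ?thesis using gA[of "C i"] i by (auto simp: \<A>_def)
        qed (use p0 in blast)
      qed
      obtain w k Kw e1 where w: "k > 0" "Kw \<ge> 0" "e1 > 0" "\<And>h. 0 < h \<Longrightarrow> h \<le> e1 \<Longrightarrow> w h \<le> - (k * h)"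
        "\<And>h. \<bar>h\<bar> \<le> e1 \<Longrightarrow> \<bar>w h\<bar> \<le> Kw * \<bar>h\<bar>"
        "AE t in lborel. ((\<lambda>h. (second_diff (\<lambda>h. ray_meas (slice (C m) x (perp \<theta>) \<theta>) h t) h - w h * indicator {..<0} t) / h) \<longlongrightarrow> 0) (at_right 0)"
      proof (rule ray_meas_kink[OF L.convex_C[OF m] L.open_C[OF m] L.bounded_C[OF m] fr p0 x nx _ 2(1)])
        show "y \<bullet> n' \<le> x \<bullet> n'" if "y \<in> C m" for y using 2(2) that by blast
        show "arc_point (C m) (x + t *\<^sub>R \<theta>)" if "t \<noteq> 0" "x + t *\<^sub>R \<theta> \<in> frontier (C m)" for t
          using that m by (intro arc) auto
      qed (assumption, rule that)
      let ?F = "\<lambda>h. layered_radon N c C f (x + h *\<^sub>R perp \<theta>) \<theta>"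
      let ?F' = "\<lambda>h. layered_radon N' c' C' f' (x + h *\<^sub>R perp \<theta>) \<theta>"
      define P where "P = (LINT t|lborel. indicator {..<0} t * (f (x + t *\<^sub>R \<theta>) * exp (- optical_depth N c C x \<theta> t)))"
      have F: "((\<lambda>h. (second_diff ?F h + c m * w h * P) / h) \<longlongrightarrow> 0) (at_right 0)"
        unfolding P_def
      proof (rule L.corner_crossing_second_diff[OF f(1) m fr reg _ w(3,5,6)])
        show "arc_point (C j) (x + t *\<^sub>R \<theta>)" if "j \<in> {1..N}" "j \<noteq> m" "x + t *\<^sub>R \<theta> \<in> frontier (C j)" for j t
          using that by (intro arc) auto
      qed
      have F': "((\<lambda>h. second_diff ?F' h / h) \<longlongrightarrow> 0) (at_right 0)"
        by (rule L'.layered_second_diff_smooth[OF fr f'(1) r' arc'])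
      obtain e4 where e4: "e4 > 0" "\<And>h. \<bar>h\<bar> \<le> e4 \<Longrightarrow> regular_line N C (x + h *\<^sub>R perp \<theta>) \<theta>"
        by (rule L.regular_line_nbhd[OF fr reg]) (rule that)
      obtain e5 where e5: "e5 > 0" "\<And>h. \<bar>h\<bar> \<le> e5 \<Longrightarrow> regular_line N' C' (x + h *\<^sub>R perp \<theta>) \<theta>"
        by (rule L'.regular_line_nbhd[OF fr r']) (rule that)
      define E where "E = min e1 (min e4 e5)"
      have E: "E > 0" using w e4 e5 by (simp add: E_def)
      have EE: "E \<le> e1" "E \<le> e4" "E \<le> e5" by (auto simp: E_def)
      have FF: "?F h = ?F' h" if "\<bar>h\<bar> \<le> E" for h
        using that EE by (intro data[OF \<theta> e4(2) e5(2)]) auto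
      have F0: "((\<lambda>h. (second_diff ?F h + (c m * P) * w h) / h) \<longlongrightarrow> 0) (at_right 0)"
        using F by (simp add: mult_ac)
      \<comment> \<open>The second pair is crossed in arc points only, so it has coefficient 0 at
        the kink, to be compared with \<open>c m * P\<close> for the first.\<close>
      have F0': "((\<lambda>h. (second_diff ?F' h + 0 * w h) / h) \<longlongrightarrow> 0) (at_right 0)"
        using F' by simp
      have "w h \<le> - (k * h)" if "0 < h" "h \<le> E" for h using w(4)[of h] that EE by simp
      from second_diff_coefficients_eq[OF w(1) E this F0 F0' FF] have "c m * P = 0" .
      moreover obtain Q where Q: "\<And>h t. \<bar>optical_depth N c C (x + h *\<^sub>R perp \<theta>) \<theta> t\<bar> \<le> Q"
        by (rule L.optical_depth_bounded[OF fr]) (rule that)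
      have "P > 0" unfolding P_def
        by (rule half_line_integral_pos[OF f \<theta> L.optical_depth_measurable[OF fr] _ pos \<tau>(1)])
           (use Q[of 0] in simp)
      ultimately show False using L.c_nz[OF m] by simp
    qed
  qed
qed

end

section \<open>Equality of the coefficients and of the sources\<close>

text \<open>\<open>?s z\<close> is the slope, with respect to \<open>a\<close> and
  \<open>perp a\<close>, of the direction in which \<open>z\<close> is seen from \<open>y\<close>;
  separation of \<open>y\<close> from the closure makes the denominator positive. A point of maximal
  slope lies on a tangent through \<open>y\<close>.\<close>

lemma tangent_from_point:
  fixes A :: "plane set"
  assumes A: "convex A" "open A" "bounded A" "A \<noteq> {}" and y: "y \<notin> closure A"
  obtains x n \<theta> \<tau> where "norm n = 1" "norm \<theta> = 1" "n \<bullet> \<theta> = 0" "\<tau> > 0" "y = x - \<tau> *\<^sub>R \<theta>"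
    "x \<in> frontier A" "\<forall>z\<in>A. (z - x) \<bullet> n < 0"
proof -
  obtain a b where ab: "a \<bullet> y < b" "\<forall>z\<in>closure A. b < a \<bullet> z"
    using separating_hyperplane_closed_point[OF convex_closure[OF A(1)] closed_closure y] by blast
  have pos: "(z - y) \<bullet> a > 0" if "z \<in> closure A" for z
    using ab(1) bspec[OF ab(2) that] by (simp add: inner_diff_left inner_diff_right inner_commute)
  let ?s = "\<lambda>z. ((z - y) \<bullet> perp a) / ((z - y) \<bullet> a)"
  have "compact (closure A)" using A(3) by simp
  moreover have "continuous_on (closure A) ?s"
  proof (intro continuous_intros ballI)
    show "(z - y) \<bullet> a \<noteq> 0" if "z \<in> closure A" for z using pos[OF that] by simp
  qed
  moreover have "closure A \<noteq> {}" using A(4) by simp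
  ultimately have "\<exists>x\<in>closure A. \<forall>z\<in>closure A. ?s z \<le> ?s x"
    using continuous_attains_sup[of "closure A" ?s] by blast
  then obtain x where x: "x \<in> closure A" "\<And>z. z \<in> closure A \<Longrightarrow> ?s z \<le> ?s x" by blast
  define n where "n = perp a - ?s x *\<^sub>R a"
  have xn: "(x - y) \<bullet> n = 0" using pos[OF x(1)] by (simp add: n_def inner_diff_right)
  have le: "(z - y) \<bullet> n \<le> 0" if z: "z \<in> closure A" for z
  proof -
    have "(z - y) \<bullet> perp a \<le> ?s x * ((z - y) \<bullet> a)" using x(2)[OF z] pos[OF z] by (simp add: pos_divide_le_eq)
    then show ?thesis by (simp add: n_def inner_diff_right)
  qed
  have "a \<noteq> 0" using pos[OF x(1)] by auto
  have nz: "n \<noteq> 0"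
  proof
    assume "n = 0"
    then have "perp a = ?s x *\<^sub>R a" by (simp add: n_def)
    from arg_cong[OF this, of "\<lambda>v. v \<bullet> perp a"] have "perp a \<bullet> perp a = ?s x * (a \<bullet> perp a)"
      by (simp only: inner_scaleR_left)
    moreover have "a \<bullet> perp a = 0" by (simp add: inner_plane perp_def)
    ultimately have "norm (perp a) = 0" by (simp add: norm_eq_sqrt_inner)
    then show False using \<open>a \<noteq> 0\<close> norm_perp[of a] by simp
  qed
  have xy: "x \<noteq> y" using x(1) y by blast
  define \<tau> where "\<tau> = norm (x - y)"
  define \<theta> where "\<theta> = (x - y) /\<^sub>R \<tau>"
  define n0 where "n0 = n /\<^sub>R norm n"
  have \<tau>: "\<tau> > 0" using xy by (simp add: \<tau>_def)
  have side: "(z - x) \<bullet> n < 0" if z: "z \<in> A" for z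
  proof -
    have "z \<bullet> n < x \<bullet> n"
    proof (rule open_less_supporting_value[OF A(2) nz _ z])
      fix w assume "w \<in> A"
      then have "(w - y) \<bullet> n \<le> (x - y) \<bullet> n" using le[of w] closure_subset xn by auto
      then show "w \<bullet> n \<le> x \<bullet> n" by (simp add: inner_diff_left)
    qed
    then show ?thesis by (simp add: inner_diff_left)
  qed
  show thesis
  proof (rule that[of n0 \<theta> \<tau> x])
    show "norm n0 = 1" using nz by (simp add: n0_def)
    show "norm \<theta> = 1" using \<tau> by (simp add: \<theta>_def \<tau>_def)
    show "n0 \<bullet> \<theta> = 0" using xn by (simp add: n0_def \<theta>_def inner_commute)
    show "y = x - \<tau> *\<^sub>R \<theta>" using \<tau> by (simp add: \<theta>_def)
    have "x \<notin> A" using side[of x] by auto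
    then show "x \<in> frontier A" using x(1) A(2) by (simp add: frontier_def interior_open)
    show "\<forall>z\<in>A. (z - x) \<bullet> n0 < 0" using side nz by (simp add: n0_def mult_pos_neg)
  qed (rule \<tau>)
qed

text \<open>By convexity with \<open>(0, 0)\<close>, a closure point on a nearby line at or before
  \<open>- \<tau> + \<delta>\<close> could be contracted towards the origin to a closure point near
  \<open>(0, - \<tau>)\<close>, and there are none.\<close>

lemma (in convex_body) chord_ahead:
  assumes z: "(0, 0) \<in> closure S" and y: "(0, - \<tau>) \<notin> closure S" "\<tau> > 0"
  obtains \<delta> e where "\<delta> > 0" "e > 0" "\<And>h t. \<bar>h\<bar> \<le> e \<Longrightarrow> (h, t) \<in> closure S \<Longrightarrow> - \<tau> + \<delta> < t"
proof -
  have "open (- closure S)" by (rule open_Compl) (rule closed_closure)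
  then obtain d where d: "d > 0" "ball (0, - \<tau>) d \<subseteq> - closure S"
    using y(1) openE[of "- closure S" "(0, - \<tau>)"] by blast
  show thesis
  proof (rule that[of "d / 2" "d / 2"])
    fix h t assume h: "\<bar>h\<bar> \<le> d / 2" and ht: "(h, t) \<in> closure S"
    show "- \<tau> + d / 2 < t"
    proof (rule ccontr)
      assume "\<not> - \<tau> + d / 2 < t"
      then have t: "t \<le> - \<tau> + d / 2" by simp
      \<comment> \<open>The contraction takes positions before \<open>- \<tau>\<close> exactly to
        \<open>- \<tau>\<close> and leaves the others fixed.\<close>
      define u where "u = (if t \<le> - \<tau> then \<tau> / \<bar>t\<bar> else 1)"
      have u: "0 \<le> u" "u \<le> 1" "- \<tau> \<le> u * t" "u * t \<le> - \<tau> + d / 2"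
      proof (atomize (full), cases "t \<le> - \<tau>")
        case True
        define r where "r = - t"
        have r: "t = - r" "\<tau> \<le> r" "r > 0" using True y(2) by (auto simp: r_def)
        have "u = \<tau> / r" using True r(1,3) by (simp add: u_def)
        then show "(0 \<le> u \<and> u \<le> 1) \<and> - \<tau> \<le> u * t \<and> u * t \<le> - \<tau> + d / 2"
          using y(2) d(1) r by simp
      next
        case False
        then show "(0 \<le> u \<and> u \<le> 1) \<and> - \<tau> \<le> u * t \<and> u * t \<le> - \<tau> + d / 2" using t by (simp add: u_def)
      qed
      have "(1 - u) *\<^sub>R (0, 0) + u *\<^sub>R (h, t) \<in> closure S"
        using convexD[OF convex_closure[OF convex] z ht, of "1 - u" u] u by simp
      then have m: "(u * h, u * t) \<in> closure S" by simp
      have b1: "\<bar>u * h\<bar> \<le> d / 2" using mult_mono[of u 1 "\<bar>h\<bar>" "d / 2"] u h by (simp add: abs_mult)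
      have b2: "\<bar>u * t + \<tau>\<bar> \<le> d / 2" using u d(1) by (simp add: abs_le_iff)
      have "dist (0, - \<tau>) (u * h, u * t) < d"
      proof -
        have "(dist (0, - \<tau>) (u * h, u * t))^2 = \<bar>u * h\<bar>^2 + \<bar>u * t + \<tau>\<bar>^2"
          unfolding dist_Pair_Pair by (simp add: dist_real_def) (simp add: power2_eq_square algebra_simps)
        also have "\<dots> \<le> (d / 2)^2 + (d / 2)^2"
          by (intro add_mono power_mono b1 b2) auto
        also have "\<dots> < d^2" using d(1) by (simp add: power2_eq_square)
        finally show ?thesis using d(1) by (simp add: power2_less_imp_less)
      qed
      then show False using d(2) m by (auto simp: subset_iff)
    qed
  qed (use d in auto)
qed

section \<open>Two pairs with common layers\<close>

locale same_shape = layered_pair N c C N c' C f f' for N c C c' f f'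
begin

lemma common_depth:
  assumes "k \<le> N" "\<And>i. i \<in> {1..k} \<Longrightarrow> c i = c' i"
  shows "optical_depth k c C p \<theta> t = optical_depth k c' C p \<theta> t"
  unfolding optical_depth_def using assms(2) by (intro sum.cong) auto

lemma difference_C1: "C1_compact_support (\<lambda>x. f x - f' x)"
proof -
  obtain d d' :: "plane \<Rightarrow> plane \<Rightarrow>\<^sub>L real" where d: "\<And>x. (f has_derivative blinfun_apply (d x)) (at x)" "continuous_on UNIV d"
    "\<And>x. (f' has_derivative blinfun_apply (d' x)) (at x)" "continuous_on UNIV d'"
    using f(1) f'(1) unfolding C1_compact_support_def by blast
  have "compact (closure {x. f x \<noteq> 0})" "compact (closure {x. f' x \<noteq> 0})"
    using f(1) f'(1) unfolding C1_compact_support_def by auto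
  then have "bounded ({x. f x \<noteq> 0} \<union> {x. f' x \<noteq> 0})" by simp
  then have "bounded {x. f x - f' x \<noteq> 0}" by (rule bounded_subset) auto
  then have "compact (closure {x. f x - f' x \<noteq> 0})" by simp
  moreover have "((\<lambda>x. f x - f' x) has_derivative blinfun_apply (d x - d' x)) (at x)" for x
    using has_derivative_diff[OF d(1)[of x] d(3)[of x]] by (simp add: minus_blinfun.rep_eq)
  moreover have "continuous_on UNIV (\<lambda>x. d x - d' x)" by (intro continuous_intros d)
  ultimately show ?thesis
    unfolding C1_compact_support_def by (intro conjI exI[of _ "\<lambda>x. d x - d' x"] allI)
qed

text \<open>As \<open>C m\<close> is regular open, its complement is the closure of the exterior, to
  which an equality of continuous functions extends.\<close>

lemma difference_zero_on_frontier:
  assumes m: "m \<in> {1..N}" and out: "\<And>x. x \<notin> closure (C m) \<Longrightarrow> f x = f' x" and x: "x \<notin> C m"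
  shows "f x = f' x"
proof -
  have "x \<in> closure (- closure (C m))"
    using x L.interior_closure_C[OF m] by (simp add: closure_complement)
  moreover have "closure (- closure (C m)) \<subseteq> {x. f x = f' x}"
  proof (rule closure_minimal)
    show "closed {x. f x = f' x}"
      using C1_compact_support_continuous[OF f(1), of UNIV] C1_compact_support_continuous[OF f'(1), of UNIV]
      by (rule closed_Collect_eq)
  qed (use out in auto)
  ultimately show ?thesis by blast
qed

text \<open>Replacing \<open>c m\<close> by \<open>c' m\<close> in the transform of \<open>f\<close>
  changes it by at least a multiple of the chord length. Replacing \<open>f\<close> by
  \<open>f'\<close> changes it by at most the chord length times \<open>O(h)\<close>: the difference
  is Lipschitz, vanishes on the tangent, and vanishes off the chord. Division by the length bounds a
  positive constant by \<open>O(h)\<close>.\<close>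

lemma coefficient_eq_exterior:
  assumes m: "m \<in> {1..N}" and prev: "\<And>i. i \<in> {1..<m} \<Longrightarrow> c i = c' i"
    and out: "\<And>x. x \<notin> closure (C m) \<Longrightarrow> f x = f' x" and y: "y \<notin> closure (C m)" "f y > 0"
  shows "c m = c' m"
proof (rule ccontr)
  assume ne: "c m \<noteq> c' m"
  obtain x n \<theta> \<tau> where fr: "norm n = 1" "norm \<theta> = 1" "n \<bullet> \<theta> = 0" and \<tau>: "\<tau> > 0" "y = x - \<tau> *\<^sub>R \<theta>"
    and x: "x \<in> frontier (C m)" and side: "\<forall>z\<in>C m. (z - x) \<bullet> n < 0"
    by (rule tangent_from_point[OF L.convex_C[OF m] L.open_C[OF m] L.bounded_C[OF m] L.ne_C[OF m] y(1)]) (rule that)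
  let ?S = "slice (C m) x n \<theta>"
  interpret S: convex_body ?S by (rule L.slice_layer[OF fr m])
  have m1: "m - 1 \<le> N" using m by auto
  interpret L0: nested_layers "m - 1" c C by (rule L.sublayers[OF m1])
  have neg: "h < 0" if "(h, t) \<in> ?S" for h t
    using bspec[OF side, of "x + h *\<^sub>R n + t *\<^sub>R \<theta>"] that frame_inner[OF fr] by (simp add: mem_slice inner_add_left)
  have z: "(0, 0) \<in> closure ?S" using x by (simp add: mem_closure_slice[OF fr] frontier_def)
  have yS: "(0, - \<tau>) \<notin> closure ?S" using y(1) \<tau>(2) by (simp add: mem_closure_slice[OF fr])
  obtain \<delta> e1 where \<delta>: "\<delta> > 0" "e1 > 0" "\<And>h t. \<bar>h\<bar> \<le> e1 \<Longrightarrow> (h, t) \<in> closure ?S \<Longrightarrow> - \<tau> + \<delta> < t"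
    by (rule S.chord_ahead[OF z yS \<tau>(1)]) (rule that)
  note near = regular_line_near_support[OF m fr x side]
  obtain e2 where e2: "e2 > 0" "\<And>h. 0 < \<bar>h\<bar> \<Longrightarrow> \<bar>h\<bar> \<le> e2 \<Longrightarrow> regular_line N C (x + h *\<^sub>R n) \<theta>"
    using near(3) by blast
  obtain e3 where e3: "e3 > 0" "\<And>h t. \<bar>h\<bar> \<le> e3 \<Longrightarrow> optical_depth N c C (x + h *\<^sub>R n) \<theta> t =
     optical_depth (m - 1) c C (x + h *\<^sub>R n) \<theta> t + c m * ray_meas ?S h t"
    by (rule L.optical_depth_split[OF fr m near(2)[rule_format]]) (assumption, rule that)
  obtain e4 where e4: "e4 > 0" "\<And>h t. \<bar>h\<bar> \<le> e4 \<Longrightarrow> optical_depth N c' C (x + h *\<^sub>R n) \<theta> t =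
     optical_depth (m - 1) c' C (x + h *\<^sub>R n) \<theta> t + c' m * ray_meas ?S h t"
    by (rule L'.optical_depth_split[OF fr m near(2)[rule_format]]) (assumption, rule that)
  obtain Q where Q: "\<And>h t. \<bar>optical_depth (m - 1) c C (x + h *\<^sub>R n) \<theta> t\<bar> \<le> Q"
    by (rule L0.optical_depth_bounded[OF fr]) (rule that)
  obtain M where M: "\<And>h t. ray_meas ?S h t \<le> M" using S.ray_meas_bound by blast
  let ?q = "\<lambda>h. optical_depth (m - 1) c C (x + h *\<^sub>R n) \<theta>"
  let ?pt = "\<lambda>h t. x + h *\<^sub>R n + t *\<^sub>R \<theta>"
  have pos: "f (x - \<tau> *\<^sub>R \<theta>) > 0" using y(2) \<tau>(2) by simp
  \<comment> \<open>Taking \<open>\<delta>\<close> as the tolerance gives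
    \<open>\<tau> - \<delta> < \<tau>1\<close>: the chords lie entirely ahead of
    \<open>- \<tau>1\<close>, and \<open>ray_meas\<close> at that position is their full
    length.\<close>
  obtain \<kappa> \<tau>1 e5 where k: "\<kappa> > 0" "\<tau>1 > 0" "\<tau> - \<delta> < \<tau>1" "e5 > 0" "\<And>h. \<bar>h\<bar> \<le> e5 \<Longrightarrow>
    \<kappa> * ray_meas ?S h (- \<tau>1) \<le> \<bar>(LINT t|lborel. f (?pt h t) * exp (- (?q h t + c m * ray_meas ?S h t)))
       - (LINT t|lborel. f (?pt h t) * exp (- (?q h t + c' m * ray_meas ?S h t)))\<bar>"
  proof (rule attenuation_difference_ge[where n = n and q = ?q and r = "ray_meas ?S" and Q = Q and M = M and a = "c m" and b = "c' m" and ?\<epsilon>0.0 = \<delta>])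
    show "?q h \<in> borel_measurable borel" for h by (rule L0.optical_depth_measurable[OF fr])
  qed (rule f fr pos \<tau>(1) Q M \<delta>(1) ne S.ray_meas_measurable S.ray_meas_nonneg S.ray_meas_antimono that; assumption?)+
  obtain k0 e6 where "k0 > 0" and e6: "e6 > 0" and "\<And>h. 0 < h \<Longrightarrow> h \<le> e6 \<Longrightarrow> k0 * h \<le> ray_meas ?S (- h) (- \<tau>)"
    and e6': "\<And>h. 0 < h \<Longrightarrow> h \<le> e6 \<Longrightarrow> \<exists>t. (- h, t) \<in> ?S"
    by (rule S.ray_meas_linear_growth[where ?t1.0 = "- \<tau>", OF neg z]) (assumption, simp add: \<tau>, rule that)
  obtain Mg Lg Rg where g: "Lg > 0" "\<And>x y. \<bar>(f x - f' x) - (f y - f' y)\<bar> \<le> Lg * norm (x - y)"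
    by (rule C1_compact_support_bounds[OF difference_C1]) blast
  define Q' where "Q' = Q + \<bar>c' m\<bar> * M"
  define E where "E = min (min e1 e2) (min (min e3 e4) (min e5 e6))"
  have E: "E > 0" using \<delta> e2 e3 e4 k e6 by (simp add: E_def)
  have EE: "E \<le> e1" "E \<le> e2" "E \<le> e3" "E \<le> e4" "E \<le> e5" "E \<le> e6" by (auto simp: E_def)
  have line0: "f (?pt 0 t) = f' (?pt 0 t)" for t
  proof (rule difference_zero_on_frontier[OF m out])
    show "?pt 0 t \<notin> C m" using bspec[OF side, of "?pt 0 t"] fr(3) by (auto simp: inner_commute)
  qed
  have upper: "\<kappa> \<le> exp Q' * (Lg * h)" if h: "0 < h" "h \<le> E" for h
  proof -
    let ?h = "- h"
    have hh: "0 < \<bar>?h\<bar>" "\<bar>?h\<bar> \<le> E" using h by auto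
    obtain p0 where p0: "(?h, p0) \<in> ?S" using e6'[OF h(1)] h(2) EE by auto
    let ?B = "chord_bot ?S ?h" and ?T = "chord_top ?S ?h"
    have lt: "?B < ?T" using S.less_chord_top[OF p0] S.chord_bot_less[OF p0] by simp
    have "- \<tau> + \<delta> < ?B" using \<delta>(3)[of ?h] S.chord_bot_in_closure[OF p0] hh EE by auto
    then have "- \<tau>1 \<le> ?B" using k(3) by simp
    then have rho: "ray_meas ?S ?h (- \<tau>1) = ?T - ?B" unfolding S.ray_meas_chord[OF p0] using lt by simp
    have ib: "\<bar>?q ?h t + c' m * ray_meas ?S ?h t\<bar> \<le> Q'" for t
      unfolding Q'_def using Q[of ?h t] mult_left_mono[OF M[of ?h t], of "\<bar>c' m\<bar>"] S.ray_meas_nonneg[of ?h t]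
      by (intro order_trans[OF abs_triangle_ineq] add_mono) (auto simp: abs_mult)
    have im: "(\<lambda>t. ?q ?h t + c' m * ray_meas ?S ?h t) \<in> borel_measurable borel"
      by (intro borel_measurable_add borel_measurable_times borel_measurable_const S.ray_meas_measurable L0.optical_depth_measurable[OF fr])
    let ?E = "\<lambda>t. exp (- (?q ?h t + c' m * ray_meas ?S ?h t))"
    have i1: "integrable lborel (\<lambda>t. f (?pt ?h t) * ?E t)"
      and i2: "integrable lborel (\<lambda>t. f' (?pt ?h t) * ?E t)"
      by (rule integrable_radon[OF f(1) fr(2) im ib] integrable_radon[OF f'(1) fr(2) im ib])+
    have F: "layered_radon N c C f (x + ?h *\<^sub>R n) \<theta> = (LINT t|lborel. f (?pt ?h t) * exp (- (?q ?h t + c m * ray_meas ?S ?h t)))"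
      using e3(2)[of ?h] hh EE by (simp add: layered_radon_def)
    have cd: "optical_depth (m - 1) c' C p \<theta> t = optical_depth (m - 1) c C p \<theta> t" for p t
      by (rule common_depth[symmetric]) (use m prev in auto)
    have F': "layered_radon N c' C f' (x + ?h *\<^sub>R n) \<theta> = (LINT t|lborel. f' (?pt ?h t) * ?E t)"
    proof -
      have "\<bar>?h\<bar> \<le> e4" using hh EE by simp
      then show ?thesis unfolding layered_radon_def by (simp only: e4(2) cd)
    qed
    have FF: "layered_radon N c C f (x + ?h *\<^sub>R n) \<theta> = layered_radon N c' C f' (x + ?h *\<^sub>R n) \<theta>"
      using hh EE by (intro data fr e2) auto
    have "\<kappa> * ray_meas ?S ?h (- \<tau>1) \<le> \<bar>(LINT t|lborel. f (?pt ?h t) * exp (- (?q ?h t + c m * ray_meas ?S ?h t)))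
       - (LINT t|lborel. f (?pt ?h t) * ?E t)\<bar>"
      using hh EE by (intro k(5)) auto
    also have "\<dots> = \<bar>(LINT t|lborel. f (?pt ?h t) * ?E t)
       - (LINT t|lborel. f' (?pt ?h t) * ?E t)\<bar>"
      unfolding F[symmetric] FF F'[symmetric] by (rule abs_minus_commute)
    also have "\<dots> = \<bar>LINT t|lborel. (f (?pt ?h t) * ?E t - f' (?pt ?h t) * ?E t)\<bar>"
      by (subst Bochner_Integration.integral_diff[OF i1 i2]) simp
    also have "\<dots> \<le> (LINT t|lborel. \<bar>f (?pt ?h t) * ?E t - f' (?pt ?h t) * ?E t\<bar>)"
      by (rule integral_abs_bound)
    also have "\<dots> \<le> (LINT t|lborel. (exp Q' * (Lg * h)) * indicator {?B..?T} t)"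
    proof (intro integral_mono integrable_abs Bochner_Integration.integrable_diff i1 i2 integrable_const_indicator_Icc)
      fix t
      have fac: "\<bar>f (?pt ?h t) * ?E t - f' (?pt ?h t) * ?E t\<bar>
        = ?E t * \<bar>f (?pt ?h t) - f' (?pt ?h t)\<bar>"
        by (simp add: abs_mult mult.commute flip: left_diff_distrib)
      show "\<bar>f (?pt ?h t) * ?E t - f' (?pt ?h t) * ?E t\<bar>
        \<le> (exp Q' * (Lg * h)) * indicator {?B..?T} t"
      proof (cases "t \<in> {?B..?T}")
        case True
        have "\<bar>f (?pt ?h t) - f' (?pt ?h t)\<bar> \<le> Lg * h"
          using g(2)[of "?pt ?h t" "?pt 0 t"] line0[of t] fr(1) h(1) by simp
        moreover have "?E t \<le> exp Q'" using ib[of t] by simp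
        ultimately show ?thesis unfolding fac using True by (simp add: mult_mono)
      next
        case False
        have "(?h, t) \<notin> closure ?S"
          using False S.closure_le_chord_top[OF _ p0] S.closure_ge_chord_bot[OF _ p0] by auto
        then have "?pt ?h t \<notin> closure (C m)" by (simp add: mem_closure_slice[OF fr])
        then show ?thesis unfolding fac using out[of "?pt ?h t"] False by simp
      qed
    qed
    also have "\<dots> = (exp Q' * (Lg * h)) * (?T - ?B)" using lt by simp
    finally show ?thesis unfolding rho using lt by simp
  qed
  \<comment> \<open>Small enough for the upper bound on \<open>\<kappa>\<close> to be at most
    \<open>\<kappa> / 2\<close>.\<close>
  define h where "h = min E (\<kappa> / (2 * exp Q' * Lg))"
  have h: "0 < h" "h \<le> E" using E k(1) g(1) by (auto simp: h_def)
  have "h \<le> \<kappa> / (2 * exp Q' * Lg)" by (simp add: h_def)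
  then have "2 * (exp Q' * (Lg * h)) \<le> \<kappa>" using g(1) by (simp add: pos_le_divide_eq mult_ac)
  then show False using upper[OF h] k(1) by simp
qed

text \<open>With the source inside \<open>C m\<close> no supporting line meets
  \<open>{f > 0}\<close>, so the visible point has two independent supporting normals. A line from
  the source through this point does not re-enter \<open>C m\<close>, by convexity; the integral
  over \<open>t < 0\<close> is then all of the data, hence the same number \<open>P\<close> for both
  pairs.\<close>

lemma coefficient_eq_interior:
  assumes m: "m \<in> {1..N}" and out: "\<And>x. x \<notin> closure (C m) \<Longrightarrow> f x = f' x"
    and f0: "\<And>x. x \<notin> closure (C m) \<Longrightarrow> f x = 0"
  shows "c m = c' m"
proof -
  have op: "open {y. f y > 0}"
    using C1_compact_support_continuous[OF f(1), of UNIV] by (auto intro!: open_Collect_less continuous_intros)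
  have "{y. f y > 0} \<subseteq> closure (C m)"
  proof
    fix y assume "y \<in> {y. f y > 0}"
    then show "y \<in> closure (C m)" using f0[of y] by (cases "y \<in> closure (C m)") auto
  qed
  then have "{y. f y > 0} \<subseteq> interior (closure (C m))" by (rule interior_maximal) (rule op)
  then have sub: "{y. f y > 0} \<subseteq> C m" by (simp add: L.interior_closure_C[OF m])
  have fz: "f y = 0" "f' y = 0" if y: "y \<notin> C m" for y
  proof -
    have "\<not> f y > 0" using sub y by blast
    then show "f y = 0" using f(2)[of y] by simp
    then show "f' y = 0" using difference_zero_on_frontier[OF m out y] by simp
  qed
  obtain x n where xn: "L.visible_boundary_point m f x n"
    using visible[OF m, of UNIV] by auto
  have x: "x \<in> frontier (C m)" and n: "n \<noteq> 0" and nx: "\<And>y. y \<in> C m \<Longrightarrow> y \<bullet> n \<le> x \<bullet> n"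
    using xn unfolding L.visible_boundary_point_def by auto
  have xc: "x \<in> closure (C m)" "x \<notin> C m" using x L.frontier_C[OF m] by auto
  have xi: "x \<in> C i" if "i \<in> {1..<m}" for i using L.nested_less[of i m] that m xc by auto
  have "\<not> f (x + r *\<^sub>R v) > 0" if v: "v \<bullet> n = 0" for r v
  proof
    assume "f (x + r *\<^sub>R v) > 0"
    then have "x + r *\<^sub>R v \<in> C m" using sub by blast
    from open_less_supporting_value[OF L.open_C[OF m] n nx this] show False using v by (simp add: inner_add_left)
  qed
  then obtain n' z where nn: "n $ 1 * n' $ 2 \<noteq> n $ 2 * n' $ 1" "\<forall>y\<in>C m. y \<bullet> n' \<le> x \<bullet> n'" "f z > 0"
    using xn unfolding L.visible_boundary_point_def by blast
  define Z where "Z = (\<Union>j\<in>{1..N}. {z \<in> frontier (C j). \<not> arc_point (C j) z})"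
  have Z: "finite Z" unfolding Z_def by (intro finite_UN_I finite_non_arc_points L.smooth_C) auto
  have far: "x \<notin> closure (C i)" if i: "i \<in> {m<..N}" for i
    using L.nested_less[of m i] m xc(2) i by auto
  define \<A> where "\<A> = C ` {m<..N}"
  have \<A>: "finite \<A>" "\<And>A. A \<in> \<A> \<Longrightarrow> open A" "\<And>A. A \<in> \<A> \<Longrightarrow> x \<notin> closure A"
    using L.open_C m far by (auto simp: \<A>_def)
  have ne: "{y. f y > 0} \<noteq> {}" using nn(3) by blast
  obtain \<theta> \<tau> where \<theta>: "norm \<theta> = 1" and \<tau>: "\<tau> > 0" "x - \<tau> *\<^sub>R \<theta> \<in> {y. f y > 0}"
    and gz: "\<And>z t. z \<in> Z \<Longrightarrow> z \<noteq> x \<Longrightarrow> x + t *\<^sub>R \<theta> \<noteq> z"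
    and gA: "\<And>A. A \<in> \<A> \<Longrightarrow> (\<exists>t. x + t *\<^sub>R \<theta> \<in> A) \<or> (\<forall>t. x + t *\<^sub>R \<theta> \<notin> closure A)"
    by (rule generic_line_through[OF \<A> Z op ne]) (assumption, assumption, rule that)
  have pos: "f (x - \<tau> *\<^sub>R \<theta>) > 0" using \<tau>(2) by simp
  have behind: "x - \<tau> *\<^sub>R \<theta> \<in> C m" using \<tau>(2) sub by blast
  then have p0: "x + (- \<tau>) *\<^sub>R \<theta> \<in> C m" by simp
  have ahead: "x + t *\<^sub>R \<theta> \<notin> C m" if t: "t \<ge> 0" for t
  proof
    assume "x + t *\<^sub>R \<theta> \<in> C m"
    from convexD[OF L.convex_C[OF m] behind this, of "t / (t + \<tau>)" "\<tau> / (t + \<tau>)"] t \<tau>(1)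
    have "(t / (t + \<tau>)) *\<^sub>R (x - \<tau> *\<^sub>R \<theta>) + (\<tau> / (t + \<tau>)) *\<^sub>R (x + t *\<^sub>R \<theta>) \<in> C m"
      by (simp flip: add_divide_distrib)
    also have "(t / (t + \<tau>)) *\<^sub>R (x - \<tau> *\<^sub>R \<theta>) + (\<tau> / (t + \<tau>)) *\<^sub>R (x + t *\<^sub>R \<theta>) = (t / (t + \<tau>) + \<tau> / (t + \<tau>)) *\<^sub>R x"
      by (simp add: algebra_simps)
    also have "t / (t + \<tau>) + \<tau> / (t + \<tau>) = 1" using t \<tau>(1) by (simp flip: add_divide_distrib)
    finally show False using xc(2) by simp
  qed
  have fr: "norm (perp \<theta>) = 1" "norm \<theta> = 1" "perp \<theta> \<bullet> \<theta> = 0" using \<theta> by auto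
  have reg: "regular_line N C x \<theta>"
    unfolding regular_line_def
  proof
    fix i assume i: "i \<in> {1..N}"
    consider "i < m" | "i = m" | "i > m" by linarith
    then show "(\<exists>t. x + t *\<^sub>R \<theta> \<in> C i) \<or> (\<forall>t. x + t *\<^sub>R \<theta> \<notin> closure (C i))"
    proof cases
      case 1
      then have "x + 0 *\<^sub>R \<theta> \<in> C i" using xi[of i] i by simp
      then show ?thesis by blast
    next
      case 3
      then show ?thesis using gA[of "C i"] i by (auto simp: \<A>_def)
    qed (use p0 in blast)
  qed
  have arc: "arc_point (C j) (x + t *\<^sub>R \<theta>)"
    if j: "j \<in> {1..N}" "x + t *\<^sub>R \<theta> \<in> frontier (C j)" "j \<noteq> m \<or> t \<noteq> 0" for j t
  proof (rule ccontr)
    assume "\<not> ?thesis"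
    then have "x + t *\<^sub>R \<theta> \<in> Z" using j by (auto simp: Z_def)
    then have e: "x + t *\<^sub>R \<theta> = x" using gz by blast
    have xf: "x \<in> frontier (C j)" using j(2) unfolding e .
    have "t = 0" using e \<theta> by auto
    then consider "j < m" | "j > m" using j(3) by linarith
    then show False
    proof cases
      case 1
      then show False using xf xi[of j] j(1) L.frontier_C[OF j(1)] by auto
    next
      case 2
      then show False using xf far[of j] j(1) by (auto simp: frontier_def)
    qed
  qed
  have arcj: "arc_point (C j) (x + t *\<^sub>R \<theta>)" if "j \<in> {1..N}" "j \<noteq> m" "x + t *\<^sub>R \<theta> \<in> frontier (C j)" for j t
    using that by (intro arc) auto
  obtain w k Kw e1 where w: "k > 0" "Kw \<ge> 0" "e1 > 0" "\<And>h. 0 < h \<Longrightarrow> h \<le> e1 \<Longrightarrow> w h \<le> - (k * h)"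
    "\<And>h. \<bar>h\<bar> \<le> e1 \<Longrightarrow> \<bar>w h\<bar> \<le> Kw * \<bar>h\<bar>"
    "AE t in lborel. ((\<lambda>h. (second_diff (\<lambda>h. ray_meas (slice (C m) x (perp \<theta>) \<theta>) h t) h - w h * indicator {..<0} t) / h) \<longlongrightarrow> 0) (at_right 0)"
  proof (rule ray_meas_kink[OF L.convex_C[OF m] L.open_C[OF m] L.bounded_C[OF m] fr p0 x nx _ nn(1)])
    show "y \<bullet> n' \<le> x \<bullet> n'" if "y \<in> C m" for y using nn(2) that by blast
    show "arc_point (C m) (x + t *\<^sub>R \<theta>)" if "t \<noteq> 0" "x + t *\<^sub>R \<theta> \<in> frontier (C m)" for t
      using that m by (intro arc) auto
  qed (assumption, rule that)
  let ?F = "\<lambda>h. layered_radon N c C f (x + h *\<^sub>R perp \<theta>) \<theta>"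
  let ?F' = "\<lambda>h. layered_radon N c' C f' (x + h *\<^sub>R perp \<theta>) \<theta>"
  define P where "P = (LINT t|lborel. indicator {..<0} t * (f (x + t *\<^sub>R \<theta>) * exp (- optical_depth N c C x \<theta> t)))"
  define P' where "P' = (LINT t|lborel. indicator {..<0} t * (f' (x + t *\<^sub>R \<theta>) * exp (- optical_depth N c' C x \<theta> t)))"
  have "P = layered_radon N c C f x \<theta>"
    unfolding P_def layered_radon_def
    by (intro Bochner_Integration.integral_cong refl) (use ahead fz(1) in \<open>auto simp: indicator_def not_less\<close>)
  also have "\<dots> = layered_radon N c' C f' x \<theta>" by (rule data[OF \<theta> reg reg])
  also have "\<dots> = P'"
    unfolding P'_def layered_radon_def
    by (intro Bochner_Integration.integral_cong refl) (use ahead fz(2) in \<open>auto simp: indicator_def not_less\<close>)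
  finally have PP: "P' = P" by simp
  have F: "((\<lambda>h. (second_diff ?F h + c m * w h * P) / h) \<longlongrightarrow> 0) (at_right 0)"
    unfolding P_def by (rule L.corner_crossing_second_diff[OF f(1) m fr reg arcj w(3,5,6)]) assumption+
  have F': "((\<lambda>h. (second_diff ?F' h + c' m * w h * P) / h) \<longlongrightarrow> 0) (at_right 0)"
    unfolding PP[symmetric] P'_def by (rule L'.corner_crossing_second_diff[OF f'(1) m fr reg arcj w(3,5,6)]) assumption+
  obtain e2 where e2: "e2 > 0" "\<And>h. \<bar>h\<bar> \<le> e2 \<Longrightarrow> regular_line N C (x + h *\<^sub>R perp \<theta>) \<theta>"
    by (rule L.regular_line_nbhd[OF fr reg]) (rule that)
  define E where "E = min e1 e2"
  have E: "E > 0" "E \<le> e1" "E \<le> e2" using w e2 by (auto simp: E_def)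
  have FF: "?F h = ?F' h" if "\<bar>h\<bar> \<le> E" for h
    using that E by (intro data[OF \<theta> e2(2) e2(2)]) auto
  have F0: "((\<lambda>h. (second_diff ?F h + (c m * P) * w h) / h) \<longlongrightarrow> 0) (at_right 0)"
    using F by (simp add: mult_ac)
  have F0': "((\<lambda>h. (second_diff ?F' h + (c' m * P) * w h) / h) \<longlongrightarrow> 0) (at_right 0)"
    using F' by (simp add: mult_ac)
  have "w h \<le> - (k * h)" if "0 < h" "h \<le> E" for h using w(4)[of h] that E by simp
  from second_diff_coefficients_eq[OF w(1) E(1) this F0 F0' FF] have "c m * P = c' m * P" .
  moreover obtain Q where Q: "\<And>h t. \<bar>optical_depth N c C (x + h *\<^sub>R perp \<theta>) \<theta> t\<bar> \<le> Q"
    by (rule L.optical_depth_bounded[OF fr]) (rule that)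
  have "P > 0" unfolding P_def
    by (rule half_line_integral_pos[OF f \<theta> L.optical_depth_measurable[OF fr] _ pos \<tau>(1)])
       (use Q[of 0] in simp)
  ultimately show ?thesis by simp
qed

text \<open>A point of the line where the sources differ lies in the closure of every layer of index
  below \<open>m\<close>, whose part ahead of it has length \<open>chord_top - t\<close>; so the
  depth is affine with slope \<open>- \<mu>\<close> there. For \<open>m = N + 1\<close> no layer is
  left, \<open>K\<close> is empty, and the equality holds everywhere.\<close>

lemma difference_supported:
  assumes m: "m \<in> {1..N + 1}" and prev: "\<And>i. i \<in> {1..<m} \<Longrightarrow> c i = c' i"
    and out: "\<And>x. 2 \<le> m \<Longrightarrow> x \<notin> closure (C (m - 1)) \<Longrightarrow> f x = f' x"
    and x: "m \<le> N \<Longrightarrow> x \<notin> closure (C m)"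
  shows "f x = f' x"
proof -
  define K where "K = (if m \<le> N then closure (C m) else {})"
  let ?g = "\<lambda>x. f x - f' x"
  obtain g' :: "plane \<Rightarrow> plane \<Rightarrow>\<^sub>L real" where der: "\<And>x. (?g has_derivative blinfun_apply (g' x)) (at x)"
    and cont: "continuous_on UNIV g'"
    using difference_C1 unfolding C1_compact_support_def by blast
  obtain R where R: "R > 0" "\<And>x. norm x \<ge> R \<Longrightarrow> ?g x = 0"
    by (rule C1_compact_support_bounds[OF difference_C1]) (rule that)
  define \<mu> where "\<mu> = (\<Sum>i\<in>{1..m - 1}. c i)"
  have K: "compact K" "convex K"
    using L.bounded_C L.convex_C m by (auto simp: K_def convex_closure)
  have "?g x = 0"
  proof (rule exponential_radon_support[OF der cont R(2) R(1) K])
    show "x \<notin> K" using x by (simp add: K_def)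
    fix s w assume miss: "\<forall>t. line_pt s w t \<notin> K"
    define p where "p = s *\<^sub>R perp (dir w)"
    define \<theta> where "\<theta> = dir w"
    have lp: "line_pt s w t = p + t *\<^sub>R \<theta>" for t by (simp add: line_pt_def p_def \<theta>_def)
    have fr: "norm (perp \<theta>) = 1" "norm \<theta> = 1" "perp \<theta> \<bullet> \<theta> = 0" by (simp_all add: \<theta>_def)
    have inner: "p + t *\<^sub>R \<theta> \<notin> closure (C i)" if i: "i \<in> {m..N}" for i t
    proof -
      have "C i \<subseteq> C m" using L.nested_le[of m i] i m by simp
      then have "closure (C i) \<subseteq> K" using i by (simp add: K_def closure_mono)
      then show ?thesis using miss unfolding lp by blast
    qed
    \<comment> \<open>A line missing \<open>C (m - 1)\<close> carries no difference of the sources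
      at all. Any other line missing \<open>K\<close> crosses all layers of index below
      \<open>m\<close> and is regular, so the data are available on it.\<close>
    show "integral {-R..R} (\<lambda>t. exp (\<mu> * t) * ?g (line_pt s w t)) = 0"
    proof (cases "2 \<le> m \<and> (\<forall>t. p + t *\<^sub>R \<theta> \<notin> C (m - 1))")
      case True
      then have m2: "m - 1 \<in> {1..N}" using m by auto
      have "?g (line_pt s w t) = 0" for t
        using difference_zero_on_frontier[OF m2 out, of "p + t *\<^sub>R \<theta>"] True unfolding lp by simp
      then show ?thesis by simp
    next
      case False
      have cross: "\<exists>t. p + t *\<^sub>R \<theta> \<in> C i" if i: "i \<in> {1..m - 1}" for i
      proof -
        have "m - 1 \<le> N" using m by auto
        then have "C (m - 1) \<subseteq> C i" using L.nested_le[of i "m - 1"] i by simp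
        then show ?thesis using False i by force
      qed
      have reg: "regular_line N C p \<theta>"
        unfolding regular_line_def
      proof
        fix i assume i: "i \<in> {1..N}"
        show "(\<exists>t. p + t *\<^sub>R \<theta> \<in> C i) \<or> (\<forall>t. p + t *\<^sub>R \<theta> \<notin> closure (C i))"
          using cross[of i] inner[of i] i by (cases "i < m") auto
      qed
      let ?q = "optical_depth (m - 1) c C p \<theta>"
      have less: "optical_depth N d C p \<theta> t = optical_depth (m - 1) d C p \<theta> t" for d t
        unfolding optical_depth_def
      proof (rule sum.mono_neutral_right)
        show "{1..m - 1} \<subseteq> {1..N}" using m by auto
        show "\<forall>i\<in>{1..N} - {1..m - 1}. d i * measure lborel {r. t \<le> r \<and> p + r *\<^sub>R \<theta> \<in> C i} = 0"
        proof
          fix i assume "i \<in> {1..N} - {1..m - 1}"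
          then have "i \<in> {m..N}" by auto
          then have "p + r *\<^sub>R \<theta> \<notin> C i" for r using inner[of i r] closure_subset[of "C i"] by blast
          then show "d i * measure lborel {r. t \<le> r \<and> p + r *\<^sub>R \<theta> \<in> C i} = 0" by simp
        qed
      qed simp
      have m1: "m - 1 \<le> N" using m by auto
      have q': "optical_depth N c' C p \<theta> t = ?q t" for t
        unfolding less by (rule common_depth[symmetric]) (use m prev in auto)
      have qm: "?q \<in> borel_measurable borel"
        by (rule nested_layers.optical_depth_measurable[OF L.sublayers[OF m1] fr])
      obtain Q where "\<And>h t. \<bar>optical_depth (m - 1) c C (p + h *\<^sub>R perp \<theta>) \<theta> t\<bar> \<le> Q"
        by (rule nested_layers.optical_depth_bounded[OF L.sublayers[OF m1] fr]) (rule that)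
      from this[of 0] have Q: "\<And>t. \<bar>?q t\<bar> \<le> Q" by simp
      define A where "A = (\<Sum>i\<in>{1..m - 1}. c i * chord_top (slice (C i) p (perp \<theta>) \<theta>) 0)"
      have q: "?q t = A - \<mu> * t" if nz: "?g (p + t *\<^sub>R \<theta>) \<noteq> 0" for t
      proof -
        have "?q t = (\<Sum>i\<in>{1..m - 1}. c i * chord_top (slice (C i) p (perp \<theta>) \<theta>) 0 - c i * t)"
          unfolding optical_depth_def
        proof (rule sum.cong[OF refl])
          fix i assume i: "i \<in> {1..m - 1}"
          then have iN: "i \<in> {1..N}" using m by auto
          interpret S: convex_body "slice (C i) p (perp \<theta>) \<theta>" by (rule L.slice_layer[OF fr iN])
          obtain p0 where "p + p0 *\<^sub>R \<theta> \<in> C i" using cross[OF i] by blast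
          then have p0: "(0, p0) \<in> slice (C i) p (perp \<theta>) \<theta>" by (simp add: mem_slice)
          have "p + t *\<^sub>R \<theta> \<in> closure (C (m - 1))" using out[of "p + t *\<^sub>R \<theta>"] nz i by fastforce
          moreover have "closure (C (m - 1)) \<subseteq> closure (C i)"
            using L.nested_le[of i "m - 1"] i m1 by (intro closure_mono) simp
          ultimately have cl: "(0, t) \<in> closure (slice (C i) p (perp \<theta>) \<theta>)"
            by (auto simp: mem_closure_slice[OF fr])
          have "measure lborel {r. t \<le> r \<and> p + r *\<^sub>R \<theta> \<in> C i} = ray_meas (slice (C i) p (perp \<theta>) \<theta>) 0 t"
            using measure_ray_eq_ray_meas[of t p 0 "perp \<theta>" \<theta> "C i"] by simp
          also have "\<dots> = chord_top (slice (C i) p (perp \<theta>) \<theta>) 0 - t"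
            unfolding S.ray_meas_chord[OF p0]
            using S.closure_le_chord_top[OF cl p0] S.closure_ge_chord_bot[OF cl p0] by simp
          finally show "c i * measure lborel {r. t \<le> r \<and> p + r *\<^sub>R \<theta> \<in> C i} = c i * chord_top (slice (C i) p (perp \<theta>) \<theta>) 0 - c i * t"
            by (simp add: right_diff_distrib)
        qed
        also have "\<dots> = A - \<mu> * t" by (simp add: sum_subtractf A_def \<mu>_def sum_distrib_right)
        finally show ?thesis .
      qed
      have eq: "?g (p + t *\<^sub>R \<theta>) * exp (- ?q t) = exp (- A) * (exp (\<mu> * t) * ?g (p + t *\<^sub>R \<theta>))" for t
      proof (cases "?g (p + t *\<^sub>R \<theta>) = 0")
        case nz: False
        have "exp (- ?q t) = exp (- A) * exp (\<mu> * t)" unfolding q[OF nz] by (simp flip: exp_add)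
        then show ?thesis by simp
      qed simp
      let ?G = "\<lambda>t. exp (\<mu> * t) * ?g (line_pt s w t)"
      have i: "integrable lborel (\<lambda>t. f (p + t *\<^sub>R \<theta>) * exp (- ?q t))" "integrable lborel (\<lambda>t. f' (p + t *\<^sub>R \<theta>) * exp (- ?q t))"
        by (rule integrable_radon[OF f(1) fr(2) qm Q] integrable_radon[OF f'(1) fr(2) qm Q])+
      have ge: "(\<lambda>t. f (p + t *\<^sub>R \<theta>) * exp (- ?q t) - f' (p + t *\<^sub>R \<theta>) * exp (- ?q t)) = (\<lambda>t. exp (- A) * ?G t)"
        unfolding lp left_diff_distrib[symmetric] eq ..
      have "(LINT t|lborel. f (p + t *\<^sub>R \<theta>) * exp (- ?q t)) = (LINT t|lborel. f' (p + t *\<^sub>R \<theta>) * exp (- ?q t))"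
        using data[OF fr(2) reg reg] unfolding layered_radon_def q' less[of c] .
      then have "(LINT t|lborel. exp (- A) * ?G t) = 0"
        unfolding ge[symmetric] Bochner_Integration.integral_diff[OF i] by (rule right_minus_eq[THEN iffD2])
      moreover have int: "integrable lborel ?G"
        using Bochner_Integration.integrable_diff[OF i] unfolding ge by (simp only: integrable_mult_left_iff exp_not_eq_zero simp_thms)
      ultimately have "(LINT t|lborel. ?G t) = 0" by simp
      with has_integral_integral_lborel[OF int] have "(?G has_integral 0) UNIV" by simp
      moreover have "?G = (\<lambda>t. if t \<in> {-R..R} then ?G t else 0)"
      proof
        fix t
        have "?g (line_pt s w t) = 0" if "t \<notin> {-R..R}"
        proof -
          have "R^2 \<le> \<bar>t\<bar>^2" using that R(1) by (intro power_mono) auto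
          then have "R^2 \<le> (norm (line_pt s w t))^2" unfolding norm_line_pt_sq by (simp add: add_increasing)
          then show ?thesis using R by (auto intro: power2_le_imp_le)
        qed
        then show "?G t = (if t \<in> {-R..R} then ?G t else 0)" by auto
      qed
      ultimately have "((\<lambda>t. if t \<in> {-R..R} then ?G t else 0) has_integral 0) UNIV" by simp
      then have "(?G has_integral 0) {-R..R}" unfolding has_integral_restrict_UNIV .
      then show ?thesis by (rule integral_unique)
    qed
  qed
  then show ?thesis by simp
qed

text \<open>Coefficients and sources are determined alternately: equality of the sources outside
  layer \<open>Suc m\<close> gives the coefficient of that layer, which extends the equality to the
  outside of the next one. At \<open>m = N\<close> the exclusion is void.\<close>

lemma determined_up_to:
  assumes "m \<le> N"
  shows "(\<forall>i\<in>{1..m}. c i = c' i) \<and> (\<forall>x. (m < N \<longrightarrow> x \<notin> closure (C (Suc m))) \<longrightarrow> f x = f' x)"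
  using assms
proof (induction m)
  case 0
  show ?case using difference_supported[of 1] by auto
next
  case (Suc m)
  then have prev: "\<And>i. i \<in> {1..<Suc m} \<Longrightarrow> c i = c' i" and out: "\<And>x. x \<notin> closure (C (Suc m)) \<Longrightarrow> f x = f' x"
    and m: "Suc m \<in> {1..N}" by auto
  have "c (Suc m) = c' (Suc m)"
  proof (cases "\<exists>y. y \<notin> closure (C (Suc m)) \<and> f y > 0")
    case True
    then obtain y where "y \<notin> closure (C (Suc m))" "f y > 0" by blast
    with m prev out show ?thesis by (rule coefficient_eq_exterior)
  next
    case False
    show ?thesis
    proof (rule coefficient_eq_interior[OF m out])
      show "f x = 0" if "x \<notin> closure (C (Suc m))" for x using False f(2)[of x] that by fastforce
    qed
  qed
  then have c: "c i = c' i" if "i \<in> {1..<Suc (Suc m)}" for i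
    using prev[of i] that by (cases "i = Suc m") auto
  have "c i = c' i" if "i \<in> {1..Suc m}" for i using that by (intro c) simp
  moreover have "f x = f' x" if x: "Suc m < N \<longrightarrow> x \<notin> closure (C (Suc (Suc m)))" for x
  proof (rule difference_supported[of "Suc (Suc m)", OF _ c])
    show "f x = f' x" if "x \<notin> closure (C (Suc (Suc m) - 1))" for x using out that by simp
  qed (use x m in auto)
  ultimately show ?case by simp
qed

lemma determined: "i \<in> {1..N} \<Longrightarrow> c i = c' i" "f = f'"
  using determined_up_to[of N] by (auto simp: fun_eq_iff)

end

text \<open>Empty sets are allowed among the given ones. Nesting makes every set after an empty one
  empty too, so cutting off at the first of them changes no value of the sum.\<close>

lemma nicely_multi_bang_layers:
  assumes "nicely_multi_bang a"
  obtains N c C where "nested_layers N c C" "AE x in lborel. a x = (\<Sum>j\<in>{1..N}. c j * indicator (C j) x)"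
proof -
  obtain M :: nat and c C where C: "\<forall>j\<in>{1..M}. c j \<noteq> 0 \<and> convex (C j) \<and> bounded (C j) \<and> open (C j) \<and> smooth_boundary_with_corners (C j)"
    and nest: "\<forall>j\<in>{2..M}. compactly_inside (C j) (C (j - 1))"
    and a: "AE x in lborel. a x = (\<Sum>j\<in>{1..M}. c j * indicator (C j) x)"
    using assms unfolding nicely_multi_bang_def by blast
  have cl: "closure (C j) \<subseteq> C (j - 1)" if j: "j \<in> {2..M}" for j
  proof -
    obtain K where K: "compact K" "C j \<subseteq> K" "K \<subseteq> C (j - 1)"
      using bspec[OF nest j] unfolding compactly_inside_def by blast
    have "closure (C j) \<subseteq> K" using K(1,2) by (intro closure_minimal compact_imp_closed)
    with K(3) show ?thesis by blast
  qed
  define N where "N = (LEAST k. k = M \<or> C (Suc k) = {})"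
  have N: "N = M \<or> C (Suc N) = {}" unfolding N_def by (rule LeastI[of _ M]) simp
  have "N \<le> M" unfolding N_def by (rule Least_le) simp
  have ne: "C j \<noteq> {}" if j: "j \<in> {1..N}" for j
  proof -
    have "j - 1 < N" using j by auto
    from not_less_Least[OF this[unfolded N_def]] show ?thesis using j by simp
  qed
  have empty: "C i = {}" if "N < i" "i \<le> M" for i
    using that
  proof (induction i)
    case (Suc i)
    show ?case
    proof (cases "i = N")
      case True
      then show ?thesis using N Suc.prems by simp
    next
      case False
      then have "C i = {}" using Suc by simp
      moreover have "closure (C (Suc i)) \<subseteq> C i" using cl[of "Suc i"] Suc.prems False by simp
      ultimately show ?thesis using closure_subset by blast
    qed
  qed simp
  have "(\<Sum>j\<in>{1..M}. c j * indicator (C j) x) = (\<Sum>j\<in>{1..N}. c j * indicator (C j) x)" for x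
    using empty \<open>N \<le> M\<close> by (intro sum.mono_neutral_right) auto
  then have "AE x in lborel. a x = (\<Sum>j\<in>{1..N}. c j * indicator (C j) x)" using a by simp
  moreover have "nested_layers N c C" using C ne cl \<open>N \<le> M\<close> by unfold_locales auto
  ultimately show thesis by (intro that)
qed

text \<open>Strong induction with both inclusions. The index ranges over the layers of either pair,
  so that their numbers are compared as well; each layer is recovered from its closure as the
  interior.\<close>

lemma layered_pair_same_layers:
  assumes A: "layered_pair N c C N' c' C' f f'" and B: "layered_pair N' c' C' N c C f' f"
  shows "N' = N" "\<And>i. i \<in> {1..N} \<Longrightarrow> C' i = C i"
proof -
  interpret A: layered_pair N c C N' c' C' f f' by (rule A)
  interpret B: layered_pair N' c' C' N c C f' f by (rule B)
  have same: "m \<in> {1..N} \<union> {1..N'} \<Longrightarrow> m \<le> N \<and> m \<le> N' \<and> C' m = C m" for m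
  proof (induction m rule: less_induct)
    case (less m)
    have IH: "i \<le> N \<and> i \<le> N' \<and> C' i = C i" if "i \<in> {1..<m}" for i
      using less.IH[of i] less.prems that by auto
    have 1: "m \<le> N' \<and> closure (C m) \<subseteq> closure (C' m)" if "m \<in> {1..N}"
      using that IH by (intro A.layer_contained) auto
    have 2: "m \<le> N \<and> closure (C' m) \<subseteq> closure (C m)" if "m \<in> {1..N'}"
      using that IH by (intro B.layer_contained) auto
    have m: "m \<in> {1..N}" "m \<in> {1..N'}" using less.prems 1 2 by auto
    then have "interior (closure (C' m)) = interior (closure (C m))" using 1 2 by simp
    then show ?case using m A.L.interior_closure_C A.L'.interior_closure_C by auto
  qed
  show "N' = N" using same[of N] same[of N'] by (cases "N = 0"; cases "N' = 0") auto
  show "C' i = C i" if "i \<in> {1..N}" for i using same that by blast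
qed

theorem theorem2:
  fixes a a' f f' :: "real ^ 2 \<Rightarrow> real"
  assumes "admissible_pair a f"
    and "admissible_pair a' f'"
    and "\<forall>s. \<forall>\<theta>\<in>sphere 0 1. attenuated_radon a f s \<theta> = attenuated_radon a' f' s \<theta>"
  shows "(AE x in lborel. a x = a' x) \<and> f = f'"
proof -
  have a: "nicely_multi_bang a" "multi_bang a" and f: "C1_compact_support f" "\<And>x. f x \<ge> 0"
    and cond: "tangent_condition a f" "corner_condition a f"
    using assms(1) unfolding admissible_pair_def nicely_multi_bang_def by auto
  have a': "nicely_multi_bang a'" "multi_bang a'" and f': "C1_compact_support f'" "\<And>x. f' x \<ge> 0"
    and cond': "tangent_condition a' f'" "corner_condition a' f'"
    using assms(2) unfolding admissible_pair_def nicely_multi_bang_def by auto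
  have b: "a \<in> borel_measurable borel" "a' \<in> borel_measurable borel"
    using a(2) a'(2) unfolding multi_bang_def L_infinity_def by auto
  obtain N c C where L: "nested_layers N c C"
    and aC: "AE x in lborel. a x = (\<Sum>j\<in>{1..N}. c j * indicator (C j) x)"
    by (rule nicely_multi_bang_layers[OF a(1)])
  obtain N' c' C' where L': "nested_layers N' c' C'"
    and aC': "AE x in lborel. a' x = (\<Sum>j\<in>{1..N'}. c' j * indicator (C' j) x)"
    by (rule nicely_multi_bang_layers[OF a'(1)])
  interpret L: nested_layers N c C by (rule L)
  interpret L': nested_layers N' c' C' by (rule L')
  have eq: "attenuated_radon a f s \<theta> = attenuated_radon a' f' s \<theta>" if "norm \<theta> = 1" for s \<theta>
    using assms(3) that by simp
  have data: "layered_radon N c C f p \<theta> = layered_radon N' c' C' f' p \<theta>"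
    if "norm \<theta> = 1" "regular_line N C p \<theta>" "regular_line N' C' p \<theta>" for p \<theta>
    by (rule layered_radon_eq[OF L L' b(1) aC b(2) aC' f(1) f'(1) eq that])
  have vis: "\<exists>x n. n \<in> V \<and> L.visible_boundary_point j f x n" if "j \<in> {1..N}" "open V" "V \<noteq> {}" for j V
    by (rule L.visible_boundary_point_exists[OF a(2) _ that(1) cond that(2,3)])
       (use aC in \<open>simp add: L.layered_def\<close>, blast)
  have vis': "\<exists>x n. n \<in> V \<and> L'.visible_boundary_point j f' x n" if "j \<in> {1..N'}" "open V" "V \<noteq> {}" for j V
    by (rule L'.visible_boundary_point_exists[OF a'(2) _ that(1) cond' that(2,3)])
       (use aC' in \<open>simp add: L'.layered_def\<close>, blast)
  have A: "layered_pair N c C N' c' C' f f'"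
    using f f' data vis by unfold_locales
  have B: "layered_pair N' c' C' N c C f' f"
    using f f' data[symmetric] vis' by unfold_locales
  note same = layered_pair_same_layers[OF A B]
  have reg: "regular_line N' C' p \<theta> = regular_line N C p \<theta>" for p \<theta>
    unfolding regular_line_def same(1) using same(2) by auto
  \<comment> \<open>The second pair is rewritten over the layers of the first, keeping its own
    coefficients and source, which is the setting of \<open>same_shape\<close>.\<close>
  have rad: "layered_radon N' c' C' f' p \<theta> = layered_radon N c' C f' p \<theta>" for p \<theta>
  proof -
    have "optical_depth N' c' C' p \<theta> = optical_depth N c' C p \<theta>"
      unfolding fun_eq_iff optical_depth_def same(1) using same(2) by (intro allI sum.cong) auto
    then show ?thesis by (simp add: layered_radon_def)
  qed
  have "nested_layers N c' C"
    using L L' same unfolding nested_layers_def by auto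
  then interpret L'': nested_layers N c' C .
  have "layered_pair N c C N c' C f f'"
    using f f' data vis unfolding reg rad by unfold_locales
  then interpret same_shape N c C c' f f' by (simp add: same_shape_def)
  have "(\<Sum>j\<in>{1..N'}. c' j * indicator (C' j) x) = (\<Sum>j\<in>{1..N}. c j * indicator (C j) x)" for x :: plane
    unfolding same(1) using same(2) determined(1) by (intro sum.cong) auto
  with aC aC' have "AE x in lborel. a x = a' x" by auto
  with determined(2) show ?thesis by blast
qed

end
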